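(* Let $n\ge 2$, let $\Omega\subset\mathbb{R}^n$ be an open bounded domain with $C^1$ boundary, let $0<\nu\le L$, $\mu\in[0,1]$, $\alpha\in(0,1]$, and let $$1<p\le q<p\left(1+\frac{\alpha}{n}\right).$$ Let $F\colon\Omega\times\mathbb{R}^n\to\mathbb{R}$ be a Carathéodory integrand such that, for all $x,x_1,x_2\in\Omega$ and all $z,z_1,z_2\in\mathbb{R}^n$, - $\nu|z|^p\le F(x,z)\le L(1+|z|^2)^{q/2}$; - $z\mapsto F(x,z)$ belongs to $C^1(\mathbb{R}^n)$; - $(\partial_zF(x,z_1)-\partial_zF(x,z_2))\cdot(z_1-z_2)\ge\nu(\mu^2+|z_1|^2+|z_2|^2)^{\frac{p-2}{2}}|z_1-z_2|^2$; - $|\partial_zF(x_1,z)-\partial_zF(x_2,z)|\le L|x_1-x_2|^{\alpha}(1+|z|^2)^{\frac{q-1}{2}}$. Let $\psi\in W^{1+\alpha,q}(\Omega)$ and $g\in W^{1,p}(\bar\Omega)$ be such that the class $\mathcal{K}_{\psi,g}(\Omega)$ is non-empty. Let $v\in\mathcal{K}_{\psi,g}(\Omega)$ be the solution of the obstacle problem $$\min_{w\in\mathcal{K}_{\psi,g}(\Omega)}\int_\Omega F(x,Dw)\,dx,$$ and assume that the Lavrentiev gap vanishes on $v$, i.e. $\mathcal{L}(v,\tilde\Omega)=0$ for all open subsets $\tilde\Omega\Subset\Omega$. Then: - $Dv\in L^d_{\rm loc}(\Omega,\mathbb{R}^n)$ for all $d\in\left[1,\frac{np}{n-\alpha}\right)$;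 - $V_{\mu,p}(Dv)\in W^{\beta,2}_{\rm loc}(\Omega,\mathbb{R}^n)$ for all $\beta\in\left(0,\frac{\alpha}{2}\right)$. In particular, if $B_\varrho\Subset\Omega$ is any ball (of radius $\varrho$, with $B_{\varrho/2}$ the concentric ball of half radius), then for every $d\in\left[1,\frac{np}{n-\alpha}\right)$ $$\|Dv\|_{L^d(B_{\varrho/2})}\le\frac{c}{\varrho^{\theta}}\left[1+\int_{B_\varrho}\left[F(x,Dv)+|D\psi|^q\right]dx\right]^{\bar\gamma},$$ where $c$ depends only on $n,\nu,L,p,q,\alpha,\|\psi\|_{W^{1+\alpha,q}(\Omega)}$ and $d$, where $\theta=\theta(n,p,q,\alpha)$, and where $\bar\gamma=\bar\gamma(n,p,q,\alpha,d)$.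
   Context: All functions $w,\psi,g,v$ are scalar real-valued functions. $\partial_z F$ denotes the gradient of $F$ in the second variable. Admissible class: $\mathcal{K}_{\psi,g}(\Omega):=\{w\in W^{1,p}(\Omega): w\ge\psi \text{ a.e. in }\Omega,\ w|_{\partial\Omega}=g|_{\partial\Omega}\}$ (boundary values in the sense of traces; $W^{1,p}(\bar\Omega)$ is read as $W^{1,p}(\Omega)$). A solution of the obstacle problem is a $v\in\mathcal{K}_{\psi,g}(\Omega)$ with $F(\cdot,Dv)\in L^1(\Omega)$ and $\int_\Omega F(x,Dv)\,dx\le\int_\Omega F(x,Dw)\,dx$ for every $w\in\mathcal{K}_{\psi,g}(\Omega)$. Lavrentiev gap functional: for an open set $\tilde\Omega\Subset\Omega$ put $$\mathcal{K}_\psi:=W^{1,p}_{\rm loc}(\Omega)\cap\{w\in W^{1,p}(\tilde\Omega): w\ge\psi\text{ a.e. in }\tilde\Omega\},\qquad \mathcal{K}^*_\psi:=W^{1,p}_{\rm loc}(\Omega)\cap\{w\in W^{1,q}(\tilde\Omega): w\ge\psi\text{ a.e. in }\tilde\Omega\}.$$ For $w\in\mathcal{K}_\psi$ let $\mathcal{F}(w,\tilde\Omega):=\int_{\tilde\Omega}F(x,Dw)\,dx$, let $\mathcal{C}(w)$ be the set of sequences $\{w_j\}_{j\in\mathbb{N}}\subset\mathcal{K}^*_\psi$ with $w_j\rightharpoonup w$ weakly in $W^{1,p}_{\rm loc}(\Omega)$, and let $$\bar{\mathcal{F}}(w,\tilde\Omega):=\inf_{\{w_j\}\in\mathcal{C}(w)}\left\{\liminf_{j\to\infty}\int_{\tilde\Omega}F(x,Dw_j)\,dx\right\}.$$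 Then $\mathcal{L}(w,\tilde\Omega):=\bar{\mathcal{F}}(w,\tilde\Omega)-\mathcal{F}(w,\tilde\Omega)$ if $\mathcal{F}(w,\tilde\Omega)<\infty$, and $\mathcal{L}(w,\tilde\Omega):=0$ if $\mathcal{F}(w,\tilde\Omega)=\infty$. Auxiliary vector field: $V_{\mu,p}(z):=(\mu^2+|z|^2)^{\frac{p-2}{4}}z$ for $z\in\mathbb{R}^n$ (equal to $0$ at $z=0$). Fractional Sobolev spaces: for $\beta\in(0,1)$ and $t\in[1,\infty)$, $W^{\beta,t}(\Omega)$ is the space of $f$ with finite norm $\|f\|_{W^{\beta,t}(\Omega)}:=\|f\|_{L^t(\Omega)}+[f]_{\beta,t;\Omega}$, where $[f]_{\beta,t;\Omega}:=\left(\int_\Omega\int_\Omega\frac{|f(x)-f(y)|^t}{|x-y|^{n+\beta t}}\,dx\,dy\right)^{1/t}$. For $\alpha\in(0,1)$, $\|f\|_{W^{1+\alpha,q}(\Omega)}:=\|f\|_{W^{1,q}(\Omega)}+[Df]_{\alpha,q;\Omega}$; for $\alpha=1$, $W^{1+\alpha,q}=W^{2,q}$ is the usual Sobolev space. $f\in W^{\beta,t}_{\rm loc}(\Omega)$ means $f\in W^{\beta,t}(\tilde\Omega)$ for every open $\tilde\Omega\Subset\Omega$. In the monotonicity hypothesis, the right-hand side is understood as $0$ when $z_1=z_2$.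
   Formalization: In the final estimate c may also depend on an upper bound R for the radius ϱ (with R=1: the listed dependencies for all ϱ ≤ 1); with θ independent of d, no constant with only the listed dependencies works for all radii, e.g. n=p=q=2, F=|z|², v=x₁/ϱ+10. *)

theory Defs
  imports "HOL-Analysis.Analysis"
begin

text \<open>
  Functions on a set are total functions whose values outside the set are irrelevant, and all
  function spaces consist of functions rather than of classes modulo null sets.
\<close>

definition compactly_inside :: "'a::euclidean_space set \<Rightarrow> 'a set \<Rightarrow> bool"  (infix "\<Subset>" 50)
  where "A \<Subset> B \<longleftrightarrow> compact (closure A) \<and> closure A \<subseteq> B"


section \<open>Classical differentiability\<close>

definition grad :: "('a::euclidean_space \<Rightarrow> real) \<Rightarrow> 'a \<Rightarrow> 'a"
  where "grad f x = (THE D. GDERIV f x :> D)"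

primrec Ck :: "nat \<Rightarrow> ('a::euclidean_space \<Rightarrow> real) \<Rightarrow> bool"
  where
    "Ck 0 f \<longleftrightarrow> continuous_on UNIV f"
  | "Ck (Suc k) f \<longleftrightarrow> (\<forall>x. f differentiable (at x)) \<and> (\<forall>b\<in>Basis. Ck k (\<lambda>x. grad f x \<bullet> b))"

definition smooth :: "('a::euclidean_space \<Rightarrow> real) \<Rightarrow> bool"
  where "smooth f \<longleftrightarrow> (\<forall>k. Ck k f)"

definition test_function :: "'a::euclidean_space set \<Rightarrow> ('a \<Rightarrow> real) \<Rightarrow> bool"
  where "test_function \<Omega> \<phi> \<longleftrightarrow> smooth \<phi> \<and> {x. \<phi> x \<noteq> 0} \<Subset> \<Omega>"

text \<open>
  Near each boundary point, \<open>\<Omega>\<close> is the part of a ball lying above a \<open>C\<^sup>1\<close> graph. The graph is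
  over the hyperplane orthogonal to a unit vector \<open>e\<close> (the rotated last coordinate axis); its
  height is a function \<open>h\<close> on the whole space that does not depend on the \<open>e\<close>-coordinate.
\<close>

definition C1_boundary :: "'a::euclidean_space set \<Rightarrow> bool"
  where "C1_boundary \<Omega> \<longleftrightarrow>
    (\<forall>x0\<in>frontier \<Omega>. \<exists>r>0. \<exists>e h. norm e = 1 \<and> Ck 1 h \<and> (\<forall>x t. h (x + t *\<^sub>R e) = h x) \<and>
       \<Omega> \<inter> ball x0 r = {x \<in> ball x0 r. h x < x \<bullet> e})"


section \<open>Lebesgue and Sobolev spaces\<close>

definition Lp :: "real \<Rightarrow> 'a::euclidean_space set \<Rightarrow> ('a \<Rightarrow> 'b::euclidean_space) set"
  where "Lp t S = {f. f \<in> borel_measurable (lebesgue_on S) \<and>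
                      integrable (lebesgue_on S) (\<lambda>x. norm (f x) powr t)}"

definition Lp_norm :: "real \<Rightarrow> 'a::euclidean_space set \<Rightarrow> ('a \<Rightarrow> 'b::euclidean_space) \<Rightarrow> real"
  where "Lp_norm t S f = (\<integral>x. norm (f x) powr t \<partial>lebesgue_on S) powr (1 / t)"

definition Lp_loc :: "real \<Rightarrow> 'a::euclidean_space set \<Rightarrow> ('a \<Rightarrow> 'b::euclidean_space) set"
  where "Lp_loc t \<Omega> = {f. \<forall>U. open U \<and> U \<Subset> \<Omega> \<longrightarrow> f \<in> Lp t U}"

definition has_weak_gradient ::
  "'a::euclidean_space set \<Rightarrow> ('a \<Rightarrow> real) \<Rightarrow> ('a \<Rightarrow> 'a) \<Rightarrow> bool"
  where "has_weak_gradient \<Omega> u G \<longleftrightarrow> u \<in> Lp_loc 1 \<Omega> \<and> G \<in> Lp_loc 1 \<Omega> \<and>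
    (\<forall>\<phi>. test_function \<Omega> \<phi> \<longrightarrow>
       (\<integral>x. u x *\<^sub>R grad \<phi> x \<partial>lebesgue_on \<Omega>) = - (\<integral>x. \<phi> x *\<^sub>R G x \<partial>lebesgue_on \<Omega>))"

text \<open>A representative of the weak gradient, which is unique up to null sets.\<close>

definition wgrad :: "'a::euclidean_space set \<Rightarrow> ('a \<Rightarrow> real) \<Rightarrow> 'a \<Rightarrow> 'a"
  where "wgrad \<Omega> u = (SOME G. has_weak_gradient \<Omega> u G)"

definition W1 :: "real \<Rightarrow> 'a::euclidean_space set \<Rightarrow> ('a \<Rightarrow> real) set"
  where "W1 p \<Omega> = {u. u \<in> Lp p \<Omega> \<and> (\<exists>G. has_weak_gradient \<Omega> u G \<and> G \<in> Lp p \<Omega>)}"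

definition W1_norm :: "real \<Rightarrow> 'a::euclidean_space set \<Rightarrow> ('a \<Rightarrow> real) \<Rightarrow> real"
  where "W1_norm p \<Omega> u = Lp_norm p \<Omega> u + Lp_norm p \<Omega> (wgrad \<Omega> u)"

definition W1_loc :: "real \<Rightarrow> 'a::euclidean_space set \<Rightarrow> ('a \<Rightarrow> real) set"
  where "W1_loc p \<Omega> = {u. \<forall>U. open U \<and> U \<Subset> \<Omega> \<longrightarrow> u \<in> W1 p U}"

definition W2 :: "real \<Rightarrow> 'a::euclidean_space set \<Rightarrow> ('a \<Rightarrow> real) set"
  where "W2 q \<Omega> = {u \<in> W1 q \<Omega>. \<forall>b\<in>Basis. (\<lambda>x. wgrad \<Omega> u x \<bullet> b) \<in> W1 q \<Omega>}"

definition hessian_norm :: "'a::euclidean_space set \<Rightarrow> ('a \<Rightarrow> real) \<Rightarrow> 'a \<Rightarrow> real"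
  where "hessian_norm \<Omega> u x =
    sqrt (\<Sum>b\<in>Basis. (norm (wgrad \<Omega> (\<lambda>y. wgrad \<Omega> u y \<bullet> b) x))\<^sup>2)"

definition W2_norm :: "real \<Rightarrow> 'a::euclidean_space set \<Rightarrow> ('a \<Rightarrow> real) \<Rightarrow> real"
  where "W2_norm q \<Omega> u = W1_norm q \<Omega> u + Lp_norm q \<Omega> (hessian_norm \<Omega> u)"


section \<open>Fractional Sobolev spaces\<close>

text \<open>The \<open>t\<close>-th power of the Gagliardo seminorm; the diagonal contributes \<open>0\<close>.\<close>

definition gagliardo ::
  "real \<Rightarrow> real \<Rightarrow> 'a::euclidean_space set \<Rightarrow> ('a \<Rightarrow> 'b::euclidean_space) \<Rightarrow> ennreal"
  where "gagliardo \<beta> t \<Omega> f =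
    (\<integral>\<^sup>+x. \<integral>\<^sup>+y. ennreal (norm (f x - f y) powr t / norm (x - y) powr (real DIM('a) + \<beta> * t))
       \<partial>lebesgue_on \<Omega> \<partial>lebesgue_on \<Omega>)"

definition gagliardo_seminorm ::
  "real \<Rightarrow> real \<Rightarrow> 'a::euclidean_space set \<Rightarrow> ('a \<Rightarrow> 'b::euclidean_space) \<Rightarrow> real"
  where "gagliardo_seminorm \<beta> t \<Omega> f = enn2real (gagliardo \<beta> t \<Omega> f) powr (1 / t)"

definition Wfrac ::
  "real \<Rightarrow> real \<Rightarrow> 'a::euclidean_space set \<Rightarrow> ('a \<Rightarrow> 'b::euclidean_space) set"
  where "Wfrac \<beta> t \<Omega> = {f \<in> Lp t \<Omega>. gagliardo \<beta> t \<Omega> f < \<infinity>}"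

definition Wfrac_loc ::
  "real \<Rightarrow> real \<Rightarrow> 'a::euclidean_space set \<Rightarrow> ('a \<Rightarrow> 'b::euclidean_space) set"
  where "Wfrac_loc \<beta> t \<Omega> = {f. \<forall>U. open U \<and> U \<Subset> \<Omega> \<longrightarrow> f \<in> Wfrac \<beta> t U}"

text \<open>The space \<open>W\<^bsup>1+\<alpha>,q\<^esup>\<close> for \<open>\<alpha> \<in> (0, 1]\<close>.\<close>

definition W1frac :: "real \<Rightarrow> real \<Rightarrow> 'a::euclidean_space set \<Rightarrow> ('a \<Rightarrow> real) set"
  where "W1frac \<alpha> q \<Omega> =
    (if \<alpha> = 1 then W2 q \<Omega> else {u \<in> W1 q \<Omega>. gagliardo \<alpha> q \<Omega> (wgrad \<Omega> u) < \<infinity>})"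

definition W1frac_norm :: "real \<Rightarrow> real \<Rightarrow> 'a::euclidean_space set \<Rightarrow> ('a \<Rightarrow> real) \<Rightarrow> real"
  where "W1frac_norm \<alpha> q \<Omega> u =
    (if \<alpha> = 1 then W2_norm q \<Omega> u else W1_norm q \<Omega> u + gagliardo_seminorm \<alpha> q \<Omega> (wgrad \<Omega> u))"


section \<open>Boundary traces\<close>

definition hausdorff_pre :: "real \<Rightarrow> real \<Rightarrow> 'a::euclidean_space set \<Rightarrow> ennreal"
  where "hausdorff_pre s \<delta> A =
    (INF C\<in>{C :: nat \<Rightarrow> 'a set. A \<subseteq> (\<Union>i. C i) \<and> (\<forall>i. bounded (C i) \<and> diameter (C i) \<le> \<delta>)}.
       \<Sum>i. ennreal (diameter (C i) powr s))"

definition hausdorff_outer :: "real \<Rightarrow> 'a::euclidean_space set \<Rightarrow> ennreal"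
  where "hausdorff_outer s A = (SUP \<delta>\<in>{0<..}. hausdorff_pre s \<delta> A)"

text \<open>
  The Hausdorff measure of dimension \<open>s > 0\<close>, on the Caratheodory measurable sets. The usual
  normalising factor is left out: it plays no role for convergence in \<open>L\<^sup>p(\<partial>\<Omega>)\<close>.
\<close>

definition hausdorff_measure :: "real \<Rightarrow> 'a::euclidean_space measure"
  where "hausdorff_measure s =
    measure_of UNIV (lambda_system UNIV UNIV (hausdorff_outer s)) (hausdorff_outer s)"

text \<open>
  \<open>measure_of\<close> silently yields the zero measure unless it is given a measure; the next facts show
  that the definition does not degenerate in this way.
\<close>

lemma hausdorff_pre_Union:
  assumes "0 < \<delta>"
  shows "hausdorff_pre s \<delta> (\<Union>i::nat. A i) \<le> (\<Sum>i. hausdorff_pre s \<delta> (A i))"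
proof (rule ennreal_le_epsilon)
  fix e :: real
  assume e: "0 < e" and fin: "(\<Sum>i. hausdorff_pre s \<delta> (A i)) < top"
  have less: "hausdorff_pre s \<delta> (A n) < hausdorff_pre s \<delta> (A n) + e * (1/2) ^ Suc n" for n
    using e fin by (auto simp: less_top dest!: ennreal_suminf_lessD)
  have "\<forall>n. \<exists>C. A n \<subseteq> (\<Union>i::nat. C i) \<and> (\<forall>i. bounded (C i) \<and> diameter (C i) \<le> \<delta>) \<and>
     (\<Sum>i. ennreal (diameter (C i) powr s)) \<le> hausdorff_pre s \<delta> (A n) + e * (1/2) ^ Suc n"
  proof
    fix n
    obtain C where "A n \<subseteq> (\<Union>i::nat. C i) \<and> (\<forall>i. bounded (C i) \<and> diameter (C i) \<le> \<delta>)"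
      "(\<Sum>i. ennreal (diameter (C i) powr s)) < hausdorff_pre s \<delta> (A n) + e * (1/2) ^ Suc n"
      using less[of n] unfolding hausdorff_pre_def[of s \<delta> "A n"] INF_less_iff
      by (elim bexE CollectE)
    then show "\<exists>C. A n \<subseteq> (\<Union>i::nat. C i) \<and> (\<forall>i. bounded (C i) \<and> diameter (C i) \<le> \<delta>) \<and>
        (\<Sum>i. ennreal (diameter (C i) powr s)) \<le> hausdorff_pre s \<delta> (A n) + e * (1/2) ^ Suc n"
      by (blast intro: less_imp_le)
  qed
  from choice[OF this] obtain B where B0:
    "\<forall>n. A n \<subseteq> (\<Union>i::nat. B n i) \<and> (\<forall>i. bounded (B n i) \<and> diameter (B n i) \<le> \<delta>) \<and>
     (\<Sum>i. ennreal (diameter (B n i) powr s)) \<le> hausdorff_pre s \<delta> (A n) + e * (1/2) ^ Suc n"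
    by (elim exE)
  have B: "A n \<subseteq> (\<Union>i::nat. B n i)" "bounded (B n i) \<and> diameter (B n i) \<le> \<delta>"
      "(\<Sum>i. ennreal (diameter (B n i) powr s)) \<le> hausdorff_pre s \<delta> (A n) + e * (1/2) ^ Suc n" for n i
    using spec[OF B0, of n] by blast+
  define C where "C = case_prod B \<circ> prod_decode"
  have "(\<Union>i. A i) \<subseteq> (\<Union>i. C i)"
    using B(1) by (auto simp: C_def subset_eq) (metis prod.case prod_encode_inverse)
  then have "hausdorff_pre s \<delta> (\<Union>i. A i) \<le> (\<Sum>i. ennreal (diameter (C i) powr s))"
    unfolding hausdorff_pre_def using B(2)
    by (intro INF_lower) (auto simp: C_def split_def)
  also have "\<dots> = (\<Sum>n. \<Sum>i. ennreal (diameter (B n i) powr s))"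
    unfolding C_def comp_def
    by (rule suminf_ennreal_2dimen[where f = "\<lambda>x. ennreal (diameter (case_prod B x) powr s)"])
      (simp only: prod.case)
  also have "\<dots> \<le> (\<Sum>n. hausdorff_pre s \<delta> (A n) + e * (1/2) ^ Suc n)"
    by (intro suminf_le B(3)) auto
  also have "\<dots> = (\<Sum>n. hausdorff_pre s \<delta> (A n)) + (\<Sum>n. ennreal e * ennreal ((1/2) ^ Suc n))"
    using e by (subst suminf_add[symmetric])
      (auto simp del: ennreal_suminf_cmult simp add: ennreal_mult[symmetric])
  also have "\<dots> = (\<Sum>n. hausdorff_pre s \<delta> (A n)) + e"
    unfolding ennreal_suminf_cmult
    by (subst suminf_ennreal_eq[OF zero_le_power power_half_series]) auto
  finally show "hausdorff_pre s \<delta> (\<Union>i. A i) \<le> (\<Sum>i. hausdorff_pre s \<delta> (A i)) + e" .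
qed

lemma outer_measure_space_hausdorff:
  "outer_measure_space UNIV (hausdorff_outer s :: 'a::euclidean_space set \<Rightarrow> ennreal)"
proof -
  have "hausdorff_pre s \<delta> ({} :: 'a set) = 0" if "0 < \<delta>" for \<delta>
  proof -
    have "hausdorff_pre s \<delta> ({} :: 'a set) \<le> (\<Sum>i::nat. ennreal (diameter ({} :: 'a set) powr s))"
      unfolding hausdorff_pre_def using that by (intro INF_lower) auto
    then show ?thesis by simp
  qed
  then have "(SUP \<delta>\<in>{0<..}. hausdorff_pre s \<delta> ({} :: 'a set)) \<le> 0"
    by (intro SUP_least) simp
  then have "positive UNIV (hausdorff_outer s :: 'a set \<Rightarrow> ennreal)"
    by (simp only: positive_def hausdorff_outer_def le_zero_eq)
  moreover have "increasing UNIV (hausdorff_outer s :: 'a set \<Rightarrow> ennreal)"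
    unfolding increasing_def
  proof (intro ballI impI)
    fix A B :: "'a set"
    assume "A \<subseteq> B"
    then have "hausdorff_pre s \<delta> A \<le> hausdorff_pre s \<delta> B" for \<delta>
      unfolding hausdorff_pre_def by (intro INF_superset_mono) blast+
    then show "hausdorff_outer s A \<le> hausdorff_outer s B"
      unfolding hausdorff_outer_def by (intro SUP_mono) blast
  qed
  moreover have "countably_subadditive UNIV (hausdorff_outer s :: 'a set \<Rightarrow> ennreal)"
    unfolding countably_subadditive_def
  proof safe
    fix A :: "nat \<Rightarrow> 'a set"
    show "hausdorff_outer s (\<Union>i. A i) \<le> (\<Sum>i. hausdorff_outer s (A i))"
      unfolding hausdorff_outer_def[of s "\<Union>i. A i"]
    proof (rule SUP_least)
      fix \<delta> :: real
      assume "\<delta> \<in> {0<..}"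
      then have "hausdorff_pre s \<delta> (\<Union>i. A i) \<le> (\<Sum>i. hausdorff_pre s \<delta> (A i))"
        by (intro hausdorff_pre_Union) auto
      also have "\<dots> \<le> (\<Sum>i. hausdorff_outer s (A i))"
        unfolding hausdorff_outer_def using \<open>\<delta> \<in> {0<..}\<close>
        by (intro suminf_le SUP_upper) auto
      finally show "hausdorff_pre s \<delta> (\<Union>i. A i) \<le> (\<Sum>i. hausdorff_outer s (A i))" .
    qed
  qed
  ultimately show ?thesis
    by (simp add: outer_measure_space_def)
qed

lemma emeasure_hausdorff_measure:
  fixes A :: "'a::euclidean_space set"
  assumes "A \<in> lambda_system UNIV UNIV (hausdorff_outer s)"
  shows "emeasure (hausdorff_measure s) A = hausdorff_outer s A"
proof -
  interpret sigma_algebra "UNIV :: 'a set" UNIV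
    using sigma_algebra_Pow[of "UNIV :: 'a set"] by simp
  have "measure_space UNIV (lambda_system UNIV UNIV (hausdorff_outer s))
      (hausdorff_outer s :: 'a set \<Rightarrow> ennreal)"
    by (rule caratheodory_lemma[OF outer_measure_space_hausdorff])
  then show ?thesis
    unfolding hausdorff_measure_def using assms
    by (intro emeasure_measure_of_sigma) (auto simp: measure_space_def)
qed

abbreviation surface_measure :: "'a::euclidean_space measure"
  where "surface_measure \<equiv> hausdorff_measure (real DIM('a) - 1)"

text \<open>
  The trace operator is the continuous extension of the restriction \<open>u \<mapsto> u|\<partial>\<Omega>\<close> from functions
  smooth up to the boundary to \<open>W\<^bsup>1,p\<^esup>(\<Omega>)\<close>, with values in \<open>L\<^sup>p(\<partial>\<Omega>)\<close>; this is its graph.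
\<close>

definition has_trace :: "real \<Rightarrow> 'a::euclidean_space set \<Rightarrow> ('a \<Rightarrow> real) \<Rightarrow> ('a \<Rightarrow> real) \<Rightarrow> bool"
  where "has_trace p \<Omega> u h \<longleftrightarrow> u \<in> W1 p \<Omega> \<and> h \<in> borel_measurable surface_measure \<and>
    (\<exists>\<phi>. (\<forall>k. smooth (\<phi> k)) \<and>
       (\<lambda>k. W1_norm p \<Omega> (\<lambda>x. \<phi> k x - u x)) \<longlonglongrightarrow> 0 \<and>
       (\<lambda>k. \<integral>\<^sup>+x\<in>frontier \<Omega>. ennreal (\<bar>\<phi> k x - h x\<bar> powr p) \<partial>surface_measure) \<longlonglongrightarrow> 0)"

definition same_trace :: "real \<Rightarrow> 'a::euclidean_space set \<Rightarrow> ('a \<Rightarrow> real) \<Rightarrow> ('a \<Rightarrow> real) \<Rightarrow> bool"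
  where "same_trace p \<Omega> u w \<longleftrightarrow> (\<exists>h. has_trace p \<Omega> u h \<and> has_trace p \<Omega> w h)"


section \<open>Weak convergence\<close>

definition W1_functional ::
  "real \<Rightarrow> 'a::euclidean_space set \<Rightarrow> (('a \<Rightarrow> real) \<Rightarrow> real) \<Rightarrow> bool"
  where "W1_functional p U l \<longleftrightarrow>
    (\<forall>u\<in>W1 p U. \<forall>w\<in>W1 p U. l (\<lambda>x. u x + w x) = l u + l w) \<and>
    (\<forall>u\<in>W1 p U. \<forall>a. l (\<lambda>x. a * u x) = a * l u) \<and>
    (\<exists>B. \<forall>u\<in>W1 p U. \<bar>l u\<bar> \<le> B * W1_norm p U u)"

definition weakly_W1 ::
  "real \<Rightarrow> 'a::euclidean_space set \<Rightarrow> (nat \<Rightarrow> 'a \<Rightarrow> real) \<Rightarrow> ('a \<Rightarrow> real) \<Rightarrow> bool"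
  where "weakly_W1 p U ws w \<longleftrightarrow> (\<forall>j. ws j \<in> W1 p U) \<and> w \<in> W1 p U \<and>
    (\<forall>l. W1_functional p U l \<longrightarrow> (\<lambda>j. l (ws j)) \<longlonglongrightarrow> l w)"

definition weakly_W1_loc ::
  "real \<Rightarrow> 'a::euclidean_space set \<Rightarrow> (nat \<Rightarrow> 'a \<Rightarrow> real) \<Rightarrow> ('a \<Rightarrow> real) \<Rightarrow> bool"
  where "weakly_W1_loc p \<Omega> ws w \<longleftrightarrow> (\<forall>U. open U \<and> U \<Subset> \<Omega> \<longrightarrow> weakly_W1 p U ws w)"


section \<open>Integrands\<close>

definition caratheodory_integrand ::
  "'a::euclidean_space set \<Rightarrow> ('a \<Rightarrow> 'a \<Rightarrow> real) \<Rightarrow> bool"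
  where "caratheodory_integrand \<Omega> F \<longleftrightarrow>
    (\<forall>z. (\<lambda>x. F x z) \<in> borel_measurable (lebesgue_on \<Omega>)) \<and>
    (\<forall>x\<in>\<Omega>. continuous_on UNIV (F x))"

text \<open>
  \<open>grad (F x) z\<close> is the gradient of \<open>F\<close> in its second variable.
\<close>

definition pq_integrand ::
  "'a::euclidean_space set \<Rightarrow> ('a \<Rightarrow> 'a \<Rightarrow> real) \<Rightarrow>
     real \<Rightarrow> real \<Rightarrow> real \<Rightarrow> real \<Rightarrow> real \<Rightarrow> real \<Rightarrow> bool"
  where "pq_integrand \<Omega> F \<nu> L \<mu> \<alpha> p q \<longleftrightarrow>
    caratheodory_integrand \<Omega> F \<and>
    (\<forall>x\<in>\<Omega>. \<forall>z. \<nu> * norm z powr p \<le> F x z \<and> F x z \<le> L * (1 + (norm z)\<^sup>2) powr (q / 2)) \<and>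
    (\<forall>x\<in>\<Omega>. Ck 1 (F x)) \<and>
    (\<forall>x\<in>\<Omega>. \<forall>z1 z2. (grad (F x) z1 - grad (F x) z2) \<bullet> (z1 - z2)
        \<ge> \<nu> * (\<mu>\<^sup>2 + (norm z1)\<^sup>2 + (norm z2)\<^sup>2) powr ((p - 2) / 2) * (norm (z1 - z2))\<^sup>2) \<and>
    (\<forall>x1\<in>\<Omega>. \<forall>x2\<in>\<Omega>. \<forall>z. norm (grad (F x1) z - grad (F x2) z)
        \<le> L * norm (x1 - x2) powr \<alpha> * (1 + (norm z)\<^sup>2) powr ((q - 1) / 2))"

definition V :: "real \<Rightarrow> real \<Rightarrow> 'a::euclidean_space \<Rightarrow> 'a"
  where "V \<mu> p z = (\<mu>\<^sup>2 + (norm z)\<^sup>2) powr ((p - 2) / 4) *\<^sub>R z"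

text \<open>For the nonnegative integrands considered here.\<close>

definition energy ::
  "('a::euclidean_space \<Rightarrow> 'a \<Rightarrow> real) \<Rightarrow> 'a set \<Rightarrow> ('a \<Rightarrow> real) \<Rightarrow> ennreal"
  where "energy F U w = (\<integral>\<^sup>+x. ennreal (F x (wgrad U w x)) \<partial>lebesgue_on U)"


section \<open>The obstacle problem and the Lavrentiev gap\<close>

definition obstacle_class ::
  "real \<Rightarrow> 'a::euclidean_space set \<Rightarrow> ('a \<Rightarrow> real) \<Rightarrow> ('a \<Rightarrow> real) \<Rightarrow> ('a \<Rightarrow> real) set"
  where "obstacle_class p \<Omega> \<psi> g =
    {w \<in> W1 p \<Omega>. (AE x in lebesgue_on \<Omega>. \<psi> x \<le> w x) \<and> same_trace p \<Omega> w g}"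

definition obstacle_solution ::
  "real \<Rightarrow> 'a::euclidean_space set \<Rightarrow> ('a \<Rightarrow> 'a \<Rightarrow> real) \<Rightarrow>
     ('a \<Rightarrow> real) \<Rightarrow> ('a \<Rightarrow> real) \<Rightarrow> ('a \<Rightarrow> real) \<Rightarrow> bool"
  where "obstacle_solution p \<Omega> F \<psi> g v \<longleftrightarrow>
    v \<in> obstacle_class p \<Omega> \<psi> g \<and>
    integrable (lebesgue_on \<Omega>) (\<lambda>x. F x (wgrad \<Omega> v x)) \<and>
    (\<forall>w\<in>obstacle_class p \<Omega> \<psi> g. energy F \<Omega> v \<le> energy F \<Omega> w)"

text \<open>
  With \<open>r = q\<close> this is the class of admissible approximations \<open>\<K>\<^sup>*\<^sub>\<psi>\<close>, with \<open>r = p\<close> the class \<open>\<K>\<^sub>\<psi>\<close>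
  on which the gap is defined.
\<close>

definition gap_class ::
  "real \<Rightarrow> real \<Rightarrow> 'a::euclidean_space set \<Rightarrow> 'a set \<Rightarrow> ('a \<Rightarrow> real) \<Rightarrow> ('a \<Rightarrow> real) set"
  where "gap_class p r \<Omega> U \<psi> =
    W1_loc p \<Omega> \<inter> {w \<in> W1 r U. AE x in lebesgue_on U. \<psi> x \<le> w x}"

definition relaxed_energy ::
  "real \<Rightarrow> real \<Rightarrow> 'a::euclidean_space set \<Rightarrow> ('a \<Rightarrow> 'a \<Rightarrow> real) \<Rightarrow>
     ('a \<Rightarrow> real) \<Rightarrow> ('a \<Rightarrow> real) \<Rightarrow> 'a set \<Rightarrow> ennreal"
  where "relaxed_energy p q \<Omega> F \<psi> w U =
    (INF ws\<in>{ws. (\<forall>j. ws j \<in> gap_class p q \<Omega> U \<psi>) \<and> weakly_W1_loc p \<Omega> ws w}.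
       liminf (\<lambda>j. energy F U (ws j)))"

definition lavrentiev_gap ::
  "real \<Rightarrow> real \<Rightarrow> 'a::euclidean_space set \<Rightarrow> ('a \<Rightarrow> 'a \<Rightarrow> real) \<Rightarrow>
     ('a \<Rightarrow> real) \<Rightarrow> ('a \<Rightarrow> real) \<Rightarrow> 'a set \<Rightarrow> ereal"
  where "lavrentiev_gap p q \<Omega> F \<psi> w U =
    (if energy F U w < \<infinity>
     then enn2ereal (relaxed_energy p q \<Omega> F \<psi> w U) - enn2ereal (energy F U w) else 0)"

end

theory Submission
  imports Defs
begin

text \<open>
  Testing minimality of \<open>y\<close> with \<open>Dy\<close> in \<open>L\<^sup>q\<close> against a localised translate of \<open>y - \<psi>\<close> and its reflection gives a
  bound of order \<open>|h|\<^sup>\<alpha>\<close> for the squared increments of \<open>V(Dy)\<close>. Interpolating with level sets improves the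
  integrability of \<open>V(Dy)\<close> up to \<open>2n/(n-\<alpha>)\<close>, and as \<open>q < p(1+\<alpha>/n)\<close> the \<open>L\<^sup>q\<close> norm of \<open>Dy\<close> on the right is absorbed,
  so that only the \<open>p\<close>-energy remains. The vanishing gap supplies \<open>W\<^sup>1\<^sup>,\<^sup>q\<close> competitors whose energies approach
  that of \<open>v\<close>; minimisers of integrands perturbed by small \<open>q\<close>-growth terms then converge strongly to \<open>v\<close>,
  and the estimates pass to the limit.
\<close>

abbreviation en :: "real => ennreal" where "en == ennreal"
abbreviation ind :: "'a set => 'a => 'b::zero_neq_one" where "ind == indicator"
abbreviation bm where "bm == borel_measurable borel"
abbreviation Lint where "Lint == integrable lborel"
abbreviation nn_lborel :: "('a::euclidean_space => ennreal) => ennreal" (binder "NN " 10) where "nn_lborel f == integral\<^sup>N lborel f"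
abbreviation int_lborel :: "('a::euclidean_space => 'b::{banach,second_countable_topology}) => 'b" (binder "LL " 10) where "int_lborel f == integral\<^sup>L lborel f"
abbreviation ae_lborel :: "('a::euclidean_space => bool) => bool" (binder "ae " 10) where "ae_lborel P == almost_everywhere lborel P"
notation inner (infix ".*" 70) and scaleR (infixr "*R" 75) and infinity ("oo") and iff (infixr "<->" 25)
 and LIMSEQ ("((_)/ ----> (_))" [60, 60] 60) and tendsto (infixr "--->" 55)
syntax
 "_nn_set" :: "pttrn => 'a set => real => ennreal" ("(NN _:_./ _)" 10)
 "_leb_set" :: "pttrn => 'a set => 'b => 'b" ("(LL _:_./ _)" 10)
 "_nn_leb_set" :: "pttrn => 'a set => ennreal => ennreal" ("(NL _:_./ _)" 10)
translations
 "NN x:A. f" => "CONST nn_integral CONST lborel (%x. CONST times (CONST indicator A x) (CONST ennreal f))"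
 "LL x:A. f" => "CONST lebesgue_integral (CONST lebesgue_on A) (%x. f)"
 "NL x:A. f" => "CONST nn_integral (CONST lebesgue_on A) (%x. f)"

section \<open>Smooth functions\<close>

lemma grad_eq: "GDERIV f x :> D ==> grad f x = D"
proof -
 assume D: "GDERIV f x :> D"
 have "E = D" if "GDERIV f x :> E" for E
 proof -
  have "(%h. h .* E) = (%h. h .* D)" using D that unfolding gderiv_def by (rule has_derivative_unique[rotated])
  thus ?thesis by (metis vector_eq_ldot)
 qed
 with D show ?thesis unfolding grad_def by (intro the_equality)
qed

lemma differentiable_GDERIV:
 fixes f :: "'a::euclidean_space => real"
 assumes "f differentiable (at x)"
 shows "GDERIV f x :> grad f x"
proof -
 from assms obtain f' where f': "(f has_derivative f') (at x)" by (auto simp: differentiable_def)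
 interpret f': bounded_linear f' using f' by (rule has_derivative_bounded_linear)
 define D where "D = (\<Sum>b\<in>Basis. f' b *R b)"
 have "f' h = h .* D" for h
 proof -
  have "f' h = f' (\<Sum>b\<in>Basis. (h .* b) *R b)" by (simp add: euclidean_representation)
  also have "... = (\<Sum>b\<in>Basis. (h .* b) * f' b)" by (simp add: f'.sum f'.scaleR)
  finally show ?thesis by (simp add: D_def inner_sum_right mult.commute)
 qed
 hence "f' = (%h. h .* D)" by auto
 with f' have "GDERIV f x :> D" by (simp add: gderiv_def)
 with grad_eq[OF this] show ?thesis by simp
qed

lemma GDERIV_differentiable: "GDERIV f x :> D ==> f differentiable (at x)" by (auto simp: gderiv_def differentiable_def)

lemma Ck_SucI:
 assumes "!!x. GDERIV f x :> D x" "!!b. b : Basis ==> Ck k (%x. D x .* b)"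
 shows "Ck (Suc k) f"
proof -
 have "grad f = D" by (intro ext grad_eq assms(1))
 thus ?thesis using GDERIV_differentiable[OF assms(1)] assms(2) by simp
qed

lemma Ck_Suc_GDERIV: "Ck (Suc k) f ==> GDERIV f x :> grad f x" by (rule differentiable_GDERIV) simp

lemma Ck_Suc_D: "Ck (Suc k) f ==> Ck k f"
proof (induction k arbitrary: f)
 case 0
 hence "!!x. isCont f x" by (simp add: differentiable_imp_continuous_within)
 thus ?case by (simp add: continuous_at_imp_continuous_on)
next
 case (Suc k)
 have "Ck k (%x. grad f x .* b)" if "b : Basis" for b by (rule Suc.IH) (use Suc.prems that in \<open>simp only: Ck.simps(2)[of "Suc k"]\<close>)
 moreover have "ALL x. f differentiable (at x)" using Suc.prems unfolding Ck.simps(2)[of "Suc k"] by simp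
 ultimately show ?case unfolding Ck.simps(2)[of k] by simp
qed

lemma Ck_const: "Ck k (%x. c)"
proof (induction k arbitrary: c)
 case (Suc k)
 have "GDERIV (%x. c) x :> 0" for x :: 'a by (rule GDERIV_const)
 thus ?case by (rule Ck_SucI) (simp add: Suc)
qed auto

lemma Ck_inner: "Ck k (%x. x .* a)"
proof (cases k)
 case 0
 thus ?thesis by (auto intro!: continuous_intros)
next
 case (Suc m)
 have "GDERIV (%x. x .* a) x :> a" for x by (auto simp: gderiv_def intro!: derivative_eq_intros)
 thus ?thesis unfolding Suc by (rule Ck_SucI) (rule Ck_const)
qed

lemma Ck_add: "Ck k f ==> Ck k g ==> Ck k (%x. f x + g x)"
proof (induction k arbitrary: f g)
 case 0
 thus ?case by (auto intro!: continuous_intros)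
next
 case (Suc k)
 have "GDERIV (%x. f x + g x) x :> grad f x + grad g x" for x by (intro GDERIV_add Ck_Suc_GDERIV[OF Suc.prems(1)] Ck_Suc_GDERIV[OF Suc.prems(2)])
 thus ?case by (rule Ck_SucI) (use Suc in "auto simp: inner_add_left")
qed

lemma Ck_mult: "Ck k f ==> Ck k g ==> Ck k (%x. f x * g x)"
proof (induction k arbitrary: f g)
 case 0
 thus ?case by (auto intro!: continuous_intros)
next
 case (Suc k)
 have "GDERIV (%x. f x * g x) x :> f x *R grad g x + g x *R grad f x" for x by (intro GDERIV_mult Ck_Suc_GDERIV[OF Suc.prems(1)] Ck_Suc_GDERIV[OF Suc.prems(2)])
 thus ?case
 proof (rule Ck_SucI)
  fix b :: 'a assume b: "b : Basis"
  have "Ck k (%x. f x * (grad g x .* b) + g x * (grad f x .* b))" using Suc.prems b by (intro Ck_add Suc.IH Ck_Suc_D[OF Suc.prems(1)] Ck_Suc_D[OF Suc.prems(2)]) auto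
  thus "Ck k (%x. (f x *R grad g x + g x *R grad f x) .* b)" by (simp add: inner_add_left)
 qed
qed

lemma Ck_affine: "Ck k f ==> Ck k (%x. f (c *R x+a))"
proof (induction k arbitrary: f)
 case 0
 hence f: "continuous_on UNIV f" by simp
 have "continuous_on UNIV (%x. c *R x+a)" by (intro continuous_on_add continuous_on_scaleR continuous_on_const continuous_on_id)
 from continuous_on_compose2[OF f this] have "continuous_on UNIV (%x. f (c *R x+a))" by simp
 thus ?case by simp
next
 case (Suc k)
 have "GDERIV (%x. f (c *R x+a)) x :> c *R grad f (c *R x+a)" for x
 proof -
  have "(f has_derivative (%h. h .* grad f (c *R x+a))) (at (c *R x+a))" using Ck_Suc_GDERIV[OF Suc.prems(1)] by (simp add: gderiv_def)
  hence "((%x. f (c *R x+a)) has_derivative (%h. (c *R h) .* grad f (c *R x+a))) (at x)" by (rule has_derivative_compose[rotated]) (auto intro!: derivative_eq_intros)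
  thus ?thesis by (simp add: gderiv_def)
 qed
 thus ?case
 proof (rule Ck_SucI)
  fix b :: 'a assume "b : Basis"
  hence "Ck k (%x. grad f x .* b)" using Suc.prems by auto
  from Ck_mult[OF Ck_const Suc.IH[OF this], of c] show "Ck k (%x. (c *R grad f (c *R x+a)) .* b)" by simp
 qed
qed

lemma smooth_const: "smooth (%x. c)" by (simp add: smooth_def Ck_const)
lemma smooth_add: "smooth f ==> smooth g ==> smooth (%x. f x + g x)" by (simp add: smooth_def Ck_add)
lemma smooth_mult: "smooth f ==> smooth g ==> smooth (%x. f x * g x)" by (simp add: smooth_def Ck_mult)
lemma smooth_affine: "smooth f ==> smooth (%x. f (c *R x+a))" by (simp add: smooth_def Ck_affine)
lemma smooth_GDERIV: "smooth f ==> GDERIV f x :> grad f x" unfolding smooth_def by (intro Ck_Suc_GDERIV[of 0]) blast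
lemma smooth_grad: "smooth f ==> b : Basis ==> smooth (%x. grad f x .* b)" unfolding smooth_def using Ck.simps(2)[of _ f] by blast
lemma smooth_continuous: "smooth f ==> continuous_on A f" unfolding smooth_def using Ck.simps(1)[of f] continuous_on_subset[of UNIV f A] by blast

lemma smooth_continuous_grad:
 assumes "smooth f" shows "continuous_on A (grad f)"
proof -
 have "continuous_on A (%x. \<Sum>b\<in>Basis. (grad f x .* b) *R b)" by (intro continuous_intros smooth_continuous smooth_grad assms)
 thus ?thesis by (simp add: euclidean_representation)
qed

lemma grad_zero_outside:
 assumes "open A" "x : A" "!!y. y : A ==> f y = 0"
 shows "grad f x = 0"
proof -
 have "GDERIV (%x. 0::real) x :> 0" by (rule GDERIV_const)
 hence "(f has_derivative (%h. h .* 0)) (at x)" unfolding gderiv_def by (rule has_derivative_transform_within_open[OF _ assms(1,2)]) (use assms(3) in auto)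
 thus ?thesis by (intro grad_eq) (simp add: gderiv_def)
qed

lemma grad_zero_outside_closed:
 assumes "closed K" "x ~: K" "!!y. y ~: K ==> f y = 0"
 shows "grad f x = 0" by (rule grad_zero_outside[of "- K"]) (use assms in auto)

definition flat :: "nat => real => real"
 where "flat m t = (if t<=0 then 0 else exp (- (1/t)) / t ^ m)"

lemma flat_tendsto_0: "(flat m ---> 0) (at 0)"
proof -
 have "((%s::real. s ^ m / exp s) ---> 0) at_top" by (rule tendsto_power_div_exp_0)
 moreover have "filterlim (%t::real. 1 / t) at_top (at_right 0)" using filterlim_inverse_at_top_right by (simp add: inverse_eq_divide)
 ultimately have "((%t. (1/t) ^ m / exp (1/t)) ---> 0) (at_right (0::real))" by (rule filterlim_compose)
 hence r: "(flat m ---> 0) (at_right 0)" by (rule Lim_transform_eventually)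
  (auto simp: eventually_at_right_less flat_def exp_minus field_simps power_divide
  intro!: eventually_at_rightI[of 0 1])
 have "((%x. 0) ---> (0::real)) (at_left (0::real))" by simp
 hence l: "(flat m ---> 0) (at_left 0)" by (rule Lim_transform_eventually) (auto simp: flat_def intro!: eventually_at_leftI[of "-1"])
 from l r show ?thesis by (simp add: filterlim_split_at)
qed

lemma flat_deriv: "(flat m has_real_derivative (flat (m+2) t - real m * flat (m+1) t)) (at t)"
proof -
 consider "t<0" | "t = 0" | "t > 0" by linarith
 thus ?thesis
 proof cases
  case 1
  have "((%t. 0) has_real_derivative 0) (at t)" by simp
  hence "(flat m has_real_derivative 0) (at t)" by (rule has_field_derivative_transform_within_open[where S="{..<0}"]) (use 1 in "auto simp: flat_def")
  with 1 show ?thesis by (simp add: flat_def)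
 next
  case 2
  have "((%h. (flat m (0+h) - flat m 0) / h) ---> 0) (at 0)" using flat_tendsto_0[of "Suc m"] by (rule Lim_transform_eventually) (auto simp: flat_def eventually_at_filter)
  hence "(flat m has_real_derivative 0) (at 0)" by (simp add: DERIV_def)
  with 2 show ?thesis by (simp add: flat_def)
 next
  case 3
  have e: "((%t. exp (- (1/t))) has_real_derivative exp (- (1/t)) / t^2) (at t)" using 3 by (auto intro!: derivative_eq_intros simp: power2_eq_square)
  have p: "((%t. t ^ m) has_real_derivative real m * t ^ m / t) (at t)" by (rule DERIV_cong[OF DERIV_pow]) (use 3 in "cases m; simp")
  have "((%t. exp (- (1/t)) / t ^ m) has_real_derivative (flat (m+2) t - real m * flat (m+1) t)) (at t)" by (rule DERIV_cong[OF DERIV_divide[OF e p]])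
   (use 3 in "auto simp: flat_def field_simps power2_eq_square")
  thus ?thesis by (rule has_field_derivative_transform_within_open[where S="{0<..}"]) (use 3 in "auto simp: flat_def")
 qed
qed

lemma Ck_flat: "Ck k (%x::'a::euclidean_space. flat m (1 - x .* x))"
proof (induction k arbitrary: m)
 case 0
 have "continuous_on UNIV (flat m)" by (auto intro!: continuous_at_imp_continuous_on DERIV_isCont flat_deriv)
 thus ?case by (auto intro!: continuous_on_compose2[of UNIV "flat m"] continuous_intros)
next
 case (Suc k)
 have "GDERIV (%x. flat m (1 - x .* x)) x :> (- 2*(flat (m+2) (1 - x .* x) - real m * flat (m+1) (1 - x .* x))) *R x"
  for x :: 'a
 proof -
  have "((%x. flat m (1 - x .* x)) has_derivative (%h. (- (x .* h + h .* x)) * (flat (m+2) (1 - x .* x) - real m * flat (m+1) (1 - x .* x)))) (at x)"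
   by (rule has_derivative_compose[OF _ flat_deriv[unfolded has_field_derivative_def mult.commute[of _ "_-_"]], of "%x. 1 - x .* x", simplified mult.commute[of "_-_"]])
   (auto intro!: derivative_eq_intros)
  thus ?thesis by (simp add: gderiv_def inner_commute algebra_simps)
 qed
 thus ?case
 proof (rule Ck_SucI)
  fix b :: 'a
  have "Ck k (%x::'a. (- 2*(flat (m+2) (1 - x .* x) + (- real m) * flat (m+1) (1 - x .* x))) * (x .* b))" by (intro Ck_mult Ck_add Ck_const Ck_inner Suc)
  thus "Ck k (%x. ((- 2*(flat (m+2) (1 - x .* x) - real m * flat (m+1) (1 - x .* x))) *R x) .* b)" by simp
 qed
qed

section \<open>Mollification\<close>

lemma lborel_distr_reflect: "distr lborel borel (%x::'a::euclidean_space. t - x) = lborel" by (subst (2) lborel_affine[of "-1" t]) (simp_all add: density_1)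

lemma lborel_distr_translate: "distr lborel borel (%x::'a::euclidean_space. x + t) = lborel"
proof -
 have "(%x. x + t) = (+) t" by (auto simp: add.commute)
 thus ?thesis by (simp only: lborel_distr_plus)
qed

lemma nn_integral_translate:
 fixes f :: "'a::euclidean_space => ennreal"
 assumes [measurable]: "f : bm"
 shows "(NN x. f (x+t)) = (NN x. f x)" by (subst (2) lborel_distr_translate[of t, symmetric], subst nn_integral_distr) auto

lemma integral_translate:
 fixes f :: "'a::euclidean_space => 'b::{banach, second_countable_topology}"
 assumes [measurable]: "f : bm"
 shows "(LL x. f (x+t)) = (LL x. f x)" by (subst (2) lborel_distr_translate[of t, symmetric], subst integral_distr) auto

lemma integral_reflect:
 fixes f :: "'a::euclidean_space => 'b::{banach, second_countable_topology}"
 assumes [measurable]: "f : bm"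
 shows "(LL x. f (t-x)) = (LL x. f x)" by (subst (2) lborel_distr_reflect[of t, symmetric], subst integral_distr) auto

lemma integrable_translate:
 fixes f :: "'a::euclidean_space => 'b::{banach, second_countable_topology}"
 assumes "Lint f"
 shows "Lint (%x. f (x+t))"
proof -
 have "integrable (distr lborel borel (%x. x + t)) f" using assms by (simp add: lborel_distr_translate)
 thus ?thesis by (rule integrable_distr[rotated]) simp
qed

lemma integrable_reflect:
 fixes f :: "'a::euclidean_space => 'b::{banach, second_countable_topology}"
 assumes "Lint f"
 shows "Lint (%x. f (t-x))"
proof -
 have "integrable (distr lborel borel (%x. t - x)) f" using assms by (simp add: lborel_distr_reflect)
 thus ?thesis by (rule integrable_distr[rotated]) simp
qed

lemma AE_translate:
 assumes "ae x. P (x::'a::euclidean_space)"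
 shows "ae x. P (x+t)"
proof -
 have "AE x in distr lborel borel (%x. x + t). P x" using assms by (simp only: lborel_distr_translate)
 thus ?thesis by (rule AE_distrD[rotated]) simp
qed

definition kernel :: "real => ('a::euclidean_space => real) => bool"
 where "kernel R k <-> smooth k & (ALL x. x ~: cball 0 R --> k x = 0)"

lemma kernel_grad_zero: "kernel R k ==> x ~: cball 0 R ==> grad k x = 0" unfolding kernel_def by (intro grad_zero_outside_closed[of "cball 0 R"]) auto

lemma kernel_grad: "kernel R k ==> b : Basis ==> kernel R (%x. grad k x .* b)" using kernel_grad_zero[of R k] by (simp add: kernel_def smooth_grad)

lemma continuous_compact_support_bounded:
 fixes f :: "'a::euclidean_space => 'b::real_normed_vector"
 assumes "continuous_on UNIV f" "!!x. x ~: cball 0 R ==> f x = 0"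
 obtains B where "0<B" "!!x. norm (f x)<=B"
proof -
 have "compact (f ` cball 0 R)" by (intro compact_continuous_image continuous_on_subset[OF assms(1)]) auto
 then obtain B where B: "0<B" "!!y. y : f ` cball 0 R ==> norm y<=B" by (metis compact_imp_bounded bounded_pos)
 have "norm (f x)<=B" for x using B assms(2)[of x] by (cases "x : cball 0 R") auto
 with B show ?thesis by (intro that)
qed

lemma continuous_compact_support_uniformly_continuous:
 fixes f :: "'a::euclidean_space => 'b::real_normed_vector"
 assumes "continuous_on UNIV f" "!!x. x ~: cball 0 R ==> f x = 0" "0<e"
 obtains d where "0<d" "!!x y. norm (x-y)<d ==> norm (f x - f y)<e"
proof -
 have "uniformly_continuous_on (cball 0 (R+1)) f" by (intro compact_uniformly_continuous continuous_on_subset[OF assms(1)]) auto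
 then obtain d where d: "0<d" "!!x y. x : cball 0 (R+1) ==> y : cball 0 (R+1) ==>
  dist y x<d ==> dist (f y) (f x)<e" unfolding uniformly_continuous_on_def using \<open>0 < e\<close> by metis
 have "norm (f x - f y)<e" if xy: "norm (x-y)<min d 1" for x y
 proof (cases "x : cball 0 (R+1) & y : cball 0 (R+1)")
  case True
  thus ?thesis using d(2)[of y x] xy by (auto simp: dist_norm)
 next
  case False
  have "norm x<=norm y + norm (x-y)" "norm y<=norm x + norm (x-y)" using norm_triangle_ineq[of y "x-y"] norm_triangle_ineq[of x "y-x"] by (auto simp: norm_minus_commute)
  with False xy have "x ~: cball 0 R" "y ~: cball 0 R" by auto
  with assms show ?thesis by simp
 qed
 thus ?thesis using d(1) by (intro that[of "min d 1"]) auto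
qed

lemma kernel_bounded:
 assumes "kernel R k" obtains B where "0<B" "!!x. abs (k x)<=B" using continuous_compact_support_bounded[of k R] assms smooth_continuous[of k UNIV] unfolding kernel_def by (metis real_norm_def)

lemma kernel_grad_bounded:
 assumes "kernel R k" obtains B where "0<B" "!!x. norm (grad k x)<=B" using continuous_compact_support_bounded[of "grad k" R] assms kernel_grad_zero[OF assms]
  smooth_continuous_grad[of k UNIV] unfolding kernel_def by metis

lemma smooth_measurable: "smooth k ==> k : bm" by (intro borel_measurable_continuous_onI smooth_continuous)

lemma smooth_grad_measurable: "smooth k ==> grad k : bm" by (intro borel_measurable_continuous_onI smooth_continuous_grad)

lemma kernel_measurable: "kernel R k ==> k : bm" by (simp add: kernel_def smooth_measurable)

lemma kernel_uniformly_differentiable: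
 fixes k :: "'a::euclidean_space => real"
 assumes k: "kernel R k" and "0<e"
 obtains d where "0<d" "!!x h. norm h<d ==> abs (k (x+h) - k x - h .* grad k x)<=e * norm h"
proof -
 have sk: "smooth k" using k by (simp add: kernel_def)
 from continuous_compact_support_uniformly_continuous[OF smooth_continuous_grad[OF sk] kernel_grad_zero[OF k] \<open>0 < e\<close>]
 obtain d where d: "0<d" "!!x y. norm (x-y)<d ==> norm (grad k x - grad k y)<e" by metis
 have "abs (k (x+h) - k x - h .* grad k x)<=e * norm h" if h: "norm h<d" for x h :: 'a
 proof -
  have "norm ((k (x+h) - h .* grad k x)-(k (x+0) - 0 .* grad k x))<=e * norm (h-0)"
  proof (rule differentiable_bound[of "ball 0 d" "%w. k (x+w) - w .* grad k x" "%w y. y .* (grad k (x+w) - grad k x)"])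
   fix w :: 'a assume w: "w : ball 0 d"
   have "((%w. k (x+w)) has_derivative (%y. y .* grad k (x+w))) (at w within ball 0 d)" by (rule has_derivative_compose[of "%w. x + w" "%h. h", OF _ smooth_GDERIV[OF sk, unfolded gderiv_def]])
    (auto intro!: derivative_eq_intros)
   thus "((%w. k (x+w) - w .* grad k x) has_derivative (%y. y .* (grad k (x+w) - grad k x)))
    (at w within ball 0 d)" by (auto intro!: derivative_eq_intros simp: inner_diff_right)
   have "norm (grad k (x+w) - grad k x)<e" using d(2)[of "x+w" x] w by simp
   thus "onorm (%y. y .* (grad k (x+w) - grad k x))<=e" by (intro onorm_bound) (use \<open>0 < e\<close> in "auto intro!: order_trans[OF Cauchy_Schwarz_ineq2] simp: mult.commute[of e] mult_left_mono")
  qed (use h d in auto)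
  thus ?thesis by (simp add: algebra_simps)
 qed
 with d(1) show ?thesis by (intro that)
qed

definition conv :: "('a::euclidean_space => real) => ('a => 'b::euclidean_space) => 'a => 'b"
 where "conv k u x = (LL y. k (x-y) *R u y)"

lemma integrable_bounded_scaleR:
 fixes u :: "'a => 'b::{banach, second_countable_topology}"
 assumes [measurable]: "k : borel_measurable M" and u: "integrable M u" and B: "!!x. abs (k x)<=B"
 shows "integrable M (%x. k x *R u x)"
proof (rule Bochner_Integration.integrable_bound[of _ "%x. B * norm (u x)"])
 have [measurable]: "u : borel_measurable M" using u by simp
 show "(%x. k x *R u x) : borel_measurable M" by simp
 have "0<=B" using B[of undefined] by simp
 thus "AE x in M. norm (k x *R u x)<=norm (B * norm (u x))" using B by (auto intro!: mult_right_mono)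
qed (use u in auto)

lemma integrable_conv_kernel:
 fixes u :: "'a::euclidean_space => 'b::euclidean_space"
 assumes k: "kernel R k" and u: "Lint u"
 shows "Lint (%y. k (x-y) *R u y)"
proof -
 obtain B where B: "!!x. abs (k x)<=B" using kernel_bounded[OF k] by metis
 have [measurable]: "k : bm" by (rule kernel_measurable[OF k])
 show ?thesis by (rule integrable_bounded_scaleR[OF _ u, of _ B]) (use B in auto)
qed

lemma conv_GDERIV:
 fixes u :: "'a::euclidean_space => real"
 assumes k: "kernel R k" and u: "Lint u"
 shows "GDERIV (conv k u) x :> (LL y. u y *R grad k (x-y))"
proof -
 have [measurable]: "k : bm" "grad k : bm" using k by (auto intro: kernel_measurable smooth_grad_measurable simp: kernel_def)
 have [measurable]: "u : borel_measurable lborel" using u by simp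
 obtain B where B: "!!x. norm (grad k x)<=B" using kernel_grad_bounded[OF k] by metis
 let ?a = "%y. u y *R grad k (x-y)"
 have int: "Lint (%y. u y *R grad k (x-y))"
 proof (rule Bochner_Integration.integrable_bound[of _ "%y. B * norm (u y)"])
  have "0<=B" using B[of undefined] norm_ge_zero by (rule order_trans[rotated])
  thus "AE y in lborel. norm (?a y)<=norm (B * norm (u y))" using B by (intro AE_I2) (simp add: mult.commute[of B] mult_left_mono)
 qed (use u in auto)
 define D where "D = (LL y. u y *R grad k (x-y))"
 define N where "N = (LL y. abs (u y))+1"
 have N: "0<N" unfolding N_def by (intro add_nonneg_pos integral_nonneg) auto
 show ?thesis unfolding gderiv_def has_derivative_at_alt D_def[symmetric]
 proof (intro conjI allI impI)
  show "bounded_linear (%h. h .* D)" by (rule bounded_linear_inner_left)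
  fix e :: real assume "0<e"
  hence "0<e/N" using N by simp
  from kernel_uniformly_differentiable[OF k this]
  obtain d where d: "0<d" "!!x h. norm h<d ==> abs (k (x+h) - k x - h .* grad k x)<=e/N * norm h" by metis
  let ?b = "%z. conv k u z - conv k u x - (z-x) .* D"
  show "EX d>0. ALL z. norm (z-x)<d --> norm (?b z)<=e * norm (z-x)"
  proof (intro exI[of _ d] conjI allI impI d(1))
   fix z assume z: "norm (z-x)<d"
   have i1: "Lint (%y. k (z-y) * u y)" "Lint (%y. k (x-y) * u y)" using integrable_conv_kernel[OF k u] by auto
   have i2: "Lint (%y. (z-x) .* ?a y)" by (intro integrable_inner_right int)
   have "?b z
    = (LL y. k (z-y) * u y - k (x-y) * u y - (z-x) .* ?a y)" using i1 i2 integral_inner_right[of "z-x" lborel "%y. u y *R grad k (x-y)"] int by (simp add: conv_def D_def del: inner_scaleR_right)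
   also have "abs (...)<=(LL y. (e/N * norm (z-x)) * abs (u y))"
   proof (rule Bochner_Integration.integral_norm_bound_integral[of _ "%y. k (z-y) * u y - k (x-y) * u y - (z-x) .* (u y *R grad k (x-y))", unfolded real_norm_def])
    show "Lint (%y. k (z-y) * u y - k (x-y) * u y - (z-x) .* ?a y)" by (intro Bochner_Integration.integrable_diff i1 i2)
    fix y
    let ?c = "k (z-y) * u y - k (x-y) * u y - (z-x) .* ?a y"
    have "?c = (k ((x-y)+(z-x)) - k (x-y) - (z-x) .* grad k (x-y)) * u y" by (simp add: algebra_simps)
    thus "abs ?c <= e/N * norm (z-x) * abs (u y)" using mult_right_mono[OF d(2)[OF z, of "x-y"], of "abs (u y)"] by (simp add: abs_mult)
   qed (use u in auto)
   also have "... = (e * norm (z-x))*((LL y. abs (u y))/N)" by simp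
   also have "...<=(e * norm (z-x))*1" using N \<open>0 < e\<close> by (intro mult_left_mono) (auto simp: N_def divide_le_eq)
   finally show "norm (?b z)<=e * norm (z-x)" by simp
  qed
 qed
qed

lemma grad_conv:
 fixes u :: "'a::euclidean_space => real"
 assumes "kernel R k" "Lint u"
 shows "grad (conv k u) x = (LL y. u y *R grad k (x-y))" by (rule grad_eq[OF conv_GDERIV[OF assms]])

lemma grad_conv_inner:
 fixes u :: "'a::euclidean_space => real"
 assumes k: "kernel R k" and u: "Lint u" and b: "b : Basis"
 shows "(LL y. u y *R grad k (x-y)) .* b = conv (%x. grad k x .* b) u x"
proof -
 have [measurable]: "grad k : bm" using k by (auto intro: smooth_grad_measurable simp: kernel_def)
 have [measurable]: "u : borel_measurable lborel" using u by simp
 obtain B where B: "!!x. norm (grad k x)<=B" using kernel_grad_bounded[OF k] by metis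
 have "Lint (%y. u y *R grad k (x-y))"
 proof (rule Bochner_Integration.integrable_bound[of _ "%y. B * norm (u y)"])
  have "0<=B" using B[of undefined] norm_ge_zero by (rule order_trans[rotated])
  thus "AE y in lborel. norm (u y *R grad k (x-y))<=norm (B * norm (u y))" using B by (intro AE_I2) (simp add: mult.commute[of B] mult_left_mono)
 qed (use u in auto)
 thus ?thesis by (simp add: conv_def mult.commute flip: integral_inner_left)
qed

lemma Ck_conv:
 fixes u :: "'a::euclidean_space => real"
 assumes "kernel R k" "Lint u"
 shows "Ck m (conv k u)" using assms(1)
proof (induction m arbitrary: k)
 case 0
 have "isCont (conv k u) x" for x using GDERIV_differentiable[OF conv_GDERIV[OF 0 assms(2)], of x] by (rule differentiable_imp_continuous_within)
 thus ?case by (simp add: continuous_at_imp_continuous_on)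
next
 case (Suc m)
 show ?case by (rule Ck_SucI[OF conv_GDERIV[OF Suc.prems assms(2)]])
  (simp add: grad_conv_inner[OF Suc.prems assms(2)] Suc.IH[OF kernel_grad[OF Suc.prems]])
qed

lemma smooth_conv:
 fixes u :: "'a::euclidean_space => real"
 assumes "kernel R k" "Lint u" shows "smooth (conv k u)" using Ck_conv[OF assms] by (simp add: smooth_def)

lemma conv_zero_outside:
 fixes u :: "'a::euclidean_space => 'b::euclidean_space"
 assumes k: "kernel R k" and "!!y. y : cball x R ==> u y = 0"
 shows "conv k u x = 0"
proof -
 have "(%y. k (x-y) *R u y) = (%y. 0)"
 proof
  fix y show "k (x-y) *R u y = 0" using assms by (cases "y : cball x R") (auto simp: kernel_def dist_norm)
 qed
 thus ?thesis by (simp only: conv_def) simp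
qed

lemma integral_grad_kernel:
 assumes k: "kernel R (k :: 'a::euclidean_space => real)"
 shows "(LL x. grad k x) = 0"
proof -
 have sk: "smooth k" using k by (simp add: kernel_def)
 have [measurable]: "k : bm" "grad k : bm" using sk by (auto intro: smooth_measurable smooth_grad_measurable)
 have icb: "Lint (%x. c * ind (cball (0::'a) r) x)" for r c :: real using emeasure_bounded_finite[OF bounded_cball, of "0::'a" r] by (intro integrable_mult_right integrable_real_indicator) auto
 obtain B where B: "0<B" "!!x. abs (k x)<=B" using kernel_bounded[OF k] by metis
 obtain B' where B': "0<B'" "!!x. norm (grad k x)<=B'" using kernel_grad_bounded[OF k] by metis
 have ik: "Lint k" by (rule Bochner_Integration.integrable_bound[OF icb[of B R]]) (use B k in "auto simp: kernel_def indicator_def")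
 have ig: "Lint (grad k)" by (rule Bochner_Integration.integrable_bound[OF icb[of B' R]])
  (use B' kernel_grad_zero[OF k] in "auto simp: indicator_def")
 let ?a = "cball (0::'a) (R+1)"
 define m where "m = measure lborel ?a"
 let ?b = "LL x. grad k x"
 let ?c = "%x h. abs (k (x+h) - k x - h .* grad k x)"
 have le: "abs (h .* ?b)<=e * norm h * m" if "norm h<d" "norm h<=1"
  and d: "!!x h. norm h<d ==> ?c x h<=e * norm h" for e d h
 proof -
  have "(LL x. k (x+h) - k x - h .* grad k x) = - (h .* ?b)" using ik ig integrable_translate[OF ik, of h] by (simp add: integral_translate)
  hence "abs (h .* ?b) = abs (LL x. k (x+h) - k x - h .* grad k x)" by simp
  also have "...<=(LL x. e * norm h * ind ?a x)"
  proof (rule Bochner_Integration.integral_norm_bound_integral[of _ "%x. k (x+h) - k x - h .* grad k x", unfolded real_norm_def])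
   fix x :: 'a
   have "norm x<=norm (x+h) + norm h" using norm_triangle_ineq[of "x+h" "- h"] by simp
   thus "?c x h<=e * norm h * ind ?a x" using d[OF that(1), of x] that(2) k kernel_grad_zero[OF k, of x] by (cases "x : cball 0 (R+1)") (auto simp: kernel_def)
  qed (use ik ig integrable_translate[OF ik, of h] icb in auto)
  also have "... = e * norm h * m" by (simp add: m_def)
  finally show ?thesis .
 qed
 define D where "D = ?b"
 have "norm D<=e" if "0<e" for e
 proof (rule ccontr)
  assume "\<not> norm D<=e"
  hence D: "e<norm D" by simp
  have m: "0<=m" by (simp add: m_def)
  have "0<e/(m+1)" using that m by simp
  from kernel_uniformly_differentiable[OF k this]
  obtain d where d: "0<d" "!!x h. norm h<d ==> ?c x h<=e/(m+1) * norm h" by metis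
  define t where "t = min (d/2) 1 / norm D"
  have "0<norm D" using D that by linarith
  hence t: "0<t" "norm (t *R D)<d" "norm (t *R D)<=1" using d(1) by (auto simp: t_def)
  from le[OF t(2,3) d(2)] have "t*(norm D)^2<=e/(m+1)*(t * norm D)*m" using t(1) by (simp add: D_def[symmetric] power2_norm_eq_inner abs_mult)
  also have "... = t * norm D * (e*(m/(m+1)))" by simp
  also have "...<=t * norm D * (e*1)" using t m that by (intro mult_left_mono) auto
  finally have "norm D<=e" using t \<open>0 < norm D\<close> by (simp add: power2_eq_square)
  with D show False by simp
 qed
 hence "norm D<=0" using field_le_epsilon[of "norm D" 0] by simp
 thus ?thesis by (simp add: D_def)
qed

definition bump :: "real => 'a::euclidean_space => real"
 where "bump ep x = flat 0 (1-(x /\<^sub>R ep) .* (x /\<^sub>R ep))"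

definition moll :: "real => 'a::euclidean_space => real"
 where "moll ep x = bump ep x / (LL y. bump ep (y::'a))"

lemma bump_nonneg: "0<=bump ep x" by (simp add: bump_def flat_def)

lemma bump_eq_norm: "0<ep ==> bump ep x = flat 0 (1-(norm x / ep)^2)" by (simp add: bump_def power_divide power2_norm_eq_inner[symmetric] power2_eq_square divide_inverse mult_ac)

lemma kernel_bump: assumes "0<ep" shows "kernel ep (bump ep :: 'a::euclidean_space => real)"
proof -
 have "smooth (%x::'a. flat 0 (1 - x .* x))" by (simp add: smooth_def Ck_flat)
 from smooth_affine[OF this, of "inverse ep" 0] have "smooth (bump ep :: 'a => real)" by (simp add: bump_def[abs_def])
 moreover have "bump ep x = 0" if "x ~: cball 0 ep" for x :: 'a
 proof -
  have "1<norm x / ep" using that assms by simp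
  hence "1<=(norm x / ep)^2" using power_mono[of 1 "norm x / ep" 2] by simp
  thus ?thesis using assms by (simp add: bump_eq_norm flat_def)
 qed
 ultimately show ?thesis by (simp add: kernel_def)
qed

lemma integrable_const_cball: "Lint (%x. c * ind (cball (a::'a::euclidean_space) r) x :: real)" using emeasure_bounded_finite[OF bounded_cball, of a r] by (intro integrable_mult_right integrable_real_indicator) auto

lemma integrable_kernel:
 assumes "kernel R (k::'a::euclidean_space => real)" shows "Lint k"
proof -
 obtain B where B: "0<B" "!!x. abs (k x)<=B" using kernel_bounded[OF assms] by metis
 have [measurable]: "k : bm" by (rule kernel_measurable[OF assms])
 show ?thesis by (rule Bochner_Integration.integrable_bound[OF integrable_const_cball[of B 0 R]])
  (use B assms in "auto simp: kernel_def indicator_def")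
qed

lemma integral_bump_ge:
 assumes "0<ep"
 shows "flat 0 (3/4) * (unit_ball_vol DIM('a) * (ep/2) ^ DIM('a))<=(LL x. bump ep (x::'a::euclidean_space))"
proof -
 have "flat 0 (3/4) * (unit_ball_vol DIM('a) * (ep/2) ^ DIM('a))
  = (LL x. flat 0 (3/4) * ind (cball (0::'a) (ep/2)) x)" using assms by (simp add: content_cball)
 also have "...<=(LL x. bump ep (x::'a))"
 proof (rule integral_mono[OF integrable_const_cball integrable_kernel[OF kernel_bump[OF assms]]])
  fix x :: 'a
  have "flat 0 (3/4)<=bump ep x" if "norm x<=ep/2"
  proof -
   let ?a = "norm x / ep"
   have "?a<=1/2" using that assms by (simp add: field_simps)
   hence "?a^2<=(1/2)^2" using assms by (intro power_mono) auto
   hence t: "?a^2<=1/4" by (simp add: power2_eq_square)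
   hence "1/(1-?a^2)<=1/(3/4)" by (intro divide_left_mono) auto
   thus ?thesis using assms t by (simp add: bump_eq_norm flat_def)
  qed
  thus "flat 0 (3/4) * ind (cball 0 (ep/2)) x<=bump ep x" by (auto simp: indicator_def bump_nonneg)
 qed
 finally show ?thesis .
qed

lemma integral_bump_pos:
 assumes "0<ep" shows "0<(LL x. bump ep (x::'a::euclidean_space))" by (rule less_le_trans[OF _ integral_bump_ge[OF assms]]) (use assms in "auto simp: flat_def")

lemma smooth_cmult: "smooth f ==> smooth (%x. c * f x)" by (intro smooth_mult smooth_const)

lemma kernel_moll: "0<ep ==> kernel ep (moll ep :: 'a::euclidean_space => real)" using kernel_bump[of ep, where 'a='a]
  smooth_cmult[of "bump ep :: 'a => real" "1/(LL y. bump ep (y::'a))"] by (auto simp: kernel_def moll_def[abs_def])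

lemma moll_nonneg: "0<=moll ep x" by (auto simp: moll_def bump_nonneg intro!: divide_nonneg_nonneg integral_nonneg)

lemma integral_moll: "0<ep ==> (LL x. moll ep (x::'a::euclidean_space)) = 1" using integral_bump_pos[of ep, where 'a='a] by (simp add: moll_def)

lemma nn_integral_moll: "0<ep ==> (NN x. en (moll ep (x::'a::euclidean_space))) = 1" by (subst nn_integral_eq_integral)
  (auto simp: moll_nonneg integral_moll intro: integrable_kernel kernel_moll)

lemma norm_grad_moll_le:
 obtains C where "0<C" "!!ep x. 0<ep ==> norm (grad (moll ep) (x::'a::euclidean_space))<=C/ep ^ (DIM('a) + 1)"
proof -
 obtain B where B: "0<B" "!!x::'a. norm (grad (bump 1) x)<=B" using kernel_grad_bounded[OF kernel_bump[of 1]] by auto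
 define c where "c = flat 0 (3/4) * (unit_ball_vol DIM('a) * (1/2) ^ DIM('a))"
 have c: "0<c" by (simp add: c_def flat_def)
 have "norm (grad (moll ep) (x::'a))<=(B/c)/ep ^ (DIM('a) + 1)" if e: "0<ep" for ep x
 proof -
  define I where "I = (LL y. bump ep (y::'a))"
  have I: "c*ep ^ DIM('a)<=I" "0<I" using integral_bump_ge[OF e, where 'a='a] integral_bump_pos[OF e, where 'a='a] by (simp_all add: c_def I_def power_divide)
  have sb: "smooth (bump 1 :: 'a => real)" using kernel_bump[of 1] by (auto simp: kernel_def)
  have "((%x. bump 1 (x /\<^sub>R ep)) has_derivative (%h. (h /\<^sub>R ep) .* grad (bump 1) (x /\<^sub>R ep))) (at x)" by (rule has_derivative_compose[OF _ smooth_GDERIV[OF sb, unfolded gderiv_def]])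
   (auto intro!: derivative_eq_intros)
  hence "((%x. bump 1 (x /\<^sub>R ep) / I) has_derivative (%h. h .* ((1/(ep*I)) *R grad (bump 1) (x /\<^sub>R ep)))) (at x)" by (rule has_derivative_eq_rhs[OF has_derivative_divide'[of _ _ x UNIV "%x. I" "%x. 0"]])
   (use I e in "auto simp: power2_eq_square divide_simps fun_eq_iff")
  moreover have "moll ep = (%x::'a. bump 1 (x /\<^sub>R ep) / I)" by (auto simp: moll_def I_def bump_def)
  ultimately have "grad (moll ep) x = (1/(ep*I)) *R grad (bump 1) (x /\<^sub>R ep)" by (intro grad_eq) (simp add: gderiv_def)
  hence "norm (grad (moll ep) x)<=(1/(ep*I))*B" using B e I by (auto intro!: mult_left_mono simp: divide_right_mono)
  also have "...<=(1/(ep*(c*ep ^ DIM('a))))*B" using I c e B by (intro mult_right_mono divide_left_mono mult_left_mono) auto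
  finally show ?thesis by (simp add: field_simps)
 qed
 with B c show ?thesis by (intro that[of "B/c"]) auto
qed

lemma smooth_cutoff:
 obtains C where "0<C" "!!(a::'a::euclidean_space) r R. 0<r ==> r<R ==> EX et. smooth et & (ALL x. 0<=et x & et x<=1) &
   (ALL x:cball a r. et x = 1) & (ALL x. x ~: cball a R --> et x = 0) & (ALL x. norm (grad et x)<=C/(R-r))"
proof -
 let ?a = "DIM('a) + 1"
 obtain C where C: "0<C" "!!ep x. 0<ep ==> norm (grad (moll ep) (x::'a))<=C/ep ^ ?a" using norm_grad_moll_le[where 'a='a] by blast
 define C' where "C' = 2*(C * unit_ball_vol DIM('a))"
 have "EX et. smooth et & (ALL x. 0<=et x & et x<=1) &
  (ALL x:cball a r. et x = 1) & (ALL x. x ~: cball a R --> et x = 0) & (ALL x. norm (grad et x)<=C'/(R-r))"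
  if rR: "0<r" "r<R" for a :: 'a and r R
 proof -
  define e where "e = (R-r)/2"
  define s where "s = (r + R)/2"
  have e: "0<e" "r+e = s" "s+e = R" using rR by (auto simp: e_def s_def field_simps)
  define u :: "'a => real" where "u = ind (cball a s)"
  define et where "et = conv (moll e) u"
  have km: "kernel e (moll e :: 'a => real)" by (rule kernel_moll[OF e(1)])
  have [measurable]: "(moll e :: 'a => real) : bm" "(grad (moll e) :: 'a => 'a) : bm" using kernel_measurable[OF km] smooth_grad_measurable[of "moll e"] km by (auto simp: kernel_def)
  have iu: "Lint u" using integrable_const_cball[of 1 a s] by (simp add: u_def)
  hence [measurable]: "u : bm" by auto
  have im: "Lint (%y. moll e (x-y))" for x :: 'a by (rule integrable_reflect[OF integrable_kernel[OF km]])
  have one: "(LL y. moll e (x-y)) = 1" for x :: 'a using integral_reflect[of "moll e" x] integral_moll[OF e(1), where 'a='a] by simp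
  have imu: "Lint (%y. moll e (x-y) * u y)" for x using integrable_conv_kernel[OF km iu] by simp
  have eta: "et x = (LL y. moll e (x-y) * u y)" for x by (simp add: et_def conv_def)
  have "0<=et x" for x by (auto simp: eta u_def intro!: Bochner_Integration.integral_nonneg mult_nonneg_nonneg moll_nonneg)
  moreover have "et x<=1" for x
  proof -
   have "et x<=(LL y. moll e (x-y))" unfolding eta by (rule integral_mono[OF imu im]) (auto simp: u_def indicator_def moll_nonneg)
   thus ?thesis by (simp add: one)
  qed
  moreover have "et x = 1" if "x : cball a r" for x
  proof -
   have "moll e (x-y) * u y = moll e (x-y)" for y
   proof (cases "x-y : cball 0 e")
    case True
    have "dist a y<=dist a x + dist x y" by (rule dist_triangle)
    moreover have "dist x y<=e" using True by (simp add: dist_norm norm_minus_commute)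
    ultimately have "y : cball a s" using that e by auto
    thus ?thesis by (simp add: u_def)
   next
    case False
    thus ?thesis using km by (simp add: kernel_def)
   qed
   from ext[of "%y. moll e (x-y) * u y", OF this] show ?thesis by (simp only: eta one)
  qed
  moreover have "et x = 0" if "x ~: cball a R" for x unfolding et_def
  proof (rule conv_zero_outside[OF km])
   fix y assume y: "y : cball x e"
   have "dist a x<=dist a y + dist x y" by (rule dist_triangle2)
   hence "y ~: cball a s" using y that e by auto
   thus "u y = 0" by (simp add: u_def)
  qed
  moreover have "norm (grad et x)<=C'/(R-r)" for x
  proof -
   have "norm (grad et x) = norm (LL y. u y *R grad (moll e) (x-y))" unfolding et_def by (simp add: grad_conv[OF km iu])
   also have "...<=(LL y. C / e ^ ?a * ind (cball x e) y)"
   proof (rule Bochner_Integration.integral_norm_bound_integral)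
    show "Lint (%y. u y *R grad (moll e) (x-y))"
    proof (rule Bochner_Integration.integrable_bound[OF integrable_const_cball[of "C/e ^ (DIM('a) + 1)" a s]])
     show "AE y in lborel. norm (u y *R grad (moll e) (x-y))<=norm (C/e ^ ?a * ind (cball a s) y)" using C(2)[OF e(1)] C(1) e(1) by (intro AE_I2) (simp add: u_def indicator_def)
    qed measurable
    fix y
    show "norm (u y *R grad (moll e) (x-y))<=C/e ^ ?a * ind (cball x e) y" using C(2)[OF e(1), of "x-y"] kernel_grad_zero[OF km, of "x-y"] C(1) e(1) by (auto simp: u_def indicator_def dist_norm norm_minus_commute[of x y])
   qed (rule integrable_const_cball)
   also have "... = C/e ^ ?a * (unit_ball_vol DIM('a) * e ^ DIM('a))" using e by (simp add: content_cball)
   also have "... = C'/(R-r)" using e rR by (simp add: C'_def e_def field_simps)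
   finally show ?thesis .
  qed
  moreover have "smooth et" unfolding et_def by (rule smooth_conv[OF km iu])
  ultimately show ?thesis by blast
 qed
 moreover have "0<C'" using C by (simp add: C'_def)
 ultimately show ?thesis by (rule that[rotated])
qed

section \<open>Powers and Lebesgue spaces\<close>

lemma powr_ge_tangent:
 fixes s t p :: real
 assumes "0<s" "0<=t" "1<=p"
 shows "s powr p + p * s powr (p-1) * (t-s)<=t powr p"
proof (cases "t = 0")
 case True
 have "s powr (p-1) * s = s powr p" using assms by (simp add: powr_mult_base mult.commute)
 hence "s powr p + p * s powr (p-1) * (0-s) = (1-p) * s powr p" by (simp add: algebra_simps)
 also have "...<=0" using assms by (simp add: mult_nonpos_nonneg)
 finally show ?thesis using True assms by simp
next
 case False
 have "p * s powr (p-1) * (t-s)<=t powr p - s powr p" by (rule convex_on_imp_above_tangent[of "{0<..}"])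
  (use assms False powr_convex[of p] in "auto simp: interior_open intro!: derivative_eq_intros")
 thus ?thesis by simp
qed

lemma jensen_powr:
 fixes f :: "'a => 'b::{banach, second_countable_topology}"
 assumes [measurable]: "w : borel_measurable M" "f : borel_measurable M" and w: "!!x. 0<=w x"
  and one: "(\<integral>\<^sup>+x. en (w x) \<partial>M) = 1" and p: "1<=p"
  and int: "integrable M (%x. w x *R f x)"
 shows "en (norm (\<integral>x. w x *R f x \<partial>M) powr p)<=(\<integral>\<^sup>+x. en (w x * norm (f x) powr p) \<partial>M)"
proof (cases "(\<integral>\<^sup>+x. en (w x * norm (f x) powr p) \<partial>M) = oo")
 case False
 have iw: "integrable M w" by (rule integrableI_nn_integral_finite[of _ _ 1]) (use w one in auto)
 have "(\<integral>x. w x \<partial>M) = 1" using nn_integral_eq_integral[OF iw] one w by simp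
 let ?d = "%x. w x * norm (f x) powr p"
 have ip: "integrable M (%x. ?d x)" by (rule integrableI_nonneg) (use w False in "auto simp: less_top[symmetric]")
 have in': "integrable M (%x. w x * norm (f x))" using integrable_norm[OF int] w by simp
 define s where "s = (\<integral>x. w x * norm (f x) \<partial>M)"
 have s0: "0<=s" unfolding s_def using w by (intro Bochner_Integration.integral_nonneg) auto
 let ?c = "\<integral>x. w x *R f x \<partial>M"
 have le: "norm ?c<=s" using integral_norm_bound[of M "%x. w x *R f x"] w by (simp add: s_def)
 let ?a = "\<integral>x. w x * norm (f x) powr p \<partial>M"
 have "s powr p<=?a"
 proof (cases "s = 0")
  case True
  thus ?thesis using p w by (auto intro!: Bochner_Integration.integral_nonneg)
 next
  case False
  hence s: "0<s" using s0 by simp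
  let ?e = "s powr (p-1)"
  let ?b = "s powr p - p * ?e * s"
  have "s powr p = (\<integral>x. w x * ?b+(p * ?e)*(w x * norm (f x)) \<partial>M)" using iw in' \<open>(\<integral>x. w x \<partial>M) = 1\<close> by (simp add: s_def[symmetric])
  also have "...<=?a"
  proof (rule integral_mono[OF _ ip])
   show "integrable M (%x. w x * ?b+p * ?e * (w x * norm (f x)))" using iw in' by simp
   fix x
   have "w x * (s powr p + p * ?e * (norm (f x) - s))<=?d x" by (intro mult_left_mono powr_ge_tangent s w p) auto
   thus "w x * ?b+p * ?e * (w x * norm (f x))<=?d x" by (simp add: algebra_simps)
  qed
  finally show ?thesis .
 qed
 moreover have "norm ?c powr p<=s powr p" using le p by (intro powr_mono2) auto
 moreover have "(\<integral>\<^sup>+x. en (?d x) \<partial>M) = en ?a" by (rule nn_integral_eq_integral[OF ip]) (use w in auto)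
 ultimately show ?thesis by (simp add: ennreal_leI)
qed simp

lemma powr_add_le:
 fixes a b p :: real
 assumes "0<=a" "0<=b" "0<=p"
 shows "(a+b) powr p<=2 powr p * (a powr p + b powr p)"
proof -
 have "(a+b) powr p<=(2 * max a b) powr p" using assms by (intro powr_mono2) auto
 also have "... = 2 powr p * max a b powr p" using assms by (simp add: powr_mult)
 also have "...<=2 powr p * (a powr p + b powr p)" by (intro mult_left_mono) (auto simp: max_def)
 finally show ?thesis .
qed

lemma norm_add_powr_le:
 fixes x y :: "'a::real_normed_vector"
 assumes "0<=p"
 shows "norm (x+y) powr p<=2 powr p * (norm x powr p + norm y powr p)" by (rule order_trans[OF powr_mono2[OF assms norm_ge_zero norm_triangle_ineq] powr_add_le]) (use assms in auto)

lemma norm_diff_powr_le: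
 fixes x y :: "'a::real_normed_vector"
 assumes "0<=p"
 shows "norm (x-y) powr p<=2 powr p * (norm x powr p + norm y powr p)" using norm_add_powr_le[OF assms, of x "- y"] by simp

definition Np :: "real => ('a::euclidean_space => 'b::euclidean_space) => ennreal"
 where "Np p f = (NN x. en (norm (f x) powr p))"

lemma Np_cong_AE: "ae x. f x = g x ==> Np p f = Np p g" unfolding Np_def by (intro nn_integral_cong_AE) auto

lemma Np_minus: "Np p (%x. - f x) = Np p f" by (simp add: Np_def)

lemma Np_diff_commute: "Np p (%x. f x - g x) = Np p (%x. g x - f x)" by (simp add: Np_def norm_minus_commute)

lemma Np_add:
 fixes f g :: "'a::euclidean_space => 'b::euclidean_space"
 assumes [measurable]: "f : bm" "g : bm" and "0<=p"
 shows "Np p (%x. f x + g x)<=en (2 powr p) * (Np p f + Np p g)"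
proof -
 have "Np p (%x. f x + g x)<=(NN x. en (2 powr p) * (en (norm (f x) powr p) + en (norm (g x) powr p)))" unfolding Np_def
  by (intro nn_integral_mono) (auto simp flip: ennreal_plus ennreal_mult' intro!: ennreal_leI norm_add_powr_le assms)
 also have "... = en (2 powr p) * (Np p f + Np p g)" by (simp add: Np_def nn_integral_cmult nn_integral_add)
 finally show ?thesis .
qed

lemma Np_diff:
 fixes f g :: "'a::euclidean_space => 'b::euclidean_space"
 assumes [measurable]: "f : bm" "g : bm" and "0<=p"
 shows "Np p (%x. f x - g x)<=en (2 powr p) * (Np p f + Np p g)" using Np_add[OF assms(1) borel_measurable_uminus[OF assms(2)] assms(3)] by (simp add: Np_minus)

lemma Np_translate:
 fixes f :: "'a::euclidean_space => 'b::euclidean_space"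
 assumes [measurable]: "f : bm"
 shows "Np p (%x. f (x+h)) = Np p f" unfolding Np_def by (rule nn_integral_translate[of "%x. en (norm (f x) powr p)"]) measurable

lemma emeasure_cball_finite: "emeasure lborel (cball (a::'a::euclidean_space) r)<oo" by (rule emeasure_bounded_finite[OF bounded_cball])

lemma continuous_dense_Lp:
 fixes f :: "'a::euclidean_space => 'b::euclidean_space"
 assumes [measurable]: "f : bm" and fin: "Np p f<oo" and p: "1<=p" and e: "0<(e::real)"
 obtains g R where "continuous_on UNIV g" "!!x. x ~: cball 0 R ==> g x = 0" "Np p (%x. f x - g x)<=en e"
proof -
 define e' where "e' = e/(2 * 2 powr p)"
 have e': "0<e'" using e by (simp add: e'_def)
 define fM where "fM M x = (if norm x<=real M & norm (f x)<=real M then f x else 0)" for M x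
 have [measurable]: "fM M : bm" for M unfolding fM_def by measurable
 let ?b = "\<integral>\<^sup>+x. 0 \<partial>(lborel::'a measure)"
 let ?e = "%M. Np p (%x. f x - fM M x)"
 have "?e ----> ?b" unfolding Np_def
 proof (rule nn_integral_dominated_convergence[where w="%x. en (norm (f x) powr p)"])
  show "ae x. (%M. en (norm (f x - fM M x) powr p)) ----> 0"
  proof (rule AE_I2)
   fix x
   have "\<forall>\<^sub>F M in sequentially. real M >= max (norm x) (norm (f x))" by (rule eventually_sequentiallyI[of "nat \<lceil>max (norm x) (norm (f x))\<rceil>"]) linarith
   hence "\<forall>\<^sub>F M in sequentially. 0 = en (norm (f x - fM M x) powr p)" by eventually_elim (auto simp: fM_def)
   thus "(%M. en (norm (f x - fM M x) powr p)) ----> 0" by (rule Lim_transform_eventually[rotated]) simp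
  qed
 qed (use fin p in "auto simp: Np_def fM_def intro!: ennreal_leI")
 hence "?e ----> 0" by simp
 from order_tendstoD(2)[OF this, of "en e'"] e' obtain M where M: "Np p (%x. f x - fM M x)<en e'" by (auto simp: eventually_sequentially)
 define m where "m = real M + 1"
 have m: "0<m" by (simp add: m_def)
 have "fM M : borel_measurable lebesgue" by (rule measurable_completion) simp
 hence "fM M measurable_on UNIV" by (rule lebesgue_measurable_imp_measurable_on) simp
 then obtain N g where N: "negligible N" and g: "!!n. continuous_on UNIV (g n)"
  and lim: "!!x. x ~: N ==> (%n. g n x) ----> fM M x" unfolding measurable_on_def by auto
 define clip where "clip z = (m / max m (norm z)) *R z" for z :: 'b
 have max0: "max m (norm z) ~= 0" for z :: 'b using m by auto
 have clipc: "isCont clip z" for z unfolding clip_def using max0 by (intro continuous_intros)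
 have clip1: "clip z = z" if "norm z<=m" for z using that m by (simp add: clip_def)
 have clip2: "norm (clip z)<=m" for z using m by (simp add: clip_def abs_of_nonneg divide_le_eq mult_left_mono)
 define cf where "cf x = max 0 (min 1 (m - norm x))" for x :: 'a
 define G where "G n x = cf x *R clip (g n x)" for n x
 have Gc: "continuous_on UNIV (G n)" for n
 proof -
  have "continuous_on UNIV clip" by (simp add: continuous_at_imp_continuous_on clipc)
  from continuous_on_compose2[OF this g] have "continuous_on UNIV (%x. clip (g n x))" by simp
  thus ?thesis unfolding G_def cf_def by (intro continuous_intros)
 qed
 have [measurable]: "G n : bm" for n by (rule borel_measurable_continuous_onI[OF Gc])
 have G0: "G n x = 0" if "x ~: cball 0 m" for n x using that by (simp add: G_def cf_def)
 have fM0: "fM M x = 0" if "x ~: cball 0 (real M)" for x using that by (simp add: fM_def)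
 have fMm: "norm (fM M x)<=m" for x by (simp add: fM_def m_def)
 let ?d = "%n. Np p (%x. fM M x - G n x)"
 have "?d ----> ?b" unfolding Np_def
 proof (rule nn_integral_dominated_convergence[where w="%x. en ((2*m) powr p) * ind (cball 0 m) x"])
  let ?a = "%x n. norm (fM M x - G n x) powr p"
  let ?c = "(2*m) powr p"
  show "ae x. en (?a x n)<=en ?c * ind (cball 0 m) x" for n
  proof (rule AE_I2)
   fix x
   have "norm (G n x)<=1*m" unfolding G_def norm_scaleR by (intro mult_mono clip2) (auto simp: cf_def)
   hence "norm (fM M x - G n x)<=2*m" using fMm[of x] norm_triangle_ineq4[of "fM M x" "G n x"] by linarith
   thus "en (?a x n)<=en ?c * ind (cball 0 m) x" using G0[of x n] fM0[of x] p by (auto simp: indicator_def m_def intro!: ennreal_leI powr_mono2)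
  qed
  show "(NN x. en ?c * ind (cball (0::'a) m) x)<oo" using emeasure_cball_finite[of "0::'a" m] by (simp add: nn_integral_cmult_indicator ennreal_mult_less_top)
  have "N : null_sets lebesgue" using N by (simp add: negligible_iff_null_sets)
  then obtain N' where N': "N' : null_sets lborel" "N<=N'" by (auto simp: null_sets_completion_iff2)
  have conv: "(%n. en (?a x n)) ----> 0" if "x ~: N'" for x
  proof -
   have "(%n. clip (g n x)) ----> clip (fM M x)" using that N' by (intro isCont_tendsto_compose[OF clipc] lim) auto
   hence "(%n. G n x) ----> cf x *R fM M x" unfolding G_def clip1[OF fMm] by (intro tendsto_intros)
   moreover have "cf x *R fM M x = fM M x" by (auto simp: cf_def fM_def m_def)
   ultimately have "(%n. G n x) ----> fM M x" by simp
   hence "(%n. norm (fM M x - G n x) powr p) ----> norm (fM M x - fM M x) powr p" using p by (intro tendsto_powr' tendsto_intros) auto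
   hence "(%n. norm (fM M x - G n x) powr p) ----> 0" using p by simp
   thus ?thesis using tendsto_ennrealI by fastforce
  qed
  from AE_not_in[OF N'(1)] show "ae x. (%n. en (?a x n)) ----> 0" by (rule eventually_mono) (rule conv)
  have [measurable]: "cball 0 m : sets (borel :: 'a measure)" by simp
  show "(%x. en (?a x n)) : borel_measurable lborel" for n by measurable
  show "(%x. en ?c * ind (cball (0::'a) m) x) : borel_measurable lborel" by measurable
 qed simp
 hence "?d ----> 0" by simp
 from order_tendstoD(2)[OF this, of "en e'"] e' obtain n where n: "Np p (%x. fM M x - G n x)<en e'" by (auto simp: eventually_sequentially)
 have "Np p (%x. f x - G n x) = Np p (%x. (f x - fM M x) + (fM M x - G n x))" by simp
 also have "...<=en (2 powr p) * (Np p (%x. f x - fM M x) + Np p (%x. fM M x - G n x))" by (rule Np_add) (use p in auto)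
 also have "...<=en (2 powr p) * (en e' + en e')" using M n by (intro mult_left_mono add_mono) auto
 also have "... = en (2 powr p * (e'+e'))" using e' by (simp only: ennreal_mult' ennreal_plus powr_ge_zero less_imp_le)
 also have "2 powr p * (e'+e') = e" by (simp add: e'_def)
 finally show ?thesis using Gc G0 by (intro that)
qed

lemma Lp_translation_continuous:
 fixes f :: "'a::euclidean_space => 'b::euclidean_space"
 assumes [measurable]: "f : bm" and fin: "Np p f<oo" and p: "1<=p" and e: "0<(e::real)"
 obtains d where "0<d" "!!h. norm h<d ==> Np p (%x. f (x+h) - f x)<=en e"
proof -
 define c where "c = 2 powr p"
 have c: "0<c" by (simp add: c_def)
 let ?e = "2*c+2*c*c"
 define e1 where "e1 = e/?e"
 have e1: "0<e1" "0<en e1" using e c by (auto simp: e1_def intro!: divide_pos_pos add_pos_pos)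
 from continuous_dense_Lp[OF assms(1) fin p e1(1)]
 obtain g R where g: "continuous_on UNIV g" "!!x. x ~: cball 0 R ==> g x = 0" "Np p (%x. f x - g x)<=en e1" by metis
 have [measurable]: "g : bm" by (rule borel_measurable_continuous_onI[OF g(1)])
 let ?b = "cball (0::'a) (R+1)"
 define m where "m = measure lborel ?b"
 have m: "0<=m" "emeasure lborel ?b = en m" using emeasure_cball_finite[of "0::'a" "R+1"] by (auto simp: m_def emeasure_eq_ennreal_measure)
 define e2 where "e2 = (e1/(m+1)) powr (1/p)"
 have e2: "0<e2" "e2 powr p * m<=e1" using e1 m p by (auto simp: e2_def powr_powr divide_le_eq mult_left_mono field_simps)
 from continuous_compact_support_uniformly_continuous[OF g(1,2) e2(1)]
 obtain d where d: "0<d" "!!x y. norm (x-y)<d ==> norm (g x - g y)<e2" by metis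
 show ?thesis
 proof (rule that[of "min d 1"])
  fix h :: 'a assume h: "norm h<min d 1"
  let ?c = "%x. g (x+h) - g x"
  have "Np p ?c<=(NN x. en (e2 powr p) * ind ?b x)" unfolding Np_def
  proof (rule nn_integral_mono)
   fix x
   have "norm x<=norm (x+h) + norm h" using norm_triangle_ineq[of "x+h" "- h"] by simp
   thus "en (norm (g (x+h) - g x) powr p)<=en (e2 powr p) * ind (cball 0 (R+1)) x" using d(2)[of "x+h" x] h g(2)[of x] g(2)[of "x+h"] p by (cases "x : cball 0 (R+1)") (auto intro!: ennreal_leI powr_mono2)
  qed
  also have "... = en (e2 powr p * m)" using m by (simp add: nn_integral_cmult_indicator ennreal_mult')
  also have "...<=en e1" by (rule ennreal_leI[OF e2(2)])
  finally have gg: "Np p ?c<=en e1" .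
  let ?a = "%x. (f (x+h) - g (x+h)) - (f x - g x)"
  let ?f = "en c * (en e1 + en e1)"
  have "Np p (%x. f (x+h) - f x) = Np p (%x. ((f (x+h) - g (x+h))-(f x - g x)) + (g (x+h) - g x))" by (simp add: algebra_simps)
  also have "...<=en c * (Np p ?a + Np p ?c)" unfolding c_def by (rule Np_add) (use p in auto)
  also have "...<=en c * (?f + en e1)"
  proof (intro mult_left_mono add_mono gg)
   let ?d = "%x. f x - g x"
   have "Np p ?a<=en c * (Np p (%x. f (x+h) - g (x+h)) + Np p ?d)" unfolding c_def by (rule Np_diff) (use p in auto)
   also have "Np p (%x. f (x+h) - g (x+h)) = Np p ?d" by (rule Np_translate[of "%x. f x - g x"]) measurable
   also have "en c * (Np p ?d + Np p ?d)<=?f" by (intro mult_left_mono add_mono g(3)) auto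
   finally show "Np p ?a<=?f" .
  qed auto
  also have "... = en (c*(c*(e1+e1)+e1))"
  proof -
   have "0<=c" "0<=e1" "0<=c*(e1+e1)" using c e1 by auto
   thus ?thesis by (simp only: ennreal_mult' ennreal_plus)
  qed
  also have "c*(c*(e1+e1)+e1)<=?e*e1" using c e1 by (simp add: algebra_simps)
  also have "?e*e1 = e"
  proof -
   have "2*c+2*c*c ~= 0" using c by (metis add_pos_pos mult_pos_pos less_irrefl zero_less_numeral)
   thus ?thesis by (simp add: e1_def)
  qed
  finally show "Np p (%x. f (x+h) - f x)<=en e" by (simp add: ennreal_leI)
 qed (use d in auto)
qed

lemma integrable_iff_Np1:
 fixes f :: "'a::euclidean_space => 'b::euclidean_space"
 shows "Lint f <-> f : bm & Np 1 f<oo" by (simp add: Np_def integrable_iff_bounded)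

lemma conv_shift:
 fixes f :: "'a::euclidean_space => 'b::euclidean_space"
 assumes "kernel R k" and [measurable]: "f : bm"
 shows "conv k f x = (LL y. k y *R f (x-y))"
proof -
 have [measurable]: "k : bm" by (rule kernel_measurable[OF assms(1)])
 show ?thesis using integral_reflect[of "%y. k y *R f (x-y)" x] by (simp add: conv_def)
qed

lemma integrable_conv_shift:
 fixes f :: "'a::euclidean_space => 'b::euclidean_space"
 assumes "kernel R k" "Lint f"
 shows "Lint (%y. k y *R f (x-y))" using integrable_reflect[OF integrable_conv_kernel[OF assms, of x], of x] by simp

lemma conv_measurable[measurable]:
 fixes f :: "'a::euclidean_space => 'b::euclidean_space"
 assumes [measurable]: "k : bm" "f : bm"
 shows "conv k f : bm" unfolding conv_def[abs_def] by measurable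

lemma mollify_Lp:
 fixes f :: "'a::euclidean_space => 'b::euclidean_space"
 assumes int: "Lint f" and fin: "Np p f<oo" and p: "1<=p" and e: "0<(e::real)"
 obtains d where "0<d" "!!ep. 0<ep ==> ep<d ==> Np p (%x. conv (moll ep) f x - f x)<=en e"
proof -
 have [measurable]: "f : bm" using int by simp
 from Lp_translation_continuous[OF \<open>f : bm\<close> fin p e]
 obtain d where d: "0<d" "!!h. norm h<d ==> Np p (%x. f (x+h) - f x)<=en e" by metis
 show ?thesis
 proof (rule that[OF d(1)])
  fix ep :: real assume eps: "0<ep" "ep<d"
  let ?k = "moll ep :: 'a => real"
  have km: "kernel ep ?k" by (rule kernel_moll[OF eps(1)])
  have [measurable]: "?k : bm" by (rule kernel_measurable[OF km])
  let ?a = "%y x. ?k y * norm (f (x-y) - f x) powr p"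
  have "Np p (%x. conv ?k f x - f x)<=(NN x. (NN y. en (?a y x)))" unfolding Np_def
  proof (rule nn_integral_mono)
   fix x :: 'a
   have i1: "Lint (%y. ?k y *R f (x-y))" by (rule integrable_conv_shift[OF km int])
   have i2: "Lint (%y. ?k y *R f x)" by (intro integrable_scaleR_left integrable_kernel[OF km])
   have "conv ?k f x - f x = (LL y. ?k y *R (f (x-y) - f x))" using i1 i2 integral_moll[OF eps(1), where 'a='a] integral_scaleR_left[of "f x" lborel ?k] integrable_kernel[OF km]
    by (simp add: scaleR_diff_right conv_shift[OF km])
   thus "en (norm (conv ?k f x - f x) powr p)<=(NN y. en (?a y x))" using i1 i2 by (simp only:, intro jensen_powr moll_nonneg nn_integral_moll eps(1) p)
    (auto simp: scaleR_diff_right)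
  qed
  also have "... = (NN y. (NN x. en (?a y x)))" by (rule lborel_pair.Fubini') measurable
  also have "... = (NN y. en (?k y) * Np p (%x. f (x+(- y)) - f x))" by (simp add: Np_def nn_integral_cmult[symmetric] ennreal_mult' moll_nonneg)
  also have "...<=(NN y. en (?k y) * en e)"
  proof (rule nn_integral_mono)
   fix y :: 'a
   show "en (?k y) * Np p (%x. f (x+(- y)) - f x)<=en (?k y) * en e"
   proof (cases "y : cball 0 ep")
    case True
    thus ?thesis using d(2)[of "- y"] eps by (intro mult_left_mono) auto
   next
    case False
    thus ?thesis using km by (simp add: kernel_def)
   qed
  qed
  also have "... = en e" using nn_integral_moll[OF eps(1), where 'a='a] by (simp add: nn_integral_multc)
  finally show "Np p (%x. conv ?k f x - f x)<=en e" .
 qed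
qed

lemma Np1_le_Np:
 fixes f :: "'a::euclidean_space => 'b::euclidean_space"
 assumes [measurable]: "f : bm" and z: "!!x. x ~: cball a R ==> f x = 0" and p: "1<=p" and d: "0<d"
 shows "Np 1 f<=en (d * measure lborel (cball a R)) + en (d powr (1-p)) * Np p f"
proof -
 have [measurable]: "cball a R : sets borel" by simp
 let ?b = "d powr (1-p)"
 have "Np 1 f<=(NN x. en d * ind (cball a R) x + en ?b * en (norm (f x) powr p))" unfolding Np_def
 proof (rule nn_integral_mono)
  fix x
  let ?a = "norm (f x) powr p"
  show "en (norm (f x) powr 1)<=en d * ind (cball a R) x + en ?b * en ?a"
  proof (cases "x : cball a R")
   case True
   have "norm (f x)<=d + ?b * ?a"
   proof (cases "norm (f x)<=d")
    case False
    hence n: "0<norm (f x)" using d by linarith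
    have "norm (f x) = norm (f x) powr (1-p) * ?a" using n by (simp flip: powr_add)
    also have "...<=?b * ?a" using False d p by (intro mult_right_mono powr_mono2') auto
    finally show ?thesis using d by simp
   qed (simp add: add_increasing2)
   thus ?thesis using True d by (simp add: ennreal_mult'[symmetric] ennreal_plus[symmetric] ennreal_leI del: ennreal_plus)
  qed (simp add: z)
 qed
 also have "... = en (d * measure lborel (cball a R)) + en ?b * Np p f" using d emeasure_cball_finite[of a R]
  by (subst nn_integral_add) (auto simp: Np_def nn_integral_cmult nn_integral_cmult_indicator ennreal_mult' emeasure_eq_ennreal_measure)
 finally show ?thesis .
qed

lemma Np_finite_imp_integrable:
 fixes f :: "'a::euclidean_space => 'b::euclidean_space"
 assumes "f : bm" and z: "!!x. x ~: cball a R ==> f x = 0" and p: "1<=p" and "Np p f<oo"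
 shows "Lint f"
proof -
 have "Np 1 f<=en (1 * measure lborel (cball a R)) + en (1 powr (1-p)) * Np p f" by (rule Np1_le_Np[OF assms(1-3)]) auto
 also have "...<oo" using assms(4) by simp
 finally show ?thesis using assms(1) by (simp add: integrable_iff_Np1)
qed

lemma Lp_complete:
 fixes f :: "nat => 'a::euclidean_space => 'b::euclidean_space"
 assumes [measurable]: "!!k. f k : bm" and z: "!!k x. x ~: cball a R ==> f k x = 0"
  and p: "1<=p" and fin: "!!k. Np p (f k)<oo"
  and Cauchy: "!!e::real. 0<e ==> EX N. ALL i>=N. ALL j>=N. Np p (%x. f i x - f j x)<=en e"
 obtains g r where "g : bm" "!!x. x ~: cball a R ==> g x = 0" "strict_mono r"
  "ae x. (%k. f (r k) x) ----> g x" "Np p g<oo"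
  "!!e::real. 0<e ==> EX N. ALL i>=N. Np p (%x. f i x - g x)<=en e"
proof -
 have int: "Lint (f k)" for k by (rule Np_finite_imp_integrable[OF _ z p fin]) auto
 define m where "m = measure lborel (cball a R)"
 have m: "0<=m" by (simp add: m_def)
 have "EX N. ALL i>=N. ALL j>=N. (LL x. norm (f i x - f j x))<e" if e: "0<e" for e
 proof -
  define d where "d = e/(4*(m+1))"
  have d: "0<d" "d*m<e/2" using e m by (auto simp: d_def field_simps intro!: add_pos_nonneg mult_nonneg_nonneg)
  let ?b = "d powr (p-1)"
  have "0<e/2 * ?b" using e d by simp
  from Cauchy[OF this] obtain N where N: "!!i j. i >= N ==> j >= N ==> Np p (%x. f i x - f j x)<=en (e/2 * ?b)" by blast
  have "(LL x. norm (f i x - f j x))<e" if "i >= N" "j >= N" for i j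
  proof -
   let ?d = "d powr (1-p)"
   have "en (LL x. norm (f i x - f j x)) = Np 1 (%x. f i x - f j x)" unfolding Np_def using int by (subst nn_integral_eq_integral) auto
   also have "...<=en (d*m) + en ?d * Np p (%x. f i x - f j x)" unfolding m_def by (rule Np1_le_Np) (use z p d in auto)
   also have "...<=en (d*m) + en ?d * en (e/2 * ?b)" by (intro add_mono mult_left_mono N that) auto
   also have "... = en (d*m+e/2*(?d * ?b))" using d e m by (simp add: ennreal_mult'[symmetric] ennreal_plus[symmetric] mult_ac del: ennreal_plus)
   also have "?d * ?b = 1" using d by (simp flip: powr_add)
   also have "en (d*m+e/2*1)<en e" using d e m by (intro ennreal_lessI) auto
   finally show ?thesis by (simp add: ennreal_less_iff Bochner_Integration.integral_nonneg)
  qed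
  thus ?thesis by blast
 qed
 from cauchy_L1_AE_cauchy_subseq[OF int this] obtain r
  where r: "strict_mono r" "ae x. Cauchy (%i. f (r i) x)" by metis
 define g where "g x = (if Cauchy (%i. f (r i) x) then lim (%i. f (r i) x) else 0)" for x
 have [measurable]: "g : bm" unfolding g_def by measurable
 have gz: "g x = 0" if "x ~: cball a R" for x using z[OF that] by (simp add: g_def)
 have lim: "ae x. (%k. f (r k) x) ----> g x" using r(2) by eventually_elim (auto simp: g_def Cauchy_convergent_iff convergent_LIMSEQ_iff)
 let ?c = "%i. Np p (%x. f i x - g x)"
 have conv: "EX N. ALL i>=N. ?c i<=en e" if e: "0<e" for e
 proof -
  from Cauchy[OF e] obtain N where N: "!!i j. i >= N ==> j >= N ==> Np p (%x. f i x - f j x)<=en e" by blast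
  have "?c i<=en e" if "i >= N" for i
  proof -
   let ?a = "%i x. %k. en (norm (f i x - f (r k) x) powr p)"
   have "?c i = (NN x. liminf (?a i x))" unfolding Np_def
   proof (rule nn_integral_cong_AE, use lim in eventually_elim)
    fix x assume "(%k. f (r k) x) ----> g x"
    hence "?a i x ----> ennreal (norm (f i x - g x) powr p)" using p by (intro tendsto_ennrealI tendsto_powr' tendsto_intros) auto
    thus "en (norm (f i x - g x) powr p) = liminf (?a i x)" by (intro lim_imp_Liminf[symmetric]) auto
   qed
   also have "...<=liminf (%k. Np p (%x. f i x - f (r k) x))" unfolding Np_def by (rule nn_integral_liminf) measurable
   also have "...<=liminf (%k. en e)"
   proof (rule Liminf_mono)
    show "\<forall>\<^sub>F k in sequentially. Np p (%x. f i x - f (r k) x)<=en e" by (rule eventually_sequentiallyI[of N]) (rule N[OF that order_trans[OF _ seq_suble[OF r(1)]]])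
   qed
   also have "... = en e" by (simp add: Liminf_const)
   finally show ?thesis .
  qed
  thus ?thesis by blast
 qed
 have "Np p g<oo"
 proof -
  obtain N where "?c N<=en 1" using conv[of 1] by auto
  moreover have "Np p (%x. f N x - (f N x - g x))<=en (2 powr p) * (Np p (f N) + Np p (%x. f N x - g x))" by (rule Np_diff) (use p in auto)
  moreover have "en (2 powr p) * (Np p (f N) + Np p (%x. f N x - g x))<oo" using fin[of N] le_less_trans[OF \<open>Np p (%x. f N x - g x) <= en 1\<close> ennreal_less_top] by (auto simp: ennreal_mult_less_top)
  ultimately show ?thesis by (simp add: le_less_trans)
 qed
 from that[OF \<open>g : bm\<close> gz r(1) lim this conv] show ?thesis .
qed

section \<open>Weak gradients\<close>

lemma test_functionE:
 fixes ph :: "'a::euclidean_space => real"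
 assumes "test_function U ph"
 obtains K R where "compact K" "K<=U" "ALL x. x ~: K --> ph x = 0" "smooth ph" "kernel R ph" "0<R"
proof -
 define K where "K = closure {x. ph x ~= 0}"
 have K: "compact K" "K<=U" "smooth ph" using assms by (auto simp: test_function_def compactly_inside_def K_def)
 have z: "ph x = 0" if "x ~: K" for x using that closure_subset[of "{x. ph x ~= 0}"] by (auto simp: K_def)
 obtain R where "0<R" "K<=ball 0 R" using compact_imp_bounded[OF K(1)] by (auto simp: bounded_subset_ballI dest: bounded_subset_ballD[of K 0])
 hence "ph x = 0" if "x ~: cball 0 R" for x using that by (intro z) auto
 hence "kernel R ph" using K(3) by (simp add: kernel_def)
 with K z \<open>0 < R\<close> show ?thesis by (intro that[of K R]) auto
qed

lemma test_functionD:
 assumes "test_function U ph"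
 shows "EX K R. compact K & K<=U & (ALL x. x ~: K --> ph x = 0) & smooth ph & kernel R ph & 0<R" using assms by (rule test_functionE) blast

lemma test_functionI:
 assumes "smooth ph" "compact K" "K<=U" "!!x. x ~: K ==> ph x = 0"
 shows "test_function U ph"
proof -
 have "closure {x. ph x ~= 0}<=K" using assms by (intro closure_minimal) (auto simp: compact_imp_closed)
 moreover have "bounded {x. ph x ~= 0}" using assms by (intro bounded_subset[OF compact_imp_bounded[OF assms(2)]]) auto
 ultimately show ?thesis using assms by (auto simp: test_function_def compactly_inside_def)
qed

lemma test_function_mono: "test_function U ph ==> U<=U' ==> test_function U' ph" by (auto simp: test_function_def compactly_inside_def)

lemma test_function_compose:
 assumes "test_function U ph" "c = 1 \<or> c = (-1::real)" "!!x. x : U ==> c *R (x-a) : U'"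
 shows "test_function U' (%x. ph (c *R x+a))"
proof -
 obtain K R where K: "compact K" "K<=U" "ALL x. x ~: K --> ph x = 0" "smooth ph" "kernel R ph" "0<R" using test_functionD[OF assms(1)] by (elim exE conjE)
 show ?thesis
 proof (rule test_functionI)
  show "smooth (%x. ph (c *R x+a))" by (rule smooth_affine[OF K(4)])
  show "compact ((%x. c *R (x-a)) ` K)" by (intro compact_continuous_image continuous_intros K)
  show "(%x. c *R (x-a)) ` K<=U'" using K assms by auto
  fix x assume "x ~: (%x. c *R (x-a)) ` K"
  hence "c *R x+a ~: K" using assms(2) by (auto simp: image_iff dest!: bspec[where x="c *R x+a"])
  thus "ph (c *R x+a) = 0" by (rule K(3)[rule_format])
 qed
qed

lemma grad_affine:
 fixes ph :: "'a::euclidean_space => real"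
 assumes "smooth ph" shows "grad (%x. ph (c *R x+a)) x = c *R grad ph (c *R x+a)"
proof (rule grad_eq)
 have "((%x. ph (c *R x+a)) has_derivative (%h. (c *R h) .* grad ph (c *R x+a))) (at x)" by (rule has_derivative_compose[OF _ smooth_GDERIV[OF assms, unfolded gderiv_def]])
  (auto intro!: derivative_eq_intros)
 thus "GDERIV (%x. ph (c *R x+a)) x :> c *R grad ph (c *R x+a)" by (simp add: gderiv_def)
qed

lemma grad_mult:
 assumes "smooth f" "smooth g"
 shows "grad (%x. f x * g x) x = f x *R grad g x + g x *R grad f x" by (intro grad_eq GDERIV_mult smooth_GDERIV assms)

definition wg :: "'a::euclidean_space set => ('a => real) => ('a => 'a) => bool"
 where "wg U u G <-> Lint u & Lint G &
  (ALL ph. test_function U ph --> (LL x. u x *R grad ph x) = - (LL x. ph x *R G x))"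

lemma wg_measurable:
 assumes "wg U u G" shows "u : bm" "G : bm" using assms by (auto simp: wg_def)

lemma wg_mono: "wg U u G ==> U'<=U ==> wg U' u G" unfolding wg_def by (blast intro: test_function_mono)

lemma integrable_test_scaleR:
 assumes "kernel R ph" "Lint (u :: 'a::euclidean_space => 'b::euclidean_space)"
 shows "Lint (%x. ph x *R u x)"
proof -
 obtain B where B: "!!x. abs (ph x)<=B" using kernel_bounded[OF assms(1)] by metis
 show ?thesis by (rule integrable_bounded_scaleR[OF _ assms(2) B]) (use kernel_measurable[OF assms(1)] in simp)
qed

lemma integrable_scaleR_grad:
 assumes "kernel R ph" "Lint (u :: 'a::euclidean_space => real)"
 shows "Lint (%x. u x *R grad ph x)"
proof -
 obtain B where B: "!!x. norm (grad ph x)<=B" using kernel_grad_bounded[OF assms(1)] by metis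
 have [measurable]: "grad ph : bm" "u : bm" using assms by (auto simp: kernel_def intro: smooth_grad_measurable)
 have B0: "0<=B" using B[of 0] norm_ge_zero by (rule order_trans[rotated])
 show ?thesis
 proof (rule Bochner_Integration.integrable_bound[of _ "%x. B * norm (u x)"])
  show "ae x. norm (u x *R grad ph x)<=norm (B * norm (u x))" using B B0 by (intro AE_I2) (simp add: mult.commute[of B] mult_left_mono)
 qed (use assms in auto)
qed

lemma wg_add:
 assumes "wg U u G" "wg U v H"
 shows "wg U (%x. u x + v x) (%x. G x + H x)" unfolding wg_def
proof (intro conjI allI impI)
 fix ph assume tf: "test_function U ph"
 then obtain R where R: "kernel R ph" by (elim test_functionE)
 show "(LL x. (u x + v x) *R grad ph x) = - (LL x. ph x *R (G x + H x))" using assms tf integrable_scaleR_grad[OF R, of u] integrable_scaleR_grad[OF R, of v]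
  integrable_test_scaleR[OF R, of G] integrable_test_scaleR[OF R, of H] by (simp add: wg_def scaleR_add_left scaleR_add_right)
qed (use assms in "auto simp: wg_def")

lemma wg_cmult:
 assumes "wg U u G"
 shows "wg U (%x. c * u x) (%x. c *R G x)" unfolding wg_def
proof (intro conjI allI impI)
 fix ph assume tf: "test_function U ph"
 let ?a = "LL x. (c * u x) *R grad ph x"
 have "?a = c *R (LL x. u x *R grad ph x)" by (simp flip: scaleR_scaleR)
 also have "... = - (c *R (LL x. ph x *R G x))" using assms tf by (simp add: wg_def)
 also have "c *R (LL x. ph x *R G x) = (LL x. c *R (ph x *R G x))" by (rule integral_scaleR_right[symmetric])
 also have "... = (LL x. ph x *R c *R G x)" by (simp add: mult.commute)
 finally show "?a = - (LL x. ph x *R c *R G x)" .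
qed (use assms in "auto simp: wg_def")

lemma wg_diff:
 assumes "wg U u G" "wg U v H"
 shows "wg U (%x. u x - v x) (%x. G x - H x)" using wg_add[OF assms(1) wg_cmult[OF assms(2), of "-1"]] by simp

lemma wg_cong_AE:
 assumes wg: "wg U u G" and int: "Lint u'" "Lint G'" and U: "U : sets borel"
  and AE: "ae x. x : U --> u' x = u x & G' x = G x"
 shows "wg U u' G'" unfolding wg_def
proof (intro conjI allI impI int)
 fix ph assume tf: "test_function U ph"
 obtain K R where K: "compact K" "K<=U" "ALL x. x ~: K --> ph x = 0" "smooth ph" "kernel R ph" "0<R" using test_functionD[OF tf] by (elim exE conjE)
 have gz: "grad ph x = 0" if "x ~: K" for x by (rule grad_zero_outside_closed[of K]) (use K that compact_imp_closed in auto)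
 have [measurable]: "ph : bm" "grad ph : bm" using K by (auto intro: kernel_measurable smooth_grad_measurable simp: kernel_def)
 have [measurable]: "u : bm" "u' : bm" "G : bm" "G' : bm" using wg int by (auto simp: wg_def)
 have "(LL x. u' x *R grad ph x) = (LL x. u x *R grad ph x)" by (rule integral_cong_AE) (use AE gz K in auto)
 moreover have "(LL x. ph x *R G' x) = (LL x. ph x *R G x)" by (rule integral_cong_AE) (use AE gz K in auto)
 ultimately show "(LL x. u' x *R grad ph x) = - (LL x. ph x *R G' x)" using wg tf by (simp add: wg_def)
qed

lemma wg_translate:
 fixes u :: "'a::euclidean_space => real"
 assumes wg: "wg U u G" and U': "!!x. x : U' ==> x + h : U"
 shows "wg U' (%x. u (x+h)) (%x. G (x+h))" unfolding wg_def
proof (intro conjI allI impI)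
 fix ph assume tf: "test_function U' ph"
 hence s: "smooth ph" by (elim test_functionE)
 hence [measurable]: "ph : bm" "grad ph : bm" by (auto intro: smooth_measurable smooth_grad_measurable)
 note [measurable] = wg_measurable[OF wg]
 have tf': "test_function U (%x. ph (1 *R x+(- h)))" by (rule test_function_compose[OF tf]) (use U' in auto)
 let ?a = "LL x. u (x+h) *R grad ph x"
 have "?a = (LL x. u x *R grad ph (x-h))" using integral_translate[of "%x. u x *R grad ph (x-h)" h] by simp
 also have "... = - (LL x. ph (x-h) *R G x)" using wg tf' grad_affine[OF s, of 1 "- h"] by (auto simp: wg_def)
 also have "... = - (LL x. ph x *R G (x+h))" using integral_translate[of "%x. ph (x-h) *R G x" h] by simp
 finally show "?a = - (LL x. ph x *R G (x+h))" .
qed (use wg in "auto simp: wg_def intro: integrable_translate")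

lemma wg_cutoff:
 fixes u :: "'a::euclidean_space => real"
 assumes wg: "wg U u G" and et: "test_function U et"
 shows "wg UNIV (%x. et x * u x) (%x. et x *R G x + u x *R grad et x)" unfolding wg_def
proof (intro conjI allI impI)
 obtain K R where K: "compact K" "K<=U" "ALL x. x ~: K --> et x = 0" "smooth et" "kernel R et" "0<R" using test_functionD[OF et] by (elim exE conjE)
 have iu: "Lint u" "Lint G" using wg by (auto simp: wg_def)
 show "Lint (%x. et x * u x)" using integrable_test_scaleR[OF K(5) iu(1)] by simp
 show "Lint (%x. et x *R G x + u x *R grad et x)" by (intro Bochner_Integration.integrable_add integrable_test_scaleR[OF K(5)] integrable_scaleR_grad[OF K(5)] iu)
 fix ph :: "'a => real" assume tf: "test_function UNIV ph"
 then obtain R' where R': "smooth ph" "kernel R' ph" by (elim test_functionE)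
 let ?b = "%x. et x * ph x"
 have tf': "test_function U ?b" by (rule test_functionI[OF smooth_mult[OF K(4) R'(1)] K(1,2)]) (use K(3) in auto)
 then obtain R'' where R'': "kernel R'' ?b" by (elim test_functionE)
 let ?e = "%x. ph x *R (u x *R grad et x)"
 have e: "u x *R grad ?b x = (et x * u x) *R grad ph x + ?e x" for x using grad_mult[OF K(4) R'(1)] by (simp add: scaleR_add_right mult.commute)
 have i1: "Lint (%x. (et x * u x) *R grad ph x)" by (rule integrable_scaleR_grad[OF R'(2)]) (use integrable_test_scaleR[OF K(5) iu(1)] in simp)
 have i2: "Lint (%x. ?e x)" by (intro integrable_test_scaleR[OF R'(2)] integrable_scaleR_grad[OF K(5)] iu)
 have i3: "Lint (%x. ph x *R (et x *R G x))" by (intro integrable_test_scaleR[OF R'(2)] integrable_test_scaleR[OF K(5)] iu)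
 let ?a = "LL x. (et x * u x) *R grad ph x"
 let ?c = "LL x. ?e x"
 let ?d = "LL x. ph x *R (et x *R G x)"
 have "?a+?c = (LL x. u x *R grad ?b x)" using i1 i2 by (simp add: e)
 also have "... = - ?d" using wg tf' by (simp add: wg_def mult.commute)
 finally have "?a = - (?d+?c)" unfolding minus_add_distrib add_uminus_conv_diff eq_diff_eq .
 also have "... = - (LL x. ph x *R (et x *R G x) + ?e x)" by (subst Bochner_Integration.integral_add[OF i3 i2]) simp
 finally show "?a = - (LL x. ph x *R (et x *R G x + u x *R grad et x))" by (simp only: scaleR_add_right)
qed

lemma wg_grad_conv:
 fixes u :: "'a::euclidean_space => real"
 assumes wg: "wg U u G" and k: "kernel R k" and x: "cball x R<=U"
 shows "grad (conv k u) x = conv k G x"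
proof -
 have sk: "smooth k" using k by (simp add: kernel_def)
 have tf: "test_function U (%y. k (-1 *R y+x))"
 proof (rule test_function_compose[of "cball 0 R"])
  show "test_function (cball 0 R) k" by (rule test_functionI[of _ "cball 0 R"]) (use k in "auto simp: kernel_def")
  fix y :: 'a assume "y : cball 0 R"
  thus "- 1 *R (y-x) : U" using x by (auto simp: subset_eq dist_norm)
 qed simp
 have "grad (conv k u) x = (LL y. u y *R grad k (x-y))" by (rule grad_conv[OF k]) (use wg in "simp add: wg_def")
 also have "... = - (LL y. u y *R grad (%y. k (-1 *R y+x)) y)" unfolding grad_affine[OF sk] by simp
 also have "... = (LL y. k (-1 *R y+x) *R G y)" using wg tf by (simp add: wg_def)
 finally show ?thesis by (simp add: conv_def)
qed

lemma smooth_weak_gradient: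
 fixes f :: "'a::euclidean_space => real"
 assumes f: "smooth f" and ph: "test_function U ph"
 shows "(LL x. f x *R grad ph x) = - (LL x. ph x *R grad f x)"
proof -
 obtain K R where K0: "compact K" "K<=U" "ALL x. x ~: K --> ph x = 0" "smooth ph" "kernel R ph" "0<R" using test_functionD[OF ph] by (elim exE conjE)
 note K = K0(1,3,4,5)
 have k: "kernel R (%x. f x * ph x)" using K f by (auto simp: kernel_def intro: smooth_mult)
 have gz: "grad ph x = 0" if "x ~: cball 0 R" for x by (rule kernel_grad_zero[OF K(4) that])
 have [measurable]: "ph : bm" "grad ph : bm" "f : bm" "grad f : bm" using K f by (auto intro: smooth_measurable smooth_grad_measurable)
 have bc: "Lint g" if g: "continuous_on UNIV g" "!!x. x ~: cball 0 R ==> g x = 0" for g :: "'a => 'a"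
 proof -
  obtain B where B: "0<B" "!!x. norm (g x)<=B" using continuous_compact_support_bounded[OF g] by metis
  show ?thesis by (rule Bochner_Integration.integrable_bound[OF integrable_const_cball[of B 0 R]])
   (use B g in "auto simp: indicator_def intro: borel_measurable_continuous_onI")
 qed
 have i: "Lint (%x. f x *R grad ph x)" "Lint (%x. ph x *R grad f x)" using K gz by (auto intro!: bc continuous_intros smooth_continuous smooth_continuous_grad f simp: kernel_def)
 have "0 = (LL x. grad (%x. f x * ph x) x)" by (simp add: integral_grad_kernel[OF k])
 also have "... = (LL x. f x *R grad ph x)+(LL x. ph x *R grad f x)" using i by (simp add: grad_mult[OF f K(3)])
 finally show ?thesis by (simp add: eq_neg_iff_add_eq_0)
qed

lemma wg_limit:
 assumes wg: "!!k. wg U (u k) (G k)" and int: "Lint v" "Lint H"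
  and lim: "!!e::real. 0<e ==> EX k. Np 1 (%x. u k x - v x)<=en e & Np 1 (%x. G k x - H x)<=en e"
 shows "wg U v H" unfolding wg_def
proof (intro conjI allI impI int)
 fix ph assume tf: "test_function U ph"
 then obtain R where R: "kernel R ph" by (elim test_functionE)
 obtain B where B: "0<B" "!!x. abs (ph x)<=B" using kernel_bounded[OF R] by metis
 obtain B' where B': "0<B'" "!!x. norm (grad ph x)<=B'" using kernel_grad_bounded[OF R] by metis
 define D where "D = (LL x. v x *R grad ph x)+(LL x. ph x *R H x)"
 have "norm D<=e" if e: "0<e" for e
 proof -
  define e' where "e' = e/(B+B')"
  have e': "0<e'" using e B B' by (simp add: e'_def)
  obtain k where k: "Np 1 (%x. u k x - v x)<=en e'" "Np 1 (%x. G k x - H x)<=en e'" using lim[OF e'] by blast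
  have iu: "Lint (u k)" "Lint (G k)" using wg[of k] by (auto simp: wg_def)
  have n: "(LL x. norm (u k x - v x))<=e'" "(LL x. norm (G k x - H x))<=e'" using k iu int e' unfolding Np_def by (auto simp: nn_integral_eq_integral)
  let ?b = "LL x. (u k x - v x) *R grad ph x"
  let ?c = "LL x. ph x *R (G k x - H x)"
  let ?a = "?b+?c"
  have "D = - ?a" using wg[of k] tf integrable_scaleR_grad[OF R iu(1)] integrable_scaleR_grad[OF R int(1)]
   integrable_test_scaleR[OF R iu(2)] integrable_test_scaleR[OF R int(2)] by (simp add: wg_def D_def scaleR_diff_left scaleR_diff_right)
  hence "norm D = norm ?a" by (simp only: norm_minus_cancel)
  also have "...<=norm ?b + norm ?c" by (rule norm_triangle_ineq)
  also have "...<=(LL x. B' * norm (u k x - v x))+(LL x. B * norm (G k x - H x))"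
  proof (intro add_mono Bochner_Integration.integral_norm_bound_integral)
   show "norm ((u k x - v x) *R grad ph x)<=B' * norm (u k x - v x)" for x using B'(2)[of x] by (simp add: mult.commute[of B'] mult_left_mono)
   show "norm (ph x *R (G k x - H x))<=B * norm (G k x - H x)" for x using B(2)[of x] by (simp add: mult_right_mono)
  qed (intro integrable_scaleR_grad[OF R] integrable_test_scaleR[OF R] integrable_mult_right
   integrable_norm Bochner_Integration.integrable_diff iu int)+
  also have "...<=B'*e'+B*e'" using n B B' by (auto intro!: add_mono mult_left_mono)
  also have "... = (B+B')*e'" by (simp add: algebra_simps)
  also have "... = e" using B(1) B'(1) by (simp add: e'_def)
  finally show ?thesis .
 qed
 hence "norm D<=0" using field_le_epsilon[of "norm D" 0] by simp
 thus "(LL x. v x *R grad ph x) = - (LL x. ph x *R H x)" by (simp add: D_def eq_neg_iff_add_eq_0)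
qed

lemma wg_unique:
 fixes u :: "'a::euclidean_space => real"
 assumes "open U" and wg: "wg U u G" "wg U u H"
 shows "ae x. x : U --> G x = H x"
proof -
 define D where "D x = G x - H x" for x
 have wgD: "wg U (%x. 0) D" using wg_diff[OF wg] by (simp add: D_def[abs_def])
 hence iD: "Lint D" by (simp add: wg_def)
 hence [measurable]: "D : bm" by simp
 have NpD: "Np 1 D<oo" using iD by (simp add: integrable_iff_Np1)
 have compactD: "ae x. x : K --> D x = 0" if K: "compact K" "K<=U" for K
 proof -
  have [measurable]: "K : sets borel" using K by (simp add: compact_imp_closed)
  obtain de where de: "0<de" "(\<Union>x\<in>K. cball x de)<=U" using compact_subset_open_imp_cball_epsilon_subset[OF K(1) \<open>open U\<close> K(2)] by metis
  have "Np 1 (%x. ind K x *R D x)<=0"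
  proof (rule ennreal_le_epsilon)
   fix e :: real assume e: "0<e"
   from mollify_Lp[OF iD NpD _ e] obtain d where d: "0<d" "!!ep. 0<ep ==> ep<d ==> Np 1 (%x. conv (moll ep) D x - D x)<=en e" by (metis order_refl)
   define ep where "ep = min de (d/2)"
   have eps: "0<ep" "ep<d" "ep<=de" using d de by (auto simp: ep_def)
   have km: "kernel ep (moll ep :: 'a => real)" by (rule kernel_moll[OF eps(1)])
   have "conv (moll ep) D x = 0" if "x : K" for x
   proof -
    have "cball x ep<=U" using de(2) that eps(3) by (auto simp: subset_eq)
    from wg_grad_conv[OF wgD km this, symmetric] have "conv (moll ep) D x = grad (conv (moll ep) (%x. 0::real)) x" .
    also have "conv (moll ep) (%x. 0::real) = (%x::'a. 0)" by (simp add: conv_def[abs_def])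
    also have "grad (%x::'a. 0::real) x = 0" by (rule grad_zero_outside[of UNIV]) auto
    finally show ?thesis .
   qed
   hence "Np 1 (%x. ind K x *R D x)<=Np 1 (%x. conv (moll ep) D x - D x)" unfolding Np_def by (intro nn_integral_mono) (auto simp: indicator_def)
   also have "...<=en e" by (rule d(2)[OF eps(1,2)])
   finally show "Np 1 (%x. ind K x *R D x)<=0 + en e" by simp
  qed
  hence "(NN x. en (norm (ind K x *R D x) powr 1)) = 0" by (simp add: Np_def)
  hence "ae x. en (norm (ind K x *R D x) powr 1) = 0" by (subst (asm) nn_integral_0_iff_AE) auto
  thus ?thesis by eventually_elim (auto simp: indicator_def)
 qed
 obtain C :: "nat => 'a set" where C: "!!n. compact (C n)" "!!n. C n<=U" "\<Union>(range C) = U" using open_Union_compact_subsets[OF \<open>open U\<close>] by metis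
 have "ae x. ALL n. x : C n --> D x = 0" unfolding AE_all_countable using compactD C by blast
 thus ?thesis by eventually_elim (use C(3) in "auto simp: D_def")
qed

section \<open>Difference quotients and Poincare inequalities\<close>

lemma conv_moll_powr_le:
 fixes G :: "'a::euclidean_space => 'a"
 assumes int: "Lint G" and [measurable]: "T : sets borel" and p: "1<=p" and e: "0<ep" and z: "cball z ep<=T"
 shows "en (norm (conv (moll ep) G z) powr p)
  <= (NN y. en (moll ep y) * (ind T (z-y) * en (norm (G (z-y)) powr p)))"
proof -
 have km: "kernel ep (moll ep :: 'a => real)" by (rule kernel_moll[OF e])
 have [measurable]: "(moll ep :: 'a => real) : bm" "G : bm" using kernel_measurable[OF km] int by auto
 let ?a = "%y. ind T (z-y) * en (norm (G (z-y)) powr p)"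
 have "en (norm (conv (moll ep) G z) powr p)<=(NN y. en (moll ep y * norm (G (z-y)) powr p))" unfolding conv_shift[OF km \<open>G : bm\<close>]
  by (intro jensen_powr moll_nonneg nn_integral_moll e p integrable_conv_shift[OF km int]) auto
 also have "... = (NN y. en (moll ep y) * ?a y)"
 proof (rule nn_integral_cong)
  fix y
  show "en (moll ep y * norm (G (z-y)) powr p) = en (moll ep y) * ?a y"
  proof (cases "y : cball 0 ep")
   case True
   hence "z-y : T" using z by (auto simp: subset_eq dist_norm)
   thus ?thesis by (simp add: ennreal_mult' moll_nonneg)
  qed (use km in "simp add: kernel_def")
 qed
 finally show ?thesis .
qed

lemma smooth_increment_powr_le:
 fixes f :: "'a::euclidean_space => real"
 assumes f: "smooth f" and p: "1<=p"
 shows "en (abs (f (x+h) - f x) powr p)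
  <= en (norm h powr p) * (NN t:{0..1}. norm (grad f (x+t *R h)) powr p)"
proof -
 have cg: "continuous_on UNIV (grad f)" by (rule smooth_continuous_grad[OF f])
 have cx: "continuous_on UNIV (%t::real. x + t *R h)" by (intro continuous_intros)
 let ?c = "%t. grad f (x+t *R h)"
 have cgx: "continuous_on UNIV (%t. ?c t)" using continuous_on_compose2[OF cg cx] by simp
 have [measurable]: "grad f : bm" by (rule smooth_grad_measurable[OF f])
 have c: "isCont (%t. h .* ?c t) t" for t using cgx by (intro continuous_intros) (simp add: continuous_on_eq_continuous_at)
 have d: "((%t. f (x+t *R h)) has_real_derivative h .* ?c t) (at t)" for t
 proof -
  have "((%t. f (x+t *R h)) has_derivative (%s. (s *R h) .* ?c t)) (at t)" by (rule has_derivative_compose[OF _ smooth_GDERIV[OF f, unfolded gderiv_def]])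
   (auto intro!: derivative_eq_intros)
  thus ?thesis unfolding has_field_derivative_def by (rule has_derivative_eq_rhs) (auto simp: fun_eq_iff)
 qed
 let ?a = "%t. h .* ?c t"
 have fi: "has_bochner_integral lborel (%t. h .* ?c t * ind {0..1} t) (f (x+1 *R h) - f (x+0 *R h))" by (rule has_bochner_integral_FTC_Icc_real) (use d c in auto)
 hence eq: "f (x+h) - f x = (LL t. ind {0..1} t *R (?a t))" by (simp add: has_bochner_integral_iff mult.commute)
 let ?b = "%t. norm (?c t) powr p"
 let ?d = "en (norm h powr p)"
 have "en (abs (f (x+h) - f x) powr p)<=(NN t. en (ind {0..1} t * norm (?a t) powr p))" unfolding eq real_norm_def[symmetric]
  by (rule jensen_powr) (use p fi in "auto simp: has_bochner_integral_iff mult.commute ennreal_indicator")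
 also have "...<=(NN t. ?d * (ind {0..1} t * en (?b t)))"
 proof (rule nn_integral_mono)
  fix t :: real
  have "norm (?a t) powr p<=(norm h * norm (?c t)) powr p" by (intro powr_mono2) (use p Cauchy_Schwarz_ineq2 in auto)
  thus "en (ind {0..1} t * norm (?a t) powr p)
   <= ?d * (ind {0..1} t * en (?b t))" by (auto simp: indicator_def powr_mult ennreal_mult'[symmetric] intro!: ennreal_leI)
 qed
 also have "... = ?d * (NN t:{0..1}. ?b t)" by (intro nn_integral_cmult) measurable
 finally show ?thesis .
qed

lemma mollify_AE_seq:
 fixes u :: "'a::euclidean_space => 'b::euclidean_space"
 assumes int: "Lint u" and de: "0<de"
 obtains ep where "!!n::nat. 0<ep n" "!!n. ep n<de" "ae x. (%n. conv (moll (ep n)) u x) ----> u x"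
proof -
 have fin: "Np 1 u<oo" using int by (simp add: integrable_iff_Np1)
 have [measurable]: "u : bm" using int by simp
 have "EX e. 0<e & e<de & Np 1 (%x. conv (moll e) u x - u x)<=en (1 / Suc n)" for n
 proof -
  have "0<1 / real (Suc n)" by simp
  from mollify_Lp[OF int fin order_refl this] obtain d where d: "0<d"
   "!!ep. 0<ep ==> ep<d ==> Np 1 (%x. conv (moll ep) u x - u x)<=en (1 / Suc n)" by metis
  thus ?thesis using de by (intro exI[of _ "min (d/2) (de/2)"]) (auto simp: min_def)
 qed
 then obtain e where e: "!!n. 0<e n" "!!n. e n<de" "!!n. Np 1 (%x. conv (moll (e n)) u x - u x)<=en (1 / Suc n)" by metis
 have [measurable]: "(moll (e n) :: 'a => real) : bm" for n by (rule kernel_measurable[OF kernel_moll[OF e(1)]])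
 have i: "Lint (%x. conv (moll (e n)) u x - u x)" for n unfolding integrable_iff_Np1 using e(3)[of n] by (auto elim!: le_less_trans)
 let ?a = "%n. LL x. norm (conv (moll (e n)) u x - u x)"
 have le: "?a n<=1 / Suc n" for n
 proof -
  have "en (?a n) = Np 1 (%x. conv (moll (e n)) u x - u x)" unfolding Np_def using i[of n] by (subst nn_integral_eq_integral) auto
  also note e(3)[of n]
  finally show ?thesis by (simp add: ennreal_le_iff)
 qed
 have "(%n. ?a n) ----> 0"
 proof (rule tendsto_sandwich[OF _ _ tendsto_const LIMSEQ_inverse_real_of_nat])
  show "\<forall>\<^sub>F n in sequentially. 0<=?a n" by (intro always_eventually allI Bochner_Integration.integral_nonneg) simp
  show "\<forall>\<^sub>F n in sequentially. ?a n<=inverse (real (Suc n))" using le by (intro always_eventually allI) (simp only: inverse_eq_divide)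
 qed
 from tendsto_L1_AE_subseq[OF i this] obtain r where r: "strict_mono r" "ae x. (%n. conv (moll (e (r n))) u x - u x) ----> 0" by (elim exE conjE)
 show ?thesis
 proof (rule that[of "%n. e (r n)"])
  show "ae x. (%n. conv (moll (e (r n))) u x) ----> u x" using r(2) by eventually_elim (simp add: LIM_zero_iff)
 qed (use e in auto)
qed

lemma wg_translation_estimate:
 fixes u :: "'a::euclidean_space => real"
 assumes wg: "wg U u G" and [measurable]: "S : sets borel" "T : sets borel" and p: "1<=p" and de: "0<de"
  and sub: "!!x t y. x : S ==> 0<=t ==> t<=1 ==> norm y<=de ==> x + t *R h+y : T" and TU: "T<=U"
 shows "(NN x:S. abs (u (x+h) - u x) powr p)
  <= en (norm h powr p) * (NN x:T. norm (G x) powr p)"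
proof -
 have int: "Lint u" "Lint G" using wg by (auto simp: wg_def)
 note [measurable] = wg_measurable[OF wg]
 define g where "g w = ind T w * en (norm (G w) powr p)" for w
 have [measurable]: "g : bm" unfolding g_def by measurable
 define I where "I = (NN x. g x)"
 let ?b = "%ep x. abs (conv (moll ep) u (x+h) - conv (moll ep) u x) powr p"
 let ?c = "norm h powr p"
 have step: "(NN x:S. ?b ep x)<=en ?c * I"
  if e: "0<ep" "ep<de" for ep
 proof -
  have km: "kernel ep (moll ep :: 'a => real)" by (rule kernel_moll[OF e(1)])
  have [measurable]: "(moll ep :: 'a => real) : bm" by (rule kernel_measurable[OF km])
  define M where "M z = (NN y. en (moll ep y) * g (z-y))" for z
  have [measurable]: "M : bm" unfolding M_def[abs_def] by measurable
  have sm: "smooth (conv (moll ep) u)" by (rule smooth_conv[OF km int(1)])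
  have gr: "en (norm (grad (conv (moll ep) u) (x+t *R h)) powr p)<=M (x+t *R h)"
   if "x : S" "0<=t" "t<=1" for x t
  proof -
   have T: "cball (x+t *R h) ep<=T"
   proof
    fix w assume "w : cball (x+t *R h) ep"
    hence "norm (w-(x+t *R h))<=de" using e by (simp add: dist_norm norm_minus_commute)
    from sub[OF that this] show "w : T" by simp
   qed
   hence "grad (conv (moll ep) u) (x+t *R h) = conv (moll ep) G (x+t *R h)" using TU by (intro wg_grad_conv[OF wg km]) auto
   with conv_moll_powr_le[OF int(2) \<open>T : sets borel\<close> p e(1) T] show ?thesis by (simp add: M_def g_def)
  qed
  let ?e = "lborel::real measure"
  have "(NN x:S. ?b ep x) <= (NN x. en ?c * (NN t. ind {0..1} t * M (x+t *R h)))"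
  proof (rule nn_integral_mono)
   fix x :: 'a
   show "ind S x * en (?b ep x) <= en ?c * (NN t. ind {0..1} t * M (x+t *R h))"
   proof (cases "x : S")
    case True
    have "en (?b ep x)<=en ?c * (NN t:{0..1}. norm (grad (conv (moll ep) u) (x+t *R h)) powr p)" by (rule smooth_increment_powr_le[OF sm p])
    also have "...<=en ?c * (NN t. ind {0..1} t * M (x+t *R h))" by (rule mult_left_mono, rule nn_integral_mono) (use gr[OF True] in "auto simp: indicator_def")
    finally show ?thesis using True by simp
   qed simp
  qed
  also have "... = en ?c * (NN x. (\<integral>\<^sup>+t. ind {0..1} t * M (x+t *R h) \<partial>?e))" by (rule nn_integral_cmult) measurable
  also have "(NN x. (\<integral>\<^sup>+t. ind {0..1} t * M (x+t *R h) \<partial>?e))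
   = (\<integral>\<^sup>+t. (NN x. ind {0..1} t * M (x+t *R h)) \<partial>?e)" by (rule lborel_pair.Fubini') measurable
  also have "... = (\<integral>\<^sup>+t. ind {0..1} t*(NN x. M x) \<partial>?e)" by (intro nn_integral_cong) (simp add: nn_integral_cmult nn_integral_translate)
  also have "... = (NN x. M x)" by (simp add: nn_integral_multc)
  also have "... = (NN y. (NN z. en (moll ep y) * g (z-y)))" unfolding M_def by (rule lborel_pair.Fubini') measurable
  also have "... = (NN y. en (moll ep (y::'a)) * I)"
  proof (rule nn_integral_cong)
   fix y :: 'a
   show "(NN z. en (moll ep y) * g (z-y)) = en (moll ep y) * I" using nn_integral_translate[of g "- y"] by (simp add: nn_integral_cmult I_def)
  qed
  also have "... = I" using nn_integral_moll[OF e(1), where 'a='a] by (simp add: nn_integral_multc)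
  finally show ?thesis .
 qed
 obtain ep where ep: "!!n::nat. 0<ep n" "!!n. ep n<de" and lim: "ae x. (%n. conv (moll (ep n)) u x) ----> u x" by (rule mollify_AE_seq[OF int(1) de]) blast
 have [measurable]: "(moll (ep n) :: 'a => real) : bm" for n by (rule kernel_measurable[OF kernel_moll[OF ep(1)]])
 let ?a = "%n x. abs (conv (moll (ep n)) u (x+h) - conv (moll (ep n)) u x) powr p"
 let ?d = "%x. abs (u (x+h) - u x) powr p"
 let ?f = "%x. %n. ind S x * en (?a n x)"
 have "(NN x:S. ?d x) = (NN x. liminf (?f x))"
 proof (rule nn_integral_cong_AE, use lim AE_translate[OF lim, of h] in eventually_elim)
  fix x assume l: "(%n. conv (moll (ep n)) u x) ----> u x" "(%n. conv (moll (ep n)) u (x+h)) ----> u (x+h)"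
  have "(%n. en (?a n x)) ----> ennreal (?d x)" using p l by (intro tendsto_ennrealI tendsto_powr' tendsto_intros) auto
  hence "?f x ----> ind S x * en (?d x)" by (auto simp: indicator_def)
  thus "ind S x * en (?d x) = liminf (?f x)" by (intro lim_imp_Liminf[symmetric]) auto
 qed
 also have "...<=liminf (%n. (NN x:S. ?a n x))" by (rule nn_integral_liminf) measurable
 also have "...<=liminf (%n::nat. en ?c * I)" by (intro Liminf_mono always_eventually allI step ep)
 also have "... = en ?c * I" by (simp add: Liminf_const)
 finally show ?thesis by (simp add: I_def g_def)
qed

lemma poincare:
 fixes u :: "'a::euclidean_space => real"
 assumes wg: "wg UNIV u G" and z: "!!x. x ~: cball a R ==> u x = 0" and p: "1<=p"
 shows "Np p u<=en ((2 * abs R + 1) powr p) * Np p G"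
proof -
 define h where "h = (2 * abs R + 1) *R (SOME b::'a. b : Basis)"
 have nh: "norm h = 2 * abs R + 1" by (simp add: h_def)
 have "Np p u<=(NN x:UNIV. abs (u (x+h) - u x) powr p)" unfolding Np_def
 proof (rule nn_integral_mono)
  fix x
  show "en (norm (u x) powr p)<=ind UNIV x * en (abs (u (x+h) - u x) powr p)"
  proof (cases "x : cball a R")
   case True
   have "norm h<=dist a (x+h) + dist a x" using norm_triangle_ineq4[of "x+h-a" "x-a"] by (simp add: dist_norm norm_minus_commute)
   hence "x+h ~: cball a R" using True nh by auto
   thus ?thesis by (simp add: z)
  qed (use z p in simp)
 qed
 also have "...<=en (norm h powr p) * (NN x:UNIV. norm (G x) powr p)" by (rule wg_translation_estimate[OF wg _ _ p, of _ _ 1]) auto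
 finally show ?thesis by (simp add: nh Np_def)
qed

lemma poincare_wirtinger:
 fixes u :: "'a::euclidean_space => real"
 assumes wg: "wg U u G" and sub: "cball a (r+de)<=U" and p: "1<=p" and r: "0<r" and de: "0<de"
 defines "m == (LL y. ind (ball a r) y * u y) / measure lborel (ball a r)"
 shows "(NN x:ball a r. abs (u x - m) powr p)
  <= en ((2*r) powr p * 2 ^ DIM('a)) * (NN x:cball a (r+de). norm (G x) powr p)"
proof -
 have int: "Lint u" "Lint G" using wg by (auto simp: wg_def)
 note [measurable] = wg_measurable[OF wg]
 have [measurable]: "ball a r : sets borel" "cball a (r+de) : sets borel" "cball (0::'a) (2*r) : sets borel" by auto
 let ?B = "ball a r"
 define b where "b = measure lborel ?B"
 have b: "0<b" using r by (simp add: b_def content_ball)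
 have eb: "emeasure lborel ?B = en b" using emeasure_bounded_finite[OF bounded_ball, of a r] by (simp add: b_def emeasure_eq_ennreal_measure)
 define J where "J = (NN x:cball a (r+de). norm (G x) powr p)"
 have [measurable]: "(ind ?B :: 'a => real) : bm" by measurable
 let ?a = "%x h. ind ?B x * ind ?B (h+x) * en (abs (u (h+x) - u x) powr p)"
 let ?b = "%x. NN y. en (ind ?B y / b * norm (u y - u x) powr p)"
 let ?d = "1/b * (2*r) powr p"
 let ?e = "cball (0::'a) (2*r)"
 let ?f = "%x. NN y. en (1/b) * (ind ?B x * ind ?B y * en (abs (u y - u x) powr p))"
 let ?g = "2 ^ DIM('a) * b"
 let ?i = "%h. NN x. en (1/b) * ?a x h"
 have "(NN x:?B. abs (u x - m) powr p) <= (NN x. ind ?B x * ?b x)"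
 proof (intro nn_integral_mono mult_left_mono)
  fix x
  have iB: "Lint (%y. ind ?B y *R u y)" by (rule integrable_bounded_scaleR[OF _ int(1), of _ 1]) (auto simp: indicator_def)
  have iB': "Lint (%y. ind ?B y :: real)" using eb by (intro integrable_real_indicator) auto
  have i1: "Lint (%y. (ind ?B y / b) *R u y)" using integrable_mult_right[OF iB, of "1/b"] by simp
  have i2: "Lint (%y. (ind ?B y / b) *R u x)" using iB' by simp
  let ?h = "LL y. (ind ?B y / b) *R (u y - u x)"
  have "m - u x = ?h" using i1 i2 b by (simp add: right_diff_distrib m_def b_def[symmetric])
  hence e: "abs (u x - m) = norm ?h" by (simp add: abs_minus_commute)
  show "en (abs (u x - m) powr p)<=?b x" unfolding e
  proof (rule jensen_powr[OF _ _ _ _ p])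
   have "(NN y. en (ind ?B y / b)) = (NN y. en (1/b) * ind ?B y)" by (intro nn_integral_cong) (auto simp: indicator_def)
   also have "... = 1" using b by (simp add: nn_integral_cmult_indicator eb ennreal_mult'[symmetric])
   finally show "(NN y. en (ind ?B y / b)) = 1" .
   show "Lint (%y. (ind ?B y / b) *R (u y - u x))" using i1 i2 by (simp add: right_diff_distrib)
  qed (use b in auto)
 qed simp
 also have "... = (NN x. ?f x)"
 proof (intro nn_integral_cong)
  fix x
  have "ind ?B x * ?b x = (NN y. ind ?B x * en (ind ?B y / b * norm (u y - u x) powr p))" by (rule nn_integral_cmult[symmetric]) measurable
  also have "... = ?f x" using b by (intro nn_integral_cong) (auto simp: indicator_def ennreal_mult'[symmetric])
  finally show "ind ?B x * ?b x = ..." .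
 qed
 also have "... = (NN x. (NN h. en (1/b) * ?a x h))" by (intro nn_integral_cong nn_integral_translate[symmetric]) measurable
 also have "... = (NN h. ?i h)" by (rule lborel_pair.Fubini') measurable
 also have "...<=(NN h. en ?d * J * ind ?e h)"
 proof (rule nn_integral_mono)
  fix h :: 'a
  let ?S = "{x. x : ?B & x+h : ?B}"
  have [measurable]: "?S : sets borel" by measurable
  let ?c = "NN x:?S. abs (u (x+h) - u x) powr p"
  have "?i h = en (1/b) * ?c" by (subst nn_integral_cmult[symmetric]) (auto intro!: nn_integral_cong simp: indicator_def add.commute)
  also have "...<=en ?d * J * ind ?e h"
  proof (cases "?S = {}")
   case True
   thus ?thesis by simp
  next
   case False
   then obtain x0 where x0: "x0 : ?B" "x0+h : ?B" by auto
   have "norm h<=dist a (x0+h) + dist a x0" using norm_triangle_ineq4[of "x0+h-a" "x0-a"] by (simp add: dist_norm norm_minus_commute)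
   hence h: "norm h<=2*r" using x0 by auto
   let ?j = "en (1/b) * (en ((2*r) powr p) * J)"
   have "?c<=en (norm h powr p) * J" unfolding J_def
   proof (rule wg_translation_estimate[OF wg _ _ p de _ sub])
    fix x t and y :: 'a assume x: "x : ?S" and t: "0<=(t::real)" "t<=1" and y: "norm y<=de"
    have "(1-t) *R x+t *R (x+h) : ?B" using x t by (intro convexD_alt[OF convex_ball]) auto
    hence "x+t *R h : ?B" by (simp add: algebra_simps)
    moreover have "dist a (x+t *R h+y)<=dist a (x+t *R h) + norm y" by (rule order_trans[OF dist_triangle[of _ _ "x+t *R h"]]) (simp add: dist_norm)
    ultimately show "x+t *R h+y : cball a (r+de)" using y by auto
   qed measurable
   also have "...<=en ((2*r) powr p) * J" using h p by (intro mult_right_mono ennreal_leI powr_mono2) auto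
   finally have "en (1/b) * ?c <= ?j" by (rule mult_left_mono) simp
   also have "?j = en ?d * J" by (subst ennreal_mult') (use b in "auto simp: mult.assoc")
   finally show ?thesis using h by simp
  qed
  finally show "?i h <= en ?d * J * ind ?e h" .
 qed
 also have "... = en ?d * J * en ?g"
 proof -
  have "emeasure lborel ?e = en ?g" using r by (simp add: emeasure_cball b_def content_ball power_mult_distrib mult_ac)
  thus ?thesis by (subst nn_integral_cmult_indicator) auto
 qed
 also have "... = en (1/b * (2*r) powr p * ?g) * J" using b by (subst ennreal_mult'') (auto simp: mult_ac)
 also have "1/b * (2*r) powr p * ?g = (2*r) powr p * 2 ^ DIM('a)" using b by simp
 finally show ?thesis by (simp add: J_def)
qed

section \<open>Borel representatives\<close>

lemma AE_lebesgue_on: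
 fixes U :: "'a::euclidean_space set"
 assumes "U : sets borel"
 shows "(AE x in lebesgue_on U. P x) <-> (ae x. x : U --> P x)"
proof -
 have "U : sets lebesgue" using assms by (auto intro: sets_completionI_sets)
 thus ?thesis by (simp add: AE_restrict_space_iff AE_completion_iff)
qed

definition rep :: "'a::euclidean_space set => ('a => 'b::euclidean_space) => ('a => 'b) => bool"
 where "rep U f f' <-> f' : bm & (ALL x. x ~: U --> f' x = 0) &
  (ae x. x : U --> f' x = f x)"

lemma rep_ex:
 fixes f :: "'a::euclidean_space => 'b::euclidean_space"
 assumes U[measurable]: "U : sets borel" and f: "f : borel_measurable (lebesgue_on U)"
 shows "EX f'. rep U f f'"
proof -
 have "U : sets lebesgue" using U by (auto intro: sets_completionI_sets)
 have f0: "(%x. if x : U then f x else 0) : borel_measurable lebesgue" using f \<open>U : sets lebesgue\<close> by (simp add: borel_measurable_if)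
 let ?a = "%x. if x : U then f x else 0"
 have "EX g. g : borel_measurable lborel & (ae x. ?a x .* b = g x)" for b
 proof -
  have "(%x. ?a x .* b) : borel_measurable lebesgue" using f0 by measurable
  from completion_ex_borel_measurable_real[OF this] show ?thesis by blast
 qed
 then obtain g where g: "!!b. g b : borel_measurable lborel" "!!b. ae x. ?a x .* b = g b x" by metis
 have [measurable]: "!!b. g b : bm" using g(1) by simp
 define f' where "f' x = ind U x *R (\<Sum>b\<in>Basis. g b x *R b)" for x
 have "ae x. ALL b:Basis. ?a x .* b = g b x" using g(2) by (simp add: AE_finite_all)
 hence "ae x. x : U --> f' x = f x"
 proof eventually_elim
  fix x assume *: "ALL b:Basis. (if x : U then f x else 0) .* b = g b x"
  show "x : U --> f' x = f x"
  proof
   assume "x : U"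
   hence "f' x = (\<Sum>b\<in>Basis. (f x .* b) *R b)" using * by (auto simp: f'_def intro!: sum.cong)
   thus "f' x = f x" by (simp add: euclidean_representation)
  qed
 qed
 moreover have "f' : bm" unfolding f'_def by measurable
 ultimately show ?thesis by (intro exI[of _ f']) (simp add: rep_def f'_def)
qed

lemma rep_measurable:
 fixes f :: "'a::euclidean_space => 'b::euclidean_space"
 assumes U: "U : sets borel" and r: "rep U f f'"
 shows "f : borel_measurable (lebesgue_on U)"
proof -
 have "U : sets lebesgue" using U by (auto intro: sets_completionI_sets)
 have "f' : borel_measurable lebesgue" using r by (auto simp: rep_def intro: measurable_completion)
 moreover have "AE x in lebesgue. f' x = (if x : U then f x else 0)" unfolding AE_completion_iff using r by (auto simp: rep_def)
 ultimately have "(%x. if x : U then f x else 0) : borel_measurable lebesgue" by (rule borel_measurable_AE)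
 thus ?thesis using \<open>U : sets lebesgue\<close> by (simp add: borel_measurable_if)
qed

lemma nn_integral_rep:
 fixes U :: "'a::euclidean_space set"
 assumes U: "U : sets borel" and "ae x. x : U --> f' x = f x" "!!x. x ~: U ==> f' x = 0"
 shows "(NL x:U. f x) = (NN x. f' x)"
proof -
 have "U : sets lebesgue" using U by (auto intro: sets_completionI_sets)
 hence "(NL x:U. f x) = (\<integral>\<^sup>+x. f x * ind U x \<partial>lebesgue)" by (simp add: nn_integral_restrict_space)
 also have "... = (NN x. f x * ind U x)" by (rule nn_integral_completion)
 also have "... = (NN x. f' x)" by (rule nn_integral_cong_AE, use assms(2) in eventually_elim) (use assms(3) in "auto simp: indicator_def")
 finally show ?thesis .
qed

lemma
 fixes f :: "'a::euclidean_space => 'b::euclidean_space"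
 assumes U: "U : sets borel" and r: "rep U f f'"
 shows integral_rep: "(LL x:U. f x) = (LL x. f' x)"
  and integrable_rep: "integrable (lebesgue_on U) f <-> Lint f'"
proof -
 have fm: "f : borel_measurable (lebesgue_on U)" by (rule rep_measurable[OF U r])
 have f'm: "f' : bm" using r by (simp add: rep_def)
 have UL: "U : sets lebesgue" using U by (auto intro: sets_completionI_sets)
 let ?b = "%x. if x : U then f x else 0"
 have if1: "?b : borel_measurable lebesgue" using fm UL by (simp add: borel_measurable_if)
 have e: "?b = (%x. ind U x *R f x)" by (auto simp: indicator_def)
 have AE: "AE x in lebesgue. ind U x *R f x = f' x" unfolding AE_completion_iff using r by (auto simp: rep_def indicator_def)
 have f'm': "f' : borel_measurable lebesgue" using f'm by (auto intro: measurable_completion)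
 let ?a = "(LL x:U. f x)"
 have "?a = (\<integral>x. ind U x *R f x \<partial>lebesgue)" using UL by (subst integral_restrict_space) auto
 also have "... = (\<integral>x. f' x \<partial>lebesgue)" by (rule integral_cong_AE) (use if1 AE f'm' in "auto simp: e")
 also have "... = (LL x. f' x)" by (rule integral_completion) (use f'm in auto)
 finally show "?a = (LL x. f' x)" .
 have "integrable (lebesgue_on U) f <-> integrable lebesgue (%x. ind U x *R f x)" using UL by (subst integrable_restrict_space) auto
 also have "... <-> integrable lebesgue f'" by (rule integrable_cong_AE) (use if1 AE f'm' in "auto simp: e")
 also have "... <-> Lint f'" by (rule integrable_completion) (use f'm in auto)
 finally show "integrable (lebesgue_on U) f <-> Lint f'" .
qed

lemma rep_norm_powr:
 assumes "rep U f f'" and t: "0<t"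
 shows "rep U (%x. norm (f x) powr t) (%x. norm (f' x) powr t)" using assms by (auto simp: rep_def elim!: eventually_mono)

lemma Lp_rep:
 assumes U: "U : sets borel" and r: "rep U f f'" and t: "0<t"
 shows "f : Lp t U <-> Np t f'<oo"
proof -
 have [measurable]: "f' : bm" using r by (simp add: rep_def)
 have "f : Lp t U <-> Lint (%x. norm (f' x) powr t)" unfolding Lp_def using rep_measurable[OF U r] integrable_rep[OF U rep_norm_powr[OF r t]] by simp
 also have "... <-> Np t f'<oo" by (simp add: integrable_iff_bounded Np_def)
 finally show ?thesis .
qed

lemma Lp_integral_rep:
 assumes U: "U : sets borel" and r: "rep U f f'" and t: "0<t"
 shows "(LL x:U. norm (f x) powr t) = enn2real (Np t f')"
proof -
 have [measurable]: "f' : bm" using r by (simp add: rep_def)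
 show ?thesis unfolding Np_def integral_rep[OF U rep_norm_powr[OF r t]] by (rule integral_eq_nn_integral) auto
qed

lemma Lp_norm_rep:
 assumes U: "U : sets borel" and r: "rep U f f'" and t: "0<t"
 shows "Lp_norm t U f = enn2real (Np t f') powr (1/t)" by (simp add: Lp_norm_def Lp_integral_rep[OF assms])

lemma rep_subset:
 assumes "rep U f f'" "A<=U" and [measurable]: "A : sets borel"
 shows "rep A f (%x. ind A x *R f' x)"
proof -
 have [measurable]: "f' : bm" using assms by (simp add: rep_def)
 show ?thesis using assms by (auto simp: rep_def elim!: eventually_mono)
qed

lemma rep_unique: "rep U f f' ==> rep U f f'' ==> ae x. f' x = f'' x" by (auto simp: rep_def elim: eventually_elim2)

lemma rep_cong: "rep U f f' ==> ae x. x : U --> f x = g x ==> rep U g f'" by (auto simp: rep_def elim: eventually_elim2)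

lemma rep_add: "rep U f f' ==> rep U g g' ==> rep U (%x. f x + g x) (%x. f' x + g' x)" by (auto simp: rep_def elim: eventually_elim2)

lemma rep_refl:
 "f : bm ==> (!!x. x ~: U ==> f x = 0) ==> rep U f f" by (auto simp: rep_def)

lemma rep_indicator:
 assumes [measurable]: "f : bm" "U : sets borel"
 shows "rep U f (%x. ind U x *R f x)" by (auto simp: rep_def)

lemma Lp_subset:
 assumes "f : Lp t U" "A<=U" "U : sets borel" "A : sets borel" "0<t"
 shows "f : Lp t A"
proof -
 obtain f' where r: "rep U f f'" using rep_ex[OF assms(3), of f] assms(1) by (auto simp: Lp_def)
 have "Np t (%x. ind A x *R f' x)<=Np t f'" unfolding Np_def by (intro nn_integral_mono) (auto simp: indicator_def)
 thus ?thesis using assms Lp_rep[OF _ r, of t] Lp_rep[OF _ rep_subset[OF r assms(2,4)], of t] by (auto elim: le_less_trans)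
qed

lemma open_sets_borel: "open U ==> U : sets borel" by simp

lemma test_integral_rep:
 fixes Om :: "'a::euclidean_space set" and u u' :: "'a => 'b::euclidean_space" and k :: "'a => 'c::euclidean_space"
  and b :: "'b => 'c => 'd::euclidean_space"
 assumes Om: "Om : sets borel" and A: "A<=Om" and r: "rep A u u'" and k[measurable]: "k : bm"
  and z: "!!x. x ~: A ==> k x = 0" and bl: "bounded_bilinear b"
 shows "(LL x:Om. b (u x) (k x)) = (LL x. b (u' x) (k x))"
proof (rule integral_rep[OF Om])
 interpret b: bounded_bilinear b by (rule bl)
 have [measurable]: "u' : bm" using r by (simp add: rep_def)
 have "continuous_on UNIV (%z. b (fst z) (snd z))" by (intro b.continuous_on continuous_intros)
 hence "(%x. b (fst (u' x, k x)) (snd (u' x, k x))) : bm" by (rule measurable_compose[OF _ borel_measurable_continuous_onI, rotated]) measurable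
 hence "(%x. b (u' x) (k x)) : bm" by simp
 moreover have "ae x. x : Om --> b (u' x) (k x) = b (u x) (k x)" using r z unfolding rep_def by (auto elim!: eventually_mono simp: b.zero_right)
 ultimately show "rep Om (%x. b (u x) (k x)) (%x. b (u' x) (k x))" using A r by (auto simp: rep_def b.zero_left)
qed

lemma hwg_integral_reps:
 fixes Om :: "'a::euclidean_space set"
 assumes Om: "Om : sets borel" and A: "A<=Om" and r: "rep A u u'" "rep A G G'" and ph: "test_function A ph"
 shows "(LL x:Om. u x *R grad ph x) = (LL x. u' x *R grad ph x)"
  "(LL x:Om. ph x *R G x) = (LL x. ph x *R G' x)"
proof -
 obtain K R where K: "compact K" "K<=A" "ALL x. x ~: K --> ph x = 0" "smooth ph" "kernel R ph" "0<R" using test_functionD[OF ph] by (elim exE conjE)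
 have gz: "grad ph x = 0" if "x ~: K" for x by (rule grad_zero_outside_closed[of K]) (use K that compact_imp_closed in auto)
 show "(LL x:Om. u x *R grad ph x) = (LL x. u' x *R grad ph x)" by (rule test_integral_rep[OF Om A r(1) smooth_grad_measurable[OF K(4)] _ bounded_bilinear_scaleR])
  (use gz K(2) in auto)
 show "(LL x:Om. ph x *R G x) = (LL x. ph x *R G' x)" using K(3) K(2) by (intro test_integral_rep[OF Om A r(2) smooth_measurable[OF K(4)] _
  bounded_bilinear.flip[OF bounded_bilinear_scaleR]]) auto
qed

lemma hwg_imp_wg:
 assumes w: "has_weak_gradient Om u G" and Om: "Om : sets borel" and A: "A : sets borel" "A<=Om"
  and L: "u : Lp 1 A" "G : Lp 1 A" and r: "rep A u u'" "rep A G G'"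
 shows "wg A u' G'"
proof -
 have "Lint u'" "Lint G'" using L Lp_rep[OF A(1) r(1), of 1] Lp_rep[OF A(1) r(2), of 1] r by (auto simp: integrable_iff_Np1 rep_def)
 moreover have "(LL x. u' x *R grad ph x) = - (LL x. ph x *R G' x)" if ph: "test_function A ph" for ph using w test_function_mono[OF ph A(2)] hwg_integral_reps[OF Om A(2) r ph] by (simp add: has_weak_gradient_def)
 ultimately show ?thesis by (simp add: wg_def)
qed

lemma wg_imp_hwg:
 assumes w: "wg A u' G'" and A: "A : sets borel" and r: "rep A u u'" "rep A G G'"
 shows "has_weak_gradient A u G"
proof -
 have "Np 1 u'<oo" "Np 1 G'<oo" using w by (auto simp: wg_def integrable_iff_Np1)
 hence "u : Lp 1 A" "G : Lp 1 A" using Lp_rep[OF A r(1), of 1] Lp_rep[OF A r(2), of 1] by auto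
 hence "u : Lp_loc 1 A" "G : Lp_loc 1 A" using closure_subset by (auto simp: Lp_loc_def compactly_inside_def intro!: Lp_subset[OF _ _ A])
 thus ?thesis using w hwg_integral_reps[OF A order_refl r] by (simp add: has_weak_gradient_def wg_def)
qed

lemma hwg_unique:
 fixes u :: "'a::euclidean_space => real"
 assumes "open U" and w: "has_weak_gradient U u G" "has_weak_gradient U u H"
 shows "ae x. x : U --> G x = H x"
proof -
 obtain C :: "nat => 'a set" where C: "!!n. compact (C n)" "!!n. C n<=U" "!!n. C n<=interior (C (Suc n))" "\<Union>(range C) = U" using open_Union_compact_subsets[OF \<open>open U\<close>] by metis
 have "ae x. x : C n --> G x = H x" for n
 proof -
  define A where "A = interior (C (Suc n))"
  have A: "open A" "A : sets borel" "A<=U" "C n<=A" using C(2)[of "Suc n"] C(3)[of n] interior_subset[of "C (Suc n)"] by (auto simp: A_def)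
  let ?a = "borel_measurable (lebesgue_on A)"
  have "closure A<=C (Suc n)" unfolding A_def by (intro closure_minimal interior_subset compact_imp_closed C)
  hence "A \<Subset> U" using C(2)[of "Suc n"] compact_imp_bounded[OF C(1)[of "Suc n"]] by (auto simp: compactly_inside_def A_def bounded_interior)
  hence L: "u : Lp 1 A" "G : Lp 1 A" "H : Lp 1 A" using w A by (auto simp: has_weak_gradient_def Lp_loc_def)
  hence "u : ?a" "G : ?a" "H : ?a" by (simp_all add: Lp_def)
  from this[THEN rep_ex[OF A(2)]] obtain u' G' H' where r: "rep A u u'" "rep A G G'" "rep A H H'" by (elim exE)
  have U: "U : sets borel" using \<open>open U\<close> by simp
  from wg_unique[OF A(1) hwg_imp_wg[OF w(1) U A(2,3) L(1,2) r(1,2)] hwg_imp_wg[OF w(2) U A(2,3) L(1,3) r(1,3)]]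
  have "ae x. x : A --> G' x = H' x" .
  moreover have "ae x. x : A --> G' x = G x" "ae x. x : A --> H' x = H x" using r by (auto simp: rep_def)
  ultimately show ?thesis by eventually_elim (use A(4) in auto)
 qed
 hence "ae x. ALL n. x : C n --> G x = H x" unfolding AE_all_countable by blast
 thus ?thesis by eventually_elim (use C(4) in auto)
qed

lemma wgrad_hwg: "has_weak_gradient U u G ==> has_weak_gradient U u (wgrad U u)" unfolding wgrad_def by (rule someI[of "has_weak_gradient U u"])

lemma wgrad_AE: "open U ==> has_weak_gradient U u G ==> ae x. x : U --> wgrad U u x = G x" by (rule hwg_unique[OF _ wgrad_hwg])

lemma W1I:
 assumes U: "open U" and r: "rep U u u'" and w: "wg U u' G'" and z: "!!x. x ~: U ==> G' x = 0"
  and p: "0<p" and fin: "Np p u'<oo" "Np p G'<oo"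
 shows "u : W1 p U" "has_weak_gradient U u G'" "rep U (wgrad U u) G'"
proof -
 have U': "U : sets borel" using U by simp
 have rG: "rep U G' G'" using w z by (intro rep_refl) (auto simp: wg_def)
 show h: "has_weak_gradient U u G'" by (rule wg_imp_hwg[OF w U' r rG])
 have "u : Lp p U" "G' : Lp p U" using Lp_rep[OF U' r p] Lp_rep[OF U' rG p] fin by auto
 with h show "u : W1 p U" by (auto simp: W1_def)
 show "rep U (wgrad U u) G'" by (rule rep_cong[OF rG]) (use wgrad_AE[OF U h] in "auto elim: eventually_mono")
qed

lemma finite_measure_Np1:
 fixes f :: "'a::euclidean_space => 'b::euclidean_space"
 assumes "bounded U" and r: "rep U f f'" and p: "1<=p" and "Np p f'<oo"
 shows "Np 1 f'<oo"
proof -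
 obtain R where "U<=cball 0 R" using bounded_subset_ballD[OF \<open>bounded U\<close>, of 0] ball_subset_cball by blast
 hence "Lint f'" using assms by (intro Np_finite_imp_integrable[of f' 0 R p]) (auto simp: rep_def)
 thus ?thesis by (simp add: integrable_iff_Np1)
qed

lemma W1_rep:
 fixes u :: "'a::euclidean_space => real"
 assumes U: "open U" "bounded U" and p: "1<=p" and u: "u : W1 p U"
 obtains u' G' where "rep U u u'" "rep U (wgrad U u) G'" "wg U u' G'" "Np p u'<oo" "Np p G'<oo"
proof -
 have U': "U : sets borel" using U by simp
 have p0: "0<p" using p by simp
 obtain G where G: "has_weak_gradient U u G" "G : Lp p U" and uL: "u : Lp p U" using u by (auto simp: W1_def)
 obtain u' where ru: "rep U u u'" using rep_ex[OF U', of u] uL by (auto simp: Lp_def)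
 obtain G' where rG: "rep U G G'" using rep_ex[OF U', of G] G by (auto simp: Lp_def)
 have fin: "Np p u'<oo" "Np p G'<oo" using Lp_rep[OF U' ru p0] Lp_rep[OF U' rG p0] uL G by auto
 hence fin1: "Np 1 u'<oo" "Np 1 G'<oo" using finite_measure_Np1[OF U(2) ru p] finite_measure_Np1[OF U(2) rG p] by auto
 have "wg U u' G'" by (rule hwg_imp_wg[OF G(1) U' U' order_refl _ _ ru rG]) (use fin1 Lp_rep[OF U' ru, of 1] Lp_rep[OF U' rG, of 1] in auto)
 moreover have "rep U (wgrad U u) G'" by (rule rep_cong[OF rG]) (use wgrad_AE[OF U(1) G(1)] in "auto elim: eventually_mono")
 ultimately show ?thesis using ru fin by (intro that)
qed

lemma W1_norm_rep:
 assumes U: "U : sets borel" and p: "0<p" and r: "rep U u u'" "rep U (wgrad U u) G'"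
 shows "W1_norm p U u = enn2real (Np p u') powr (1/p) + enn2real (Np p G') powr (1/p)" by (simp add: W1_norm_def Lp_norm_rep[OF U r(1) p] Lp_norm_rep[OF U r(2) p])


lemma mollify_exterior_zero:
 assumes "0<ep" "ep<=de" "!!y. y ~: cball a r ==> ph y = 0" "x ~: cball a (r+de)"
 shows "conv (moll ep) ph x = (0::'b::euclidean_space)"
proof (rule conv_zero_outside[OF kernel_moll[OF assms(1)]])
 fix y assume "y : cball x ep"
 moreover have "dist a x<=dist a y + dist x y" by (rule dist_triangle2)
 ultimately show "ph y = 0" using assms by (intro assms(3)) auto
qed

lemma wg_conv_UNIV:
 assumes w: "wg UNIV ph Ph" and e: "0<ep"
 shows "grad (conv (moll ep) ph) = conv (moll ep) Ph" by (intro ext wg_grad_conv[OF w kernel_moll[OF e]]) simp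

lemma enn2real_powr_tendsto_0:
 assumes "0<p" "(%k. a k + b k) ----> (0::real)" "!!k. a k = A k powr (1/p)" "!!k. 0<=A k" "!!k. 0<=b k"
 shows "A ----> 0"
proof -
 have "a ----> 0" by (rule tendsto_sandwich[OF _ _ tendsto_const assms(2)]) (use assms(3,5) in auto)
 hence "(%k. a k powr p) ----> 0 powr p" by (rule tendsto_powr'[OF _ tendsto_const]) (simp add: assms(1,3))
 thus ?thesis using assms(1,3,4) by (simp add: powr_powr)
qed

lemma smooth_Np_bounded:
 fixes f :: "'a::euclidean_space => 'b::euclidean_space"
 assumes c: "continuous_on UNIV f" and b: "bounded U" and [measurable]: "U : sets borel" and p: "1<=p"
 shows "Np p (%x. ind U x *R f x)<oo"
proof -
 obtain R where R: "U<=cball 0 R" using bounded_subset_ballD[OF b, of 0] ball_subset_cball by blast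
 have "compact (f ` cball 0 R)" by (intro compact_continuous_image continuous_on_subset[OF c]) auto
 then obtain B where B: "!!y. y : f ` cball 0 R ==> norm y<=B" by (metis compact_imp_bounded bounded_iff)
 have "Np p (%x. ind U x *R f x)<=(NN x. en (B powr p) * ind (cball (0::'a) R) x)" unfolding Np_def
 proof (rule nn_integral_mono)
  fix x
  show "en (norm (ind U x *R f x) powr p)<=en (B powr p) * ind (cball 0 R) x"
  proof (cases "x : U")
   case True
   hence x: "x : cball 0 R" using R by blast
   hence "norm (f x)<=B" by (intro B imageI)
   thus ?thesis using x True p by (simp add: ennreal_leI powr_mono2)
  qed (use p in simp)
 qed
 also have "...<oo" using emeasure_cball_finite[of "0::'a" R] by (simp add: nn_integral_cmult_indicator ennreal_mult_less_top)
 finally show ?thesis .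
qed

lemma W1_norm_wg:
 assumes U: "open U" and p: "0<p" and r: "rep U u u'" and w: "wg U u' G'" and z: "!!x. x ~: U ==> G' x = 0"
 shows "W1_norm p U u = enn2real (Np p u') powr (1/p) + enn2real (Np p G') powr (1/p)"
proof -
 have U': "U : sets borel" using U by simp
 have rG: "rep U G' G'" using w z by (intro rep_refl) (auto simp: wg_def)
 have h: "has_weak_gradient U u G'" by (rule wg_imp_hwg[OF w U' r rG])
 have "rep U (wgrad U u) G'" by (rule rep_cong[OF rG]) (use wgrad_AE[OF U h] in "auto elim: eventually_mono")
 from W1_norm_rep[OF U' p r this] show ?thesis .
qed

lemma Np_indicator_le: "Np p (%x. ind U x *R f x)<=Np p f" unfolding Np_def by (intro nn_integral_mono) (auto simp: indicator_def)

lemma wg_indicator: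
 assumes w: "wg U u G" and [measurable]: "U : sets borel"
 shows "wg U (%x. ind U x *R u x) (%x. ind U x *R G x)"
proof (rule wg_cong_AE[OF w])
 show "Lint (%x. ind U x *R u x)" "Lint (%x. ind U x *R G x)" by (rule integrable_bounded_scaleR[where B=1]; use w in "auto simp: wg_def indicator_def")+
qed auto

lemma Np_sum_tendsto_0:
 fixes X Y :: "nat => 'a::euclidean_space => 'b::euclidean_space"
 assumes X: "(%k. enn2real (Np p (X k))) ----> 0" "!!k. Np p (X k)<oo" and Y: "!!k. Np p (Y k)<=en (1 / Suc k)"
  and m: "!!k. X k : bm" "!!k. Y k : bm" and p: "1<=p"
 shows "(%k. enn2real (Np p (%x. X k x + Y k x)) powr (1/p)) ----> 0"
proof -
 have p0: "0<p" "0<=p" using p by auto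
 let ?a = "%k. enn2real (Np p (X k)) + 1 / Suc k"
 let ?b = "%k. Np p (%x. X k x + Y k x)"
 have le: "enn2real (?b k)<=2 powr p * ?a k" for k
 proof -
  have "?b k<=en (2 powr p) * (Np p (X k) + Np p (Y k))" by (rule Np_add[OF m p0(2)])
  also have "...<=en (2 powr p) * (en (enn2real (Np p (X k))) + en (1 / Suc k))" using X(2)[of k] by (intro mult_left_mono add_mono Y) auto
  also have "... = en (2 powr p * ?a k)" by (subst ennreal_plus[symmetric]) (auto simp: ennreal_mult')
  finally show ?thesis by (rule enn2real_leI[rotated]) auto
 qed
 have "(%k. 2 powr p * ?a k) ----> 2 powr p * (0+0)" by (intro tendsto_intros X) (use LIMSEQ_inverse_real_of_nat in "simp add: inverse_eq_divide")
 hence "(%k. 2 powr p * ?a k) ----> 0" by simp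
 hence "(%k. enn2real (?b k)) ----> 0" by (rule tendsto_sandwich[OF always_eventually always_eventually tendsto_const, rotated -1]) (use le in auto)
 hence "(%k. enn2real (?b k) powr (1/p)) ----> 0 powr (1/p)" using p0 by (intro tendsto_powr') auto
 thus ?thesis by simp
qed

text \<open>Adding a function supported inside the domain does not change the trace: the mollifications of
  that function vanish on the boundary.\<close>

lemma same_trace_perturb:
 fixes v g :: "'a::euclidean_space => real"
 assumes Om: "open Om" "bounded Om" and p: "1<=p" and tr: "same_trace p Om v g"
  and w: "wg UNIV ph Ph" and fin: "Np p ph<oo" "Np p Ph<oo" and sub: "cball a r<=Om"
  and z: "!!x. x ~: cball a r ==> ph x = 0" "!!x. x ~: cball a r ==> Ph x = 0" and r: "0<r"
 shows "same_trace p Om (%x. v x + ph x) g"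
proof -
 have p0: "0<p" "0<=p" using p by auto
 have Omb[measurable]: "Om : sets borel" using Om(1) by simp
 obtain h th where h: "has_trace p Om g h" and v: "v : W1 p Om" and hm: "h : borel_measurable surface_measure"
  and th: "!!k::nat. smooth (th k)" "(%k. W1_norm p Om (%x. th k x - v x)) ----> 0"
  "(%k. \<integral>\<^sup>+x\<in>frontier Om. en (abs (th k x - h x) powr p) \<partial>surface_measure) ----> 0" using tr unfolding same_trace_def has_trace_def by blast
 obtain v' G' where v': "rep Om v v'" "rep Om (wgrad Om v) G'" "wg Om v' G'" "Np p v'<oo" "Np p G'<oo" by (rule W1_rep[OF Om p v])
 have [measurable]: "v' : bm" "G' : bm" using v' by (auto simp: rep_def)
 note [measurable] = wg_measurable[OF w]
 have int: "Lint ph" "Lint Ph" using w by (auto simp: wg_def)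
 obtain de where de: "0<de" "cball a (r+de)<=Om"
 proof -
  obtain e where e: "0<e" "(\<Union>x\<in>cball a r. cball x e)<=Om" using compact_subset_open_imp_cball_epsilon_subset[OF compact_cball Om(1) sub] by metis
  have "x : Om" if x: "x : cball a (r+e)" for x
  proof (cases "x : cball a r")
   case False
   hence d: "r<dist a x" by simp
   have ax: "a ~= x" using d r by auto
   define y where "y = a+(r / dist a x) *R (x-a)"
   have "dist a y = r" using d r ax by (simp add: y_def dist_norm norm_minus_commute)
   moreover have "x-y = (1-r / dist a x) *R (x-a)" by (simp add: y_def algebra_simps)
   hence "dist y x = abs (1 - r / dist a x) * dist a x" by (simp add: dist_norm norm_minus_commute)
   hence "dist y x = dist a x - r" using d r by (auto simp: abs_of_nonneg divide_le_eq left_diff_distrib)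
   ultimately have "y : cball a r" "x : cball y e" using x by auto
   with e(2) show ?thesis by blast
  qed (use sub in auto)
  with e(1) show ?thesis by (intro that) auto
 qed
 let ?e = "%k. en (1 / Suc k)"
 have "EX e. 0<e & e<de & Np p (%x. conv (moll e) ph x - ph x)<=?e k & Np p (%x. conv (moll e) Ph x - Ph x)<=?e k" for k
 proof -
  have k: "0<1 / real (Suc k)" by simp
  obtain d1 where d1: "0<d1" "!!ep. 0<ep ==> ep<d1 ==> Np p (%x. conv (moll ep) ph x - ph x)<=?e k" using mollify_Lp[OF int(1) fin(1) p k] by metis
  obtain d2 where d2: "0<d2" "!!ep. 0<ep ==> ep<d2 ==> Np p (%x. conv (moll ep) Ph x - Ph x)<=?e k" using mollify_Lp[OF int(2) fin(2) p k] by metis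
  show ?thesis using d1 d2 de by (intro exI[of _ "min (de/2) (min (d1/2) (d2/2))"]) (auto simp: min_def)
 qed
 then obtain e where e: "!!k. 0<e k" "!!k. e k<de" "!!k. Np p (%x. conv (moll (e k)) ph x - ph x)<=?e k"
  "!!k. Np p (%x. conv (moll (e k)) Ph x - Ph x)<=?e k" by metis
 define rh where "rh k = conv (moll (e k)) ph" for k
 have srh: "smooth (rh k)" for k unfolding rh_def by (rule smooth_conv[OF kernel_moll[OF e(1)] int(1)])
 have grh: "grad (rh k) = conv (moll (e k)) Ph" for k unfolding rh_def by (rule wg_conv_UNIV[OF w e(1)])
 have zrh: "rh k x = 0" if "x ~: Om" for k x unfolding rh_def by (rule mollify_exterior_zero[OF e(1) less_imp_le[OF e(2)] z(1)]) (use that de(2) in auto)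
 define I where "I = (%x. ind Om x :: real)"
 define A where "A k x = I x *R (th k x - v' x)" for k x
 define A' where "A' k x = I x *R (grad (th k) x - G' x)" for k x
 define B where "B k x = I x *R (rh k x - ph x)" for k x
 define B' where "B' k x = I x *R (grad (rh k) x - Ph x)" for k x
 have [measurable]: "th k : bm" "grad (th k) : bm"
  "rh k : bm" "grad (rh k) : bm" "I : bm" for k using th(1) srh by (auto intro: smooth_measurable smooth_grad_measurable simp: I_def)
 have meas[measurable]: "A k : bm" "A' k : bm" "B k : bm" "B' k : bm" for k unfolding A_def A'_def B_def B'_def by measurable
 have smooth_wg: "wg Om (%x. I x *R f x) (%x. I x *R grad f x)" if f: "smooth f" for f :: "'a => real"
 proof -
  have [measurable]: "f : bm" "grad f : bm" using f by (auto intro: smooth_measurable smooth_grad_measurable)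
  have "Np 1 (%x. I x *R f x)<oo" "Np 1 (%x. I x *R grad f x)<oo" unfolding I_def by (intro smooth_Np_bounded Om smooth_continuous[OF f] smooth_continuous_grad[OF f] Omb order_refl)+
  hence i: "Lint (%x. I x *R f x)" "Lint (%x. I x *R grad f x)" by (auto simp: integrable_iff_Np1)
  have "(LL x. (I x *R f x) *R grad ph x) = - (LL x. ph x *R (I x *R grad f x))"
   if ph: "test_function Om ph" for ph
  proof -
   obtain K R where K: "compact K" "K<=Om" "ALL x. x ~: K --> ph x = 0" "smooth ph" "kernel R ph" "0<R" using test_functionD[OF ph] by (elim exE conjE)
   have gz: "grad ph x = 0" if "x ~: K" for x by (rule grad_zero_outside_closed[of K]) (use K that compact_imp_closed in auto)
   have "(%x. (I x *R f x) *R grad ph x) = (%x. f x *R grad ph x)" using gz K(2) by (auto simp: I_def fun_eq_iff indicator_def)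
   moreover have "(%x. ph x *R (I x *R grad f x)) = (%x. ph x *R grad f x)" using K(2,3) by (auto simp: I_def fun_eq_iff indicator_def)
   ultimately show ?thesis using smooth_weak_gradient[OF f ph] by simp
  qed
  with i show ?thesis by (simp add: wg_def)
 qed
 have wv: "wg Om (%x. I x *R v' x) (%x. I x *R G' x)" unfolding I_def by (rule wg_indicator[OF v'(3) Omb])
 have wph: "wg Om (%x. I x *R ph x) (%x. I x *R Ph x)" unfolding I_def by (rule wg_indicator[OF wg_mono[OF w] Omb]) simp
 have wA: "wg Om (A k) (A' k)" for k unfolding A_def[abs_def] A'_def[abs_def] scaleR_diff_right by (intro wg_diff smooth_wg th wv)
 have wB: "wg Om (B k) (B' k)" for k unfolding B_def[abs_def] B'_def[abs_def] scaleR_diff_right by (intro wg_diff smooth_wg srh wph)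
 have repA: "rep Om (%x. th k x - v x) (A k)" for k using v'(1) by (auto simp: rep_def A_def I_def elim!: eventually_mono)
 let ?a = "%k. %x. (th k x + rh k x) - (v x + ph x)"
 have repAB: "rep Om (?a k) (%x. A k x + B k x)" for k using v'(1) by (auto simp: rep_def A_def B_def I_def elim!: eventually_mono)
 have finA: "Np p (A k)<oo" "Np p (A' k)<oo" for k
 proof -
  have "Np p (%x. I x *R th k x - I x *R v' x)<=en (2 powr p) * (Np p (%x. I x *R th k x) + Np p (%x. I x *R v' x))" by (rule Np_diff) (use p in auto)
  also have "...<oo" using smooth_Np_bounded[OF smooth_continuous[OF th(1)] Om(2) Omb p, of k] le_less_trans[OF Np_indicator_le[of p Om v'] v'(4)] by (simp add: I_def ennreal_mult_less_top)
  finally show "Np p (A k)<oo" by (simp add: A_def[abs_def] scaleR_diff_right del: real_scaleR_def)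
  have "Np p (%x. I x *R grad (th k) x - I x *R G' x)<=en (2 powr p) * (Np p (%x. I x *R grad (th k) x) + Np p (%x. I x *R G' x))" by (rule Np_diff) (use p in auto)
  also have "...<oo" using smooth_Np_bounded[OF smooth_continuous_grad[OF th(1)] Om(2) Omb p, of k] le_less_trans[OF Np_indicator_le[of p Om G'] v'(5)] by (simp add: I_def ennreal_mult_less_top)
  finally show "Np p (A' k)<oo" by (simp add: A'_def[abs_def] scaleR_diff_right)
 qed
 have leB: "Np p (B k)<=?e k" "Np p (B' k)<=?e k" for k using order_trans[OF Np_indicator_le[of p Om "%x. rh k x - ph x"] e(3)[of k, folded rh_def]]
  order_trans[OF Np_indicator_le[of p Om "%x. grad (rh k) x - Ph x"] e(4)[of k, folded grh]] by (simp_all add: B_def[abs_def] B'_def[abs_def] I_def)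
 have nA: "W1_norm p Om (%x. th k x - v x) = enn2real (Np p (A k)) powr (1/p) + enn2real (Np p (A' k)) powr (1/p)" for k by (rule W1_norm_wg[OF Om(1) p0(1) repA wA]) (simp add: A'_def I_def)
 have nAB: "W1_norm p Om (?a k)
  = enn2real (Np p (%x. A k x + B k x)) powr (1/p) + enn2real (Np p (%x. A' k x + B' k x)) powr (1/p)" for k by (rule W1_norm_wg[OF Om(1) p0(1) repAB wg_add[OF wA wB]]) (simp add: A'_def B'_def I_def)
 have limA: "(%k. enn2real (Np p (A k))) ----> 0" "(%k. enn2real (Np p (A' k))) ----> 0" using th(2) unfolding nA by (rule enn2real_powr_tendsto_0[OF p0(1)], simp_all)
  (rule enn2real_powr_tendsto_0[OF p0(1), of "%k. enn2real (Np p (A' k)) powr (1/p)" "%k. enn2real (Np p (A k)) powr (1/p)"],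
  use th(2) in "simp_all add: nA add.commute")
 have "(%k. W1_norm p Om (?a k)) ----> 0 + 0" unfolding nAB by (intro tendsto_add Np_sum_tendsto_0 limA finA leB meas p)
 hence lim: "(%k. W1_norm p Om (?a k)) ----> 0" by simp
 have front: "x ~: Om" if "x : frontier Om" for x using that Om(1) by (simp add: frontier_def interior_open)
 let ?d = "%k x. en (abs (th k x + rh k x - h x) powr p)"
 have "(\<integral>\<^sup>+x\<in>frontier Om. ?d k x \<partial>surface_measure)
  = (\<integral>\<^sup>+x\<in>frontier Om. en (abs (th k x - h x) powr p) \<partial>surface_measure)" for k by (rule nn_integral_cong) (auto simp: indicator_def zrh[OF front])
 hence limf: "(%k. \<integral>\<^sup>+x\<in>frontier Om. ?d k x \<partial>surface_measure) ----> 0" using th(3) by simp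
 let ?c = "%x. v x + ph x"
 have "?c : W1 p Om"
 proof (rule W1I(1)[OF Om(1)])
  let ?b = "%x. v' x + ph x"
  show "rep Om ?c ?b"
  proof -
   have "ph x = 0" if "x ~: Om" for x using z(1)[of x] sub that by blast
   thus ?thesis using v'(1) by (auto simp: rep_def elim!: eventually_mono)
  qed
  show "wg Om ?b (%x. G' x + Ph x)" by (intro wg_add v'(3) wg_mono[OF w]) simp
  show "G' x + Ph x = 0" if "x ~: Om" for x
  proof -
   have "Ph x = 0" using z(2)[of x] sub that by blast
   thus ?thesis using v'(2) that by (auto simp: rep_def)
  qed
  show "Np p ?b<oo" by (rule le_less_trans[OF Np_add]) (use p v' fin in "auto simp: ennreal_mult_less_top")
  show "Np p (%x. G' x + Ph x)<oo" by (rule le_less_trans[OF Np_add]) (use p v' fin in "auto simp: ennreal_mult_less_top")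
 qed (use p in simp)
 hence "has_trace p Om ?c h" unfolding has_trace_def using hm lim limf smooth_add[OF th(1) srh] by (intro conjI exI[of _ "%k x. th k x + rh k x"]) auto
 with h show ?thesis unfolding same_trace_def by blast
qed

section \<open>The integrand\<close>

definition Dp :: "real => real => 'a::euclidean_space => 'a => real"
 where "Dp mu p a b = (mu\<^sup>2 + (norm a)^2 + (norm b)^2) powr ((p-2)/2) * (norm (a-b))^2"

lemma square_powr: "0<x ==> (x^2) powr (e/2) = x powr (e::real)" by (simp add: powr_powr flip: powr_numeral)

lemma powr_times_square: "0<x ==> x powr (p-2) * x^2 = x powr (p::real)" by (simp flip: powr_numeral powr_add)

lemma Dp_nonneg: "0<=Dp mu p a b" by (simp add: Dp_def)

lemma powr_sandwich:
 fixes x y e :: real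
 assumes "0<=x" "x<=y" "y<=4*x"
 shows "y powr e<=4 powr abs e * x powr e" "x powr e<=4 powr abs e * y powr e"
proof -
 let ?b = "4 powr abs e"
 let ?c = "?b * x powr e"
 let ?d = "?b * y powr e"
 have "y powr e<=?c & x powr e<=?d"
 proof (cases "x = 0")
  case False
  hence x: "0<x" "0<y" using assms by auto
  have one: "1<=?b" by (intro ge_one_powr_ge_zero) auto
  show ?thesis
  proof (cases "0<=e")
   case True
   have "x powr e<=y powr e" using assms True by (intro powr_mono2) auto
   also have "...<=?d" using mult_right_mono[OF one, of "y powr e"] by simp
   finally have 1: "x powr e<=?d" .
   have "y powr e<=(4*x) powr e" using assms True x by (intro powr_mono2) auto
   thus ?thesis using 1 True x by (simp add: powr_mult)
  next
   case e: False
   have "y powr e<=x powr e" using assms e x by (intro powr_mono2') auto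
   also have "...<=?c" using mult_right_mono[OF one, of "x powr e"] by simp
   finally have 1: "y powr e<=?c" .
   let ?a = "4 powr e * x powr e"
   have "(4*x) powr e<=y powr e" using assms e x by (intro powr_mono2') auto
   hence "?a<=y powr e" using x by (simp add: powr_mult)
   hence "4 powr (-e) * ?a<=4 powr (-e) * y powr e" by (intro mult_left_mono) auto
   moreover have "4 powr (-e) * ?a = x powr e" by (simp flip: mult.assoc powr_add)
   ultimately show ?thesis using 1 e by simp
  qed
 qed (use assms in simp)
 thus "y powr e<=?c" "x powr e<=?d" by auto
qed

lemma Dp_controls_power:
 fixes p ep :: real
 assumes p: "1<p" and ep: "0<ep" "ep<=1"
 obtains C where "0<C" "!!mu (a::'a::euclidean_space) b. 0<=mu ==> mu<=1 ==>
  norm (a-b) powr p<=ep*(1 + norm a powr p + norm b powr p)+C * Dp mu p a b"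
proof -
 define c where "c = 2 powr p * 2 powr p"
 have c: "0<c" by (simp add: c_def)
 define de where "de = (ep/c) powr (1/p)"
 have de: "0<de" "de powr p = ep/c" using ep c p by (auto simp: de_def powr_powr)
 define C where "C = de powr (p-2) + 2 powr (p-2)"
 let ?a = "%a b. 1 + norm a powr p + norm b powr p"
 have "norm (a-b) powr p<=ep*?a a b+C * Dp mu p a b"
  if mu: "0<=mu" "mu<=1" for mu and a b :: 'a
 proof (cases "a = b")
  case True
  thus ?thesis using ep p by (simp add: Dp_def)
 next
  case False
  define S where "S = sqrt (mu\<^sup>2 + (norm a)^2 + (norm b)^2)"
  have S2: "S^2 = mu\<^sup>2 + (norm a)^2 + (norm b)^2" by (simp add: S_def)
  have S0: "0<S"
  proof -
   have "0<(norm a)^2 + (norm b)^2"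
   proof (cases "b = 0")
    case True
    thus ?thesis using \<open>a ~= b\<close> by simp
   next
    case False
    thus ?thesis by (intro add_nonneg_pos) auto
   qed
   hence "0<mu\<^sup>2 + ((norm a)^2 + (norm b)^2)" by (rule add_nonneg_pos[rotated]) simp
   thus ?thesis by (simp add: S_def add.assoc)
  qed
  let ?b = "S powr (p-2)"
  have D: "Dp mu p a b = ?b * (norm (a-b))^2" unfolding Dp_def S2[symmetric] square_powr[OF S0] ..
  have n0: "0<norm (a-b)" using False by simp
  have np: "norm (a-b) powr p = norm (a-b) powr (p-2) * (norm (a-b))^2" unfolding powr_times_square[OF n0] ..
  have SS: "S<=1 + norm a + norm b"
  proof -
   have "S^2<=(1 + norm a + norm b)^2"
   proof -
    have "0<=2 * norm a + (2+2 * norm a) * norm b" by (intro add_nonneg_nonneg mult_nonneg_nonneg) auto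
    moreover have "(1 + norm a + norm b)^2 = 1+(norm a)^2 + (norm b)^2 + (2 * norm a + (2+2 * norm a) * norm b)" by (simp add: power2_eq_square algebra_simps)
    moreover have "mu\<^sup>2<=1" using power_mono[OF mu(2,1), of 2] by simp
    ultimately show ?thesis unfolding S2 by linarith
   qed
   thus ?thesis by (rule power2_le_imp_le) auto
  qed
  have Sp: "S powr p<=c*?a a b"
  proof -
   have "S powr p<=(1 + norm a + norm b) powr p" using SS S0 p by (intro powr_mono2) auto
   also have "...<=2 powr p * ((1 + norm a) powr p + norm b powr p)" by (intro powr_add_le) (use p in auto)
   also have "...<=2 powr p * (2 powr p * (1 powr p + norm a powr p) + 2 powr p * norm b powr p)" using p ge_one_powr_ge_zero[of 2 p] mult_right_mono[of 1 "2 powr p" "norm b powr p"]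
    by (intro mult_left_mono add_mono powr_add_le) auto
   finally show ?thesis by (simp add: c_def algebra_simps)
  qed
  show ?thesis
  proof (cases "norm (a-b)<=de*S")
   case True
   have "norm (a-b) powr p<=(de*S) powr p" using True p by (intro powr_mono2) auto
   also have "... = ep/c * S powr p" using de S0 by (simp add: powr_mult)
   also have "...<=ep/c*(c*?a a b)" using ep c by (intro mult_left_mono Sp) auto
   also have "... = ep*?a a b" using c by simp
   finally show ?thesis using Dp_nonneg[of mu p a b] de by (simp add: C_def add_increasing2)
  next
   case far: False
   have "norm (a-b) powr (p-2)<=C * ?b"
   proof (cases "p<=2")
    case True
    have "norm (a-b) powr (p-2)<=(de*S) powr (p-2)" using far True de S0 by (intro powr_mono2') auto
    also have "... = de powr (p-2) * ?b" using de S0 by (simp add: powr_mult)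
    also have "...<=C * ?b" unfolding C_def by (intro mult_right_mono) auto
    finally show ?thesis .
   next
    case False
    have "norm (a-b)<=norm a + norm b" by (rule norm_triangle_ineq4)
    also have "...<=2*S"
    proof -
     have "norm a<=S" "norm b<=S" by (auto simp: S_def intro!: real_le_rsqrt)
     thus ?thesis by simp
    qed
    finally have "norm (a-b) powr (p-2)<=(2*S) powr (p-2)" using False by (intro powr_mono2) auto
    also have "... = 2 powr (p-2) * ?b" using S0 by (simp add: powr_mult)
    also have "...<=C * ?b" unfolding C_def by (intro mult_right_mono) auto
    finally show ?thesis .
   qed
   hence "norm (a-b) powr p<=C * ?b * (norm (a-b))^2" unfolding np by (intro mult_right_mono) auto
   thus ?thesis using ep D by (simp add: mult.assoc add_increasing)
  qed
 qed
 moreover have "0<C" using de by (simp add: C_def add_pos_pos)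
 ultimately show ?thesis by (rule that[rotated])
qed

lemma V_difference:
 fixes p mu :: real and a b :: "'a::euclidean_space"
 assumes p: "1<p" and mu: "0<=mu"
 shows "(norm (V mu p a - V mu p b))^2<=(1 + max 1 ((p-2)/2))^2 * 4 powr abs ((p-2) / 2) * Dp mu p a b"
proof -
 define e where "e = (p-2)/2"
 define K where "K = max 1 e"
 have e1: "0<e+1" using p by (simp add: e_def field_simps)
 let ?b = "%a b. norm (V mu p a - V mu p b)"
 have main: "(?b a b)^2<=(1+K)^2 * 4 powr abs e * Dp mu p a b" if ab: "norm b<=norm a" for a b :: 'a
 proof (cases "a = 0")
  case True
  thus ?thesis using ab by (simp add: Dp_def)
 next
  case False
  let ?e = "mu\<^sup>2"
  define s where "s z = sqrt (?e + (norm z)^2)" for z :: 'a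
  have s2: "(s z)^2 = ?e + (norm z)^2" for z by (simp add: s_def)
  have sn: "norm z<=s z" "0<=s z" for z by (auto simp: s_def intro!: real_le_rsqrt)
  have sa: "0<s a" using sn(1)[of a] False by (metis less_le_trans zero_less_norm_iff)
  have Vs: "V mu p z = s z powr e *R z" for z
  proof (cases "z = 0")
   case False
   hence "0<s z" using sn(1)[of z] by (metis less_le_trans zero_less_norm_iff)
   hence "(s z)\<^sup>2 powr ((p-2)/4) = s z powr e" using square_powr[of "s z" e] by (simp add: e_def)
   thus ?thesis by (simp add: V_def s2)
  qed (simp add: V_def)
  have sba: "s b<=s a" using ab by (simp add: s_def power_mono)
  have lip: "s a - s b<=norm (a-b)"
  proof -
   have "s a = norm (mu, norm a)" "s b = norm (mu, norm b)" by (simp_all add: s_def norm_Pair)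
   hence "s a - s b<=norm ((mu, norm a)-(mu, norm b))" by (simp add: norm_triangle_ineq2 del: diff_Pair)
   also have "... = norm a - norm b" using ab by (simp add: norm_Pair)
   also have "...<=norm (a-b)" by (rule norm_triangle_ineq2)
   finally show ?thesis .
  qed
  let ?d = "%a b. s a powr e - s b powr e"
  have key: "abs (?d a b) * s b<=K*(s a powr e * (s a - s b))"
  proof (cases "s b = 0")
   case True
   thus ?thesis using sa by (simp add: K_def)
  next
   case False
   hence sb: "0<s b" using sn(2)[of b] by linarith
   define r where "r = s b / s a"
   have r: "0<r" "r<=1" "s b = r * s a" using sa sb sba by (auto simp: r_def)
   let ?a = "abs (1 - r powr e) * r"
   let ?c = "%a. s a powr e * s a * (K*(1-r))"
   have "?a<=K*(1-r)"
   proof -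
    consider "e<0" | "0<=e" "e<=1" | "1<e" by linarith
    thus ?thesis
    proof cases
     case 1
     have "1<=r powr e" using powr_mono2'[of e r 1] r 1 by simp
     hence "?a = r powr (e+1) - r" using r by (simp add: powr_add left_diff_distrib)
     also have "...<=1-r" using r e1 powr_mono2[of "e+1" r 1] by simp
     also have "...<=K*(1-r)" using r mult_right_mono[of 1 K "1-r"] by (simp add: K_def)
     finally show ?thesis .
    next
     case 2
     have "r powr 1<=r powr e" using r 2 by (intro powr_mono') auto
     moreover have "r powr e<=1" using r 2 powr_mono2[of e r 1] by simp
     ultimately have "?a<=(1-r)*1" using r by (intro mult_mono) auto
     also have "...<=K*(1-r)" using r mult_right_mono[of 1 K "1-r"] by (simp add: K_def)
     finally show ?thesis .
    next
     case 3
     have "1+e*(r-1)<=r powr e" using powr_ge_tangent[of 1 r e] r 3 by simp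
     moreover have "r powr e<=1" using r 3 powr_mono2[of e r 1] by simp
     ultimately have "?a<=(e*(1-r))*1" using r 3 by (intro mult_mono) (auto simp: algebra_simps)
     thus ?thesis using 3 by (simp add: K_def)
    qed
   qed
   hence "s a powr e * s a * ?a<=?c a" using sa by (intro mult_left_mono) auto
   moreover have "abs (?d a b) = s a powr e * abs (1 - r powr e)"
   proof -
    have "s b powr e = r powr e * s a powr e" using r sa by (simp add: powr_mult)
    hence "?d a b = s a powr e * (1 - r powr e)" by (simp add: algebra_simps)
    thus ?thesis by (simp add: abs_mult)
   qed
   ultimately have "abs (?d a b) * (s a * r)<=?c a" by (simp only: mult_ac)
   moreover have "?c a = K*(s a powr e * (s a - r * s a))" by (simp add: algebra_simps)
   ultimately show ?thesis unfolding r(3) by (simp only: mult.commute)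
  qed
  let ?f = "%a b. s a powr e * norm (a-b)"
  have "V mu p a - V mu p b = s a powr e *R (a-b)+(?d a b) *R b" by (simp add: Vs algebra_simps)
  hence "?b a b<=?f a b + abs (?d a b) * norm b" by (metis norm_triangle_ineq norm_scaleR abs_of_nonneg powr_ge_zero)
  also have "abs (?d a b) * norm b<=abs (?d a b) * s b" by (intro mult_left_mono sn) auto
  also note key
  also have "K*(s a powr e * (s a - s b))<=K*(?f a b)" using lip by (intro mult_left_mono) (auto simp: K_def)
  finally have "?b a b<=(1+K)*(?f a b)" by (simp add: algebra_simps)
  hence "(?b a b)^2<=((1+K)*(?f a b))^2" by (intro power_mono) auto
  also have "... = (1+K)^2 * ((s a)\<^sup>2 powr e * (norm (a-b))^2)" using sa by (simp add: power_mult_distrib powr_powr powr_power mult.commute flip: powr_numeral)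
  also have "...<=(1+K)^2 * ((4 powr abs e * (?e + (norm a)^2 + (norm b)^2) powr e)*(norm (a-b))^2)"
  proof (intro mult_left_mono mult_right_mono powr_sandwich(2))
   have "(norm b)^2<=(norm a)^2" using ab by (intro power_mono) auto
   moreover have "0<=?e" "0<=(norm a)^2" by auto
   moreover have "4*(s a)^2 = 4*?e + 4*(norm a)^2" by (simp add: s2)
   ultimately show "?e + (norm a)^2 + (norm b)^2<=4*(s a)^2" by linarith
  qed (auto simp: s2)
  finally show ?thesis by (simp add: Dp_def e_def mult.assoc)
 qed
 have sym: "Dp mu p b a = Dp mu p a b" by (simp add: Dp_def norm_minus_commute add.commute add.left_commute)
 show ?thesis using main[of b a] main[of a b] sym by (cases "norm b<=norm a") (auto simp: K_def e_def norm_minus_commute)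
qed

lemma V_norm_sq: "(norm (V mu p z))^2 = (mu\<^sup>2 + (norm z)^2) powr ((p-2)/2) * (norm z)^2"
proof -
 have "((mu\<^sup>2 + (norm z)^2) powr ((p-2)/4))^2 = (mu\<^sup>2 + (norm z)^2) powr ((p-2)/2)" by (simp add: power2_eq_square flip: powr_add)
 thus ?thesis by (simp add: V_def power_mult_distrib)
qed

lemma power_le_V:
 fixes z :: "'a::euclidean_space"
 assumes p: "1<p" and mu: "0<=mu" "mu<=1"
 shows "norm z powr p<=2 powr p * (1+(norm (V mu p z))^2)"
proof (cases "norm z<=1")
 case True
 have "norm z powr p<=1" using True p powr_mono2[of p "norm z" 1] by simp
 also have "...<=2 powr p * 1" using p ge_one_powr_ge_zero[of 2 p] by simp
 also have "...<=2 powr p * (1+(norm (V mu p z))^2)" by (intro mult_left_mono) auto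
 finally show ?thesis .
next
 case False
 hence z: "1<norm z" by simp
 let ?a = "(p-2)/2"
 let ?c = "(norm z)^2"
 let ?f = "?c powr ?a"
 have zp: "norm z powr p = ?f * (norm z)^2"
 proof -
  have "0<norm z" using z by linarith
  thus ?thesis by (simp only: square_powr powr_times_square)
 qed
 let ?b = "mu\<^sup>2 + (norm z)^2"
 let ?g = "?b powr ?a"
 have "mu\<^sup>2<=1" using mu by (simp add: power_le_one)
 moreover have "1<=(norm z)^2" using z by (simp add: one_le_power less_imp_le)
 ultimately have "?f<=2 powr p * ?g"
 proof (cases "2<=p")
  case True
  have "?f<=?g" using True by (intro powr_mono2) auto
  also have "...<=2 powr p * ..." using p ge_one_powr_ge_zero[of 2 p] mult_right_mono[of 1 "2 powr p" "(mu\<^sup>2 + (norm z)^2) powr ((p-2)/2)"] by simp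
  finally show ?thesis .
 next
  case False
  let ?d = "(2*(norm z)^2) powr ?a"
  let ?e = "2 powr (p+(p-2)/2) * ?f"
  have "?d<=?g"
  proof (rule powr_mono2')
   show "0<?b" using \<open>1 <= (norm z)^2\<close> zero_le_power2[of mu] by linarith
  qed (use False \<open>mu\<^sup>2 <= 1\<close> \<open>1 <= (norm z)^2\<close> in auto)
  hence "2 powr p * ?d<=2 powr p * ?g" by (intro mult_left_mono) auto
  moreover have "2 powr p * ?d = ?e" by (simp add: powr_mult powr_add)
  moreover have "1 * ?f<=?e" using p by (intro mult_right_mono ge_one_powr_ge_zero) (auto simp: field_simps)
  ultimately show ?thesis by linarith
 qed
 hence "norm z powr p<=2 powr p * ?g * (norm z)^2" unfolding zp by (intro mult_right_mono) auto
 also have "...<=2 powr p * (1+(norm (V mu p z))^2)" unfolding V_norm_sq by (simp add: mult.assoc)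
 finally show ?thesis .
qed

lemma V_le_power:
 fixes z :: "'a::euclidean_space"
 assumes p: "1<p" and mu: "0<=mu" "mu<=1"
 shows "(norm (V mu p z))^2<=2 powr p * (1 + norm z powr p)"
proof (cases "z = 0")
 case False
 hence z: "0<norm z" by simp
 have one: "1<=2 powr p" using p by (intro ge_one_powr_ge_zero) auto
 let ?a = "1 + norm z powr p"
 let ?b = "(p-2)/2"
 show ?thesis
 proof (cases "p<=2")
  case True
  have "(mu\<^sup>2 + (norm z)^2) powr ?b<=((norm z)^2) powr ?b" using True z by (intro powr_mono2') auto
  hence "(norm (V mu p z))^2<=((norm z)^2) powr ?b * (norm z)^2" unfolding V_norm_sq by (intro mult_right_mono) auto
  also have "... = norm z powr p" using z by (simp only: square_powr powr_times_square)
  also have "...<=1*?a" by simp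
  also have "...<=2 powr p * ?a" by (intro mult_right_mono one) auto
  finally show ?thesis .
 next
  case False
  have m: "mu\<^sup>2<=1" using mu by (simp add: power_le_one)
  have "(norm (V mu p z))^2<=(1+(norm z)^2) powr ?b * (1+(norm z)^2)" unfolding V_norm_sq using False m by (intro mult_mono powr_mono2) auto
  also have "... = (1+(norm z)^2) powr (p/2)" by (simp add: powr_mult_base mult.commute diff_divide_distrib add_nonneg_pos[of 1] add_pos_nonneg)
  also have "...<=2 powr (p/2) * (1 powr (p/2) + ((norm z)^2) powr (p/2))" by (intro powr_add_le) (use p in auto)
  also have "... = 2 powr (p/2) * ?a" using z by (simp add: powr_powr flip: powr_numeral)
  also have "...<=2 powr p * ?a" using p by (intro mult_right_mono powr_mono) auto
  finally show ?thesis .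
 qed
qed (simp add: V_def)


lemma pq_integrandD:
 assumes "pq_integrand Om F nu L mu al p q" "x : Om"
 shows "nu * norm z powr p<=F x z" "F x z<=L * (1+(norm z)^2) powr (q/2)" "Ck 1 (F x)"
  "(grad (F x) a - grad (F x) b) .* (a-b) >= nu * Dp mu p a b"
  "y : Om ==> norm (grad (F x) z - grad (F y) z)<=L * norm (x-y) powr al * (1+(norm z)^2) powr ((q-1)/2)" using assms by (auto simp: pq_integrand_def Dp_def mult.assoc)

lemma Ck1_GDERIV: "Ck 1 f ==> GDERIV f x :> grad f x" by (rule Ck_Suc_GDERIV[of 0]) simp

lemma Ck1_continuous_grad:
 assumes "Ck 1 f" shows "continuous_on A (grad f)"
proof -
 have "continuous_on UNIV (%x. \<Sum>b\<in>Basis. (grad f x .* b) *R b)" using assms by (intro continuous_on_sum continuous_on_scaleR continuous_on_const) auto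
 thus ?thesis by (simp add: euclidean_representation continuous_on_subset[OF _ subset_UNIV])
qed

lemma GDERIV_along_line:
 assumes "!!z. GDERIV f z :> G z"
 shows "((%t. f (a+t *R d)) has_real_derivative G (a+t *R d) .* d) (at t)"
proof -
 have "((%t. f (a+t *R d)) has_derivative (%s. (s *R d) .* G (a+t *R d))) (at t)" by (rule has_derivative_compose[OF _ assms[unfolded gderiv_def]]) (auto intro!: derivative_eq_intros)
 thus ?thesis unfolding has_field_derivative_def by (rule has_derivative_eq_rhs) (auto simp: fun_eq_iff inner_commute)
qed

lemma monotone_gradient_above_tangent:
 assumes G: "!!z. GDERIV f z :> G z" and mono: "!!a b. 0<=(G a - G b) .* (a-b)"
 shows "f a + G a .* (b-a)<=f b"
proof -
 obtain t where t: "0<t" "t<1" "f (a+1 *R (b-a)) - f (a+0 *R (b-a)) = (1-0)*(G (a+t *R (b-a)) .* (b-a))" using MVT2[of 0 1 "%t. f (a+t *R (b-a))" "%t. G (a+t *R (b-a)) .* (b-a)"] GDERIV_along_line[OF G] by auto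
 let ?a = "(G (a+t *R (b-a)) - G a) .* (b-a)"
 have "0<=t*?a" using mono[of "a+t *R (b-a)" a] by simp
 hence "0<=?a" using t by (simp add: zero_le_mult_iff)
 with t(3) show ?thesis by (simp add: inner_diff_left)
qed

lemma integrand_above_tangent:
 assumes F: "pq_integrand Om F nu L mu al p q" and "x : Om" "0<=nu"
 shows "F x a + grad (F x) a .* (b-a)<=F x b"
proof (rule monotone_gradient_above_tangent)
 show "GDERIV (F x) z :> grad (F x) z" for z by (rule Ck1_GDERIV[OF pq_integrandD(3)[OF F \<open>x : Om\<close>]])
 show "0<=(grad (F x) a - grad (F x) b) .* (a-b)" for a b using pq_integrandD(4)[OF F \<open>x : Om\<close>, of a b] Dp_nonneg[of mu p a b] \<open>0 <= nu\<close> by (meson mult_nonneg_nonneg order_trans)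
qed

lemma integrand_nonneg:
 assumes F: "pq_integrand Om F nu L mu al p q" and "x : Om" "0<=nu"
 shows "0<=F x z" using pq_integrandD(1)[OF F \<open>x : Om\<close>, of z] \<open>0 <= nu\<close> by (meson mult_nonneg_nonneg order_trans powr_ge_zero)

lemma quadratic_growth_bound:
 assumes q: "0<=q"
 shows "(1+(norm z)^2) powr (q/2)<=(1 + norm z) powr q"
proof -
 have "(1+(norm z)^2) powr (q/2)<=((1 + norm z)^2) powr (q/2)" using q by (intro powr_mono2) (auto simp: power2_sum)
 also have "... = (1 + norm z) powr q" by (rule square_powr) (simp add: add_pos_nonneg)
 finally show ?thesis .
qed

lemma integrand_le:
 assumes F: "pq_integrand Om F nu L mu al p q" and "x : Om" "0<=L" "0<=q"
 shows "F x z<=L * (1 + norm z) powr q" by (rule order_trans[OF pq_integrandD(2)[OF F \<open>x : Om\<close>]])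
  (intro mult_left_mono quadratic_growth_bound assms)

lemma grad_integrand_bound:
 assumes F: "pq_integrand Om F nu L mu al p q" and x: "x : Om" and "0<=nu" "0<=L" "1<=q"
 shows "norm (grad (F x) z)<=2 powr q * L * (1 + norm z) powr (q-1)"
proof (cases "grad (F x) z = 0")
 case False
 define g where "g = grad (F x) z"
 let ?a = "1 + norm z"
 define xi where "xi = (?a / norm g) *R g"
 have g: "0<norm g" using False by (simp add: g_def)
 have nxi: "norm xi = 1 + norm z" using g by (simp add: xi_def)
 have n0: "0<1 + norm z" by (simp add: add_pos_nonneg)
 have "g .* xi = norm g * ?a" using g by (simp add: xi_def power2_norm_eq_inner[symmetric] power2_eq_square)
 hence "norm g * ?a<=F x z + g .* ((z+xi)-z)" using integrand_nonneg[OF F x \<open>0 <= nu\<close>, of z] by simp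
 also have "...<=F x (z+xi)" unfolding g_def by (rule integrand_above_tangent[OF F x \<open>0 <= nu\<close>])
 also have "...<=L * (1 + norm (z+xi)) powr q" by (rule integrand_le[OF F x]) (use assms in auto)
 also have "...<=L * (2*?a) powr q" using norm_triangle_ineq[of z xi] nxi assms by (intro mult_left_mono powr_mono2) auto
 also have "... = (2 powr q * L * ?a powr (q-1))*?a"
 proof -
  have "(2*?a) powr q = 2 powr q * ?a powr q" by (rule powr_mult)
  moreover have "?a powr q = ?a powr (q-1) * ?a" using n0 by (simp add: powr_diff)
  ultimately show ?thesis by (simp only: mult_ac)
 qed
 finally show ?thesis using n0 by (simp add: g_def)
qed (use assms in simp)

lemma parallelogram_midpoint:
 fixes m d :: "'a::euclidean_space"
 shows "(norm (m+t *R d))^2 + (norm (m-t *R d))^2 = 2*(norm m)^2 + 2*t^2 * (norm d)^2" unfolding power2_norm_eq_inner by (simp add: inner_add_left inner_add_right inner_diff_left inner_diff_right inner_commute power2_eq_square)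

lemma integrand_midpoint:
 fixes a b :: "'a::euclidean_space"
 assumes F: "pq_integrand Om F nu L mu al p q" and x: "x : Om" and nu: "0<=nu"
 shows "nu/8 / 4 powr abs ((p-2) / 2) * Dp mu p a b<=F x a + F x b - 2 * F x ((a+b) /\<^sub>R 2)"
proof -
 define m where "m = (a+b) /\<^sub>R 2"
 define d where "d = (b-a) /\<^sub>R 2"
 have ab: "b = m+1 *R d" "a = m-1 *R d" by (simp_all add: m_def d_def algebra_simps flip: scaleR_add_left)
 define E where "E = 4 powr abs ((p-2) / 2)"
 have E: "0<E" by (simp add: E_def)
 define f where "f t = F x (m+t *R d) + F x (m+t *R (- d))" for t
 define f' where "f' t = (grad (F x) (m+t *R d) - grad (F x) (m+t *R (- d))) .* d" for t
 have Fd: "GDERIV (F x) z :> grad (F x) z" for z by (rule Ck1_GDERIV[OF pq_integrandD(3)[OF F x]])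
 have df: "(f has_real_derivative f' t) (at t)" for t unfolding f_def by (rule DERIV_cong[OF DERIV_add[OF GDERIV_along_line[OF Fd] GDERIV_along_line[OF Fd]]])
  (simp add: f'_def inner_diff_left)
 let ?b = "(p-2)/2"
 let ?c = "mu\<^sup>2"
 have f'ge: "nu * (?c + 2*(norm m)^2 + 2*t^2 * (norm d)^2) powr ?b * (2*t*(norm d)^2)<=f' t" if t: "0<t" for t
 proof -
  have "nu * Dp mu p (m+t *R d) (m+t *R (- d))<=(2*t) * f' t" using pq_integrandD(4)[OF F x, of "m+t *R d" "m+t *R (- d)"] by (simp add: f'_def scaleR_2[symmetric] algebra_simps flip: scaleR_add_left)
  moreover have "norm (m+t *R d-(m+t *R (- d))) = 2*t * norm d"
  proof -
   have "m+t *R d-(m+t *R (- d)) = (2*t) *R d" by (simp add: algebra_simps flip: scaleR_add_left)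
   thus ?thesis using t by simp
  qed
  moreover have "?c + (norm (m+t *R d))^2 + (norm (m+t *R (- d)))^2 = ?c + 2*(norm m)^2 + 2*t^2 * (norm d)^2" using parallelogram_midpoint[of m t d] by simp
  ultimately have "nu*((?c + 2*(norm m)^2 + 2*t^2 * (norm d)^2) powr ?b * (2*t * norm d)^2)<=(2*t) * f' t" by (simp only: Dp_def)
  also have "nu*((?c + 2*(norm m)^2 + 2*t^2 * (norm d)^2) powr ?b * (2*t * norm d)^2)
   = (2*t)*(nu * (?c + 2*(norm m)^2 + 2*t^2 * (norm d)^2) powr ?b * (2*t*(norm d)^2))" by (simp add: power_mult_distrib power2_eq_square[of t] mult_ac)
  finally show ?thesis using t by (simp add: mult_ac)
 qed
 let ?a = "?c + 2*(norm m)^2 + 2*(norm d)^2"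
 define c where "c = nu*(norm d)^2 * ?a powr ?b / E"
 have f'c: "c<=f' t" if t: "1/2<t" "t<1" for t
 proof -
  have t2: "t^2<=1" "1/4<=t^2" using t power_mono[of t 1 2] power_mono[of "1/2" t 2] by (auto simp: power2_eq_square)
  have "?a powr ?b<=E * (?c + 2*(norm m)^2 + 2*t^2 * (norm d)^2) powr ?b" unfolding E_def
  proof (rule powr_sandwich(1))
   show "?c + 2*(norm m)^2 + 2*t^2 * (norm d)^2<=?a" using mult_right_mono[OF t2(1), of "(norm d)^2"] by simp
   have "(norm d)^2<=4*(t^2 * (norm d)^2)" using mult_right_mono[OF t2(2), of "(norm d)^2"] by simp
   moreover have "0<=?c" "0<=(norm m)^2" by auto
   ultimately show "?a<=4*(?c + 2*(norm m)^2 + 2*t^2 * (norm d)^2)"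
   proof -
    have "?a<=4*?c + 8*(norm m)^2 + 8*(t^2 * (norm d)^2)" by (rule add_mono[OF add_mono]) (use \<open>(norm d)^2 <= 4 * (t^2 * (norm d)^2)\<close> in auto)
    thus ?thesis by (simp add: distrib_left)
   qed
  qed auto
  hence "nu*(norm d)^2 * ?a powr ?b <= nu*(norm d)^2 * (E * (?c + 2*(norm m)^2 + 2*t^2 * (norm d)^2) powr ?b)" using nu by (intro mult_left_mono) auto
  hence "c<=nu*(norm d)^2 * (?c + 2*(norm m)^2 + 2*t^2 * (norm d)^2) powr ?b" unfolding c_def using E by (simp add: divide_le_eq mult_ac)
  also have "...<=nu*(norm d)^2 * (?c + 2*(norm m)^2 + 2*t^2 * (norm d)^2) powr ?b * (2*t)"
   using t nu mult_left_mono[of 1 "2*t" "nu*(norm d)^2 * (mu\<^sup>2 + 2*(norm m)^2 + 2*t^2 * (norm d)^2) powr ((p-2)/2)"] by simp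
  also have "...<=f' t" using f'ge[of t] t by (simp add: mult_ac)
  finally show ?thesis .
 qed
 obtain t1 where t1: "1/2<t1" "t1<1" "f 1 - f (1/2) = (1-1/2) * f' t1" using MVT2[of "1/2" 1 f f'] df by auto
 obtain t0 where t0: "0<t0" "t0<1/2" "f (1/2) - f 0 = (1/2-0) * f' t0" using MVT2[of 0 "1/2" f f'] df by auto
 have "0<=f' t0" by (rule order_trans[OF _ f'ge[OF t0(1)]]) (use nu t0 in simp)
 with t0 t1 f'c[OF t1(1,2)] have "c/2<=f 1 - f 0" by simp
 moreover have "f 1 - f 0 = F x a + F x b - 2 * F x m" by (simp add: f_def ab)
 moreover have "c/2 = nu/8/E * Dp mu p a b"
 proof -
  have "(norm a)^2 + (norm b)^2 = 2*(norm m)^2 + 2*(norm d)^2" using parallelogram_midpoint[of m 1 d] by (simp add: ab)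
  moreover have "norm (a-b) = 2 * norm d"
  proof -
   have "a-b = (- 2) *R d" by (simp add: d_def algebra_simps)
   thus ?thesis by simp
  qed
  ultimately show ?thesis using E by (simp add: c_def Dp_def add.assoc power_mult_distrib field_simps)
 qed
 ultimately show ?thesis by (simp add: E_def m_def)
qed


definition qpow :: "real => 'a::euclidean_space => real"
 where "qpow q z = (1+(norm z)^2) powr (q/2)"

lemma qpow_GDERIV: "GDERIV (qpow q) z :> (q * (1+(norm z)^2) powr (q/2-1)) *R z"
proof -
 have pos: "0<1 + z .* z" by (simp add: add_pos_nonneg)
 let ?a = "%z. (1 + z .* z) powr (q/2)"
 have "(?a has_derivative (%h. (q/2 * (1 + z .* z) powr (q/2-1)) * (z .* h + h .* z))) (at z)" by (rule has_derivative_compose[of "%z. 1 + z .* z" "%h. z .* h + h .* z",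
  OF _ has_real_derivative_powr[OF pos, unfolded has_field_derivative_def]])
  (auto intro!: derivative_eq_intros)
 hence "(?a has_derivative (%h. h .* ((q * (1 + z .* z) powr (q/2-1)) *R z))) (at z)" by (rule has_derivative_eq_rhs) (auto simp: fun_eq_iff inner_commute)
 thus ?thesis by (simp add: gderiv_def qpow_def[abs_def] power2_norm_eq_inner)
qed

lemma grad_qpow: "grad (qpow q) z = (q * (1+(norm z)^2) powr (q/2-1)) *R z" by (rule grad_eq[OF qpow_GDERIV])

lemma Ck1_qpow: "Ck 1 (qpow q)"
proof -
 have c: "continuous_on UNIV (%z::'a::euclidean_space. (q * (1+(norm z)^2) powr (q/2-1)) *R z)" by (intro continuous_intros) (auto simp: add_eq_0_iff_both_eq_0 add_nonneg_eq_0_iff)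
 have "Ck (Suc 0) (qpow q :: 'a => real)" by (rule Ck_SucI[OF qpow_GDERIV]) (use c in "auto intro: continuous_on_inner simp del: inner_scaleR_left")
 thus ?thesis by simp
qed

lemma qpow_monotone:
 fixes a b :: "'a::euclidean_space"
 assumes q: "1<=q"
 shows "0<=(grad (qpow q) a - grad (qpow q) b) .* (a-b)"
proof -
 define f where "f s = (1+s^2) powr (q/2-1)" for s :: real
 have f0: "0<=f s" for s by (simp add: f_def)
 have mono: "f s * s<=f t * t" if st: "0<=s" "s<=t" for s t
 proof -
  let ?b = "(q-1)/2"
  have e: "f r * r = (1+r^2) powr ?b * (r / sqrt (1+r^2))" for r
  proof -
   have p: "0<1+r^2" by (simp add: add_pos_nonneg)
   have "f r = (1+r^2) powr ((q-1)/2-1/2)" by (simp add: f_def diff_divide_distrib)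
   also have "... = (1+r^2) powr ?b / sqrt (1+r^2)" using p by (simp only: powr_diff powr_half_sqrt less_imp_le)
   finally show ?thesis by simp
  qed
  have "s^2<=t^2" using st by (intro power_mono) auto
  hence 1: "(1+s^2) powr ?b<=(1+t^2) powr ?b" using q by (intro powr_mono2) auto
  have "(s * sqrt (1+t^2))^2<=(t * sqrt (1+s^2))^2" using \<open>s^2 <= t^2\<close> by (simp add: power_mult_distrib algebra_simps)
  hence "s * sqrt (1+t^2)<=t * sqrt (1+s^2)" by (rule power2_le_imp_le) (use st in auto)
  hence 2: "s / sqrt (1+s^2)<=t / sqrt (1+t^2)" by (simp add: divide_le_eq le_divide_eq add_pos_nonneg mult.commute real_sqrt_gt_zero field_simps)
  show ?thesis unfolding e by (rule mult_mono[OF 1 2]) (use st in auto)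
 qed
 let ?c = "f (norm a)"
 let ?d = "f (norm b)"
 let ?a = "?c *R a - ?d *R b"
 have "0<=(?c * norm a - ?d * norm b)*(norm a - norm b)" using mono[of "norm b" "norm a"] mono[of "norm a" "norm b"] by (cases "norm b<=norm a") (auto simp: mult_nonneg_nonneg mult_nonpos_nonpos)
 also have "... = ?c * (norm a)^2 + ?d * (norm b)^2 - (?c + ?d)*(norm a * norm b)" by (simp add: algebra_simps power2_eq_square)
 also have "...<=?c * (norm a)^2 + ?d * (norm b)^2 - (?c + ?d)*(a .* b)" using f0 norm_cauchy_schwarz[of a b] by (intro diff_left_mono mult_left_mono add_nonneg_nonneg) auto
 also have "... = ?a .* (a-b)" by (simp add: inner_diff_left inner_diff_right inner_commute power2_norm_eq_inner algebra_simps)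
 finally have "0<=q*(?a .* (a-b))" using q by simp
 also have "... = (grad (qpow q) a - grad (qpow q) b) .* (a-b)" by (simp add: grad_qpow f_def inner_diff_left inner_diff_right algebra_simps)
 finally show ?thesis .
qed

lemma norm_powr_le_qpow: "0<=q ==> norm z powr q<=qpow q z"
proof -
 assume q: "0<=q"
 show ?thesis
 proof (cases "z = 0")
  case False
  have "norm z powr q = ((norm z)^2) powr (q/2)" using False by (simp add: square_powr)
  also have "...<=qpow q z" unfolding qpow_def using q by (intro powr_mono2) auto
  finally show ?thesis .
 qed (simp add: qpow_def)
qed

lemma qpow_nonneg: "0<=qpow q z" by (simp add: qpow_def)

lemma pq_integrand_perturb:
 assumes F: "pq_integrand Om F nu L mu al p q" and e: "0<=ep" "ep<=1" and q: "1<=q" and L: "0<=L"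
 shows "pq_integrand Om (%x z. F x z + ep * qpow q z) nu (L+1) mu al p q"
proof -
 let ?a = "%x z. grad (F x) z + ep *R grad (qpow q) z"
 let ?c = "%z. ep * qpow q z"
 let ?b = "%x. %z. F x z + ?c z"
 have gd: "GDERIV (?b x) z :> grad (F x) z + ep *R grad (qpow q) z" if x: "x : Om" for x z
 proof -
  have "GDERIV (%z. ?c z) z :> ep *R grad (qpow q) z" using GDERIV_mult[OF GDERIV_const[of ep] qpow_GDERIV[of q z]] by (simp add: grad_qpow)
  thus ?thesis by (intro GDERIV_add Ck1_GDERIV[OF pq_integrandD(3)[OF F x]])
 qed
 hence gr: "grad (?b x) z = ?a x z" if "x : Om" for x z using that by (intro grad_eq)
 have c: "continuous_on UNIV (qpow q :: 'a => real)" using Ck_Suc_D[of 0 "qpow q"] Ck1_qpow[of q] by simp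
 have "caratheodory_integrand Om (%x z. F x z + ?c z)" unfolding caratheodory_integrand_def
 proof (intro conjI allI ballI)
  show "(%x. F x z + ?c z) : borel_measurable (lebesgue_on Om)" for z using F by (intro borel_measurable_add borel_measurable_const) (auto simp: caratheodory_integrand_def pq_integrand_def)
  show "continuous_on UNIV (?b x)" if "x : Om" for x using F c that by (intro continuous_on_add continuous_on_mult continuous_on_const)
   (auto simp: caratheodory_integrand_def pq_integrand_def)
 qed
 moreover have "nu * norm z powr p<=F x z + ?c z" "F x z + ?c z<=(L+1) * (1+(norm z)^2) powr (q/2)"
  if x: "x : Om" for x z
 proof -
  have "?c z<=1 * qpow q z" using e by (intro mult_right_mono qpow_nonneg)
  moreover have "0<=?c z" using e by (intro mult_nonneg_nonneg qpow_nonneg)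
  ultimately show "nu * norm z powr p<=F x z + ?c z" "F x z + ?c z<=(L+1) * (1+(norm z)^2) powr (q/2)" using pq_integrandD(1,2)[OF F x, of z] by (auto simp: qpow_def algebra_simps)
 qed
 moreover have "Ck 1 (?b x)" if x: "x : Om" for x by (intro Ck_add Ck_mult Ck_const Ck1_qpow pq_integrandD(3)[OF F x])
 moreover have "nu * Dp mu p a b<=(?a x a-?a x b) .* (a-b)"
  if x: "x : Om" for x a b
 proof -
  have "0<=ep*((grad (qpow q) a - grad (qpow q) b) .* (a-b))" using e qpow_monotone[OF q, of a b] by simp
  thus ?thesis using pq_integrandD(4)[OF F x, of a b] by (simp add: inner_diff_left inner_add_left algebra_simps)
 qed
 moreover have "norm (?a x z-?a y z) <= (L+1) * norm (x-y) powr al * (1+(norm z)^2) powr ((q-1)/2)" if "x : Om" "y : Om" for x y z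
 proof -
  have "L*(norm (x-y) powr al * (1+(norm z)^2) powr ((q-1)/2))<=(L+1)*(norm (x-y) powr al * (1+(norm z)^2) powr ((q-1)/2))" by (intro mult_right_mono) auto
  thus ?thesis using pq_integrandD(5)[OF F that, of z] by (simp add: mult.assoc)
 qed
 ultimately show ?thesis unfolding pq_integrand_def by (simp add: gr Dp_def mult.assoc)
qed

lemma caratheodory_measurable:
 fixes F :: "'a::euclidean_space => 'b::euclidean_space => real"
 assumes F: "!!z. (%x. F x z) : borel_measurable M" "!!x. x : space M ==> continuous_on UNIV (F x)"
  and G: "G : borel_measurable M"
 shows "(%x. F x (G x)) : borel_measurable M"
proof -
 obtain s where s: "!!i. simple_function M (s i)" "!!x. x : space M ==> (%i. s i x) ----> G x" using borel_measurable_implies_sequence_metric[OF G, of 0] by metis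
 show ?thesis
 proof (rule borel_measurable_LIMSEQ_real)
  fix x assume x: "x : space M"
  have "isCont (F x) (G x)" using F(2)[OF x] by (simp add: continuous_on_eq_continuous_at)
  from isCont_tendsto_compose[OF this s(2)[OF x]] show "(%i. F x (s i x)) ----> F x (G x)" .
 next
  fix i
  let ?a = "s i ` space M"
  have fin: "finite ?a" using s(1) by (simp add: simple_function_def)
  have meas[measurable]: "s i -` {z} \<inter> space M : sets M" if "z : ?a" for z using s(1) that by (auto simp: simple_function_def)
  have "(%x. \<Sum>z\<in>?a . ind (s i -` {z} \<inter> space M) x * F x z) : borel_measurable M" by (intro borel_measurable_sum borel_measurable_times borel_measurable_indicator F(1) meas)
  moreover have "(\<Sum>z\<in>?a . ind (s i -` {z} \<inter> space M) x * F x z) = F x (s i x)" if x: "x : space M" for x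
  proof -
   have "(\<Sum>z\<in>?a . ind (s i -` {z} \<inter> space M) x * F x z) = (\<Sum>z\<in>s i ` space M. if z = s i x then F x (s i x) else 0)" using x by (intro sum.cong) (auto simp: indicator_def)
   also have "... = F x (s i x)" using fin x by (simp add: sum.delta)
   finally show ?thesis .
  qed
  ultimately show "(%x. F x (s i x)) : borel_measurable M" by (simp cong: measurable_cong)
 qed
qed

lemma integrand_measurable:
 assumes F: "pq_integrand Om F nu L mu al p q" and U: "U<=Om" "U : sets borel" "Om : sets borel"
  and G: "G : borel_measurable (lebesgue_on U)"
 shows "(%x. F x (G x)) : borel_measurable (lebesgue_on U)"
  "(%x. grad (F x) (G x)) : borel_measurable (lebesgue_on U)"
proof -
 let ?a = "lebesgue_on U"
 let ?b = "borel_measurable ?a"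
 have m: "(%x. F x z) : ?b" for z
 proof -
  have "(%x. F x z) : borel_measurable (lebesgue_on Om)" using F by (auto simp: pq_integrand_def caratheodory_integrand_def)
  thus ?thesis by (rule measurable_restrict_mono[OF _ U(1)])
 qed
 show "(%x. F x (G x)) : ?b" by (rule caratheodory_measurable[OF m _ G]) (use F U in "auto simp: pq_integrand_def caratheodory_integrand_def")
 have "(%x. grad (F x) (G x) .* b) : ?b" if b: "b : Basis" for b
 proof (rule caratheodory_measurable[of "%x z. grad (F x) z .* b", OF _ _ G])
  fix x assume "x : space (lebesgue_on U)"
  hence "x : Om" using U by auto
  thus "continuous_on UNIV (%z. grad (F x) z .* b)" by (intro continuous_intros Ck1_continuous_grad pq_integrandD(3)[OF F])
 next
  fix z
  show "(%x. grad (F x) z .* b) : ?b"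
  proof (rule borel_measurable_LIMSEQ_real)
   fix x assume "x : space (lebesgue_on U)"
   hence x: "x : Om" using U by auto
   have "((%t. F x (z+t *R b)) has_real_derivative grad (F x) (z+0 *R b) .* b) (at 0)" by (rule GDERIV_along_line[OF Ck1_GDERIV[OF pq_integrandD(3)[OF F x]]])
   hence "((%h. (F x (z+h *R b) - F x z) / h) ---> grad (F x) z .* b) (at 0)" by (simp add: DERIV_def)
   thus "(%i. (F x (z+(1 / real (Suc i)) *R b) - F x z) / (1 / real (Suc i))) ----> grad (F x) z .* b" by (rule filterlim_compose)
    (use LIMSEQ_inverse_real_of_nat in "auto simp: filterlim_at inverse_eq_divide")
  next
   show "(%x. (F x (z+(1 / real (Suc i)) *R b) - F x z) / (1 / real (Suc i))) : ?b" for i using m by measurable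
  qed
 qed
 thus "(%x. grad (F x) (G x)) : ?b" by (subst borel_measurable_euclidean_space) auto
qed

section \<open>Differences in fractional Sobolev spaces\<close>

lemma gagliardo_rep:
 fixes f :: "'a::euclidean_space => 'b::euclidean_space"
 assumes Om[measurable]: "Om : sets borel" and r: "rep Om f P"
 shows "gagliardo be t Om f = (NN x. (NN y. ind Om x * (ind Om y *
   en (norm (P x - P y) powr t / norm (x-y) powr (real DIM('a) + be*t)))))"
proof -
 have AE: "ae x. x : Om --> P x = f x" using r by (simp add: rep_def)
 let ?a = "real DIM('a) + be*t"
 have inner: "(NL y:Om. en (norm (z - f y) powr t / norm (x-y) powr ?a))
  = (NN y:Om. norm (z - P y) powr t / norm (x-y) powr ?a)" for x z by (rule nn_integral_rep[OF Om]) (use AE in "auto elim!: eventually_mono")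
 show ?thesis unfolding gagliardo_def inner
 proof (rule nn_integral_rep[OF Om])
  show "ae x. x : Om --> (NN y. ind Om x * (ind Om y * en (norm (P x - P y) powr t / norm (x-y) powr ?a)))
   = (NN y:Om. norm (f x - P y) powr t / norm (x-y) powr ?a)" using AE by eventually_elim auto
 qed simp
qed

lemma gagliardo_difference:
 fixes P :: "'a::euclidean_space => 'b::euclidean_space"
 assumes [measurable]: "P : bm" "Om : sets borel" "S : sets borel" and h: "h ~= 0"
  and sub: "!!x. x : S ==> ball (x+h /\<^sub>R 2) (norm h / 2)<=Om & x : Om & x+h : Om" and q: "0<=q" and al: "0<=al"
 shows "(NN x:S. norm (P (x+h) - P x) powr q)
  <= en (2 * 2 powr q * 2 ^ DIM('a) / unit_ball_vol DIM('a) * norm h powr (al*q)) *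
   (NN x. (NN y. ind Om x * (ind Om y *
   en (norm (P x - P y) powr q / norm (x-y) powr (real DIM('a) + al*q)))))"
proof -
 define n where "n = real DIM('a)"
 let ?b = "n+al*q"
 let ?e = "%x y. norm (P x - P y) powr q / norm (x-y) powr ?b"
 define k where "k x y = ind Om x * (ind Om y * en (?e x y))" for x y
 define Gag where "Gag = (NN x. (NN y. k x y))"
 have [measurable]: "(%(x, y). k x y) : borel_measurable (lborel \<Otimes>\<^sub>M lborel)" unfolding k_def by measurable
 have [measurable]: "k x : bm" for x unfolding k_def by measurable
 have kint[measurable]: "(%x. (NN y. k x y)) : bm" using lborel.borel_measurable_nn_integral[of "k" lborel] by simp
 let ?k = "norm h / 2"
 define v where "v = unit_ball_vol n * ?k ^ DIM('a)"
 have v: "0<v" using h by (simp add: v_def n_def)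
 have vb: "emeasure lborel (ball c ?k) = en v" for c :: 'a by (simp add: emeasure_ball v_def n_def)
 let ?i = "norm h powr ?b"
 define c where "c = 2 powr q * ?i"
 have c0: "0<=c" by (simp add: c_def)
 have step: "norm (P w - P y) powr q<=?i * ?e w y"
  if "norm (w-y)<=norm h" for w y
 proof (cases "w = y")
  case False
  hence "0<norm (w-y) powr ?b" by simp
  moreover have "norm (w-y) powr ?b<=?i" using that q al by (intro powr_mono2) (auto simp: n_def)
  ultimately show ?thesis using mult_right_mono[of "norm (w-y) powr (n+al*q)" "norm h powr (n+al*q)" "norm (P w - P y) powr q"] by (simp add: le_divide_eq mult.commute)
 qed simp
 let ?a = "%x. norm (P (x+h) - P x) powr q"
 have pt: "en v * en (?a x)<=en c * (NN y. k (x+h) y + k x y)" if x: "x : S" for x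
 proof -
  let ?j = "h /\<^sub>R 2"
  let ?B = "ball (x+?j) ?k"
  have [measurable]: "?B : sets borel" by simp
  have "en v * en (?a x) = (NN y. en (?a x) * ind ?B y)" by (simp add: nn_integral_cmult_indicator vb mult.commute)
  also have "...<=(NN y. en c * (k (x+h) y + k x y))"
  proof (rule nn_integral_mono)
   fix y
   show "en (?a x) * ind ?B y<=en c * (k (x+h) y + k x y)"
   proof (cases "y : ?B")
    case True
    hence d: "norm (x+?j - y)<?k" by (simp add: dist_norm)
    have h2: "norm ?j = ?k" by simp
    let ?h = "%x. norm (x+?j - y) + norm ?j"
    have "norm (x+h-y)<=?h x" using norm_triangle_ineq[of "x+h /\<^sub>R 2 - y" "h /\<^sub>R 2"] by (simp add: algebra_simps flip: scaleR_add_left)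
    hence 1: "norm (x+h-y)<=norm h" using d h2 by linarith
    have "norm (x-y)<=?h x" using norm_triangle_ineq4[of "x+h /\<^sub>R 2 - y" "h /\<^sub>R 2"] by (simp add: algebra_simps)
    hence 2: "norm (x-y)<=norm h" using d h2 by linarith
    let ?l = "%x. norm (P (x+h) - P y) powr q / norm (x+h-y) powr ?b"
    let ?c = "%x. ?l x + norm (P x - P y) powr q / norm (x-y) powr ?b"
    have "?a x = norm ((P (x+h) - P y)-(P x - P y)) powr q" by simp
    also have "...<=2 powr q * (norm (P (x+h) - P y) powr q + norm (P x - P y) powr q)" by (rule norm_diff_powr_le[OF q])
    also have "...<=2 powr q * (?i * (?l x) + ?i * ?e x y)" by (intro mult_left_mono add_mono step 1 2) auto
    also have "... = c*?c x" by (simp add: c_def algebra_simps)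
    finally have "en (?a x)<=en (c*?c x)" by (rule ennreal_leI)
    also have "... = en c * (k (x+h) y + k x y)" using sub[OF x] True c0 by (auto simp: k_def ennreal_mult' subset_eq)
    finally show ?thesis using True by simp
   qed simp
  qed
  also have "... = en c * (NN y. k (x+h) y + k x y)" by (rule nn_integral_cmult) measurable
  finally show ?thesis .
 qed
 let ?d = "2 * 2 powr q * 2 ^ DIM('a) / unit_ball_vol DIM('a) * norm h powr (al*q)"
 let ?f = "en (1/v) * (en c * (Gag+Gag))"
 let ?g = "en v * (NN x:S. ?a x)"
 have "?g = (NN x. en v * (ind S x * en (?a x)))" by (rule nn_integral_cmult[symmetric]) measurable
 also have "...<=(NN x. en c * ((NN y. k (x+h) y)+(NN y. k x y)))"
 proof (rule nn_integral_mono)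
  fix x
  show "en v * (ind S x * en (?a x))<=en c * ((NN y. k (x+h) y)+(NN y. k x y))" using pt[of x] by (cases "x : S") (auto simp: nn_integral_add)
 qed
 also have "... = en c * ((NN x. (NN y. k (x+h) y))+Gag)" unfolding Gag_def by (subst nn_integral_cmult, measurable, subst nn_integral_add) (auto)
 also have "(NN x. (NN y. k (x+h) y)) = Gag" unfolding Gag_def by (rule nn_integral_translate[OF kint])
 finally have "en (1/v) * ?g<=?f" by (rule mult_left_mono) simp
 moreover have "en (1/v) * (en v * X) = X" for X using v by (simp add: mult.assoc[symmetric] ennreal_mult'[symmetric])
 moreover have "?f = en ?d * Gag"
 proof -
  have "?f = en (1/v * (c*2)) * Gag"
  proof -
   have "en (1/v * (c*2)) = en (1/v) * en (c*2)" by (rule ennreal_mult') (use v in simp)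
   also have "en (c*2) = en c * 2" using c0 by (simp add: ennreal_mult')
   finally show ?thesis by (simp only: mult.assoc mult_2)
  qed
  also have "1/v * (c*2) = ?d"
  proof -
   have "?i = norm h ^ DIM('a) * norm h powr (al*q)" using h by (simp add: powr_add n_def powr_realpow)
   thus ?thesis using h by (simp add: v_def c_def n_def power_divide)
  qed
  finally show ?thesis .
 qed
 ultimately show ?thesis by (simp add: Gag_def k_def n_def)
qed

lemma ennreal_enn2real_powr_le:
 assumes "X<oo" "0<q" "enn2real X powr (1/q)<=N"
 shows "X<=en (N powr q)"
proof -
 have "(enn2real X powr (1/q)) powr q<=N powr q" using assms by (intro powr_mono2) auto
 hence "enn2real X<=N powr q" using assms by (simp add: powr_powr)
 thus ?thesis using assms(1) by (simp add: ennreal_enn2real_if flip: ennreal_le_iff2) (metis ennreal_enn2real ennreal_leI infinity_ennreal_def less_top)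
qed

lemma Lp_norm_nonneg: "0<=Lp_norm t U f" by (simp add: Lp_norm_def)

lemma norm_powr_le_components:
 fixes x :: "'a::euclidean_space"
 assumes "0<=q"
 shows "norm x powr q<=real DIM('a) powr q * (\<Sum>b\<in>Basis. abs (x .* b) powr q)"
proof -
 obtain b where b: "b : Basis" "!!i. i : Basis ==> abs (x .* i)<=abs (x .* b)"
 proof -
  define M where "M = Max ((%i. abs (x .* i)) ` Basis)"
  have "M : (%i. abs (x .* i)) ` Basis" unfolding M_def by (intro Max_in) auto
  then obtain b where "b : Basis" "M = abs (x .* b)" by auto
  moreover have "abs (x .* i)<=M" if "i : Basis" for i unfolding M_def using that by (intro Max_ge) auto
  ultimately show ?thesis using that by auto
 qed
 have "norm x<=(\<Sum>i\<in>Basis. abs (x .* i))" by (rule norm_le_l1)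
 also have "...<=(\<Sum>i\<in>(Basis::'a set). abs (x .* b))" by (rule sum_mono) (rule b(2))
 finally have "norm x powr q<=(real DIM('a) * abs (x .* b)) powr q" using assms by (intro powr_mono2) auto
 also have "... = real DIM('a) powr q * abs (x .* b) powr q" by (simp add: powr_mult)
 also have "abs (x .* b) powr q<=(\<Sum>b\<in>Basis. abs (x .* b) powr q)" by (rule member_le_sum[OF b(1)]) auto
 finally show ?thesis by (simp add: mult_left_mono)
qed

lemma W2_difference:
 fixes ps :: "'a::euclidean_space => real"
 assumes Om: "open Om" "bounded Om" and q: "1<=q" and ps: "ps : W2 q Om" and r: "rep Om (wgrad Om ps) P"
  and sub: "ball a (r0+2 * norm h)<=Om" and h: "h ~= 0"
 shows "(NN x:ball a r0. norm (P (x+h) - P x) powr q)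
  <= en (real DIM('a) powr q * real DIM('a) * norm h powr q * (W2_norm q Om ps) powr q)"
proof -
 have q0: "0<q" "0<=q" using q by auto
 have Omb[measurable]: "Om : sets borel" using Om(1) by simp
 have [measurable]: "P : bm" "ball a r0 : sets borel" using r by (auto simp: rep_def)
 define H where "H = hessian_norm Om ps"
 let ?c = "%b. wgrad Om (%y. wgrad Om ps y .* b)"
 have "EX D. rep Om (?c b) D & wg Om (%x. P x .* b) D & Np q D<oo" if b: "b : Basis" for b
 proof -
  have "(%y. wgrad Om ps y .* b) : W1 q Om" using ps b by (simp add: W2_def)
  from W1_rep[OF Om q this] obtain u' D where D: "rep Om (%y. wgrad Om ps y .* b) u'" "rep Om (?c b) D" "wg Om u' D" "Np q D<oo" by metis
  have rb: "rep Om (%y. wgrad Om ps y .* b) (%x. P x .* b)" using r by (auto simp: rep_def elim!: eventually_mono)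
  have AE: "ae x. u' x = P x .* b" by (rule rep_unique[OF D(1) rb])
  have "Lint u'" using D by (simp add: wg_def)
  hence "Lint (%x. P x .* b)" by (rule integrable_cong_AE_imp) (use AE in "auto elim: eventually_mono")
  hence "wg Om (%x. P x .* b) D" by (intro wg_cong_AE[OF D(3)]) (use AE D(3) in "auto simp: wg_def elim: eventually_mono")
  with D show ?thesis by blast
 qed
 then obtain D where D: "!!b. b : Basis ==> rep Om (?c b) (D b)"
  "!!b. b : Basis ==> wg Om (%x. P x .* b) (D b)" "!!b. b : Basis ==> Np q (D b)<oo" by metis
 have [measurable]: "D b : bm" if "b : Basis" for b using D(1)[OF that] by (simp add: rep_def)
 define H' where "H' x = sqrt (\<Sum>b\<in>Basis. (norm (D b x))^2)" for x
 have "ae x. ALL b:Basis. x : Om --> D b x = wgrad Om (%y. wgrad Om ps y .* b) x" by (subst AE_finite_all) (use D(1) in "auto simp: rep_def")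
 hence "ae x. x : Om --> H' x = H x" by eventually_elim (auto simp: H_def H'_def hessian_norm_def)
 moreover have "H' x = 0" if "x ~: Om" for x using D(1) that by (simp add: H'_def rep_def)
 ultimately have rH: "rep Om H H'" by (auto simp: rep_def H'_def[abs_def])
 have [measurable]: "H' : bm" using rH by (simp add: rep_def)
 have DH: "norm (D b x)<=H' x" if "b : Basis" for b x unfolding H'_def by (rule real_le_rsqrt) (rule member_le_sum[OF that], auto)
 have H'0: "0<=H' x" for x by (simp add: H'_def sum_nonneg)
 let ?e = "real DIM('a) powr q"
 let ?a = "?e"
 have finH: "Np q H'<oo"
 proof -
  have "H' x powr q<=?e * (\<Sum>b\<in>Basis. norm (D b x) powr q)" for x
  proof -
   have "H' x = norm (\<Sum>b\<in>Basis. norm (D b x) *R b)" by (simp add: H'_def norm_eq_sqrt_inner inner_sum_left inner_sum_right inner_Basis power2_eq_square sum.delta' if_distrib cong: if_cong)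
   thus ?thesis using norm_powr_le_components[OF q0(2), of "\<Sum>b\<in>Basis. norm (D b x) *R b"] by (simp add: inner_sum_left inner_Basis if_distrib sum.delta cong: if_cong sum.cong)
  qed
  hence "Np q H'<=(NN x. en ?a * (\<Sum>b\<in>Basis. en (norm (D b x) powr q)))" unfolding Np_def using H'0 by (intro nn_integral_mono) (auto simp: ennreal_mult'[symmetric] sum_ennreal intro!: ennreal_leI)
  also have "... = en ?a * (\<Sum>b\<in>Basis. Np q (D b))" by (subst nn_integral_cmult, measurable, subst nn_integral_sum) (auto simp: Np_def)
  also have "...<oo" using D(3) by (simp add: ennreal_mult_less_top)
  finally show ?thesis .
 qed
 have "Lp_norm q Om H<=W2_norm q Om ps" by (simp add: W2_norm_def W1_norm_def H_def Lp_norm_nonneg add_nonneg_nonneg)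
 hence NH: "Np q H'<=en (W2_norm q Om ps powr q)" by (intro ennreal_enn2real_powr_le[OF finH q0(1)]) (simp add: Lp_norm_rep[OF Omb rH q0(1)])
 let ?b = "%x b. abs ((P (x+h) - P x) .* b) powr q"
 let ?d = "norm h powr q"
 have comp: "(NN x:ball a r0. ?b x b)<=en ?d * Np q H'" if b: "b : Basis" for b
 proof -
  have "(NN x:ball a r0. abs (P (x+h) .* b - P x .* b) powr q) <= en ?d * (NN x:Om. norm (D b x) powr q)"
  proof (rule wg_translation_estimate[OF D(2)[OF b] _ _ q, of _ _ "norm h / 2"])
   fix x t and y :: 'a assume x: "x : ball a r0" and t: "0<=(t::real)" "t<=1" and y: "norm y<=norm h / 2"
   have "dist a (x+t *R h+y)<=dist a x + norm (t *R h+y)" using norm_triangle_ineq4[of "a-x" "t *R h+y"] by (simp add: dist_norm diff_diff_eq add.assoc)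
   also have "norm (t *R h+y)<=norm h + norm h / 2" by (rule order_trans[OF norm_triangle_ineq]) (use t y mult_right_mono[of t 1 "norm h"] in auto)
   finally have "x+t *R h+y : ball a (r0+2 * norm h)" using x h norm_ge_zero[of h] by (simp del: norm_ge_zero)
   thus "x+t *R h+y : Om" using sub by auto
  qed (use h in auto)
  also have "...<=en ?d * Np q H'" unfolding Np_def using DH[OF b] H'0 q by (intro mult_left_mono nn_integral_mono) (auto simp: indicator_def intro!: ennreal_leI powr_mono2)
  finally show ?thesis by (simp add: inner_diff_left)
 qed
 have "(NN x:ball a r0. norm (P (x+h) - P x) powr q)
  <= (NN x. en ?a * (\<Sum>b\<in>Basis. ind (ball a r0) x * en (?b x b)))" using norm_powr_le_components[OF q0(2)] by (intro nn_integral_mono) (auto simp: indicator_def ennreal_mult'[symmetric] sum_ennreal intro!: ennreal_leI)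
 also have "... = en ?a * (\<Sum>b\<in>Basis. (NN x:ball a r0. ?b x b))" by (subst nn_integral_cmult, measurable, subst nn_integral_sum) auto
 also have "...<=en ?a * (\<Sum>b\<in>(Basis::'a set). en ?d * en (W2_norm q Om ps powr q))" by (intro mult_left_mono sum_mono order_trans[OF comp]) (auto intro: NH)
 also have "... = en (?e * real DIM('a) * norm h powr q * (W2_norm q Om ps) powr q)" by (simp add: ennreal_mult' mult.assoc ennreal_of_nat_eq_real_of_nat)
 finally show ?thesis .
qed

lemma obstacle_difference:
 fixes ps :: "'a::euclidean_space => real"
 assumes Om: "open Om" "bounded Om" and q: "1<=q" and al: "0<al" and ps: "ps : W1frac al q Om" and r: "rep Om (wgrad Om ps) P"
  and sub: "ball a (r0+2 * norm h)<=Om"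
 shows "(NN x:ball a r0. norm (P (x+h) - P x) powr q)
  <= en ((real DIM('a) powr q * real DIM('a) + 2 * 2 powr q * 2 ^ DIM('a) / unit_ball_vol DIM('a))
   * norm h powr (al*q) * W1frac_norm al q Om ps powr q)"
proof -
 define c1 where "c1 = real DIM('a) powr q * real DIM('a)"
 define c2 where "c2 = 2 * 2 powr q * 2 ^ DIM('a) / unit_ball_vol DIM('a)"
 have c: "0<=c1" "0<=c2" by (auto simp: c1_def c2_def)
 have Omb: "Om : sets borel" using Om(1) by simp
 let ?d = "W1frac_norm al q Om ps powr q"
 let ?e = "norm h powr (al*q)"
 let ?a = "(c1+c2) * ?e * ?d"
 let ?b = "NN x:ball a r0. norm (P (x+h) - P x) powr q"
 have Pm: "P : bm" using r by (simp add: rep_def)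
 consider "h = 0" | "h ~= 0" "al = 1" | "h ~= 0" "al ~= 1" by auto
 hence "?b <= en ?a"
 proof cases
  case 1
  thus ?thesis using q by simp
 next
  case 2
  hence "ps : W2 q Om" "W1frac_norm al q Om ps = W2_norm q Om ps" using ps by (auto simp: W1frac_def W1frac_norm_def)
  hence "?b <= en (c1 * ?e * ?d)" using W2_difference[OF Om q _ r sub 2(1)] 2 by (simp add: c1_def)
  also have "...<=en ?a" using c by (intro ennreal_leI mult_right_mono) auto
  finally show ?thesis .
 next
  case 3
  hence fin: "gagliardo al q Om (wgrad Om ps)<oo" and N: "W1frac_norm al q Om ps = W1_norm q Om ps + gagliardo_seminorm al q Om (wgrad Om ps)" using ps by (auto simp: W1frac_def W1frac_norm_def)
  let ?c = "?d"
  have le: "gagliardo al q Om (wgrad Om ps)<=en ?c" by (rule ennreal_enn2real_powr_le[OF fin]) (use q N Lp_norm_nonneg[of q Om ps] Lp_norm_nonneg[of q Om "wgrad Om ps"] in "auto simp: gagliardo_seminorm_def W1_norm_def")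
  let ?f = "h /\<^sub>R 2"
  have sub': "ball (x+?f) (norm h / 2)<=Om & x : Om & x+h : Om" if x: "x : ball a r0" for x
  proof -
   have inOm: "y : Om" if "norm (y-x)<2 * norm h" for y
   proof -
    have "dist a y<=dist a x + norm (y-x)" by (metis dist_commute dist_norm dist_triangle)
    hence "y : ball a (r0+2 * norm h)" using x that by auto
    thus ?thesis using sub by auto
   qed
   have "ball (x+?f) (norm h / 2)<=Om"
   proof
    fix y assume "y : ball (x+h /\<^sub>R 2) (norm h / 2)"
    hence "norm (x+?f - y)<norm h / 2" by (simp add: dist_norm)
    moreover have "norm (y-x)<=norm (x+?f - y) + norm ?f" using norm_triangle_ineq4[of "h /\<^sub>R 2" "x+h /\<^sub>R 2 - y"] by (simp add: algebra_simps)
    moreover have "norm ?f = norm h / 2" by simp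
    ultimately have "norm (y-x)<2 * norm h" using 3(1) by (smt (verit) norm_not_less_zero zero_less_norm_iff field_sum_of_halves)
    thus "y : Om" by (rule inOm)
   qed
   thus ?thesis using inOm[of x] inOm[of "x+h"] 3(1) by simp
  qed
  have "?b
   <= en (c2 * ?e) * gagliardo al q Om (wgrad Om ps)" unfolding c2_def gagliardo_rep[OF Omb r] by (rule gagliardo_difference[OF Pm Omb _ 3(1) sub']) (use q al in auto)
  also have "...<=en (c2 * ?e) * en ?c" by (intro mult_left_mono le) auto
  also have "... = en (c2 * ?e * ?d)" using c by (simp add: ennreal_mult')
  also have "...<=en ?a" using c by (intro ennreal_leI mult_right_mono) auto
  finally show ?thesis .
 qed
 thus ?thesis by (simp add: c1_def c2_def)
qed

section \<open>Higher integrability from differences\<close>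

lemma ennreal_le_suminf: "f j<=(\<Sum>i. f i)" for f :: "nat => ennreal" using sum_le_suminf[of f "{j}"] by simp

lemma level_set_measure:
 fixes W :: "'a::euclidean_space => 'b::euclidean_space"
 assumes [measurable]: "W : bm" and s: "0<s" and al: "0<al" and I: "0<I" "Np s W<=en I"
  and K: "0<=K" "!!h. Np 2 (%x. W (x+h) - W x)<=en (K * norm h powr al)" and l: "0<l"
 shows "emeasure lborel {x. l<norm (W x)}
  <= en (8 * (2 * 2 powr s / unit_ball_vol DIM('a)) powr (al / DIM('a)) * K * I powr (al / DIM('a)) * l powr (- 2-al * s / DIM('a)))"
proof -
 define n where "n = real DIM('a)"
 have n: "0<n" by (simp add: n_def)
 define w where "w = unit_ball_vol n"
 have w: "0<w" by (simp add: w_def n_def)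
 define m where "m = (2/l) powr s * I"
 have m: "0<m" using l I by (simp add: m_def)
 define de where "de = (2*m/w) powr (1/n)"
 have de: "0<de" using m w by (simp add: de_def)
 have wd: "w*de ^ DIM('a) = 2*m" using m w n by (simp add: de_def powr_power n_def)
 let ?B = "ball (0::'a) de"
 define A where "A = {x. l<norm (W x)}"
 have [measurable]: "A : sets borel" "?B : sets borel" by (auto simp: A_def)
 have eB: "emeasure lborel ?B = en (2*m)" using de wd by (simp add: emeasure_ball w_def n_def)
 let ?b = "(l/2) powr 2 * m"
 let ?c = "%x. NN h:?B. norm (W (x+h) - W x) powr 2"
 have pt: "en ?b<=?c x" if x: "x : A" for x
 proof -
  define E where "E = {h. l / 2<norm (W (x+h))}"
  have [measurable]: "E : sets borel" by (auto simp: E_def)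
  let ?d = "(2/l) powr s"
  have "emeasure lborel E = (NN h. ind E h)" by simp
  also have "...<=(NN h. en ?d * en (norm (W (h+x)) powr s))"
  proof (rule nn_integral_mono)
   fix h
   have "1<=(2/l) powr s * norm (W (h+x)) powr s" if "h : E"
   proof -
    have "1<=((2/l) * norm (W (h+x))) powr s" using that l s by (intro ge_one_powr_ge_zero) (auto simp: E_def field_simps add.commute)
    thus ?thesis using l by (simp add: powr_mult powr_divide)
   qed
   hence "h : E ==> ennreal 1<=en ((2/l) powr s * norm (W (h+x)) powr s)" by (intro ennreal_leI)
   thus "ind E h<=en ?d * en (norm (W (h+x)) powr s)" by (auto simp: indicator_def ennreal_mult')
  qed
  also have "... = en ?d * Np s (%h. W (h+x))" by (simp add: nn_integral_cmult Np_def)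
  also have "Np s (%h. W (h+x)) = Np s W" by (rule Np_translate) measurable
  also have "en ?d * Np s W<=en ?d * en I" by (intro mult_left_mono I) auto
  also have "... = en m" by (simp add: m_def ennreal_mult')
  finally have eE: "emeasure lborel E<=en m" .
  let ?g = "(l/2) powr 2"
  let ?i = "emeasure lborel (?B-E)"
  have "en (2*m) = emeasure lborel ?B" by (simp add: eB)
  also have "...<=emeasure lborel ((?B-E) \<union> E)" by (rule emeasure_mono) auto
  also have "...<=?i + emeasure lborel E" by (rule emeasure_subadditive) auto
  also have "...<=?i + en m" using eE by (rule add_left_mono)
  finally have "en m + en m<=en m + ?i" using m by (simp add: ennreal_plus[symmetric] add.commute del: ennreal_plus)
  hence "en m<=?i" by (simp add: ennreal_add_left_cancel_le)
  hence "en ?g * en m<=en ?g * ?i" by (rule mult_left_mono) simp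
  also have "... = (NN h. en ?g * ind (?B-E) h)" by (simp add: nn_integral_cmult_indicator)
  also have "...<=?c x"
  proof (rule nn_integral_mono)
   fix h
   have "l/2<=norm (W (x+h) - W x)" if "h ~: E" using that x norm_triangle_ineq2[of "W x" "W (x+h)"] by (auto simp: E_def A_def norm_minus_commute)
   thus "en ?g * ind (?B-E) h<=ind ?B h * en (norm (W (x+h) - W x) powr 2)" using l by (auto simp: indicator_def intro!: ennreal_leI powr_mono2)
  qed
  finally show ?thesis by (simp add: ennreal_mult')
 qed
 let ?j = "de powr al"
 let ?a = "K * ?j * (2*m)"
 let ?f = "en ?b * emeasure lborel A"
 let ?h = "K * ?j"
 have "?f = (NN x. en ?b * ind A x)" by (simp add: nn_integral_cmult_indicator)
 also have "...<=(NN x. ?c x)" by (intro nn_integral_mono) (use pt in "auto simp: indicator_def")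
 also have "... = (NN h. (NN x. ind ?B h * en (norm (W (x+h) - W x) powr 2)))" by (rule lborel_pair.Fubini') measurable
 also have "... = (NN h. ind ?B h * Np 2 (%x. W (x+h) - W x))" by (intro nn_integral_cong) (simp add: nn_integral_cmult Np_def)
 also have "...<=(NN h. en ?h * ind ?B h)"
 proof (rule nn_integral_mono)
  fix h :: 'a
  have "Np 2 (%x. W (x+h) - W x)<=en ?h" if "h : ?B" by (rule order_trans[OF K(2)]) (use that K(1) al in "auto intro!: ennreal_leI mult_left_mono powr_mono2")
  thus "ind ?B h * Np 2 (%x. W (x+h) - W x)<=en ?h * ind ?B h" by (auto simp: indicator_def)
 qed
 also have "... = en ?a" using K(1) m by (simp add: nn_integral_cmult_indicator eB ennreal_mult')
 finally have le: "?f<=en ?a" .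
 define c where "c = 1/?b"
 have c: "0<c" using l m by (simp add: c_def)
 let ?e = "2 * 2 powr s / w"
 have "en c * ?f<=en c * en ?a" by (rule mult_left_mono[OF le]) simp
 moreover have "en c * (en ?b * X) = X" for X
 proof -
  have "en c * en ?b = 1" using l m by (simp add: c_def ennreal_mult'[symmetric])
  thus ?thesis by (simp add: mult.assoc[symmetric])
 qed
 moreover have "en c * en ?a = en (c*?a)" using c by (simp add: ennreal_mult')
 ultimately have "emeasure lborel A<=en (c*?a)" by simp
 also have "c*?a = 8*K * ?j / l powr 2" using m l by (simp add: c_def powr_divide field_simps)
 also have "... = 8 * ?e powr (al/n) * K * I powr (al/n) * l powr (- 2-al * s/n)"
 proof -
  have "2*m/w = ?e*I * l powr (- s)" using l w by (simp add: m_def powr_divide powr_minus_divide mult.commute)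
  moreover have "?j = (2*m/w) powr (al/n)" by (simp add: de_def powr_powr)
  ultimately have "?j = (?e*I * l powr (- s)) powr (al/n)" by (simp only:)
  also have "... = ?e powr (al/n) * I powr (al/n) * l powr (- (al * s/n))" by (simp only: powr_mult powr_powr) (simp add: mult.commute)
  finally show ?thesis using l by (simp add: powr_diff powr_minus_divide mult_ac)
 qed
 finally show ?thesis by (simp add: A_def n_def w_def)
qed

lemma level_set_moment:
 fixes W :: "'a::euclidean_space => 'b::euclidean_space"
 assumes s: "0<s" and al: "0<al" and t: "2<=t" "t<2+al * s / DIM('a)"
 obtains C where "0<C" "!!(W :: 'a => 'b::euclidean_space) I K l. W : bm ==> 0<I ==> Np s W<=en I ==> 0<=K ==>
   (!!h. Np 2 (%x. W (x+h) - W x)<=en (K * norm h powr al)) ==> 0<l ==>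
   Np t W<=en (l powr (t-2)) * Np 2 W + en (C*K * I powr (al / DIM('a)) * l powr (t-2-al * s / DIM('a)))"
proof -
 define n where "n = real DIM('a)"
 define c where "c = 8 * (2 * 2 powr s / unit_ball_vol n) powr (al/n)"
 define ka where "ka = 2+al * s/n-t"
 have ka: "0<ka" using t by (simp add: ka_def n_def)
 define rh where "rh = 2 powr (- ka)"
 have rh: "0<rh" "rh<1" using ka by (auto simp: rh_def powr_less_one)
 let ?c = "1/(1-rh)"
 define C where "C = 2 powr t * c*?c"
 have "0<unit_ball_vol n" by (simp add: n_def)
 hence c0: "0<c" by (simp add: c_def)
 have C0: "0<C" using c0 rh by (simp add: C_def)
 have "Np t W<=en (l powr (t-2)) * Np 2 W + en (C*K * I powr (al/n) * l powr (t-2-al * s/n))"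
  if [measurable]: "W : bm" and I: "0<I" "Np s W<=en I" and K: "0<=K"
  "!!h. Np 2 (%x. W (x+h) - W x)<=en (K * norm h powr al)" and l: "0<l" for W :: "'a => 'b" and I K l
 proof -
  define A where "A j = {x. 2 ^ j * l<norm (W x)}" for j :: nat
  have [measurable]: "A j : sets borel" for j by (auto simp: A_def)
  define a where "a j = (2 ^ Suc j * l) powr t" for j :: nat
  let ?b = "\<Sum>j. en (a j) * emeasure lborel (A j)"
  have "Np t W<=(NN x. en (l powr (t-2)) * en (norm (W x) powr 2) + (\<Sum>j. en (a j) * ind (A j) x))" unfolding Np_def
  proof (rule nn_integral_mono)
   fix x
   let ?d = "\<Sum>j. en (a j) * ind (A j) x"
   show "en (norm (W x) powr t)<=en (l powr (t-2)) * en (norm (W x) powr 2) + ?d"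
   proof (cases "norm (W x)<=l")
    case True
    have "norm (W x) powr t = norm (W x) powr (t-2) * norm (W x) powr 2" by (simp flip: powr_add del: powr_numeral)
    also have "...<=l powr (t-2) * norm (W x) powr 2" using True t by (intro mult_right_mono powr_mono2) auto
    finally show ?thesis by (simp add: ennreal_mult'[symmetric] ennreal_leI add_increasing2)
   next
    case False
    define j where "j = nat (\<lceil>log 2 (norm (W x) / l)\<rceil> - 1)"
    have r: "1<norm (W x) / l" using False l by simp
    hence lg: "0<log 2 (norm (W x) / l)" by simp
    hence cl: "1<=\<lceil>log 2 (norm (W x) / l)\<rceil>" by linarith
    have rj: "real j = real_of_int \<lceil>log 2 (norm (W x) / l)\<rceil> - 1" using cl by (simp add: j_def)
    have "real j<log 2 (norm (W x) / l)" unfolding rj by linarith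
    hence "2 powr real j<norm (W x) / l" using r by (simp add: less_log_iff)
    hence 1: "x : A j" using l by (simp add: A_def powr_realpow less_divide_eq)
    have "log 2 (norm (W x) / l)<=real (Suc j)" using rj by (simp add: le_of_int_ceiling)
    hence "norm (W x) / l<=2 powr real (Suc j)" using r by (simp add: log_le_iff)
    hence "norm (W x)<=2 ^ Suc j * l" using l by (simp add: powr_realpow divide_le_eq del: of_nat_Suc)
    hence "norm (W x) powr t<=a j" unfolding a_def using t by (intro powr_mono2) auto
    hence "en (norm (W x) powr t)<=en (a j) * ind (A j) x" using 1 by (simp add: ennreal_leI)
    also have "...<=?d" by (rule ennreal_le_suminf)
    finally show ?thesis by (simp add: add_increasing)
   qed
  qed
  also have "... = en (l powr (t-2)) * Np 2 W + ?b" by (simp add: nn_integral_add nn_integral_cmult nn_integral_suminf Np_def)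
  also have "?b<=(\<Sum>j. en (2 powr t * c*K * I powr (al/n) * l powr (- ka) * rh ^ j))"
  proof (intro suminf_le)
   fix j
   let ?a = "- 2-al * s/n"
   let ?e = "en (a j) * emeasure lborel (A j)"
   have "?e<=en (a j) * en (c*K * I powr (al/n) * (2 ^ j * l) powr ?a)" unfolding A_def c_def n_def using l by (intro mult_left_mono level_set_measure[OF that(1) s al I K]) auto
   also have "... = en (a j * (c*K * I powr (al/n) * (2 ^ j * l) powr ?a))" by (simp add: a_def ennreal_mult')
   also have aj: "a j = 2 powr t * (2 ^ j * l) powr t"
   proof -
    have "2 ^ Suc j * l = 2*(2 ^ j * l)" by simp
    thus ?thesis unfolding a_def by (simp only: powr_mult)
   qed
   also have "2 powr t * (2 ^ j * l) powr t * (c*K * I powr (al/n) * (2 ^ j * l) powr ?a)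
    = 2 powr t * c*K * I powr (al/n) * ((2 ^ j * l) powr t * (2 ^ j * l) powr ?a)" by (simp add: mult_ac)
   also have "(2 ^ j * l) powr t * (2 ^ j * l) powr ?a = (2 ^ j * l) powr (- ka)" by (simp add: ka_def algebra_simps flip: powr_add)
   also have "... = l powr (- ka) * rh ^ j"
   proof -
    have "(2 ^ j) powr (- ka) = (rh :: real) ^ j" by (simp add: rh_def powr_powr powr_power mult.commute flip: powr_realpow)
    thus ?thesis by (simp add: powr_mult)
   qed
   finally show "?e<=en (2 powr t * c*K * I powr (al/n) * l powr (- ka) * rh ^ j)" by (simp only: aj mult.assoc)
  qed auto
  also have "... = en (2 powr t * c*K * I powr (al/n) * l powr (- ka) * ?c)"
  proof (rule suminf_ennreal_eq)
   show "(%j. 2 powr t * c*K * I powr (al/n) * l powr (- ka) * rh ^ j) sums (2 powr t * c*K * I powr (al/n) * l powr (- ka) * ?c)" by (intro sums_mult geometric_sums) (use rh in auto)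
  qed (use K c0 rh in auto)
  also have "2 powr t * c*K * I powr (al/n) * l powr (- ka) * ?c = C*K * I powr (al/n) * l powr (t-2-al * s/n)" by (simp add: C_def ka_def algebra_simps)
  finally show ?thesis by (simp add: add_left_mono)
 qed
 with C0 show ?thesis by (intro that[of C]) (auto simp: n_def)
qed

lemma moment_iteration:
 fixes al si :: real
 assumes n: "2<=DIM('a::euclidean_space)" and al: "0<al" "al<=1" and si: "2<=si" "si<2 * DIM('a) / (DIM('a) - al)"
 obtains C where "0<C" "!!(W :: 'a => 'b::euclidean_space) M. W : bm ==> 1<=M ==> Np 2 W<=en M ==>
   (!!h. Np 2 (%x. W (x+h) - W x)<=en (M * norm h powr al)) ==> Np si W<=en (C*M^2)"
proof -
 define n where "n = real DIM('a)"
 have n2: "2<=n" using n by (simp add: n_def)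
 define P where "P s C <-> 0<C & (ALL (W :: 'a => 'b) M. W : bm --> 1<=M --> Np 2 W<=en M -->
  (ALL h. Np 2 (%x. W (x+h) - W x)<=en (M * norm h powr al)) --> Np s W<=en (C*M^2))" for s C :: real
 have step: "EX C'. P t C'" if P: "P s C" and s: "2<=s" and t: "2<=t" "t<2+al * s/n" for s t C
 proof -
  have s0: "0<s" using s by simp
  have t': "t<2+al * s / DIM('a)" using t by (simp add: n_def)
  obtain c where c: "0<c" "!!(W :: 'a => 'b) I K l. W : bm ==> 0<I ==> Np s W<=en I ==> 0<=K ==>
   (!!h. Np 2 (%x. W (x+h) - W x)<=en (K * norm h powr al)) ==> 0<l ==>
   Np t W<=en (l powr (t-2)) * Np 2 W + en (c*K * I powr (al / DIM('a)) * l powr (t-2-al * s / DIM('a)))" using level_set_moment[OF s0 al(1) t(1) t', where 'b='b] by blast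
  have C: "0<C" using P by (simp add: P_def)
  define C' where "C' = 1+c * C powr (al/n)"
  have C': "0<C'" using c C by (simp add: C'_def add_pos_nonneg)
  have "Np t W<=en (C'*M^2)"
   if W: "W : bm" and M: "1<=M" and W2: "Np 2 W<=en M"
   and Wh: "!!h. Np 2 (%x. W (x+h) - W x)<=en (M * norm h powr al)" for W :: "'a => 'b" and M
  proof -
   have Is: "Np s W<=en (C*M^2)" using P W M W2 Wh by (auto simp: P_def)
   have I0: "0<C*M^2" using C M by simp
   have "Np t W<=en (1 powr (t-2)) * Np 2 W + en (c*M * (C*M^2) powr (al / DIM('a)) * 1 powr (t-2-al * s / DIM('a)))" by (rule c(2)[OF W I0 Is _ Wh]) (use M in auto)
   also have "...<=en M + en (c*M * (C*M^2) powr (al/n))" using W2 by (simp add: n_def)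
   also have "... = en (M+c*M * (C*M^2) powr (al/n))" using M c by (subst ennreal_plus) auto
   also have "...<=en (C'*M^2)"
   proof (rule ennreal_leI)
    have "(M^2) powr (al/n) = M powr (2*al/n)" using M by (simp add: powr_powr flip: powr_numeral)
    also have "...<=M powr 1" using M al n2 by (intro powr_mono) (auto simp: divide_le_eq)
    finally have "(M^2) powr (al/n)<=M" using M by simp
    hence "c*M * (C*M^2) powr (al/n)<=c*M*(C powr (al/n) * M)" using c M by (simp add: powr_mult mult_left_mono)
    moreover have "M<=M^2" using M by (simp add: power2_eq_square)
    ultimately show "M+c*M * (C*M^2) powr (al/n)<=C'*M^2" by (simp add: C'_def power2_eq_square algebra_simps)
   qed
   finally show ?thesis .
  qed
  hence "P t C'" using C' by (auto simp: P_def)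
  thus ?thesis ..
 qed
 have an: "al<n" using al n2 by linarith
 define al' where "al' = max (al/2) ((al+(n-2*n/si))/2)"
 have sin: "n-2*n/si<al"
 proof -
  have "si*(n-al)<2*n" using si(2) an by (simp add: n_def less_divide_eq)
  hence "n-al<2*n/si" using si by (simp add: less_divide_eq mult.commute)
  thus ?thesis by simp
 qed
 have al': "0<al'" "al'<al" "n-2*n/si<al'" using al sin by (auto simp: al'_def less_max_iff_disj)
 define r where "r = al'/n"
 have r: "0<r" "r<1" using al' an n2 by (auto simp: r_def)
 define L where "L = 2/(1-r)"
 have L: "si<L"
 proof -
  have "1-2/si<r"
  proof -
   have "n*(1-2/si)<n*r" using al'(3) n2 by (simp add: r_def algebra_simps)
   thus ?thesis using n2 by simp
  qed
  hence "1-r<2/si" by simp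
  thus ?thesis using si r by (simp add: L_def less_divide_eq mult.commute)
 qed
 have L2: "2<L" using L si by simp
 have Lr: "2+r*L = L" using r by (simp add: L_def field_simps)
 define S where "S k = L-(L-2)*r ^ k" for k :: nat
 have S2: "2<=S k" for k
 proof -
  have "(L-2)*r ^ k<=(L-2)*1" using L2 r by (intro mult_left_mono power_le_one) auto
  thus ?thesis by (simp add: S_def)
 qed
 have S_Suc: "S (Suc k) = 2+al' * S k / n" for k
 proof -
  have "2+al' * S k / n = 2+r * S k" by (simp add: r_def)
  also have "... = S (Suc k)" using Lr by (simp add: S_def algebra_simps)
  finally show ?thesis ..
 qed
 have "EX C. P (S k) C" for k
 proof (induction k)
  case 0
  have "P (S 0) 1" unfolding P_def
  proof (intro conjI allI impI)
   fix W :: "'a => 'b" and M :: real assume M: "1<=M" and W: "Np 2 W<=en M"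
   have "M<=M^2" using M by (simp add: power2_eq_square)
   thus "Np (S 0) W<=en (1*M^2)" using W by (simp add: S_def order_trans[OF _ ennreal_leI])
  qed simp
  thus ?case ..
 next
  case (Suc k)
  then obtain C where "P (S k) C" ..
  thus ?case
  proof (rule step)
   have "al' * S k / n<al * S k / n" using al' S2[of k] n2 by (intro divide_strict_right_mono mult_strict_right_mono) auto
   thus "S (Suc k)<2+al * S k / n" by (simp add: S_Suc)
  qed (rule S2)+
 qed
 moreover obtain k where k: "si<=S k"
 proof -
  have "0<(L-si)/(L-2)" using L L2 by simp
  then obtain k where "r ^ k<(L-si)/(L-2)" using real_arch_pow_inv r by blast
  hence "(L-2)*r ^ k<L-si" using L2 by (simp add: less_divide_eq mult.commute)
  thus ?thesis by (intro that[of k]) (simp add: S_def)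
 qed
 ultimately obtain C where C: "P (S k) C" by blast
 have C0: "0<C" using C by (simp add: P_def)
 show ?thesis
 proof (rule that[of "1+C"])
  fix W :: "'a => 'b" and M
  assume W[measurable]: "W : bm" and M: "1<=M" and W2: "Np 2 W<=en M"
   and Wh: "!!h. Np 2 (%x. W (x+h) - W x)<=en (M * norm h powr al)"
  have "Np si W<=(NN x. en (norm (W x) powr 2) + en (norm (W x) powr S k))" unfolding Np_def
  proof (rule nn_integral_mono)
   fix x
   let ?a = "norm (W x) powr si"
   let ?b = "norm (W x) powr S k"
   let ?c = "norm (W x) powr 2"
   have "?a<=?c + ?b"
   proof (cases "norm (W x)<=1")
    case True
    have "?a<=?c" using True si by (intro powr_mono') auto
    thus ?thesis by (simp add: add_increasing2)
   next
    case False
    have "?a<=?b" using False k by (intro powr_mono) auto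
    thus ?thesis by (simp add: add_increasing)
   qed
   thus "en ?a<=en ?c + en ?b" by (simp add: ennreal_plus[symmetric] ennreal_leI del: ennreal_plus)
  qed
  also have "... = Np 2 W + Np (S k) W" by (simp add: nn_integral_add Np_def)
  also have "...<=en M + en (C*M^2)" using C W M W2 Wh by (intro add_mono) (auto simp: P_def)
  also have "... = en (M+C*M^2)" using M C0 by (subst ennreal_plus) auto
  also have "...<=en ((1+C)*M^2)" using M by (intro ennreal_leI) (simp add: power2_eq_square algebra_simps)
  finally show "Np si W<=en ((1+C)*M^2)" .
 qed (use C0 in simp)
qed

lemma nn_integral_radial_power_finite:
 fixes ga de :: real
 assumes g: "0<ga" and de: "0<de"
 shows "(NN h:ball (0::'a::euclidean_space) de. norm h powr (ga - DIM('a)))<oo"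
proof -
 define e where "e = ga - real DIM('a)"
 define B where "B j = ball (0::'a) (de/2 ^ j)" for j :: nat
 have [measurable]: "B j : sets borel" for j by (simp add: B_def)
 define c where "c = 4 powr abs e"
 let ?h = "unit_ball_vol DIM('a)"
 let ?i = "de powr ga"
 let ?b = "c * ?h * ?i * (1/(1 - 2 powr (- ga)))"
 let ?f = "2 powr (- ga)"
 have "(NN h:ball (0::'a) de. norm h powr e) <= (NN h. (\<Sum>j. en (c * (de/2 ^ j) powr e) * ind (B j) h))"
 proof (rule nn_integral_mono)
  fix h :: 'a
  let ?d = "\<Sum>j. en (c * (de/2 ^ j) powr e) * ind (B j) h"
  let ?e = "ind (ball (0::'a) de) h * en (norm h powr e)"
  show "?e<=?d"
  proof (cases "h : ball 0 de & h ~= 0")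
   case True
   hence h: "0<norm h" "norm h<de" by auto
   have "EX j. de / 2 ^ j<=norm h"
   proof -
    obtain j where "de / norm h<2 ^ j" using real_arch_pow[of 2 "de / norm h"] by auto
    thus ?thesis using h by (intro exI[of _ j]) (simp add: field_simps)
   qed
   then obtain j0 where j0: "de/2 ^ j0<=norm h" "!!i. i<j0 ==> \<not> de / 2 ^ i<=norm h" using exists_least_iff[of "%j. de / 2 ^ j<=norm h"] by auto
   then obtain j where j: "j0 = Suc j" using h by (cases j0) auto
   have lt: "norm h<de/2 ^ j" using j0(2)[of j] j by simp
   have "de/2 ^ j<=2 * norm h" using j0(1) j by (simp add: field_simps)
   hence "de/2 ^ j<=4 * norm h" using h by linarith
   hence "norm h powr e<=c * (de/2 ^ j) powr e" unfolding c_def using lt h by (intro powr_sandwich(2)) auto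
   hence "?e<=en (c * (de/2 ^ j) powr e) * ind (B j) h" using True lt by (simp add: B_def ennreal_leI)
   also have "...<=?d" by (rule ennreal_le_suminf)
   finally show ?thesis .
  qed (auto simp: indicator_def)
 qed
 also have "... = (\<Sum>j. en (c * (de/2 ^ j) powr e) * emeasure lborel (B j))" by (simp add: nn_integral_suminf nn_integral_cmult_indicator)
 also have "... = (\<Sum>j. en (c * ?h * ?i * ?f ^ j))"
 proof (rule suminf_cong)
  fix j
  have p: "0<de/2 ^ j" using de by simp
  let ?a = "de/2 ^ j"
  let ?c = "c * ?a powr e * (?h * ?a ^ DIM('a))"
  let ?g = "en (c * ?a powr e) * emeasure lborel (B j)"
  have "?g = en ?c" using p by (simp add: B_def emeasure_ball c_def ennreal_mult')
  also have "?c = c * ?h * ?a powr ga"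
  proof -
   have "?a powr ga = ?a powr e * ?a ^ DIM('a)" using p by (simp add: e_def flip: powr_realpow powr_add)
   thus ?thesis by simp
  qed
  also have "?a powr ga = ?i * ?f ^ j" using de by (simp add: powr_divide powr_minus_divide powr_power power_one_over mult.commute flip: powr_realpow powr_powr)
   (simp add: powr_powr mult.commute powr_realpow[symmetric] powr_minus_divide)?
  finally show "?g = en (c * ?h * ?i * ?f ^ j)" by (simp add: mult.assoc)
 qed
 also have "... = en ?b"
 proof (rule suminf_ennreal_eq)
  show "(%j. c * ?h * ?i * ?f ^ j) sums ?b" by (intro sums_mult geometric_sums) (use g in "auto simp: powr_less_one")
 qed (simp add: c_def)
 finally show ?thesis by (simp add: e_def le_less_trans)
qed

abbreviation incr2 :: "'a::euclidean_space set => ('a => 'b::real_normed_vector) => 'a => ennreal"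
 where "incr2 A f h == NN x. ind A x * ind A (x+h) * en (norm (f (x+h) - f x) powr 2)"

lemma gagliardo_finite:
 fixes f :: "'a::euclidean_space => 'b::euclidean_space" and al be de :: real
 assumes U[measurable]: "U : sets borel" and b: "bounded U" and r: "rep U f P" and de: "0<de" and K: "0<=K"
  and be: "0<be" "be<al/2" and fin: "Np 2 P<oo"
  and D: "!!h. norm h<de ==> incr2 U P h<=en (K * norm h powr al)"
 shows "gagliardo be 2 U f<oo"
proof -
 have [measurable]: "P : bm" using r by (simp add: rep_def)
 define ga where "ga = al-2*be"
 have ga: "0<ga" using be by (simp add: ga_def)
 define e where "e = real DIM('a) + be*2"
 have e: "0<e" using be by (simp add: e_def add_pos_pos)
 obtain D where D0: "0<D" "!!x. x : U ==> norm x<=D" using b by (auto simp: bounded_pos)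
 define M where "M = en (2 powr 2) * (Np 2 P + Np 2 P)"
 have M: "M<oo" using fin by (simp add: M_def ennreal_mult_less_top)
 let ?B = "ball (0::'a) de" and ?E = "cball (0::'a) (2*D)"
 have [measurable]: "?B : sets borel" "?E : sets borel" by auto
 let ?b = "%h x. ind U (h+x) * en (norm (P x - P (h+x)) powr 2 / norm (x-(h+x)) powr e)"
 let ?d = "%h. norm h powr (ga - DIM('a))"
 let ?e = "de powr (- e)"
 have "gagliardo be 2 U f = (NN x. (NN y. ind U x * (ind U y * en (norm (P x - P y) powr 2 / norm (x-y) powr e))))" unfolding e_def by (rule gagliardo_rep[OF U r])
 also have "... = (NN x. (NN h. ind U x * ?b h x))" by (intro nn_integral_cong nn_integral_translate[symmetric]) measurable
 also have "... = (NN h. (NN x. ind U x * ?b h x))" by (rule lborel_pair.Fubini') measurable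
 also have "...<=(NN h. en K * (ind ?B h * en (?d h))+(en ?e * M) * ind ?E h)"
 proof (rule nn_integral_mono)
  fix h :: 'a
  let ?a = "incr2 U P h"
  let ?c = "norm h powr (- e)"
  have eq: "(NN x. ind U x * ?b h x) = en ?c * ?a" by (subst nn_integral_cmult[symmetric], measurable)
   (auto intro!: nn_integral_cong simp: indicator_def add.commute norm_minus_commute powr_minus_divide ennreal_mult'[symmetric])
  show "(NN x. ind U x * ?b h x) <= en K * (ind ?B h * en (?d h))+(en ?e * M) * ind ?E h"
  proof (cases "norm h<de")
   case True
   have "en ?c * ?a <= en ?c * en (K * norm h powr al)" by (intro mult_left_mono D True) auto
   also have "... = en K * en (?d h)" using K by (simp add: ennreal_mult'[symmetric] ga_def e_def mult_ac algebra_simps flip: powr_add)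
   finally show ?thesis unfolding eq using True by (simp add: add_increasing2)
  next
   case False
   have "?a<=M * ind ?E h"
   proof (cases "h : ?E")
    case True
    have "?a<=Np 2 (%x. P (x+h) - P x)" unfolding Np_def by (intro nn_integral_mono) (auto simp: indicator_def)
    also have "...<=en (2 powr 2) * (Np 2 (%x. P (x+h)) + Np 2 P)" by (rule Np_diff) auto
    also have "Np 2 (%x. P (x+h)) = Np 2 P" by (rule Np_translate) measurable
    finally show ?thesis using True by (simp add: M_def)
   next
    case False
    have "ind U x * ind U (x+h) = (0::ennreal)" for x using False D0(2)[of x] D0(2)[of "x+h"] norm_triangle_ineq4[of "x+h" x] by (auto simp: indicator_def)
    thus ?thesis by (simp only: mult_zero_left) simp
   qed
   moreover have "?c<=de powr (- e)" using False de e by (intro powr_mono2') auto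
   ultimately have "en ?c * ?a <= en ?e * (M * ind ?E h)" by (intro mult_mono ennreal_leI) auto
   thus ?thesis unfolding eq by (simp add: mult.assoc add_increasing)
  qed
 qed
 also have "... = en K * (NN h:?B. ?d h) + en ?e * M * emeasure lborel ?E" by (simp add: nn_integral_add nn_integral_cmult nn_integral_cmult_indicator)
 also have "...<oo" using nn_integral_radial_power_finite[OF ga de, where 'a='a] M emeasure_cball_finite[of "0::'a" "2*D"] by (simp add: ennreal_mult_less_top)
 finally show ?thesis .
qed

section \<open>Fractional differentiability of minimisers with integrable gradient\<close>

definition obstacle_minimiser ::
 "('a::euclidean_space => 'a => real) => real => 'a set => 'a set => ('a => real) => ('a => real) => ('a => 'a) => bool"
 where "obstacle_minimiser H q U S ps y Y <-> wg U y Y & (ALL x. x ~: U --> Y x = 0) & Np q Y<oo &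
  (ae x. x : U --> ps x<=y x) &
  (ALL ph Ph. wg UNIV ph Ph --> (ALL x. x ~: S --> ph x = 0 & Ph x = 0) --> Np q Ph<oo -->
   (ae x. x : U --> ps x<=y x + ph x) -->
   (NL x:U. en (H x (Y x)))<=(NL x:U. en (H x (Y x + Ph x))))"

lemma integrable_one_plus_powr:
 fixes Y Ph :: "'a::euclidean_space => 'b::euclidean_space"
 assumes [measurable]: "U : sets borel" "Y : bm" "Ph : bm"
  and b: "bounded U" and q: "0<=q" and fin: "Np q Y<oo" "Np q Ph<oo"
 shows "integrable (lebesgue_on U) (%x. (1 + norm (Y x) + norm (Ph x)) powr q)"
proof -
 let ?f = "%x. (1 + norm (Y x) + norm (Ph x)) powr q"
 obtain R where "U<=ball 0 R" using bounded_subset_ballD[OF b, of 0] by blast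
 hence R: "U<=cball 0 R" using ball_subset_cball by blast
 have U: "emeasure lborel U<oo" by (rule le_less_trans[OF emeasure_mono[OF R] emeasure_cball_finite]) simp
 have "Lint (%x. ind U x *R ?f x)"
 proof (rule integrableI_bounded)
  let ?a = "2 powr q * 2 powr q"
  let ?b = "%x. en ?a * en (norm (Y x) powr q) + en ?a * en (norm (Ph x) powr q)"
  let ?c = "NN x. en (norm (ind U x *R ?f x))"
  have "?c <= (NN x. en (2 powr q) * ind U x + ?b x)"
  proof (rule nn_integral_mono)
   fix x
   have "?f x = (1+(norm (Y x) + norm (Ph x))) powr q" by (simp add: add.assoc)
   also have "...<=2 powr q * (1 powr q + (norm (Y x) + norm (Ph x)) powr q)" by (rule powr_add_le) (use q in auto)
   also have "...<=2 powr q * (1 powr q + 2 powr q * (norm (Y x) powr q + norm (Ph x) powr q))" by (intro mult_left_mono add_left_mono powr_add_le) (use q in auto)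
   finally have "en (?f x)<=en (2 powr q + (2 powr q * 2 powr q * norm (Y x) powr q + 2 powr q * 2 powr q * norm (Ph x) powr q))" by (intro ennreal_leI) (simp add: algebra_simps)
   thus "en (norm (ind U x *R ?f x))<=en (2 powr q) * ind U x + ?b x" by (auto simp: indicator_def ennreal_mult'[symmetric])
  qed
  also have "... = en (2 powr q) * emeasure lborel U + (en ?a * Np q Y + en ?a * Np q Ph)" by (simp add: nn_integral_add nn_integral_cmult nn_integral_cmult_indicator Np_def)
  also have "...<oo" using fin U by (simp add: ennreal_mult_less_top)
  finally show "?c<oo" .
 qed measurable
 thus ?thesis by (subst integrable_rep[OF _ rep_indicator]) auto
qed

lemma variational_inequality:
 fixes H :: "'a::euclidean_space => 'a => real"
 assumes H: "pq_integrand Om H nu L mu al p q" and U: "U<=Om" "U : sets borel" "Om : sets borel" "bounded U"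
  and par: "0<=nu" "0<=L" "1<=q" and m: "obstacle_minimiser H q U S ps y Y"
  and A: "rep U (%x. grad (H x) (Y x)) A"
  and ph: "wg UNIV ph Ph" "!!x. x ~: S ==> ph x = 0 & Ph x = 0" "Np q Ph<oo" "ae x. x : U --> ps x<=y x + ph x"
 shows "Lint (%x. A x .* Ph x)" "0<=(LL x. A x .* Ph x)"
proof -
 have wgY: "wg U y Y" and Y: "Np q Y<oo" and AEy: "ae x. x : U --> ps x<=y x" using m by (auto simp: obstacle_minimiser_def)
 have [measurable]: "Y : bm" "Ph : bm" "A : bm" "U : sets borel" using wg_measurable[OF wgY] wg_measurable[OF ph(1)] A U by (auto simp: rep_def)
 let ?M = "lebesgue_on U"
 have sp: "space ?M = U" by simp
 have q0: "0<=q" using par by simp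
 have xOm: "x : U ==> x : Om" for x using U by auto
 let ?a = "%x. 1 + norm (Y x) + norm (Ph x)"
 define w where "w x = ?a x powr q" for x
 have w: "integrable ?M w" unfolding w_def[abs_def] by (rule integrable_one_plus_powr) (use U Y ph q0 in auto)
 define Z where "Z t x = Y x + t *R Ph x" for t x
 have Zb[measurable]: "Z t : bm" for t unfolding Z_def[abs_def] by measurable
 let ?f = "borel_measurable ?M"
 have mL: "f : bm ==> f : ?f" for f :: "'a => 'a" by (rule rep_measurable[OF _ rep_indicator]) auto
 have Zn: "1 + norm (Z t x)<=?a x" if "0<=t" "t<=1" for t x using norm_triangle_ineq[of "Y x" "t *R Ph x"] that mult_left_le_one_le[of "norm (Ph x)" t] by (simp add: Z_def)
 define G where "G t x = grad (H x) (Z t x) .* Ph x" for t x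
 have Gm[measurable]: "G t : ?f" for t unfolding G_def by (intro borel_measurable_inner integrand_measurable(2)[OF H U(1-3)] mL Zb) measurable
 have Gb: "norm (G t x)<=2 powr q * L * w x" if "0<=t" "t<=1" "x : U" for t x
 proof -
  have "norm (G t x)<=norm (grad (H x) (Z t x)) * norm (Ph x)" by (simp add: G_def Cauchy_Schwarz_ineq2)
  also have "...<=(2 powr q * L * (1 + norm (Z t x)) powr (q-1)) * norm (Ph x)" by (intro mult_right_mono grad_integrand_bound[OF H xOm[OF that(3)]]) (use par in auto)
  also have "...<=(2 powr q * L * ?a x powr (q-1))*?a x" by (intro mult_mono mult_left_mono powr_mono2 Zn) (use that par in auto)
  also have "... = 2 powr q * L * w x" by (simp add: w_def powr_diff add_pos_nonneg)
  finally show ?thesis .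
 qed
 have Gint: "integrable ?M (G t)" if "0<=t" "t<=1" for t by (rule Bochner_Integration.integrable_bound[OF integrable_mult_right[OF w, of "2 powr q * L"]]) (use Gb that par in "auto simp: w_def sp")
 have Hint: "integrable ?M (%x. H x (Z t x))" if "0<=t" "t<=1" for t
 proof (rule Bochner_Integration.integrable_bound[OF integrable_mult_right[OF w, of L]])
  show "(%x. H x (Z t x)) : ?f" by (rule integrand_measurable(1)[OF H U(1-3)]) (rule mL[OF Zb])
  show "AE x in ?M. norm (H x (Z t x))<=norm (L * w x)"
  proof (rule AE_I2)
   fix x assume "x : space ?M"
   hence x: "x : Om" using U by auto
   have "H x (Z t x)<=L * (1 + norm (Z t x)) powr q" by (rule integrand_le[OF H x par(2) q0])
   also have "...<=L * w x" unfolding w_def by (intro mult_left_mono powr_mono2 Zn) (use that par in auto)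
   finally show "norm (H x (Z t x))<=norm (L * w x)" using integrand_nonneg[OF H x par(1), of "Z t x"] by simp
  qed
 qed
 have pos: "0<=(\<integral>x. G t x \<partial>?M)" if t: "0<t" "t<=1" for t
 proof -
  let ?b = "%t. \<integral>x. H x (Z t x) \<partial>?M"
  let ?c = "\<integral>x. H x (Z 0 x) \<partial>?M"
  let ?d = "%t. \<integral>\<^sup>+x. en (H x (Z t x)) \<partial>?M"
  have "ae x. x : U --> ps x<=y x + t * ph x" using AEy ph(4)
  proof eventually_elim
   case (elim x)
   have "x : U ==> (1-t) * ps x + t * ps x<=(1-t) * y x + t*(y x + ph x)" using elim t by (intro add_mono mult_left_mono) auto
   thus ?case by (auto simp: algebra_simps)
  qed
  moreover have "Np q (%x. t *R Ph x)<oo"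
  proof (rule le_less_trans[OF _ ph(3)])
   show "Np q (%x. t *R Ph x)<=Np q Ph" unfolding Np_def using t q0 by (intro nn_integral_mono ennreal_leI powr_mono2) (auto simp: mult_left_le_one_le)
  qed
  ultimately have "(\<integral>\<^sup>+x. en (H x (Y x)) \<partial>?M)<=(\<integral>\<^sup>+x. en (H x (Y x + t *R Ph x)) \<partial>?M)" using m wg_cmult[OF ph(1), of t] ph(2) unfolding obstacle_minimiser_def by fastforce
  hence "(\<integral>\<^sup>+x. en (H x (Z 0 x)) \<partial>?M)<=?d t" by (simp add: Z_def)
  moreover have "?d t = en (?b t)" if "0<=t" "t<=1" for t by (rule nn_integral_eq_integral[OF Hint[OF that]]) (use integrand_nonneg[OF H xOm par(1)] in auto)
  moreover have "0<=?b t" by (rule Bochner_Integration.integral_nonneg) (use integrand_nonneg[OF H xOm par(1)] in auto)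
  ultimately have le: "?c<=?b t" using t by simp
  have "(\<integral>x. H x (Z t x) - t * G t x \<partial>?M)<=?c"
  proof (intro integral_mono Bochner_Integration.integrable_diff integrable_mult_right Hint Gint)
   fix x assume "x : space ?M"
   thus "H x (Z t x) - t * G t x<=H x (Z 0 x)" using integrand_above_tangent[OF H xOm par(1), of x "Z t x" "Z 0 x"] by (simp add: G_def Z_def)
  qed (use t in auto)
  hence "0<=t*(\<integral>x. G t x \<partial>?M)" using le t by (simp add: Bochner_Integration.integral_diff Hint Gint)
  thus ?thesis using t by (simp add: zero_le_mult_iff)
 qed
 let ?e = "\<integral>x. G 0 x \<partial>?M"
 have lim: "(%k. \<integral>x. G (1 / Suc k) x \<partial>?M) ----> ?e"
 proof (rule integral_dominated_convergence[where w = "%x. 2 powr q * L * w x"])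
  show "AE x in ?M. (%k. G (1 / Suc k) x) ----> G 0 x"
  proof (rule AE_I2)
   fix x assume "x : space ?M"
   hence c: "continuous_on UNIV (grad (H x))" using pq_integrandD(3)[OF H] U by (intro Ck1_continuous_grad) auto
   have "(%k. Y x + (1 / real (Suc k)) *R Ph x) ----> Y x + 0 *R Ph x" by (intro tendsto_intros) (use LIMSEQ_inverse_real_of_nat in "simp add: inverse_eq_divide")
   hence "(%k. grad (H x) (Z (1 / Suc k) x)) ----> grad (H x) (Z 0 x)" unfolding Z_def by (rule continuous_on_tendsto_compose[OF c]) auto
   thus "(%k. G (1 / Suc k) x) ----> G 0 x" unfolding G_def by (rule tendsto_inner[OF _ tendsto_const])
  qed
  show "AE x in ?M. norm (G (1 / Suc k) x)<=2 powr q * L * w x" for k by (rule AE_I2) (rule Gb, auto simp: divide_simps)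
 qed (use w in auto)
 have "0<=?e" by (rule LIMSEQ_le_const[OF lim]) (intro exI[of _ 0] allI impI pos, auto simp: divide_simps)
 moreover have r: "rep U (G 0) (%x. A x .* Ph x)" using A by (auto simp: rep_def G_def Z_def)
 ultimately show "Lint (%x. A x .* Ph x)" "0<=(LL x. A x .* Ph x)" using integrable_rep[OF U(2) r] integral_rep[OF U(2) r] Gint[of 0] by auto
qed

lemma young_increment:
 fixes E b t q :: real
 assumes E: "0<=E" and b: "0<=b" and t: "0<t" and q: "1<=q"
 shows "E powr (q-1) * b<=t*(E powr q + (b/t) powr q)"
proof -
 define c where "c = b/t"
 have c: "0<=c" using b t by (simp add: c_def)
 have mb: "x powr (q-1) * x = x powr q" if "0<=x" for x :: real using that by (cases "x = 0") (auto simp: powr_diff)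
 have "E powr (q-1) * c<=max E c powr (q-1) * max E c" using E c q by (intro mult_mono powr_mono2) auto
 also have "... = max E c powr q" using E by (intro mb) auto
 also have "...<=E powr q + c powr q" by (auto simp: max_def)
 finally have "t*(E powr (q-1) * c)<=t*(E powr q + c powr q)" using t by (intro mult_left_mono) auto
 thus ?thesis using t by (simp add: c_def mult_ac)
qed

lemma gradient_difference_lower:
 fixes a b :: "'a::euclidean_space"
 assumes H: "pq_integrand Om H nu L mu al p q" and x: "x : Om" "z : Om" and L: "0<=L" and q: "1<=q"
 shows "nu * Dp mu p b a - L * norm (z-x) powr al * (1 + norm a + norm b) powr q<=(grad (H z) b - grad (H x) a) .* (b-a)"
proof -
 let ?E = "1 + norm a + norm b"
 let ?c = "(1+(norm b)^2) powr ((q-1)/2)"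
 have "?c<=(1 + norm b) powr (q-1)" using q by (intro quadratic_growth_bound) auto
 also have "...<=?E powr (q-1)" using q by (intro powr_mono2) auto
 finally have 1: "?c<=?E powr (q-1)" .
 let ?a = "grad (H z) b - grad (H x) b"
 let ?b = "L * norm (z-x) powr al * ?E powr (q-1)"
 let ?d = "grad (H x) b - grad (H x) a"
 let ?e = "L * norm (z-x) powr al * ?E powr q"
 have "abs (?a .* (b-a))<=norm ?a * norm (b-a)" by (rule Cauchy_Schwarz_ineq2)
 also have "...<=?b*?E"
 proof (intro mult_mono)
  show "norm ?a<=?b" by (rule order_trans[OF pq_integrandD(5)[OF H x(2,1)]]) (intro mult_left_mono 1, use L in auto)
  show "norm (b-a)<=?E" using norm_triangle_ineq4[of b a] by simp
 qed (use L in auto)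
 also have "... = ?e" by (simp add: powr_diff add_pos_nonneg)
 finally have "abs (?a .* (b-a))<=?e" .
 moreover have "nu * Dp mu p b a<=?d .* (b-a)" by (rule pq_integrandD(4)[OF H x(1)])
 moreover have "(grad (H z) b - grad (H x) a) .* (b-a) = ?a .* (b-a)+?d .* (b-a)" by (simp add: inner_diff_left)
 ultimately show ?thesis by linarith
qed

lemma gradient_difference_bound:
 fixes a b :: "'a::euclidean_space"
 assumes H: "pq_integrand Om H nu L mu al p q" and x: "x : Om" "z : Om" and par: "0<=nu" "0<=L" "1<=q"
 shows "norm (grad (H z) b - grad (H x) a)<=2 * 2 powr q * L * (1 + norm a + norm b) powr (q-1)"
proof -
 let ?a = "2 powr q * L * (1 + norm a + norm b) powr (q-1)"
 have "norm (grad (H z) b)<=?a" by (rule order_trans[OF grad_integrand_bound[OF H x(2) par]]) (intro mult_left_mono powr_mono2, use par in auto)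
 moreover have "norm (grad (H x) a)<=?a" by (rule order_trans[OF grad_integrand_bound[OF H x(1) par]]) (intro mult_left_mono powr_mono2, use par in auto)
 ultimately show ?thesis using norm_triangle_ineq4[of "grad (H z) b" "grad (H x) a"] by simp
qed

lemma obstacle_pointwise_estimate:
 fixes a b d g :: "'a::euclidean_space"
 assumes H: "pq_integrand Om H nu L mu al p q" and x: "x : Om" "z : Om" and par: "0<=nu" "0<=L" "1<=q"
  and h: "0<norm (z-x)" "norm (z-x)<=1" and al: "al<=1" and et: "0<=et" "et<=1" and g: "norm g<=ka"
 defines "t == norm (z-x) powr al" and "E == (1 + norm a + norm b) powr q"
 shows "et*(nu * Dp mu p b a)<=(grad (H z) b - grad (H x) a) .* (et *R ((b-a)-d)+e *R g) +
  5 * 2 powr q * L*(1+ka)*t*(E + (norm d / t) powr q + (abs e / norm (z-x)) powr q)"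
proof -
 let ?D = "grad (H z) b - grad (H x) a" and ?e = "(1 + norm a + norm b) powr (q-1)" and ?K = "2 * 2 powr q * L"
 have t: "0<t" using h by (simp add: t_def)
 have ka: "0<=ka" using g norm_ge_zero[of g] by linarith
 have st: "norm (z-x)<=t" using powr_mono'[of al 1 "norm (z-x)"] h al by (simp add: t_def)
 have D: "norm ?D<=?K*?e" by (rule gradient_difference_bound[OF H x par])
 have K: "0<=?K" using par by simp
 have E0: "0<=E" by (simp add: E_def)
 let ?d = "t*(E + (norm d / t) powr q)"
 have Y1: "?e * norm d<=?d" unfolding E_def by (rule young_increment) (use t par in auto)
 let ?h = "abs e / norm (z-x)"
 let ?a = "E + ?h powr q"
 let ?g = "?e * abs e"
 have Y2: "?g<=t*?a"
 proof -
  have "?g<=norm (z-x) * ?a" unfolding E_def by (rule young_increment) (use h par in auto)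
  also have "...<=t*?a" using E0 by (intro mult_right_mono st) auto
  finally show ?thesis .
 qed
 let ?j = "nu * Dp mu p b a"
 have "et*(?j - L*t*E)<=et*(?D .* (b-a))" unfolding t_def E_def by (intro mult_left_mono gradient_difference_lower[OF H x]) (use par et in auto)
 moreover have "et*(L*t*E)<=L*t*E" using et par t E0 by (intro mult_left_le_one_le) auto
 ultimately have A: "et*?j<=et*(?D .* (b-a))+L*t*E" by (simp add: right_diff_distrib)
 have "et*(?D .* d)<=1 * abs (?D .* d)" by (rule order_trans[OF mult_left_mono[OF abs_ge_self] mult_right_mono]) (use et in auto)
 also have "1 * abs (?D .* d)<=norm ?D * norm d" using Cauchy_Schwarz_ineq2[of ?D d] by simp
 also have "...<=(?K*?e) * norm d" by (intro mult_right_mono D) auto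
 also have "... = ?K*(?e * norm d)" by simp
 also have "...<=?K*?d" by (intro mult_left_mono Y1 K)
 finally have B: "et*(?D .* d)<=?K*?d" .
 have "- (e*(?D .* g))<=abs e * abs (?D .* g)" by (metis abs_ge_minus_self abs_mult)
 also have "...<=abs e * ((?K*?e)*ka)" by (intro mult_left_mono order_trans[OF Cauchy_Schwarz_ineq2] mult_mono D g) (use K in auto)
 also have "... = (?K*ka)*?g" by simp
 also have "...<=(?K*ka)*(t*?a)" using K ka by (intro mult_left_mono Y2) auto
 finally have C: "- (e*(?D .* g))<=(?K*ka)*(t*?a)" .
 define X where "X = (norm d / t) powr q"
 define Y where "Y = ?h powr q"
 have XY: "0<=X" "0<=Y" by (auto simp: X_def Y_def)
 have q1: "1<=2 powr q" using par by (intro ge_one_powr_ge_zero) auto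
 let ?f = "2 powr q * L"
 have "L*t*E<=?f*t*E" using par t E0 q1 by (intro mult_right_mono) (auto simp: mult_le_cancel_right1)
 also have "...<=?f*t*(E+X+Y)" using par t E0 XY by (intro mult_left_mono) auto
 finally have 1: "L*t*E<=?f*t*(E+X+Y)" .
 let ?b = "t*(E+X+Y)"
 have 2: "?K*(t*(E+X))<=?K*?b" using K t XY by (intro mult_left_mono) auto
 have 3: "(?K*ka)*(t*(E+Y))<=(?K*ka)*?b" using K ka t XY by (intro mult_left_mono) auto
 let ?c = "?f*t*(E+X+Y)+?K*?b+(?K*ka)*?b"
 let ?i = "et *R ((b-a)-d)+e *R g"
 have "?D .* ?i = et*(?D .* (b-a))-et*(?D .* d)+e*(?D .* g)" by (simp add: inner_add_right inner_diff_right right_diff_distrib)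
 hence "et*?j<=?D .* ?i+?c" using A B C 1 2 3 unfolding X_def[symmetric] Y_def[symmetric] by linarith
 also have "?c = (3+2*ka)*(2 powr q * L*?b)" by (simp add: algebra_simps)
 also have "...<=(5*(1+ka))*(2 powr q * L*?b)" using ka par t E0 XY by (intro mult_right_mono) auto
 finally show ?thesis by (simp only: X_def Y_def mult_ac)
qed

lemma nn_integral_le_add_integral:
 fixes f g b :: "'a => real"
 assumes g: "integrable M g" and [measurable]: "f : borel_measurable M" "b : borel_measurable M"
  and f: "!!x. 0<=f x" and b: "!!x. 0<=b x" and le: "AE x in M. f x<=g x + b x"
 shows "(\<integral>\<^sup>+x. en (f x) \<partial>M)<=(\<integral>\<^sup>+x. en (b x) \<partial>M) + en (\<integral>x. g x \<partial>M)"
proof (cases "(\<integral>\<^sup>+x. en (b x) \<partial>M)<oo")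
 case True
 have ib: "integrable M b" by (rule integrableI_bounded) (use True b in auto)
 let ?a = "\<integral>x. b x \<partial>M"
 let ?b = "\<integral>x. f x \<partial>M"
 let ?c = "\<integral>x. g x \<partial>M"
 have "integrable M f" by (rule Bochner_Integration.integrable_bound[OF Bochner_Integration.integrable_add[OF g ib]]) (use le f in "auto elim!: eventually_mono")
 hence "(\<integral>\<^sup>+x. en (f x) \<partial>M) = en ?b" by (intro nn_integral_eq_integral) (use f in auto)
 also have "?b<=(\<integral>x. g x + b x \<partial>M)" by (rule integral_mono_AE) (use \<open>integrable M f\<close> g ib le in auto)
 also have "... = ?a+?c" using g ib by simp
 also have "en ...<=en ?a + en ?c" using b by (cases "0<=(\<integral>x. g x \<partial>M)") (auto simp: ennreal_neg ennreal_leI)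
 also have "en ?a = (\<integral>\<^sup>+x. en (b x) \<partial>M)" using nn_integral_eq_integral[OF ib] b by simp
 finally show ?thesis by (simp add: ennreal_leI)
qed (simp add: not_less top_unique)

lemma three_powr_le:
 fixes s w q :: real
 assumes "0<=s" "0<=w" "1<=q"
 shows "(1+s+w) powr q<=4 powr q * (1 + s powr q + w powr q)"
proof -
 have q1: "1<=2 powr q" using assms by (intro ge_one_powr_ge_zero) auto
 let ?a = "2 powr q * (s powr q + w powr q)"
 have "(1+(s+w)) powr q<=2 powr q * (1 powr q + (s+w) powr q)" by (rule powr_add_le) (use assms in auto)
 also have "...<=2 powr q * (1 powr q + ?a)" by (intro mult_left_mono add_left_mono powr_add_le) (use assms in auto)
 also have "...<=2 powr q * (2 powr q * 1 + ?a)" using q1 by (intro mult_left_mono add_right_mono) auto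
 also have "... = 4 powr q * (1 + s powr q + w powr q)" using powr_mult[of 2 2 q] by (simp add: algebra_simps)
 finally show ?thesis by (simp add: add.assoc)
qed

text \<open>
  The variation \<open>\<eta> (u(x + h) - u(x))\<close> of \<open>u = y - \<psi>\<close> and the reflection of its translate by \<open>-h\<close> are both
  admissible for \<open>u \<ge> 0\<close> and \<open>0 \<le> \<eta> \<le> 1\<close>; adding the two variational inequalities produces the
  difference quotient of the gradient of the integrand.
\<close>

lemma obstacle_a_priori:
 fixes nu L q al :: real
 assumes par: "0<nu" "0<=L" "1<=q" and al: "0<al" "al<=1"
 obtains C where "0<C" "!!Om H mu p U S ps y (Y :: 'a::euclidean_space => 'a) P a r R N h.
  pq_integrand Om H nu L mu al p q ==> U<=Om ==> U : sets borel ==> Om : sets borel ==> bounded U ==>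
  obstacle_minimiser H q U S ps y Y ==> wg U ps P ==> Np q P<oo ==> 0<r ==> r<R ==> ball a R<=S ==> ball a R<=U ==>
  0<=N ==> norm h<=1 ==> norm h<=(R-r)/4 ==>
  (NN x:cball a ((r + R)/2). norm (P (x+h) - P x) powr q)<=en (N * norm h powr (al*q)) ==>
  (NN x:cball a r. Dp mu p (Y (x+h)) (Y x))
   <= en (C*(1+1/(R-r)) * norm h powr al) *
   ((NN x:ball a R. 1 + norm (Y x) powr q + norm (P x) powr q) + en N)"
proof (rule smooth_cutoff[where 'a='a], goal_cases)
 case (1 C0)
 note C0 = 1(2,3)
 define c where "c = 5 * 2 powr q * L"
 let ?c = "3 * 4 powr q"
 let ?n = "c*(1+2*C0)*?c+1"
 define C where "C = ?n/nu"
 have c: "0<=c" using par by (simp add: c_def)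
 have C: "0<C" using c C0 par by (simp add: C_def add_nonneg_pos)
 show ?thesis
 proof (rule that[OF C], goal_cases)
  case (1 Om H mu p U S ps y Y P a r R N h)
  note H = 1(1) and U = 1(2-5) and m = 1(6) and wP = 1(7) and NP = 1(8) and r = 1(9,10) and S = 1(11,12) and N = 1(13) and h = 1(14,15) and hP = 1(16)
  let ?a = "%x. 1 + norm (Y x) powr q + norm (P x) powr q"
  let ?v = "NN x:ball a R. ?a x"
  define J where "J = ?v"
  let ?j = "NN x:cball a r. Dp mu p (Y (x+h)) (Y x)"
  let ?l = "1+1/(R-r)"
  let ?goal = "?j<=en (C*?l * norm h powr al) * (J + en N)"
  have ?goal
  proof (cases "h = 0")
   case True
   thus ?thesis by (simp add: Dp_def)
  next
   case False
   define r' where "r' = (r + R)/2"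
   define ka where "ka = C0/(r'-r)"
   define t where "t = norm h powr al"
   have h0: "0<norm h" using False by simp
   have t0: "0<t" using h0 by (simp add: t_def)
   have r': "r<r'" "0<r'" "r' + norm h<R" using r h by (auto simp: r'_def field_simps)
   obtain et where et: "smooth et" "!!x. 0<=et x" "!!x. et x<=1" "!!x. x : cball a r ==> et x = 1"
    "!!x. x ~: cball a r' ==> et x = 0" "!!x. norm (grad et x)<=ka" using C0(2)[OF r(1) r'(1), of a] unfolding ka_def by blast
   have get: "grad et x = 0" if "x ~: cball a r'" for x by (rule grad_zero_outside_closed[of "cball a r'"]) (use that et(5) in auto)
   have ka0: "0<=ka" using order_trans[OF norm_ge_zero et(6)] .
   have inR: "x : ball a R" "x+h : ball a R" if "x : cball a r'" for x
   proof -
    show "x : ball a R" using that r' norm_ge_zero[of h] unfolding mem_ball mem_cball by linarith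
    have "dist a (x+h)<=dist a x + norm h" using norm_triangle_ineq4[of "a-x" h] by (simp add: dist_norm diff_diff_eq)
    thus "x+h : ball a R" using that r' by auto
   qed
   have inU: "x : U" "x+h : U" if "x : cball a r'" for x using inR[OF that] S by auto
   have mY: "wg U y Y" "!!x. x ~: U ==> Y x = 0" "Np q Y<oo" "ae x. x : U --> ps x<=y x" using m by (auto simp: obstacle_minimiser_def)
   have q0: "0<=q" using par by simp
   define u where "u x = y x - ps x" for x
   define G where "G x = Y x - P x" for x
   have wu: "wg U u G" unfolding u_def[abs_def] G_def[abs_def] by (rule wg_diff[OF mY(1) wP])
   have [measurable]: "Y : bm" "P : bm" "u : bm" "G : bm"
    "U : sets borel" "cball a r : sets borel" "cball a r' : sets borel" "ball a R : sets borel" "et : bm" "grad et : bm"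
    using wg_measurable[OF mY(1)] wg_measurable[OF wP] wg_measurable[OF wu] U smooth_measurable[OF et(1)] smooth_grad_measurable[OF et(1)] by auto
   have NG: "Np q G<oo" unfolding G_def[abs_def] by (rule le_less_trans[OF Np_diff]) (use mY NP q0 in "auto simp: ennreal_mult_less_top")
   define B where "B = ball a (R - norm h)"
   have B: "x : U" "x+h : U" if "x : B" for x
   proof -
    have "dist a (x+h)<=dist a x + norm h" using norm_triangle_ineq4[of "a-x" h] by (simp add: dist_norm diff_diff_eq)
    hence "x+h : ball a R" "x : ball a R" using that norm_ge_zero[of h] unfolding B_def mem_ball by linarith+
    thus "x : U" "x+h : U" using S by auto
   qed
   have wB: "wg B (%x. u (x+h) - u x) (%x. G (x+h) - G x)" by (intro wg_diff wg_translate[OF wu] wg_mono[OF wu]) (use B in auto)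
   have tf: "test_function B et" by (rule test_functionI[OF et(1), of "cball a r'"]) (use et(5) r' in "auto simp: B_def")
   let ?z = "%x h. u (x+h) - u x"
   define ph where "ph x = et x * (?z x h)" for x
   define Ph where "Ph x = et x *R (G (x+h) - G x)+(?z x h) *R grad et x" for x
   have wph: "wg UNIV ph Ph" unfolding ph_def[abs_def] Ph_def[abs_def] by (rule wg_cutoff[OF wB tf])
   have zph: "ph x = 0" "Ph x = 0" if "x ~: cball a r'" for x using that et(5) get by (auto simp: ph_def Ph_def)
   have [measurable]: "Ph : bm" using wg_measurable[OF wph] by simp
   let ?b = "cball a r'"
   let ?f = "NN x:ball a R. norm (G x) powr q"
   let ?t = "%x h. abs (?z x h) powr q"
   let ?k = "NN x:?b. ?t x h"
   have Tu: "?k <= en (norm h powr q) * ?f"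
   proof (rule wg_translation_estimate[OF wu _ _ par(3), where de = "(R-r' - norm h)/2"])
    fix x z :: 'a and s :: real assume x: "x : cball a r'" and s: "0<=s" "s<=1" and z: "norm z<=(R-r' - norm h)/2"
    have "dist a (x+s *R h+z)<=dist a x + norm (s *R h+z)" using norm_triangle_ineq4[of "a-x" "s *R h+z"] by (simp add: dist_norm diff_diff_eq add.assoc)
    moreover have "norm (s *R h+z)<=norm h + (R-r' - norm h)/2" by (rule order_trans[OF norm_triangle_ineq]) (use s z h0 in "auto intro!: add_mono mult_left_le_one_le")
    moreover have "dist a x<=r'" using x by simp
    moreover have "r' + norm h + (R-r' - norm h)/2<R" using r' by (simp add: field_simps)
    ultimately show "x+s *R h+z : ball a R" unfolding mem_ball by linarith
   next
    show "0<(R-r' - norm h)/2" using r' by simp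
   qed (use S in auto)
   have IG: "?f<=Np q G" unfolding Np_def by (intro nn_integral_mono) (auto simp: indicator_def)
   have NPh: "Np q Ph<oo"
   proof -
    let ?x = "Np q (%x. et x *R (G (x+h) - G x))"
    have "?x<=Np q (%x. G (x+h) - G x)" unfolding Np_def using et(2,3) q0 by (intro nn_integral_mono ennreal_leI powr_mono2) (auto intro: mult_left_le_one_le)
    also have "...<=en (2 powr q) * (Np q (%x. G (x+h)) + Np q G)" by (rule Np_diff) (use q0 in auto)
    also have "...<oo" using NG by (simp add: Np_translate ennreal_mult_less_top)
    finally have 1: "?x<oo" .
    let ?u = "Np q (%x. (?z x h) *R grad et x)"
    have "?u<=(NN x. en (ka powr q) * (ind ?b x * en (?t x h)))" unfolding Np_def
    proof (rule nn_integral_mono)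
     fix x
     have "(abs (?z x h) * norm (grad et x)) powr q<=ka powr q * abs (?z x h) powr q" using et(6)[of x] q0 by (simp add: powr_mult mult.commute mult_right_mono powr_mono2)
     thus "en (norm ((?z x h) *R grad et x) powr q)<=en (ka powr q) * (ind ?b x * en (?t x h))" using get[of x] by (cases "x : cball a r'") (auto simp: ennreal_mult'[symmetric] intro: ennreal_leI)
    qed
    also have "... = en (ka powr q) * ?k" by (rule nn_integral_cmult) measurable
    also have "...<oo" using le_less_trans[OF order_trans[OF Tu mult_left_mono[OF IG]]] NG by (simp add: ennreal_mult_less_top)
    finally have 2: "?u<oo" .
    show ?thesis unfolding Ph_def[abs_def] by (rule le_less_trans[OF Np_add]) (use 1 2 q0 in "auto simp: ennreal_mult_less_top")
   qed
   obtain A where A: "rep U (%x. grad (H x) (Y x)) A" using rep_ex[OF U(2) integrand_measurable(2)[OF H U(1-3) rep_measurable[OF U(2) rep_refl[of Y]]]] mY(2) by auto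
   have [measurable]: "A : bm" using A by (simp add: rep_def)
   have u0: "ae x. x : U --> 0<=u x" using mY(4) by (auto simp: u_def)
   have zS: "ph x = 0 & Ph x = 0" if "x ~: S" for x using zph[of x] inR(1)[of x] subsetD[OF S(1), of x] that by blast
   have cons1: "ae x. x : U --> ps x<=y x + ph x" using u0 AE_translate[OF u0, of h]
   proof eventually_elim
    case (elim x)
    show ?case
    proof (cases "x : cball a r'")
     case True
     have "0<=(1 - et x) * u x + et x * u (x+h)" using elim inU[OF True] et(2,3)[of x] by (intro add_nonneg_nonneg mult_nonneg_nonneg) auto
     thus ?thesis by (simp add: ph_def u_def algebra_simps)
    qed (use elim zph in "auto simp: u_def")
   qed
   note VI1 = variational_inequality[OF H U less_imp_le[OF par(1)] par(2,3) m A wph zS NPh cons1]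
   define Ph2 where "Ph2 x = (-1) *R Ph (x + - h)" for x
   have w2: "wg UNIV (%x. (-1) * ph (x + - h)) Ph2" unfolding Ph2_def[abs_def] by (intro wg_cmult wg_translate[OF wph]) auto
   have z2: "(-1) * ph (x + - h) = 0 & Ph2 x = 0" if "x ~: S" for x using zph[of "x + - h"] inR(2)[of "x + - h"] subsetD[OF S(1), of x] that by (cases "x + - h : cball a r'") (auto simp: Ph2_def simp del: mem_cball mem_ball)
   have N2: "Np q Ph2<oo" using NPh Np_translate[of Ph q "- h"] by (simp add: Ph2_def[abs_def] Np_minus)
   have cons2: "ae x. x : U --> ps x<=y x + (-1) * ph (x + - h)" using u0 AE_translate[OF u0, of "- h"]
   proof eventually_elim
    case (elim x)
    show ?case
    proof (cases "x + - h : cball a r'")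
     case True
     have "0<=(1 - et (x + - h)) * u x + et (x + - h) * u (x + - h)" using elim inU[OF True] et(2,3)[of "x + - h"] by (intro add_nonneg_nonneg mult_nonneg_nonneg) auto
     thus ?thesis by (simp add: ph_def u_def algebra_simps)
    qed (use elim zph in "auto simp: u_def")
   qed
   note VI2 = variational_inequality[OF H U less_imp_le[OF par(1)] par(2,3) m A w2 z2 N2 cons2]
   define g where "g x = (A (x+h) - A x) .* Ph x" for x
   have eq2: "A (x+h) .* Ph2 (x+h) = - (A (x+h) .* Ph x)" for x by (simp add: Ph2_def)
   have i2: "Lint (%x. A (x+h) .* Ph x)" using integrable_translate[OF VI2(1), of h] by (simp add: eq2)
   have "(LL x. A (x+h) .* Ph2 (x+h)) = (LL x. A x .* Ph2 x)" by (rule integral_translate[of "%x. A x .* Ph2 x"]) (simp add: Ph2_def)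
   hence "(LL x. A (x+h) .* Ph x)<=0" using VI2(2) by (simp add: eq2)
   hence g: "Lint g" "(LL x. g x)<=0" using VI1 i2 by (auto simp: g_def[abs_def] inner_diff_left)
   define E where "E x = (1 + norm (Y x) + norm (Y (x+h))) powr q" for x
   let ?p = "%x. abs (?z x h) / norm h"
   let ?y = "%x. norm (P (x+h) - P x) / t"
   define b where "b x = c*(1+ka)*t*(ind ?b x * (E x + ?y x powr q + ?p x powr q))" for x
   have b0: "0<=b x" for x using c ka0 t0 by (simp add: b_def E_def)
   have AEA: "ae x. x : U --> A x = grad (H x) (Y x)" using A by (simp add: rep_def)
   let ?d = "NN x. ind ?b x * en (E x) + ind ?b x * en (?y x powr q) + ind ?b x * en (?p x powr q)"
   let ?o = "%x h. nu * Dp mu p (Y (x+h)) (Y x)"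
   let ?e = "NN x. en (et x * ?o x h)"
   let ?g = "NN x:?b. ?p x powr q"
   let ?i = "NN x:?b. ?y x powr q"
   let ?m = "en (c*(1+ka)*t) * (en ?c * (J + en N))"
   let ?q = "NN x:?b. E x"
   let ?r = "2 * 4 powr q"
   have "ae x. et x * ?o x h<=g x + b x" using AEA AE_translate[OF AEA, of h]
   proof eventually_elim
    case (elim x)
    show ?case
    proof (cases "x : cball a r'")
     case True
     let ?w = "(Y (x+h) - Y x)-(P (x+h) - P x)"
     have "et x * ?o x h<=(grad (H (x+h)) (Y (x+h)) - grad (H x) (Y x)) .* (et x *R ?w+(?z x h) *R grad et x) +
      5 * 2 powr q * L*(1+ka) * norm (x+h-x) powr al * ((1 + norm (Y x) + norm (Y (x+h))) powr q + (norm (P (x+h) - P x) / norm (x+h-x) powr al) powr q + (abs (?z x h) / norm (x+h-x)) powr q)"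
      by (rule obstacle_pointwise_estimate[OF H]) (use inU[OF True] U par h h0 al et in auto)
     moreover have "?w = G (x+h) - G x" by (simp add: G_def)
     ultimately show ?thesis using elim inU[OF True] True by (simp add: g_def b_def E_def Ph_def c_def t_def)
    qed (use et(5) zph b0[of x] in "auto simp: g_def")
   qed
   hence "?e<=(NN x. en (b x))" using nn_integral_le_add_integral[OF g(1), of "%x. et x * (nu * Dp mu p (Y (x+h)) (Y x))" b] g(2) et(2) par b0 by (simp add: ennreal_neg Dp_nonneg Dp_def[abs_def] b_def[abs_def] E_def)
   also have "(NN x. en (b x)) = en (c*(1+ka)*t) * ?d" using c ka0 t0 by (subst nn_integral_cmult[symmetric])
    (auto simp: b_def E_def indicator_def ennreal_mult'[symmetric] ennreal_plus[symmetric] simp del: ennreal_plus intro!: nn_integral_cong)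
   also have "?d = ?q+?i +?g" by (simp add: nn_integral_add E_def)
   also have "...<=en ?r * J + en N + en (4 powr q) * J"
   proof (intro add_mono)
    let ?h = "%x h. 1 + norm (Y (x+h)) powr q + norm (P (x+h)) powr q"
    let ?s = "%x h. ind (ball a R) x * en (?a x) + ind (ball a R) (x+h) * en (?h x h)"
    have "?q <= (NN x. en (4 powr q) * ?s x h)"
    proof (rule nn_integral_mono)
     fix x
     show "ind ?b x * en (E x)<=en (4 powr q) * ?s x h"
     proof (cases "x : cball a r'")
      case True
      have "E x<=4 powr q * (1 + norm (Y x) powr q + norm (Y (x+h)) powr q)" unfolding E_def by (rule three_powr_le) (use par in auto)
      also have "...<=4 powr q * (?a x+?h x h)" by (intro mult_left_mono) auto
      finally have "en (E x)<=en (4 powr q) * en (?a x+?h x h)" by (subst ennreal_mult'[symmetric]) (auto intro: ennreal_leI)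
      thus ?thesis using True inR[OF True] by (subst (asm) ennreal_plus) auto
     qed simp
    qed
    also have "... = en (4 powr q) * (J+J)" using nn_integral_translate[of "%x. ind (ball a R) x * en (1 + norm (Y x) powr q + norm (P x) powr q)" h] by (simp add: nn_integral_cmult nn_integral_add J_def)
    also have "... = en ?r * J" by (simp add: ennreal_mult' mult_ac flip: mult_2)
    finally show "?q<=en ?r * J" .
    have "?i = en (t powr (- q)) * (NN x:?b. norm (P (x+h) - P x) powr q)" using t0 by (subst nn_integral_cmult[symmetric], measurable)
     (auto simp: indicator_def powr_divide powr_minus_divide ennreal_mult'[symmetric] intro!: nn_integral_cong)
    also have "...<=en (t powr (- q)) * en (N * norm h powr (al*q))" using hP unfolding r'_def by (intro mult_left_mono) auto
    also have "... = en N" using h0 by (simp add: t_def powr_powr ennreal_mult'[symmetric] powr_minus_divide)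
    finally show "?i<=en N" .
    have "?g = en (norm h powr (- q)) * ?k" using h0 by (subst nn_integral_cmult[symmetric], measurable)
     (auto simp: indicator_def powr_divide powr_minus_divide ennreal_mult'[symmetric] intro!: nn_integral_cong)
    also have "...<=en (norm h powr (- q)) * (en (norm h powr q) * ?f)" by (intro mult_left_mono Tu) auto
    also have "... = ?f" using h0 by (simp add: mult.assoc[symmetric] ennreal_mult'[symmetric] powr_minus)
    also have "...<=(NN x. en (4 powr q) * (ind (ball a R) x * en (?a x)))"
    proof (rule nn_integral_mono)
     fix x
     have "norm (G x) powr q<=2 powr q * (norm (Y x) powr q + norm (P x) powr q)" unfolding G_def using q0 by (rule norm_diff_powr_le)
     also have "...<=4 powr q * ?a x" using q0 by (intro mult_mono powr_mono2) auto
     finally show "ind (ball a R) x * en (norm (G x) powr q)<=en (4 powr q) * (ind (ball a R) x * en (?a x))" by (auto simp: indicator_def ennreal_mult'[symmetric] simp del: ennreal_plus intro: ennreal_leI)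
    qed
    also have "... = en (4 powr q) * J" unfolding J_def by (rule nn_integral_cmult) measurable
    finally show "?g<=en (4 powr q) * J" .
   qed
   also have "en ?r * J + en N + en (4 powr q) * J = en ?c * J + en N"
   proof -
    have "en ?c = en ?r + en (4 powr q)" by (subst ennreal_plus[symmetric]) auto
    thus ?thesis by (simp only: distrib_right add_ac)
   qed
   also have "...<=en ?c * J + en ?c * en N"
   proof -
    have "1<=(4::real) powr q" using q0 by (intro ge_one_powr_ge_zero) auto
    hence "N<=3 * 4 powr q * N" using N by (simp add: mult_le_cancel_right1)
    thus ?thesis by (intro add_left_mono) (simp add: ennreal_mult'[symmetric] ennreal_leI)
   qed
   also have "... = en ?c * (J + en N)" by (simp add: distrib_left)
   finally have "?e<=?m" by (simp add: mult_left_mono)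
   hence le: "en (1/nu) * ?e<=en (1/nu) * ?m" by (rule mult_left_mono) simp
   have "?j<=(NN x. en (1/nu) * en (et x * ?o x h))" using et(4) par by (intro nn_integral_mono) (auto simp: indicator_def ennreal_mult'[symmetric])
   also have "... = en (1/nu) * ?e" by (rule nn_integral_cmult) (simp add: Dp_def[abs_def])
   also note le
   also have "en (1/nu) * ?m = en (1/nu*(c*(1+ka)*t*?c)) * (J + en N)" using par c ka0 t0 by (simp add: mult.assoc[symmetric] ennreal_mult'[symmetric] del: ennreal_plus)
   also have "...<=en (C*?l*t) * (J + en N)"
   proof (intro mult_right_mono ennreal_leI)
    have "1+ka = 1+2*C0*(1/(R-r))" using r by (simp add: ka_def r'_def field_simps)
    also have "...<=(1+2*C0)*?l" using C0 r by (simp add: algebra_simps)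
    finally have "c*(1+ka)*?c<=c*((1+2*C0)*?l)*?c" using c by (intro mult_right_mono mult_left_mono) auto
    also have "...<=?n*?l" using r by (simp add: algebra_simps)
    finally have "c*(1+ka)*?c*(t/nu)<=?n*?l*(t/nu)" using t0 par by (intro mult_right_mono) auto
    thus "1/nu*(c*(1+ka)*t*?c)<=C*?l*t" by (simp add: C_def mult_ac)
   qed simp
   finally show ?thesis by (simp add: t_def)
  qed
  thus ?case by (simp add: J_def)
 qed
qed

section \<open>Uniform higher integrability of regular minimisers\<close>

lemma smooth_lipschitz:
 assumes f: "smooth f" and k: "!!z. norm (grad f z)<=k"
 shows "abs (f (x+h) - f x)<=k * norm h"
proof -
 have "EX z. 0<z & z<1 & f (x+1 *R h) - f (x+0 *R h) = (1-0)*(grad f (x+z *R h) .* h)" by (rule MVT2) (use GDERIV_along_line[OF smooth_GDERIV[OF f]] in auto)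
 then obtain z where "f (x+h) - f x = grad f (x+z *R h) .* h" by auto
 hence "abs (f (x+h) - f x)<=norm (grad f (x+z *R h)) * norm h" by (simp add: Cauchy_Schwarz_ineq2)
 also have "...<=k * norm h" by (intro mult_right_mono k) auto
 finally show ?thesis .
qed

lemma hole_filling:
 fixes k :: real
 assumes k: "0<k"
 obtains c where "0<c" "!!f A B r0 r1. 0<=A ==> r0<r1 ==> (!!r. r0<=r ==> r<=r1 ==> f r<=B) ==>
  (!!r R. r0<=r ==> r<R ==> R<=r1 ==> f r<=f R / 2+A * (1+1/(R-r)^2) powr k) ==>
  f r0<=c*A * (1+1/(r1-r0)^2) powr k"
proof -
 define ta where "ta = (3/4) powr (1/(2*k))"
 have ta: "0<ta" "ta<1" using k powr_less_mono2[of "1/(2*k)" "3/4" 1] by (auto simp: ta_def)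
 let ?a = "1/(1-ta)^2"
 define c where "c = 3 * ?a powr k"
 have c: "0<c" using ta by (simp add: c_def)
 show ?thesis
 proof (rule that[OF c])
  fix f :: "real => real" and A B r0 r1 :: real
  assume A: "0<=A" and r: "r0<r1" and B: "!!r. r0<=r ==> r<=r1 ==> f r<=B"
   and f: "!!r R. r0<=r ==> r<R ==> R<=r1 ==> f r<=f R / 2+A * (1+1/(R-r)^2) powr k"
  define D where "D = r1-r0"
  have D: "0<D" using r by (simp add: D_def)
  define s where "s i = r1-ta ^ i * D" for i :: nat
  let ?b = "1+1/D^2"
  define T where "T = A * ?b powr k * ?a powr k"
  have T: "0<=T" using A by (simp add: T_def)
  have s: "r0<=s i" "s i<s (Suc i)" "s i<=r1" for i
  proof -
   have "ta ^ i * D<=1*D" using ta D by (intro mult_right_mono power_le_one) auto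
   thus "r0<=s i" by (simp add: s_def D_def)
   show "s i<s (Suc i)" "s i<=r1" using ta D by (auto simp: s_def)
  qed
  have step: "f (s i)<=f (s (Suc i)) / 2+T*(4/3) ^ i" for i
  proof -
   have d: "s (Suc i) - s i = (1-ta)*ta ^ i * D" by (simp add: s_def algebra_simps)
   let ?c = "%i. 1 + 1/(s (Suc i) - s i)^2"
   have "?c i<=?b*?a*(1/(ta ^ i)^2)"
   proof -
    have a: "1<=?a" using ta by (simp add: power_le_one)
    have b: "1<=1/(ta ^ i)^2" using ta by (simp add: power_le_one)
    define X where "X = ?a*(1/(ta ^ i)^2)"
    have "1*1<=X" unfolding X_def using a b by (intro mult_mono) auto
    hence "1+(1/D^2)*X<=?b*X" by (simp only: distrib_right mult_1_left add_le_cancel_right)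
    hence "1+(1/D^2)*(?a*(1/(ta ^ i)^2))<=?b*(?a*(1/(ta ^ i)^2))" by (simp only: X_def)
    thus ?thesis by (simp add: d power_mult_distrib mult_ac)
   qed
   hence "?c i powr k<=(?b*?a*(1/(ta ^ i)^2)) powr k" using k by (intro powr_mono2) (auto intro: add_nonneg_nonneg)
   also have "... = ?b powr k * ?a powr k * (1/(ta ^ i)^2) powr k" by (simp only: powr_mult)
   also have "(1/(ta ^ i)^2) powr k = (4/3) ^ i"
   proof -
    have "(ta ^ i)^2 = ta powr (2*i)" using ta by (simp add: powr_realpow[symmetric] powr_powr mult.commute flip: power_mult)
    hence "((ta ^ i)^2) powr k = ta powr (2*i*k)" by (simp add: powr_powr)
    also have "... = (3/4) powr real i" unfolding ta_def using k by (simp add: powr_powr)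
    finally have "((ta ^ i)^2) powr k = (3/4) ^ i" by (simp add: powr_realpow)
    hence "(1/(ta ^ i)^2) powr k = 1/(3/4) ^ i" by (simp add: powr_divide)
    thus ?thesis by (simp add: power_divide)
   qed
   finally have "A * ?c i powr k<=A*(?b powr k * ?a powr k * (4/3) ^ i)" using A by (rule mult_left_mono)
   thus ?thesis using f[OF s(1)[of i] s(2)[of i] s(3)[of "Suc i"]] by (simp add: T_def mult_ac)
  qed
  have bd: "f (s 0)<=B*(1/2) ^ m + 3*T" for m
  proof -
   have "f (s 0)<=f (s m) * (1/2) ^ m + T*(\<Sum>i<m. (2/3) ^ i)"
   proof (induction m)
    case (Suc m)
    have "f (s m) * (1/2) ^ m<=(f (s (Suc m)) / 2+T*(4/3) ^ m)*(1/2) ^ m" by (intro mult_right_mono step) auto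
    also have "... = f (s (Suc m)) * (1/2) ^ Suc m + T*(2/3) ^ m" by (simp add: algebra_simps flip: power_mult_distrib)
    finally show ?case using Suc by (simp add: algebra_simps)
   qed simp
   also have "...<=B*(1/2) ^ m + T*3"
   proof (intro add_mono mult_right_mono mult_left_mono B s T)
    have "(\<Sum>i<m. (2/3 :: real) ^ i) = 3*(1-(2/3) ^ m)" by (simp add: geometric_sum)
    thus "(\<Sum>i<m. (2/3 :: real) ^ i)<=3" by simp
   qed auto
   finally show ?thesis by simp
  qed
  have "(%m. B * (1/2) ^ m + 3*T) ----> B * 0+3*T" by (intro tendsto_intros LIMSEQ_power_zero) auto
  hence "f (s 0)<=B*0+3*T" by (rule LIMSEQ_le_const) (use bd in auto)
  thus "f r0<=c*A * (1+1/(r1-r0)^2) powr k" by (simp add: s_def D_def T_def c_def mult_ac)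
 qed
qed

lemma V_measurable[measurable]:
 "Y : borel_measurable M ==> (%x. V mu p (Y x)) : borel_measurable M" unfolding V_def by measurable

lemma cutoff_difference:
 fixes nu L p q al :: real
 assumes par: "0<nu" "0<=L" "1<p" "p<=q" and al: "0<al" "al<=1"
 obtains C where "0<C" "!!Om H mu U S ps y (Y :: 'a::euclidean_space => 'a) P a r R N j.
  pq_integrand Om H nu L mu al p q ==> 0<=mu ==> mu<=1 ==> U<=Om ==> U : sets borel ==> Om : sets borel ==> bounded U ==>
  obstacle_minimiser H q U S ps y Y ==> wg U ps P ==> Np q P<oo ==> 0<r ==> r<R ==> ball a R<=S ==> ball a R<=U ==>
  0<=N ==> 0<=j ==>
  (!!h. norm h<=(R-r)/8 ==> (NN x:ball a R. norm (P (x+h) - P x) powr q)<=en (N * norm h powr (al*q))) ==>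
  (NN x:ball a R. 1 + norm (Y x) powr q + norm (P x) powr q)<=en j ==>
  EX W. W : bm & (ALL x:cball a r. W x = V mu p (Y x)) &
   (ALL x. norm (W x)<=ind (ball a R) x * norm (V mu p (Y x))) &
   (ALL h. Np 2 (%x. W (x+h) - W x)<=en (C*(1+1/(R-r)^2)*(j+N) * norm h powr al))"
proof -
 have q1: "1<=q" using par by simp
 show ?thesis
 proof (rule smooth_cutoff[where 'a='a], goal_cases)
  case (1 C0)
  note C0 = 1
  show ?thesis
  proof (rule obstacle_a_priori[OF par(1,2) q1 al, where 'a='a], goal_cases)
   case (1 C1)
   note C1 = 1(1) and ap = 1(2)
   define Cv where "Cv = (1 + max 1 ((p-2)/2))^2 * 4 powr abs ((p-2) / 2)"
   have Cv: "0<=Cv" by (simp add: Cv_def)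
   define c2 where "c2 = 2 * 2 powr p"
   have c2: "0<c2" by (simp add: c2_def)
   define C where "C = 4*Cv*C1+8*C0^2 * c2+40*c2"
   have C: "0<C" using Cv C1 c2 by (simp add: C_def add_nonneg_pos)
   show ?thesis
   proof (rule that[OF C], goal_cases)
    case (1 Om H mu U S ps y Y P a r R N j)
    note H = 1(1) and mu = 1(2,3) and U = 1(4-7) and m = 1(8) and wP = 1(9) and NP = 1(10) and r = 1(11,12) and S = 1(13,14) and N = 1(15) and j = 1(16) and hP = 1(17) and J = 1(18)
    have wY: "wg U y Y" using m by (simp add: obstacle_minimiser_def)
    define d where "d = R-r"
    have d: "0<d" using r by (simp add: d_def)
    define s where "s = (r + R)/2"
    have s: "r<s" "s<R" "0<s" "R-s = d/2" "s-r = d/2" using r by (auto simp: s_def d_def field_simps)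
    define ka where "ka = C0/(s-r)"
    let ?p = "cball a s"
    obtain et where et: "smooth et" "!!x. 0<=et x" "!!x. et x<=1" "!!x. x : cball a r ==> et x = 1"
     "!!x. x ~: ?p ==> et x = 0" "!!x. norm (grad et x)<=ka" using C0(2)[OF r(1) s(1), of a] unfolding ka_def by blast
    define v where "v x = V mu p (Y x)" for x
    have [measurable]: "Y : bm" "v : bm" "et : bm" "?p : sets borel" "ball a R : sets borel" "P : bm" using wg_measurable[OF wY] wg_measurable[OF wP] smooth_measurable[OF et(1)] by (auto simp: v_def[abs_def])
    define W where "W x = et x *R v x" for x
    have [measurable]: "W : bm" unfolding W_def[abs_def] by measurable
    have Wle: "norm (W x)<=ind (ball a R) x * norm (v x)" for x
    proof (cases "x : ball a R")
     case True thus ?thesis using et(2,3)[of x] by (simp add: W_def mult_left_le_one_le)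
    next
     case False
     hence "x ~: ?p" using s by auto
     thus ?thesis using et(5)[of x] by (simp add: W_def)
    qed
    define Q where "Q = 1+1/d^2"
    have Q: "1<=Q" "2/d<=Q" "1/d^2<=Q"
    proof -
     have "0<=(1-1/d)^2" by simp
     thus "2/d<=Q" by (simp add: Q_def power2_diff power_one_over)
    qed (auto simp: Q_def)
    let ?a = "NN x:ball a R. norm (v x) powr 2"
    let ?d = "%x. 1 + norm (Y x) powr q + norm (P x) powr q"
    let ?l = "NN x:ball a R. ?d x"
    have v2: "?a<=en (c2*j)"
    proof -
     have "?a<=(NN x. en c2 * (ind (ball a R) x * en (?d x)))"
     proof (rule nn_integral_mono)
      fix x
      have "norm (Y x) powr p<=1 + norm (Y x) powr q"
      proof (cases "norm (Y x)<=1")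
       case True thus ?thesis using powr_le1[of p "norm (Y x)"] par by (simp add: add_increasing2)
      next
       case False thus ?thesis using powr_mono[of p q "norm (Y x)"] par by (simp add: add_increasing)
      qed
      hence "norm (v x) powr 2<=2 powr p * (1+(1 + norm (Y x) powr q))" using V_le_power[OF par(3) mu, of "Y x"] by (auto simp: v_def intro: order_trans)
      also have "...<=c2*?d x" by (simp add: c2_def algebra_simps)
      finally show "ind (ball a R) x * en (norm (v x) powr 2)<=en c2 * (ind (ball a R) x * en (?d x))" using c2 by (auto simp: indicator_def ennreal_mult'[symmetric] simp del: ennreal_plus intro: ennreal_leI)
     qed
     also have "... = en c2 * ?l" by (rule nn_integral_cmult) measurable
     also have "...<=en c2 * en j" by (intro mult_left_mono J) simp
     finally show ?thesis using c2 by (simp add: ennreal_mult'[symmetric])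
    qed
    let ?n = "%h. norm h powr al"
    let ?g = "%h. C * Q*(j+N) * ?n h"
    have main: "Np 2 (%x. W (x+h) - W x)<=en (?g h)" for h
    proof (cases "norm h<=min 1 (d/8)")
     case True
     hence h: "norm h<=1" "norm h<=d/8" by auto
     let ?c = "%h. NN x:?p . Dp mu p (Y (x+h)) (Y x)"
     let ?f = "%h. C1 * (2*Q) * ?n h * (j+N)"
     have "?c h <= en (C1*(1+1/(R-s)) * ?n h) * (?l + en N)"
     proof (rule ap[OF H U m wP NP s(3,2) S N h(1)])
      show "norm h<=(R-s)/4" using h s by simp
      let ?i = "%h. NN x:cball a ((s + R)/2). norm (P (x+h) - P x) powr q"
      have "?i h<=(NN x:ball a R. norm (P (x+h) - P x) powr q)" using s by (intro nn_integral_mono) (auto simp: indicator_def)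
      also have "...<=en (N * norm h powr (al*q))" by (rule hP) (use h in "simp add: d_def")
      finally show "?i h<=en (N * norm h powr (al*q))" .
     qed
     also have "...<=en (C1*(1+1/(R-s)) * ?n h) * (en j + en N)" by (intro mult_left_mono add_right_mono J) simp
     also have "... = en (C1*(1+2/d) * ?n h * (j+N))" unfolding s(4) using C1 d j N by (simp add: ennreal_mult' ennreal_plus)
     also have "...<=en (?f h)" using Q C1 j N by (intro ennreal_leI mult_right_mono mult_left_mono) auto
     finally have D: "?c h<=en (?f h)" .
     let ?h = "%x h. ind (?p) x * en (Dp mu p (Y (x+h)) (Y x))"
     let ?j = "%h. 2 * (ka * norm h)^2"
     let ?o = "%x h. ind (ball a R) (x+h) * en (norm (v (x+h)) powr 2)"
     let ?k = "%h. NN x. ?o x h"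
     let ?m = "%h. 2 * Cv*?f h+2*(ka * norm h)^2 * (c2*j)"
     have "Np 2 (%x. W (x+h) - W x)<=(NN x. en (2*Cv) * ?h x h + en (?j h) * (?o x h))" unfolding Np_def
     proof (rule nn_integral_mono)
      fix x
      have eq: "W (x+h) - W x = et x *R (v (x+h) - v x)+(et (x+h) - et x) *R v (x+h)" by (simp add: W_def algebra_simps)
      have sq: "(norm (A+B))^2<=2*(norm A)^2 + 2*(norm B)^2" for A B :: 'a using sum_squares_bound[of "norm A" "norm B"] norm_triangle_ineq[of A B] power_mono[of "norm (A+B)" "norm A + norm B" 2] by (simp add: power2_sum)
      let ?e = "%h. ind (?p) x * (Cv * Dp mu p (Y (x+h)) (Y x))"
      have 1: "(norm (et x *R (v (x+h) - v x)))^2<=?e h"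
      proof (cases "x : cball a s")
       case True
       have "(norm (et x *R (v (x+h) - v x)))^2<=(norm (v (x+h) - v x))^2" using et(2,3)[of x] by (intro power_mono) (auto simp: mult_left_le_one_le)
       also have "...<=Cv * Dp mu p (Y (x+h)) (Y x)" unfolding v_def Cv_def by (rule V_difference[OF par(3) mu(1)])
       finally show ?thesis using True by simp
      qed (use et(5) in simp)
      let ?b = "%h. ind (ball a R) (x+h) * ((ka * norm h)^2 * (norm (v (x+h)))^2)"
      have 2: "(norm ((et (x+h) - et x) *R v (x+h)))^2<=?b h"
      proof (cases "x+h : ball a R")
       case True
       have "(abs (et (x+h) - et x) * norm (v (x+h)))^2<=(ka * norm h * norm (v (x+h)))^2" by (intro power_mono mult_right_mono smooth_lipschitz[OF et(1,6)]) auto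
       thus ?thesis using True by (simp add: power_mult_distrib)
      next
       case False
       have "dist a (x+h)<=dist a x + norm h" using norm_triangle_ineq4[of "a-x" h] by (simp add: dist_norm diff_diff_eq)
       hence "x+h ~: ?p" "x ~: ?p" using False s h d by auto
       thus ?thesis using et(5) by simp
      qed
      have "(norm (W (x+h) - W x))^2<=2*?e h+2*?b h" unfolding eq by (rule order_trans[OF sq]) (use 1 2 in linarith)
      hence "en ((norm (W (x+h) - W x))^2)<=en (2*?e h) + en (2*?b h)" using Cv by (subst ennreal_plus[symmetric]) (auto intro: ennreal_leI simp: Dp_nonneg simp del: ennreal_plus)
      also have "en (2*?e h) = en (2*Cv) * ?h x h" using Cv by (auto simp: indicator_def ennreal_mult'[symmetric] mult.assoc)
      finally show "en (norm (W (x+h) - W x) powr 2)<=en (2*Cv) * ?h x h +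
       en (?j h) * (?o x h)" by (auto simp: indicator_def ennreal_mult'[symmetric] mult.assoc)
     qed
     also have "... = en (2*Cv) * ?c h + en (?j h) * ?k h" by (simp add: nn_integral_add nn_integral_cmult Dp_def del: powr_numeral)
     also have "?k h = ?a" by (rule nn_integral_translate[of "%x. ind (ball a R) x * en (norm (v x) powr 2)"]) measurable
     also have "en (2*Cv) * ?c h + en (?j h) * ?a <= en (2*Cv) * en (?f h) + en (?j h) * en (c2*j)" by (intro add_mono mult_left_mono D v2) auto
     also have "... = en (?m h)" using Cv C1 Q j N c2 by (subst ennreal_plus) (auto simp: ennreal_mult'[symmetric] simp del: ennreal_plus)
     also have "...<=en (?g h)"
     proof (rule ennreal_leI)
      have "(norm h)^2<=?n h" using powr_mono'[of al 2 "norm h"] h al by simp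
      moreover have "ka\<^sup>2<=4*C0^2 * Q" using mult_left_mono[OF Q(3), of "4*C0^2"] by (simp add: ka_def s power_divide power_mult_distrib mult.commute[of 4])
      ultimately have "(ka * norm h)^2<=4*C0^2 * Q * ?n h" unfolding power_mult_distrib using Q by (intro mult_mono) auto
      hence "2*(ka * norm h)^2 * (c2*j)<=2*(4*C0^2 * Q * ?n h)*(c2*(j+N))" using c2 j N Q by (intro mult_mono mult_left_mono) auto
      moreover have "0<=40*c2*Q*(j+N) * ?n h" using c2 Q j N by simp
      ultimately show "?m h<=?g h" by (simp add: C_def algebra_simps)
     qed
     finally show ?thesis .
    next
     case False
     define h1 where "h1 = min 1 (d/8)"
     have h1: "0<h1" "h1<=1" "h1<norm h" using d False by (auto simp: h1_def)
     have "Np 2 (%x. W (x+h) - W x)<=en (2 powr 2) * (Np 2 (%x. W (x+h)) + Np 2 W)" by (rule Np_diff) auto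
     also have "Np 2 (%x. W (x+h)) = Np 2 W" by (rule Np_translate) measurable
     also have "en (2 powr 2) * (Np 2 W + Np 2 W) = en 8 * Np 2 W" by (simp add: mult_2[symmetric] mult.assoc[symmetric] flip: ennreal_mult' ennreal_numeral)
     also have "...<=en 8 * en (c2*j)"
     proof (intro mult_left_mono order_trans[OF _ v2])
      show "Np 2 W<=?a" unfolding Np_def
      proof (rule nn_integral_mono)
       fix x show "en (norm (W x) powr 2)<=ind (ball a R) x * en (norm (v x) powr 2)" using Wle[of x] by (cases "x : ball a R") (auto intro!: ennreal_leI power_mono)
      qed
     qed simp
     also have "... = en (8*(c2*j))" by (simp add: ennreal_mult')
     also have "...<=en (?g h)"
     proof (rule ennreal_leI)
      have "1<=(norm h / h1) powr al" using h1 al by (intro ge_one_powr_ge_zero) auto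
      also have "... = ?n h * (1/h1) powr al" using h1 by (simp add: powr_divide)
      also have "...<=?n h * (1/h1) powr 1" using h1 al by (intro mult_left_mono powr_mono) auto
      also have "(1/h1) powr 1 = 1/h1" using h1 by simp
      also have "1/h1<=5*Q"
      proof (cases "d/8<=1")
       case True
       hence "1/h1 = 4*(2/d)" by (simp add: h1_def min_def)
       thus ?thesis using Q by linarith
      qed (use Q in "simp add: h1_def")
      finally have "1<=?n h * (5*Q)" by (simp add: mult_left_mono)
      hence "8*(c2*j)*1<=8*(c2*(j+N))*(?n h * (5*Q))" using c2 j N by (intro mult_mono mult_left_mono) auto
      also have "... = 40*c2*(Q*(j+N) * ?n h)" by (simp add: mult_ac)
      also have "...<=C*(Q*(j+N) * ?n h)" using Cv C1 c2 Q j N by (intro mult_right_mono) (auto simp: C_def)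
      finally show "8*(c2*j)<=?g h" by (simp add: mult.assoc)
     qed
     finally show ?thesis .
    qed
    show ?case by (rule exI[of _ W]) (use Wle main et(4) in "auto simp: W_def v_def Q_def d_def simp del: mem_cball")
   qed
  qed
 qed
qed

definition absorb_exponent :: "real => real => real => real => real"
 where "absorb_exponent n p q al = (2*q/p-2)/(2+al*2/n-2*q/p)"

lemma emeasure_ball_le:
 assumes "rh<=R0" shows "emeasure lborel (ball (x0::'a::euclidean_space) rh)<=en (measure lborel (cball (0::'a) R0))"
proof -
 have "emeasure lborel (ball x0 rh)<=emeasure lborel (cball x0 R0)" using assms by (intro emeasure_mono) auto
 also have "... = emeasure lborel (cball (0::'a) R0)" by (cases "0<=R0") (auto simp: emeasure_cball)
 also have "... = en (measure lborel (cball (0::'a) R0))" using emeasure_cball_finite[of "0::'a" R0] by (intro emeasure_eq_ennreal_measure) auto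
 finally show ?thesis .
qed

text \<open>
  The level-set estimate with \<open>s = 2\<close> reaches the exponent \<open>2 q / p\<close>, that is, the \<open>L\<^sup>q\<close> norm of the
  gradient occurring on its right-hand side; this is where \<open>q < p (1 + \<alpha> / n)\<close> enters. Choosing the
  level makes the coefficient of that norm \<open>1 / 2\<close>, and hole filling absorbs it.
\<close>

lemma regular_minimiser_estimate:
 fixes nu L p q al si R0 N :: real
 defines "n == real DIM('a::euclidean_space)"
 defines "k == absorb_exponent n p q al"
 assumes n: "2<=n" and par: "0<nu" "0<=L" "1<p" "p<=q" and al: "0<al" "al<=1"
  and q: "q<p*(1+al/n)" and si: "2<=si" "si<2*n/(n-al)" and R0: "0<R0" and N: "0<=N"
 obtains C where "0<C" "!!Om H mu ps y (Y :: 'a => 'a) P x0 rh X.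
  pq_integrand Om H nu L mu al p q ==> 0<=mu ==> mu<=1 ==> ball x0 rh<=Om ==> Om : sets borel ==> 0<rh ==> rh<=R0 ==>
  obstacle_minimiser H q (ball x0 rh) (cball x0 (7*rh/8)) ps y Y ==> wg (ball x0 rh) ps P ==> Np q P<oo ==> 1<=X ==>
  (NN x:ball x0 rh. norm (Y x) powr p + norm (P x) powr q)<=en X ==>
  (!!h. norm h<=rh/16 ==> (NN x:ball x0 (13*rh/16). norm (P (x+h) - P x) powr q)<=en (N * norm h powr (al*q))) ==>
  (NN x:ball x0 (rh/2). norm (V mu p (Y x)) powr si)<=en (C*(X powr (2*(1+al/n*k)) / rh powr (4*(k+2)))) &
  (ALL h. (incr2 (ball x0 (rh/2)) (%x. V mu p (Y x)) h)
   <= en (C*(X powr (2*(1+al/n*k)) / rh powr (4*(k+2))) * norm h powr al))"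
proof -
 define t where "t = 2*q/p"
 define ka where "ka = 2+al*2/n-t"
 have ka: "0<ka" using q par n by (simp add: ka_def t_def field_simps)
 have t: "2<=t" "t<2+al*2 / DIM('a)" using par ka by (auto simp: t_def ka_def n_def field_simps)
 have k: "k = (t-2)/ka" "0<=k" using t ka by (auto simp: k_def absorb_exponent_def t_def ka_def)
 define k1 where "k1 = 1+al/n*k"
 have an: "0<al/n" using al n by simp
 have k1: "1<=k1" using mult_nonneg_nonneg[OF less_imp_le[OF an] k(2)] by (simp add: k1_def)
 show ?thesis
 proof (rule level_set_moment[OF zero_less_numeral al(1) t, where 'b='a], goal_cases)
  case (1 C2)
  note C2 = 1(1) and lsm = 1(2)
  show ?thesis
  proof (rule cutoff_difference[OF par al, where 'a='a], goal_cases)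
   case (1 C3)
   note C3 = 1(1) and cd = 1(2)
   show ?thesis
   proof (rule moment_iteration[OF _ al si(1), where 'a='a and 'b='a], goal_cases)
    case 1 show ?case using n n_def by simp
   next
    case 2 show ?case using si unfolding n_def by simp
   next
    case (3 Ci)
    note Ci = 3(1) and it = 3(2)
    show ?thesis
    proof (rule hole_filling[of "k+1"], goal_cases)
     case 1 show ?case using k by simp
    next
     case (2 c7)
     note c7 = 2(1) and hf = 2(2)
     define m0 where "m0 = measure lborel (cball (0::'a) R0)"
     have m0: "0<=m0" by (simp add: m0_def)
     define c4 where "c4 = 2 powr q * 2 powr (q/p)"
     have c4: "0<c4" by (simp add: c4_def)
     define c5 where "c5 = 2 powr p * (m0+1)"
     have c5: "0<c5" using m0 by (simp add: c5_def)
     define B where "B = 2*c4*C2*C3"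
     have B: "0<B" using c4 C2 C3 by (simp add: B_def)
     define c6 where "c6 = c4*m0+c4 * B powr k * c5 powr k1 + m0+1+N"
     have c6: "0<c6" using m0 N c4 by (simp add: c6_def add_nonneg_pos add_pos_nonneg)
     let ?g = "m0+c7*c6+1+N"
     define c8 where "c8 = C3*?g+c5+1"
     have c8: "0<c8" using C3 m0 c7 c6 N c5 by (simp add: c8_def add_pos_pos add_nonneg_pos)
     let ?i = "2*(k+2)"
     define c9 where "c9 = (R0^2 + 64) powr ?i"
     define C where "C = (Ci*c8^2 + c8)*c9"
     have "0<R0^2 + 64" by (simp add: add_nonneg_pos)
     hence c9: "0<c9" by (simp add: c9_def)
     have C: "0<C" using Ci c8 c9 by (simp add: C_def add_pos_pos)
     show ?thesis
     proof (rule that[OF C], goal_cases)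
      case (1 Om H mu ps y Y P x0 rh X)
      note H = 1(1) and mu = 1(2,3) and U = 1(4,5) and rh = 1(6,7) and m = 1(8) and wP = 1(9) and NP = 1(10) and X = 1(11) and XI = 1(12) and hP = 1(13)
      let ?n = "ball x0 rh"
      have wY: "wg ?n y Y" and NY: "Np q Y<oo" using m by (auto simp: obstacle_minimiser_def)
      define v where "v x = V mu p (Y x)" for x
      have [measurable]: "Y : bm" "P : bm" "v : bm" using wg_measurable[OF wY] wg_measurable[OF wP] by (auto simp: v_def[abs_def])
      have [measurable]: "ball x0 r : sets borel" for r by simp
      let ?u = "%x. norm (Y x) powr q"
      define fe where "fe r = (NN x:ball x0 r. ?u x)" for r
      define f where "f r = enn2real (fe r)" for r
      have fe_le: "fe r<=Np q Y" for r unfolding fe_def Np_def by (intro nn_integral_mono) (auto simp: indicator_def)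
      have fe: "fe r = en (f r)" for r unfolding f_def using le_less_trans[OF fe_le NY] by (simp add: top.not_eq_extremum)
      have f0: "0<=f r" for r by (simp add: f_def)
      have mb: "emeasure lborel (ball x0 r)<=en m0" if "r<=rh" for r unfolding m0_def by (rule emeasure_ball_le) (use that rh in simp)
      let ?b = "%x. norm (Y x) powr p + norm (P x) powr q"
      let ?d = "%R. NN x:ball x0 R. 1 + norm (Y x) powr q + norm (P x) powr q"
      have JR: "(?d R)<=en (m0 + f R + X)" if "R<=rh" for R
      proof -
       have "(?d R)
        <= (NN x. ind (ball x0 R) x + ind (ball x0 R) x * en (?u x) + ind ?n x * en (?b x))" using that by (intro nn_integral_mono) (auto simp: indicator_def add_increasing)
       also have "... = emeasure lborel (ball x0 R) + fe R + (NN x:?n. ?b x)" by (simp add: nn_integral_add fe_def del: ennreal_plus)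
       also have "...<=en m0 + en (f R) + en X" using mb[OF that] XI fe by (intro add_mono) auto
       also have "... = en (m0 + f R + X)" using m0 f0[of R] X by simp
       finally show ?thesis .
      qed
      define I where "I = c5*X"
      have I: "0<I" using c5 X by (simp add: I_def)
      let ?p = "%x. norm (v x) powr 2"
      have v2: "(NN x:ball x0 R. ?p x)<=en I" if "R<=rh" for R
      proof -
       let ?z = "en (2 powr p)"
       have "(NN x:ball x0 R. ?p x) <= (NN x. ?z * (ind (ball x0 R) x + ind ?n x * en (?b x)))"
       proof (rule nn_integral_mono)
        fix x
        have "?p x<=2 powr p * (1+?b x)" using order_trans[OF V_le_power[OF par(3) mu, of "Y x"] mult_left_mono[of _ "1+(norm (Y x) powr p + norm (P x) powr q)"]] by (simp add: v_def)
        hence "en (?p x)<=?z * en (1+?b x)" by (subst ennreal_mult'[symmetric]) (auto intro: ennreal_leI simp del: ennreal_plus)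
        thus "ind (ball x0 R) x * en (?p x)<=?z * (ind (ball x0 R) x + ind ?n x * en (?b x))" using that by (auto simp: indicator_def)
       qed
       also have "... = ?z * (emeasure lborel (ball x0 R) + (NN x:?n. ?b x))" by (simp add: nn_integral_add nn_integral_cmult del: ennreal_plus)
       also have "...<=?z * (en m0 + en X)" by (intro mult_left_mono add_mono mb[OF that] XI) auto
       also have "... = en (2 powr p * (m0+X))" using m0 X by (simp add: ennreal_mult')
       also have "...<=en I" using X m0 mult_left_mono[of 1 X m0] by (intro ennreal_leI) (simp add: I_def c5_def distrib_right)
       finally show ?thesis .
      qed
      have cut: "EX W. W : bm & (ALL x:cball x0 r. W x = v x) & (ALL x. norm (W x)<=ind (ball x0 R) x * norm (v x)) &
       (ALL h. Np 2 (%x. W (x+h) - W x)<=en (C3*(1+1/(R-r)^2)*((m0 + f R + X)+N) * norm h powr al))"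
       if r: "rh/2<=r" "r<R" "R<=3*rh/4" for r R unfolding v_def
      proof (rule cd[OF H mu U(1) _ U(2) _ m wP NP _ r(2) _ _ N])
       fix h :: 'a assume h: "norm h<=(R-r)/8"
       have "(R-r)/8<=rh/16" using r rh by (simp add: field_simps)
       with h have h': "norm h<=rh/16" by (rule order_trans)
       let ?q = "%R. NN x:ball x0 R. norm (P (x+h) - P x) powr q"
       have "(?q R)<=(NN x:ball x0 (13*rh/16). norm (P (x+h) - P x) powr q)" using r rh by (intro nn_integral_mono) (auto simp: indicator_def)
       also have "...<=en (N * norm h powr (al*q))" by (rule hP[OF h'])
       finally show "(?q R)<=en (N * norm h powr (al*q))" .
      next
       show "(?d R)<=en (m0 + f R + X)" by (rule JR) (use r rh in simp)
      qed (use r rh m0 f0[of R] X in auto)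
      have W2: "Np 2 W<=en I" if "ALL x. norm (W x)<=ind (ball x0 R) x * norm (v x)" "R<=rh" for W :: "'a => 'a" and R
      proof (rule order_trans[OF _ v2[OF that(2)]], unfold Np_def, rule nn_integral_mono)
       fix x show "en (norm (W x) powr 2)<=ind (ball x0 R) x * en (?p x)" using that(1)[rule_format, of x] by (cases "x : ball x0 R") (auto intro!: ennreal_leI power_mono)
      qed
      let ?x = "X powr k1"
      define A where "A = c6 * ?x"
      have A: "0<=A" using c6 by (simp add: A_def)
      let ?s = "3*rh/4-5*rh/8"
      have "f (5*rh/8)<=c7*A * (1+1/?s^2) powr (k+1)"
      proof (rule hf[OF A])
       show "5*rh/8<3*rh/4" using rh by simp
       show "f r<=enn2real (Np q Y)" for r unfolding f_def by (rule enn2real_mono[OF fe_le]) (use NY in simp)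
       fix r R assume r: "5*rh/8<=r" "r<R" "R<=3*rh/4"
       have r2: "rh/2<=r" using r rh by simp
       define Q where "Q = 1+1/(R-r)^2"
       have Q: "1<=Q" by (simp add: Q_def)
       define G where "G = (m0 + f R + X)+N"
       have G: "0<=G" using m0 f0[of R] X N by (simp add: G_def)
       obtain W where W: "W : bm" "ALL x:cball x0 r. W x = v x" "ALL x. norm (W x)<=ind (ball x0 R) x * norm (v x)"
        "ALL h. Np 2 (%x. W (x+h) - W x)<=en (C3*Q*G * norm h powr al)" using cut[OF r2 r(2,3)] unfolding Q_def G_def by (elim exE conjE)
       let ?k = "B*Q * I powr (al/n)"
       define l where "l = ?k powr (1/ka)"
       have l: "0<l" using B Q I by (simp add: l_def)
       have W2': "Np 2 W<=en I" by (rule W2[OF W(3)]) (use r rh in simp)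
       let ?e = "C2*(C3*Q*G) * I powr (al/n) * l powr (- ka)"
       let ?j = "l powr (t-2) * I+C2*(C3*Q*G) * I powr (al/n) * l powr (- ka)"
       have "Np t W<=en (l powr (t-2)) * Np 2 W + en (C2*(C3*Q*G) * I powr (al / DIM('a)) * l powr (t-2-al*2 / DIM('a)))" by (rule lsm[OF W(1) I W2' _ _ l]) (use W(4) C3 Q G in auto)
       also have "...<=en (l powr (t-2)) * en I + en ?e" using W2' by (intro add_mono mult_left_mono) (auto simp: ka_def n_def algebra_simps)
       also have "... = en ?j" using I C2 C3 Q G by (subst ennreal_plus) (auto simp: ennreal_mult')
       finally have NW: "Np t W<=en ?j" (is "_<=en ?Z") .
       have Z0: "0<=?Z" using I C2 C3 Q G by simp
       have "fe r<=(NN x. en c4 * (ind (ball x0 r) x + en (norm (W x) powr t)))" unfolding fe_def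
       proof (rule nn_integral_mono)
        fix x
        show "ind (ball x0 r) x * en (?u x)<=en c4 * (ind (ball x0 r) x + en (norm (W x) powr t))"
        proof (cases "x : ball x0 r")
         case True
         hence Wx: "W x = v x" using W(2) by auto
         have "?u x = (norm (Y x) powr p) powr (q/p)" using par by (simp add: powr_powr)
         also have "...<=(2 powr p * (1+(norm (v x))^2)) powr (q/p)" unfolding v_def using par power_le_V[OF par(3) mu, of "Y x"] by (intro powr_mono2) auto
         also have "... = 2 powr q * (1+(norm (v x))^2) powr (q/p)" using par by (simp add: powr_mult powr_powr)
         also have "...<=2 powr q * (2 powr (q/p) * (1 powr (q/p) + ((norm (v x))^2) powr (q/p)))" using par by (intro mult_left_mono powr_add_le) auto
         also have "((norm (v x))^2) powr (q/p) = norm (W x) powr t" unfolding Wx by (cases "v x = 0") (simp_all add: t_def powr_powr flip: powr_numeral)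
         finally have "en (?u x)<=en (c4*(1 + norm (W x) powr t))" by (intro ennreal_leI) (simp add: c4_def mult.assoc)
         thus ?thesis using True c4 by (simp add: ennreal_mult')
        qed simp
       qed
       also have "... = en c4 * (emeasure lborel (ball x0 r) + Np t W)" using W(1) by (simp add: nn_integral_add nn_integral_cmult Np_def)
       also have "...<=en c4 * (en m0 + en ?Z)" by (intro mult_left_mono add_mono mb NW) (use r rh in auto)
       also have "... = en (c4*(m0+?Z))" using c4 m0 Z0 by (simp add: ennreal_mult' del: ennreal_plus add: ennreal_plus[symmetric])
       finally have "f r<=c4*(m0+?Z)" unfolding fe using c4 m0 Z0 by (subst (asm) ennreal_le_iff) auto
       also have "...<=f R / 2+A * Q powr (k+1)"
       proof -
        have lka: "l powr ka = ?k" using ka B Q I by (simp add: l_def powr_powr)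
        have Ip: "0<I powr (al/n)" using I by simp
        have "c4*?e = c4*(C2*(C3*Q*G) * I powr (al/n))/?k" by (simp add: powr_minus_divide lka)
        also have "... = G/2" unfolding B_def using c4 C2 C3 Q Ip by (simp add: field_simps)
        finally have half: "c4*?e = G/2" .
        let ?h = "c4 * B powr k * c5 powr k1"
        let ?v = "l powr (t-2) * I"
        have "l powr (t-2) = ?k powr k" by (simp add: l_def powr_powr k)
        also have "... = B powr k * Q powr k * I powr (al/n*k)" by (simp add: powr_mult powr_powr)
        finally have "?v = B powr k * Q powr k * (I powr (al/n*k) * I powr 1)" using I by simp
        also have "I powr (al/n*k) * I powr 1 = c5 powr k1 * ?x" by (simp only: powr_add I_def powr_mult k1_def mult_ac)
        finally have lI: "c4*?v = ?h * ?x * Q powr k" by simp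
        define e where "e = ?x"
        define Qk where "Qk = Q powr (k+1)"
        have e: "1<=e" "X<=e" using X k1 powr_mono[of 1 k1 X] by (auto simp: e_def intro: ge_one_powr_ge_zero)
        have Qk: "1<=Qk" "Q powr k<=Qk" using Q k by (auto simp: Qk_def intro: ge_one_powr_ge_zero powr_mono)
        have eQ: "e<=e*Qk" "1<=e*Qk" using e Qk mult_mono[of 1 e 1 Qk] by (auto simp: mult_le_cancel_left1)
        have 1: "?h*e * Q powr k<=?h*(e*Qk)" using c4 Qk e by (simp add: mult.assoc mult_left_mono)
        have 2: "c4*m0<=c4*m0*(e*Qk)" "m0<=m0*(e*Qk)" "N<=N*(e*Qk)" using eQ m0 N c4 mult_left_mono[OF eQ(2), of "c4*m0"] mult_left_mono[OF eQ(2), of m0] mult_left_mono[OF eQ(2), of N] by auto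
        have 3: "X<=e*Qk" using e eQ by linarith
        have "c4*(m0+?Z) = c4*m0+c4*?v+G/2" using half by (simp add: distrib_left)
        also have "...<=f R / 2+(c4*m0*(e*Qk)+?h*(e*Qk)+m0*(e*Qk)+1*(e*Qk)+N*(e*Qk))" using 1 2 3 m0 N X unfolding lI e_def[symmetric] G_def add_divide_distrib by linarith
        also have "... = f R / 2+A*Qk" by (simp only: A_def c6_def e_def distrib_right mult.assoc)
        finally show ?thesis by (simp only: Qk_def)
       qed
       finally show "f r<=f R / 2+A * (1+1/(R-r)^2) powr (k+1)" by (simp only: Q_def)
      qed
      define D where "D = 1+64/rh\<^sup>2"
      have D1: "1<=D" by (simp add: D_def)
      let ?y = "D powr (k+1)"
      have f1: "f (5*rh/8)<=c7*c6*(?x * ?y)"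
      proof -
       have "?s = rh/8" by simp
       hence "1+1/?s^2 = D" by (simp only: D_def power_divide) simp
       with \<open>f (5 * rh / 8) <= c7 * A * (1 + 1 / (3 * rh / 4 - 5 * rh / 8)^2) powr (k + 1)\<close> show ?thesis by (simp only: A_def mult.assoc)
      qed
      define E where "E = ?x * D powr (k+2)"
      have E: "1<=E" "X<=E" "?x * ?y * D = E"
      proof -
       have "1<=?x" "X<=?x" using X k1 powr_mono[of 1 k1 X] by (auto intro: ge_one_powr_ge_zero)
       moreover have "1<=D powr (k+2)" using D1 k by (intro ge_one_powr_ge_zero) auto
       ultimately show "1<=E" "X<=E" unfolding E_def using mult_mono[of 1 "X powr k1" 1 "D powr (k+2)"] mult_mono[of X "X powr k1" 1 "D powr (k+2)"] X by auto
       have "D powr (k+2) = ?y * D powr 1" using powr_add[of D "k+1" 1] by (simp add: add.assoc)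
       thus "?x * ?y * D = E" using D1 by (simp add: E_def)
      qed
      define M where "M = c8*E"
      let ?f = "(m0 + f (5*rh/8) + X)+N"
      let ?l = "1+1/(5*rh/8-rh/2)^2"
      obtain W where W: "W : bm" "ALL x:cball x0 (rh/2). W x = v x" "ALL x. norm (W x)<=ind (ball x0 (5*rh/8)) x * norm (v x)"
       "ALL h. Np 2 (%x. W (x+h) - W x)<=en (C3*?l*?f * norm h powr al)"
      proof -
       have "rh/2<=rh/2" "rh/2<5*rh/8" "5*rh/8<=3*rh/4" using rh by auto
       from cut[OF this] show ?thesis by (elim exE conjE) (rule that)
      qed
      have K: "C3*?l*?f<=M"
      proof -
       have "5*rh/8-rh/2 = rh/8" by simp
       hence D: "?l = D" by (simp only: D_def power_divide) simp
       define z where "z = ?x * ?y"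
       have z: "1<=z" "X<=z"
       proof -
        have "1<=?x" "X<=?x" using X k1 powr_mono[of 1 k1 X] by (auto intro: ge_one_powr_ge_zero)
        moreover have "1<=?y" using D1 k by (intro ge_one_powr_ge_zero) auto
        ultimately show "1<=z" "X<=z" unfolding z_def using mult_mono[of 1 "X powr k1" 1 "D powr (k+1)"] mult_mono[of X "X powr k1" 1 "D powr (k+1)"] X by auto
       qed
       have "?f<=m0*z+c7*c6*z+1*z+N*z" using z f1[folded z_def] mult_left_mono[OF z(1) m0] mult_left_mono[OF z(1) N] by linarith
       also have "... = ?g*z" by (simp only: distrib_right)
       finally have "C3*D*?f<=C3*D*(?g*z)" using C3 D1 by (intro mult_left_mono) auto
       also have "... = C3*?g*(z*D)" by simp
       also have "z*D = E" using E(3) by (simp add: z_def)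
       also have "C3*?g*E<=c8*E" using E(1) c5 by (intro mult_right_mono) (auto simp: c8_def)
       finally show ?thesis by (simp only: D M_def)
      qed
      have "c5+1<=c8" using C3 m0 c7 c6 N by (simp add: c8_def)
      hence "(c5+1)*E<=M" unfolding M_def using E by (intro mult_right_mono) auto
      moreover have "I+1<=(c5+1)*E" using mult_left_mono[OF E(2), of c5] c5 E(1) by (simp add: I_def distrib_right add_mono)
      ultimately have IM: "I+1<=M" by simp
      have Wh: "Np 2 (%x. W (x+h) - W x)<=en (M * norm h powr al)" for h by (rule order_trans[OF W(4)[rule_format]]) (intro ennreal_leI mult_right_mono K, simp)
      have "Np 2 W<=en I" by (rule W2[OF W(3)]) (use rh in simp)
      also have "...<=en M" using IM by (intro ennreal_leI) simp
      finally have "Np si W<=en (Ci*M^2)" using IM I by (intro it W(1) Wh) auto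
      let ?t = "4*(k+2)"
      define Z where "Z = X powr (2*(1+al/n*k)) / rh powr ?t"
      have EZ: "E^2<=c9*Z"
      proof -
       let ?o = "X powr (2*k1) * D powr ?i"
       let ?r = "(R0^2 + 64)/rh\<^sup>2"
       have "D powr ?i<=?r powr ?i"
       proof (intro powr_mono2)
        have "rh\<^sup>2<=R0^2" using rh by (intro power_mono) auto
        hence "1<=R0^2 / rh\<^sup>2" using rh by simp
        thus "D<=?r" unfolding D_def add_divide_distrib by simp
       qed (use D1 k(2) in auto)
       also have "?r powr ?i = c9 / rh powr ?t"
       proof -
        have "(rh\<^sup>2) powr ?i = rh powr ?t" using rh powr_powr[of rh 2 "2*(k+2)"] by (simp add: algebra_simps)
        thus ?thesis using R0 by (simp add: powr_divide c9_def)
       qed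
       finally have "?o<=X powr (2*k1) * (c9 / rh powr ?t)" by (intro mult_left_mono) auto
       also have "... = c9*Z" by (simp add: Z_def k1_def)
       finally have le: "?o<=c9*Z" .
       have "E^2 = ?o" using X D1 by (simp add: E_def power_mult_distrib powr_power mult.commute)
       with le show ?thesis by (simp only:)
      qed
      have E2: "E<=E^2" using E by (simp add: power2_eq_square)
      have Z: "Ci*M^2<=C*Z" "M<=C*Z"
      proof -
       have "Ci*M^2 + M<=Ci*c8^2 * E^2 + c8*E^2" using E2 c8 by (simp add: M_def power_mult_distrib)
       also have "... = (Ci*c8^2 + c8)*E^2" by (simp add: distrib_right)
       also have "...<=(Ci*c8^2 + c8)*(c9*Z)" using Ci c8 by (intro mult_left_mono EZ) auto
       finally have "Ci*M^2 + M<=C*Z" by (simp add: C_def mult.assoc)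
       moreover have "0<=Ci*M^2" "0<=M" using Ci IM I by auto
       ultimately show "Ci*M^2<=C*Z" "M<=C*Z" by linarith+
      qed
      let ?w = "ball x0 (rh/2)"
      let ?a = "%h. incr2 ?w (%x. V mu p (Y x)) h"
      let ?c = "NN x:?w. norm (V mu p (Y x)) powr si"
      show ?case unfolding Z_def[symmetric]
      proof (intro conjI allI)
       have "?c<=Np si W" unfolding Np_def using W(2) by (intro nn_integral_mono) (auto simp: indicator_def v_def)
       also have "...<=en (C*Z)" by (rule order_trans[OF \<open>Np si W <= _\<close>]) (intro ennreal_leI Z)
       finally show "?c<=en (C*Z)" .
       fix h
       have "?a h<=Np 2 (%x. W (x+h) - W x)" unfolding Np_def using W(2) by (intro nn_integral_mono) (auto simp: indicator_def v_def)
       also have "...<=en (C*Z * norm h powr al)" by (rule order_trans[OF Wh]) (intro ennreal_leI mult_right_mono Z, simp)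
       finally show "?a h<=en (C*Z * norm h powr al)" .
      qed
     qed
    qed
   qed
  qed
 qed
qed

section \<open>Minimisation\<close>

definition En :: "('a::euclidean_space => 'a => real) => 'a set => ('a => 'a) => ennreal"
 where "En H U Y = (NL x:U. en (H x (Y x)))"

definition W0 :: "'a::euclidean_space => real => ('a => real) => ('a => 'a) => bool"
 where "W0 a r ph Ph <-> wg UNIV ph Ph & (ALL x. x ~: cball a r --> ph x = 0 & Ph x = 0)"

lemma Np_zero_AE:
 fixes f :: "'a::euclidean_space => 'b::euclidean_space"
 assumes [measurable]: "f : bm" and "!!e::real. 0<e ==> Np p f<=en e"
 shows "ae x. f x = 0"
proof -
 have "Np p f = 0" using ennreal_le_epsilon[of 0 "Np p f"] assms(2) by simp
 hence "ae x. en (norm (f x) powr p) = 0" unfolding Np_def by (subst (asm) nn_integral_0_iff_AE) auto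
 thus ?thesis by eventually_elim simp
qed

lemma W0_limit:
 fixes Ph :: "nat => 'a::euclidean_space => 'a" and ph :: "nat => 'a => real"
 assumes W: "!!i. W0 a r (ph i) (Ph i)" and p: "1<=p" and fin: "!!i. Np p (Ph i)<oo" and [measurable]: "G : bm"
  and lim: "!!e::real. 0<e ==> EX N. ALL i>=N. Np p (%x. Ph i x - G x)<=en e"
 obtains u G' where "W0 a r u G'" "ae x. G' x = G x" "Np p G'<oo"
  "!!e::real. 0<e ==> EX N. ALL i>=N. Np p (%x. ph i x - u x)<=en e"
proof -
 let ?c = "cball a r"
 have w: "wg UNIV (ph i) (Ph i)" and z: "x ~: ?c ==> ph i x = 0" "x ~: ?c ==> Ph i x = 0" for i x using W[of i] by (auto simp: W0_def)
 have [measurable]: "ph i : bm" "Ph i : bm" "?c : sets borel" for i using wg_measurable[OF w[of i]] by auto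
 have p0: "0<=p" using p by simp
 define c where "c = (2 * abs r + 1) powr p"
 have c: "0<c" by (simp add: c_def)
 let ?d = "%i j. Np p (%x. ph i x - ph j x)"
 have poin: "?d i j<=en c * Np p (%x. Ph i x - Ph j x)" for i j unfolding c_def by (rule poincare[OF wg_diff[OF w w] _ p, of a]) (use z in auto)
 let ?a = "%i. %x. Ph i x - G x"
 have tri: "Np p (%x. Ph i x - Ph j x)<=en (2 powr p) * (Np p (?a i) + Np p (?a j))" for i j using Np_diff[of "%x. Ph i x - G x" "%x. Ph j x - G x" p] p0 by simp
 have Cauchy: "EX N. ALL i>=N. ALL j>=N. ?d i j<=en e" if e: "0<e" for e
 proof -
  define d where "d = e/(2*c * 2 powr p)"
  have d: "0<d" using e c by (simp add: d_def)
  obtain N where N: "!!i. i >= N ==> Np p (?a i)<=en d" using lim[OF d] by auto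
  have "?d i j<=en e" if "i >= N" "j >= N" for i j
  proof -
   have "?d i j<=en c * (en (2 powr p) * (en d + en d))" by (intro order_trans[OF poin] mult_left_mono order_trans[OF tri] add_mono N that) auto
   also have "... = en e" using c d by (simp add: ennreal_mult'[symmetric] ennreal_plus[symmetric] d_def del: ennreal_plus)
   finally show ?thesis .
  qed
  thus ?thesis by blast
 qed
 have finph: "Np p (ph i)<oo" for i by (rule le_less_trans[OF poincare[OF w[of i] _ p, of a r]]) (use z(1) fin[of i] in "auto simp: ennreal_mult_less_top")
 obtain u s where u[measurable]: "u : bm" and uz: "!!x. x ~: ?c ==> u x = 0" and "strict_mono (s :: nat => nat)"
  "ae x. (%k. ph (s k) x) ----> u x" and ufin: "Np p u<oo" and ulim: "!!e::real. 0<e ==> EX N. ALL i>=N. Np p (%x. ph i x - u x)<=en e" by (rule Lp_complete[of ph a r p]) (use z(1) p finph Cauchy in auto)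
 define G' where "G' x = ind (?c) x *R G x" for x
 have [measurable]: "G' : bm" unfolding G'_def[abs_def] by measurable
 have G'z: "x ~: ?c ==> G' x = 0" for x by (simp add: G'_def)
 have le1: "Np p (%x. Ph i x - G' x)<=Np p (?a i)" and le2: "Np p (%x. G' x - G x)<=Np p (?a i)" for i
  unfolding Np_def using z(2)[of _ i] p0 by (auto intro!: nn_integral_mono ennreal_leI powr_mono2 simp: G'_def indicator_def)
 have AE: "ae x. G' x - G x = 0"
 proof (rule Np_zero_AE)
  fix e :: real assume "0<e"
  thus "Np p (%x. G' x - G x)<=en e" using lim[of e] le2 order_trans by blast
 qed measurable
 have Gfin: "Np p G'<oo"
 proof -
  obtain N where N: "Np p (?a N)<=en 1" using lim[of 1] by auto
  have "Np p (%x. Ph N x - G' x)<oo" by (rule le_less_trans[OF order_trans[OF le1 N]]) simp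
  hence "en (2 powr p) * (Np p (Ph N) + Np p (%x. Ph N x - G' x))<oo" using fin[of N] by (simp add: ennreal_mult_less_top)
  thus ?thesis using Np_diff[of "Ph N" "%x. Ph N x - G' x" p] p0 by (auto intro: le_less_trans)
 qed
 define m where "m = measure lborel (?c)"
 have "wg UNIV u G'"
 proof (rule wg_limit[OF w])
  show "Lint u" "Lint G'" by (rule Np_finite_imp_integrable[of _ a r p], use uz p ufin G'z Gfin in auto)+
  fix e :: real assume e: "0<e"
  define d where "d = e/(2*(m+1))"
  have m: "0<=m" by (simp add: m_def)
  have d: "0<d" "d*m<=e/2" using e m by (auto simp: d_def field_simps)
  let ?b = "d powr (1-p)"
  define b where "b = e/2 / ?b"
  have b: "0<b" "?b * b = e/2" using e d by (auto simp: b_def)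
  obtain N1 where N1: "!!i. i >= N1 ==> Np p (%x. ph i x - u x)<=en b" using ulim[OF b(1)] by auto
  obtain N2 where N2: "!!i. i >= N2 ==> Np p (?a i)<=en b" using lim[OF b(1)] by auto
  define i where "i = max N1 N2"
  have fin1: "en (d*m) + en ?b * X<=en e" if "X<=en b" for X
  proof -
   have "en (d*m) + en ?b * X<=en (e/2) + en ?b * en b" using d that by (intro add_mono mult_left_mono ennreal_leI) auto
   also have "... = en e" using e b by (simp add: ennreal_mult'[symmetric] ennreal_plus[symmetric] del: ennreal_plus)
   finally show ?thesis .
  qed
  have "Np 1 (%x. ph i x - u x)<=en e" by (rule order_trans[OF Np1_le_Np[of _ a r p d] fin1[OF N1, unfolded m_def]]) (use z uz p d in "auto simp: i_def m_def")
  moreover have "Np 1 (%x. Ph i x - G' x)<=en e" by (rule order_trans[OF Np1_le_Np[of _ a r p d] fin1[OF order_trans[OF le1 N2], unfolded m_def]]) (use z G'z p d in "auto simp: i_def m_def")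
  ultimately show "EX k. Np 1 (%x. ph k x - u x)<=en e & Np 1 (%x. Ph k x - G' x)<=en e" by blast
 qed
 hence "W0 a r u G'" using uz G'z by (simp add: W0_def)
 thus ?thesis using AE Gfin ulim by (intro that[of u G']) auto
qed

lemma constraint_limit:
 fixes ps v u :: "'a::euclidean_space => real" and w ph :: "nat => 'a => real"
 assumes [measurable]: "ps : bm" "v : bm" "u : bm" "B : sets borel"
   "!!i. w i : bm" "!!i. ph i : bm" and p: "1<=p"
  and AE: "!!i. ae x. x : B --> ps x<=w i x + ph i x"
  and w: "!!e::real. 0<e ==> EX N. ALL i>=N. Np p (%x. ind B x *R (w i x - v x))<=en e"
  and ph: "!!e::real. 0<e ==> EX N. ALL i>=N. Np p (%x. ph i x - u x)<=en e"
 shows "ae x. x : B --> ps x<=v x + u x"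
proof -
 have "ae x. ind B x *R max 0 (ps x - v x - u x) = (0::real)"
 proof (rule Np_zero_AE)
  fix e :: real assume e: "0<e"
  define d where "d = e/(2 * 2 powr p)"
  have d: "0<d" using e by (simp add: d_def)
  obtain N1 N2 where N: "!!i. i >= N1 ==> Np p (%x. ind B x *R (w i x - v x))<=en d" "!!i. i >= N2 ==> Np p (%x. ph i x - u x)<=en d" using w[OF d] ph[OF d] by auto
  define i where "i = max N1 N2"
  let ?a = "Np p (%x. ind B x *R max 0 (ps x - v x - u x))"
  have "?a<=Np p (%x. ind B x *R (w i x - v x)+(ph i x - u x))" unfolding Np_def
  proof (rule nn_integral_mono_AE, use AE[of i] in eventually_elim)
   case (elim x) thus ?case using p by (auto simp: indicator_def intro!: ennreal_leI powr_mono2)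
  qed
  also have "...<=en (2 powr p) * (Np p (%x. ind B x *R (w i x - v x)) + Np p (%x. ph i x - u x))" by (rule Np_add) (use p in auto)
  also have "...<=en (2 powr p) * (en d + en d)" by (intro mult_left_mono add_mono N) (auto simp: i_def)
  also have "... = en e" using d by (simp add: ennreal_mult'[symmetric] ennreal_plus[symmetric] d_def del: ennreal_plus)
  finally show "?a<=en e" .
 qed measurable
 thus ?thesis by eventually_elim (auto simp: indicator_def max_def split: if_splits)
qed

locale integrand_on =
 fixes Om U :: "'a::euclidean_space set" and H :: "'a => 'a => real" and nu L mu al p q :: real
 assumes H: "pq_integrand Om H nu L mu al p q" and U: "U<=Om" "U : sets borel" "Om : sets borel" "bounded U"
  and par: "0<nu" "0<=L" "0<=mu" "mu<=1" "1<p" "p<=q"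
begin

lemma H_nonneg: "x : U ==> 0<=H x z" using integrand_nonneg[OF H, of x z] U par by auto

lemma H_measurable: "Y : bm ==> (%x. H x (Y x)) : borel_measurable (lebesgue_on U)" by (rule integrand_measurable(1)[OF H U(1-3)], rule rep_measurable[OF U(2) rep_indicator]) (use U in auto)

lemma Np_le_En:
 assumes "Y : bm" and z: "!!x. x ~: U ==> Y x = 0"
 shows "en nu * Np p Y<=En H U Y"
proof -
 have "en nu * Np p Y = (NN x. en (nu * norm (Y x) powr p))" unfolding Np_def using assms par by (subst nn_integral_cmult[symmetric]) (auto simp: ennreal_mult')
 also have "... = (NL x:U. en (nu * norm (Y x) powr p))" by (rule nn_integral_rep[symmetric]) (use U z in auto)
 also have "...<=En H U Y" unfolding En_def using pq_integrandD(1)[OF H] U by (intro nn_integral_mono ennreal_leI) auto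
 finally show ?thesis .
qed

lemma Np_finite_of_En:
 assumes "Y : bm" and "!!x. x ~: U ==> Y x = 0" and "En H U Y<oo"
 shows "Np p Y<oo" using le_less_trans[OF Np_le_En[OF assms(1,2)] assms(3)] par by (auto simp: ennreal_mult_less_top)

lemma En_finite:
 assumes "Y : bm" "Np q Y<oo" shows "En H U Y<oo"
proof -
 have i: "integrable (lebesgue_on U) (%x. L * (1 + norm (Y x) + norm ((%_. 0 :: 'a) x)) powr q)" by (intro integrable_mult_right integrable_one_plus_powr) (use assms U par in "auto simp: Np_def")
 have "En H U Y<=(NL x:U. en (norm (L * (1 + norm (Y x) + norm (0 :: 'a)) powr q)))" unfolding En_def using integrand_le[OF H _ par(2)] U par by (intro nn_integral_mono ennreal_leI) auto
 also have "...<oo" by (rule conjunct2[OF iffD1[OF integrable_iff_bounded i]])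
 finally show ?thesis .
qed

lemma uniform_convexity:
 assumes e: "0<e" and M: "0<=M"
 obtains de where "0<de" "!!Y Z. Y : bm ==> Z : bm ==> (!!x. x ~: U ==> Y x = 0 & Z x = 0) ==>
  En H U Y<=en M ==> En H U Z<=en M ==> En H U Y + En H U Z<=2 * En H U (%x. (Y x + Z x) /\<^sub>R 2) + en de ==>
  Np p (%x. Y x - Z x)<=en e"
proof -
 obtain R where "U<=ball 0 R" using bounded_subset_ballD[OF U(4), of 0] by blast
 hence UR: "U<=cball 0 R" using ball_subset_cball by blast
 let ?f = "emeasure lborel U"
 have "?f<=emeasure lborel (cball (0::'a) R)" by (rule emeasure_mono[OF UR]) simp
 hence Ufin: "?f<oo" using emeasure_cball_finite[of "0::'a" R] by (rule le_less_trans)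
 define u where "u = measure lborel U"
 have u: "?f = en u" "0<=u" unfolding u_def using Ufin by (auto intro: emeasure_eq_ennreal_measure)
 define K where "K = u+2*(M/nu)+1"
 have K: "0<K" using u M par by (simp add: K_def add_nonneg_pos)
 define ep where "ep = min 1 (e/(2*K))"
 have ep: "0<ep" "ep<=1" "ep*K<=e/2" using e K by (auto simp: ep_def min_def field_simps)
 obtain C where C: "0<C" "!!mu (a::'a) b. 0<=mu ==> mu<=1 ==> norm (a-b) powr p<=ep*(1 + norm a powr p + norm b powr p)+C * Dp mu p a b" using Dp_controls_power[OF par(5) ep(1,2), where 'a='a] by blast
 define c where "c = nu/8 / 4 powr abs ((p-2) / 2)"
 have c: "0<c" using par by (simp add: c_def)
 define de where "de = c*e/(2*C)"
 have de: "0<de" using c e C by (simp add: de_def)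
 show ?thesis
 proof (rule that[OF de])
  fix Y Z :: "'a => 'a"
  assume Ym[measurable]: "Y : bm" and Zm[measurable]: "Z : bm" and z: "!!x. x ~: U ==> Y x = 0 & Z x = 0"
   and EY: "En H U Y<=en M" and EZ: "En H U Z<=en M"
   and le: "En H U Y + En H U Z<=2 * En H U (%x. (Y x + Z x) /\<^sub>R 2) + en de"
  let ?h = "%x. Dp mu p (Y x) (Z x)"
  let ?a = "%x. ?h x"
  let ?m = "%x. (Y x + Z x) /\<^sub>R 2" and ?D = "(NN x. en (?a x))"
  have [measurable]: "(%x. ?h x) : bm" "U : sets borel" unfolding Dp_def using U by measurable
  let ?c = "lebesgue_on U"
  let ?g = "borel_measurable ?c"
  have [measurable]: "(%x. H x (Y x)) : ?g" "(%x. H x (Z x)) : ?g" "(%x. H x ((1/2) *R (Y x + Z x))) : ?g" by (rule H_measurable, measurable)+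
  have Dm[measurable]: "(%x. ?h x) : ?g" by (rule rep_measurable[OF U(2) rep_indicator]) (use U in auto)
  have D: "?D = (NL x:U. en (?a x))" by (rule nn_integral_rep[symmetric]) (use U z in "auto simp: Dp_def")
  have "en c * ?D+2 * En H U ?m = (NL x:U. en c * en (?a x) + 2 * en (H x (?m x)))" unfolding D En_def by (simp add: nn_integral_add nn_integral_cmult)
  also have "...<=(NL x:U. en (H x (Y x)) + en (H x (Z x)))"
  proof (rule nn_integral_mono)
   fix x let ?d = "c * ?h x + 2 * H x (?m x)"
   assume "x : space (lebesgue_on U)"
   hence x: "x : U" by simp
   hence "?d<=H x (Y x) + H x (Z x)" using integrand_midpoint[OF H, of x "Y x" "Z x"] U par by (auto simp: c_def)
   hence "en ?d<=en (H x (Y x) + H x (Z x))" by (rule ennreal_leI)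
   thus "en c * en (?a x) + 2 * en (H x (?m x))<=en (H x (Y x)) + en (H x (Z x))" using c x by (simp add: H_nonneg Dp_nonneg ennreal_mult')
  qed
  also have "... = En H U Y + En H U Z" unfolding En_def by (rule nn_integral_add) auto
  finally have *: "2 * En H U ?m + en c * ?D<=En H U Y + En H U Z" by (simp add: add.commute)
  have "2 * En H U ?m<oo" by (rule le_less_trans[OF order_trans[OF order_trans[OF add_increasing2[OF zero_le order_refl] *] add_mono[OF EY EZ]]]) simp
  hence "en c * ?D<=en de" using order_trans[OF * le] by (auto simp: ennreal_add_left_cancel_le)
  hence "en (C/c) * (en c * ?D)<=en (C/c) * en de" by (rule mult_left_mono) simp
  hence CD: "en C * ?D<=en (e/2)" using C c e by (simp add: mult.assoc[symmetric] ennreal_mult'[symmetric] de_def)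
  have NpM: "Np p X<=en (M/nu)" if X: "X : bm" "!!x. x ~: U ==> X x = 0" "En H U X<=en M" for X
  proof -
   have "en (1/nu) * (en nu * Np p X)<=en (1/nu) * en M" by (intro mult_left_mono order_trans[OF Np_le_En X(3)] X) auto
   thus ?thesis using par M by (simp add: mult.assoc[symmetric] ennreal_mult'[symmetric])
  qed
  let ?b = "%x. ind U x + en (norm (Y x) powr p) + en (norm (Z x) powr p)"
  let ?e = "u+M/nu+M/nu"
  have "Np p (%x. Y x - Z x)<=(NN x. en ep * ?b x + en C * en (?a x))" unfolding Np_def
  proof (rule nn_integral_mono)
   fix x
   show "en (norm (Y x - Z x) powr p)<=en ep * ?b x + en C * en (?a x)"
   proof (cases "x : U")
    case True
    have "en (norm (Y x - Z x) powr p)<=en (ep*(1 + norm (Y x) powr p + norm (Z x) powr p)+C * ?h x)" by (intro ennreal_leI C par)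
    thus ?thesis using True ep C(1) by (simp add: Dp_nonneg ennreal_mult')
   qed (simp add: z)
  qed
  also have "... = en ep * (en u + Np p Y + Np p Z) + en C * ?D" unfolding Np_def u(1)[symmetric] by (simp add: nn_integral_add nn_integral_cmult)
  also have "...<=en ep * (en u + en (M/nu) + en (M/nu)) + en (e/2)" by (intro add_mono mult_left_mono CD NpM order_refl EY EZ Ym Zm) (use z in auto)
  also have "... = en (ep*?e+e/2)" using ep u M par e by (simp add: ennreal_mult'[symmetric] ennreal_plus[symmetric] del: ennreal_plus)
  also have "...<=en e"
  proof (rule ennreal_leI)
   have "ep*?e<=ep*K" using ep by (intro mult_left_mono) (auto simp: K_def)
   thus "ep*?e+e/2<=e" using ep(3) by linarith
  qed
  finally show "Np p (%x. Y x - Z x)<=en e" .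
 qed
qed

lemma nested_minimisers:
 fixes S :: "nat => ('a => 'a) set" and M :: real
 assumes S: "!!k Y. Y : S k ==> Y : bm & (ALL x. x ~: U --> Y x = 0)" and dec: "decseq S"
  and mid: "!!k Y Z. Y : S k ==> Z : S k ==> (%x. (Y x + Z x) /\<^sub>R 2) : S k" and bd: "!!k. (INF Y\<in>S k. En H U Y)<=en M"
 obtains z Z where "!!k. z k : S k" "!!k. En H U (z k)<oo" "Z : bm" "!!x. x ~: U ==> Z x = 0"
  "!!e::real. 0<e ==> EX N. ALL i>=N. Np p (%x. z i x - Z x)<=en e" "En H U Z<=(SUP k. INF Y\<in>S k. En H U Y)"
proof -
 define m where "m k = (INF Y\<in>S k. En H U Y)" for k
 define s where "s = (SUP k. m k)"
 have ms: "m k<=s" for k unfolding s_def by (rule SUP_upper) simp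
 have sM: "s<=en M" unfolding s_def m_def by (rule SUP_least) (rule bd)
 have fin: "s<oo" "m k<oo" for k using le_less_trans[OF sM] le_less_trans[OF order_trans[OF ms sM]] by auto
 have "EX Y:S k. En H U Y<m k + en (1 / Suc k)" for k
 proof -
  have "m k<m k + en (1 / Suc k)" using fin(2)[of k] by (cases "m k") (auto simp: ennreal_plus[symmetric] ennreal_less_iff simp del: ennreal_plus)
  thus ?thesis unfolding m_def INF_less_iff by blast
 qed
 then obtain z where z: "!!k. z k : S k" "!!k. En H U (z k)<m k + en (1 / Suc k)" by metis
 have zb[measurable]: "z k : bm" and z0: "x ~: U ==> z k x = 0" for k x using S[OF z(1)] by auto
 have zs: "En H U (z k)<=s + en (1 / Suc k)" for k using order_trans[OF less_imp_le[OF z(2)[of k]] add_right_mono[OF ms]] .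
 have zfin: "En H U (z k)<oo" for k using le_less_trans[OF zs[of k]] fin by simp
 define M' where "M' = max M 0 + 1"
 have zM: "En H U (z k)<=en M'" for k
 proof -
  have "En H U (z k)<=en (max M 0) + en 1" by (rule order_trans[OF zs add_mono]) (use sM in "auto intro: order_trans ennreal_leI simp del: ennreal_1")
  thus ?thesis by (simp add: M'_def ennreal_plus)
 qed
 obtain R where R: "U<=ball 0 R" using bounded_subset_ballD[OF U(4), of 0] by blast
 have zR: "x ~: cball 0 R ==> z k x = 0" for x k using z0[of x k] R by fastforce
 have Cauchy: "EX N. ALL i>=N. ALL j>=N. Np p (%x. z i x - z j x)<=en e" if e: "0<e" for e
 proof -
  show ?thesis
  proof (rule uniform_convexity[OF e, of M'], goal_cases)
   case 1 show ?case using e by (simp add: M'_def)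
  next
   case (2 de)
   note de = 2(1) and uc = 2(2)
   let ?e = "en (de/4)"
   obtain N1 where N1: "s<=m N1 + ?e"
   proof (cases "s = 0")
    case False
    hence "s - ?e<s" using fin de by (cases s) (auto simp: ennreal_minus intro!: ennreal_lessI)
    then obtain k where "s - ?e<m k" unfolding s_def less_SUP_iff by auto
    hence "s<=m k + ?e" by (metis add.commute ennreal_minus_le_iff ennreal_less_top less_imp_le less_top)
    thus ?thesis by (rule that)
   qed (use that in simp)
   obtain N2 :: nat where N2: "1 / Suc N2<de/4" using de by (metis nat_approx_posE zero_less_divide_iff zero_less_numeral)
   define N where "N = max N1 N2"
   have "Np p (%x. z i x - z j x)<=en e" if ij: "i >= N" "j >= N" for i j
   proof (rule uc)
    have zN: "z l : S N1" if "l >= N" for l using z(1)[of l] decseqD[OF dec, of N1 l] that by (auto simp: N_def)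
    let ?c = "%i j. %x. (z i x + z j x) /\<^sub>R 2"
    have mN: "m N1<=En H U (?c i j)" unfolding m_def by (intro INF_lower mid zN ij)
    let ?b = "m N1 + en (de/2)"
    have zl: "En H U (z l)<=?b" if "l >= N" for l
    proof -
     have "1 / Suc l<=de/4"
     proof -
      have "1 / real (Suc l)<=1 / Suc N2" using that by (intro divide_left_mono) (auto simp: N_def)
      thus ?thesis using N2 by linarith
     qed
     hence "En H U (z l)<=(m N1 + ?e) + ?e" by (intro order_trans[OF zs] add_mono N1 ennreal_leI)
     also have "... = m N1 + en (de/2)" using de by (simp add: add.assoc ennreal_plus[symmetric] del: ennreal_plus)
     finally show ?thesis .
    qed
    have "En H U (z i) + En H U (z j)<=?b+?b" by (intro add_mono zl ij)
    also have "... = 2 * m N1 + en de"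
    proof -
     have "en de = en (de/2) + en (de/2)" using de by (simp add: ennreal_plus[symmetric] del: ennreal_plus)
     thus ?thesis by (simp add: mult_2 add_ac)
    qed
    also have "...<=2 * En H U (?c i j) + en de" by (intro add_right_mono mult_left_mono mN) auto
    finally show "En H U (z i) + En H U (z j)<=2 * En H U (?c i j) + en de" .
   qed (use z0 zM in auto)
   thus ?thesis by blast
  qed
 qed
 have p1: "1<=p" using par by simp
 obtain Z r where Z[measurable]: "Z : bm" and "!!x. x ~: cball 0 R ==> Z x = 0" and r: "strict_mono (r :: nat => nat)"
  and lim: "ae x. (%k. z (r k) x) ----> Z x" and "Np p Z<oo" and Zlim: "!!e::real. 0<e ==> EX N. ALL i>=N. Np p (%x. z i x - Z x)<=en e"
  by (rule Lp_complete[of z 0 R p]) (use zR p1 Np_finite_of_En[OF zb z0 zfin] Cauchy in auto)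
 define Z' where "Z' x = ind U x *R Z x" for x
 have [measurable]: "Z' : bm" unfolding Z'_def[abs_def] using U by measurable
 let ?a = "%x z. %k. en (H x (z (r k) x))"
 have "AE x in lebesgue_on U. (%k. z (r k) x) ----> Z' x" unfolding AE_lebesgue_on[OF U(2)] using lim by eventually_elim (simp add: Z'_def)
 hence AE: "AE x in lebesgue_on U. en (H x (Z' x)) = liminf (?a x z)"
 proof (rule AE_mp, intro AE_I2 impI)
  fix x assume "x : space (lebesgue_on U)" and l: "(%k. z (r k) x) ----> Z' x"
  hence "continuous_on UNIV (H x)" using H U by (auto simp: pq_integrand_def caratheodory_integrand_def)
  hence "(%k. H x (z (r k) x)) ----> H x (Z' x)" by (rule continuous_on_tendsto_compose[OF _ l]) auto
  hence "?a x z ----> ennreal (H x (Z' x))" by (rule tendsto_ennrealI)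
  thus "en (H x (Z' x)) = liminf (?a x z)" using lim_imp_Liminf[of sequentially] by fastforce
 qed
 let ?d = "%k. s + en (1 / Suc (r k))"
 have "En H U Z' = (NL x:U. liminf (?a x z))" unfolding En_def by (rule nn_integral_cong_AE[OF AE])
 also have "...<=liminf (%k. En H U (z (r k)))" unfolding En_def by (rule nn_integral_liminf) (use H_measurable[OF zb] in measurable)
 also have "...<=liminf ?d" by (rule Liminf_mono) (use zs in auto)
 also have "... = s"
 proof -
  have "(%k. 1 / real (Suc (r k))) ----> 0" using LIMSEQ_subseq_LIMSEQ[OF LIMSEQ_inverse_real_of_nat r] by (simp add: o_def inverse_eq_divide)
  hence "(%k. en (1 / Suc (r k))) ----> ennreal 0" by (rule tendsto_ennrealI)
  hence "?d ----> s + en 0" by (intro tendsto_add tendsto_const)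
  thus ?thesis using lim_imp_Liminf[of sequentially] by fastforce
 qed
 finally have Es: "En H U Z'<=s" .
 have Z'lim: "EX N. ALL i>=N. Np p (%x. z i x - Z' x)<=en e" if "0<e" for e
 proof -
  have "Np p (%x. z i x - Z' x)<=Np p (%x. z i x - Z x)" for i unfolding Np_def using z0[of _ i] p1 by (auto intro!: nn_integral_mono ennreal_leI powr_mono2 simp: Z'_def indicator_def)
  thus ?thesis using Zlim[OF that] order_trans by blast
 qed
 show ?thesis by (rule that[of z Z']) (use z(1) zfin Z'lim Es in "auto simp: Z'_def s_def m_def")
qed

end

lemma W0_add: "W0 a r ph Ph ==> W0 a r ph' Ph' ==> W0 a r (%x. ph x + ph' x) (%x. Ph x + Ph' x)" unfolding W0_def by (auto intro: wg_add)

lemma W0_cmult: "W0 a r ph Ph ==> W0 a r (%x. c * ph x) (%x. c *R Ph x)" unfolding W0_def by (auto intro: wg_cmult)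

lemma W0_zero: "W0 a r (%x. 0) (%x. 0)" by (simp add: W0_def wg_def)

lemma W0_measurable: "W0 a r ph Ph ==> ph : bm" "W0 a r ph Ph ==> Ph : bm" unfolding W0_def using wg_measurable by blast+

lemma Np_midpoint:
 fixes f g :: "'a::euclidean_space => 'b::euclidean_space"
 assumes [measurable]: "f : bm" "g : bm" and p: "1<=p" and le: "Np p f<=e" "Np p g<=e"
 shows "Np p (%x. (f x + g x) /\<^sub>R 2)<=e"
proof -
 have mid: "norm ((a+b) /\<^sub>R 2) powr p<=norm a powr p / 2 + norm b powr p / 2" for a b :: 'b
 proof -
  define s where "s = (norm a + norm b)/2"
  have "norm ((a+b) /\<^sub>R 2) powr p<=s powr p" using p norm_triangle_ineq[of a b] by (intro powr_mono2) (auto simp: s_def)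
  also have "...<=norm a powr p / 2 + norm b powr p / 2"
  proof (cases "0<s")
   case True
   have "(norm a - s)+(norm b - s) = 0" by (simp add: s_def)
   hence "p * s powr (p-1) * (norm a - s)+p * s powr (p-1) * (norm b - s) = 0" by (metis distrib_left mult_zero_right)
   thus ?thesis using powr_ge_tangent[OF True norm_ge_zero[of a] p] powr_ge_tangent[OF True norm_ge_zero[of b] p] by linarith
  next
   case False
   hence "s = 0" by (simp add: s_def not_less add_nonneg_eq_0_iff order.antisym)
   thus ?thesis by simp
  qed
  finally show ?thesis .
 qed
 have "Np p (%x. (f x + g x) /\<^sub>R 2)<=(NN x. en (1/2) * en (norm (f x) powr p) + en (1/2) * en (norm (g x) powr p))" unfolding Np_def
 proof (rule nn_integral_mono)
  fix x
  let ?a = "en (norm ((f x + g x) /\<^sub>R 2) powr p)"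
  have "?a<=en (norm (f x) powr p / 2 + norm (g x) powr p / 2)" by (intro ennreal_leI mid)
  thus "?a<=en (1/2) * en (norm (f x) powr p) + en (1/2) * en (norm (g x) powr p)" by (subst (1 2) ennreal_mult'[symmetric]) auto
 qed
 also have "... = en (1/2) * Np p f + en (1/2) * Np p g" by (simp add: nn_integral_add nn_integral_cmult Np_def)
 also have "...<=en (1/2) * e + en (1/2) * e" by (intro add_mono mult_left_mono le) auto
 also have "... = e"
 proof -
  have "en (1/2) + en (1/2) = 1" by (subst ennreal_plus[symmetric]) auto
  thus ?thesis by (simp only: distrib_right[symmetric] mult_1)
 qed
 finally show ?thesis .
qed

lemma ennreal_SUP_approx:
 fixes m :: "nat => ennreal"
 assumes s: "en s<=(SUP k. m k)" and de: "0<de"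
 obtains k where "en s<=m k + en de"
proof (cases "s<=0")
 case False
 hence "en (s-de)<(SUP k. m k)" using de by (intro less_le_trans[OF _ s] ennreal_lessI) auto
 then obtain k where "en (s-de)<m k" unfolding less_SUP_iff by auto
 hence "en (s-de) + en de<=m k + en de" by (intro add_right_mono) simp
 moreover have "en s<=en (s-de) + en de" using de by (cases "0<=s-de") (auto simp: ennreal_plus[symmetric] ennreal_neg ennreal_leI simp del: ennreal_plus)
 ultimately show ?thesis by (rule that[OF order_trans[rotated]])
qed (use that[of 0] in "simp add: ennreal_neg")

context integrand_on
begin

lemma En_cong: "ae x. x : U --> Y x = Z x ==> En H U Y = En H U Z" unfolding En_def by (rule nn_integral_cong_AE) (auto simp: AE_lebesgue_on[OF U(2)] elim!: eventually_mono)

lemma obstacle_minimiser_exists: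
 assumes co: "0<ep" "!!x z. x : U ==> ep * norm z powr q<=H x z" and w: "wg U w W" "!!x. x ~: U ==> W x = 0" "Np q W<oo"
  and ps[measurable]: "ps : bm" and AE: "ae x. x : U --> ps x<=w x" and ball: "cball a r<=U"
 obtains ph Ph where "W0 a r ph Ph" "obstacle_minimiser H q U (cball a r) ps (%x. w x + ph x) (%x. W x + Ph x)"
  "ae x. x : U --> ps x<=w x + ph x" "En H U (%x. W x + Ph x)<=En H U W"
proof -
 have wm[measurable]: "w : bm" "W : bm" "U : sets borel" using wg_measurable[OF w(1)] U by auto
 have p1: "1<=p" using par by simp
 define adm where "adm ph <-> (ae x. x : U --> ps x<=w x + ph x)" for ph
 define S where "S = {Y. EX ph Ph. Y = (%x. W x + Ph x) & W0 a r ph Ph & adm ph}"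
 have WS: "W : S" unfolding S_def using W0_zero[of a r] AE by (fastforce simp: adm_def)
 have S: "Y : bm & (ALL x. x ~: U --> Y x = 0)" if Y: "Y : S" for Y
 proof -
  obtain ph Ph where Y: "Y = (%x. W x + Ph x)" "W0 a r ph Ph" using Y by (auto simp: S_def)
  have "Ph x = 0" if "x ~: U" for x using Y(2) subsetD[OF ball, of x] that by (auto simp: W0_def)
  thus ?thesis using W0_measurable[OF Y(2)] w(2) by (simp add: Y(1))
 qed
 have mid: "(%x. (Y x + Z x) /\<^sub>R 2) : S" if YZ: "Y : S" "Z : S" for Y Z
 proof -
  obtain ph Ph ph' Ph' where Y: "Y = (%x. W x + Ph x)" "W0 a r ph Ph" "adm ph" and Z: "Z = (%x. W x + Ph' x)" "W0 a r ph' Ph'" "adm ph'" using YZ by (auto simp: S_def)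
  have "adm (%x. (1/2) * (ph x + ph' x))" using Y(3) Z(3) unfolding adm_def by eventually_elim (auto simp: field_simps)
  moreover have "(Y x + Z x) /\<^sub>R 2 = W x + (1/2) *R (Ph x + Ph' x)" for x
  proof -
   have "(Y x + Z x) /\<^sub>R 2 = (1/2+1/2) *R W x + (1/2) *R (Ph x + Ph' x)" unfolding Y(1) Z(1) scaleR_left_distrib by (simp add: scaleR_right_distrib)
   thus ?thesis by simp
  qed
  ultimately show ?thesis unfolding S_def using W0_cmult[OF W0_add[OF Y(2) Z(2)], of "1/2"] by (intro CollectI exI[of _ "%x. (1/2) * (ph x + ph' x)"] exI[of _ "%x. (1/2) *R (Ph x + Ph' x)"]) auto
 qed
 have EW: "En H U W<oo" by (rule En_finite[OF wm(2) w(3)])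
 have bd: "(INF Y\<in>S. En H U Y)<=en (enn2real (En H U W))" by (rule order_trans[OF INF_lower[OF WS]]) (use EW in simp)
 obtain z Z where z: "!!k. z k : S" "!!k::nat. En H U (z k)<oo" and Z[measurable]: "Z : bm" and Z0: "!!x. x ~: U ==> Z x = 0"
  and lim: "!!e::real. 0<e ==> EX N. ALL i>=N. Np p (%x. z i x - Z x)<=en e" and EZ: "En H U Z<=(SUP k::nat. INF Y\<in>S. En H U Y)" by (rule nested_minimisers[of "%_. S"]) (use S mid bd in "auto simp: decseq_def")
 from z(1) have "ALL k. EX ph Ph. z k = (%x. W x + Ph x) & W0 a r ph Ph & adm ph" by (simp add: S_def)
 then obtain ph Ph where zk: "!!k. z k = (%x. W x + Ph k x)" and W0: "!!k. W0 a r (ph k) (Ph k)" and ad: "!!k. adm (ph k)" by metis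
 have [measurable]: "ph k : bm" "Ph k : bm" for k using W0_measurable[OF W0] by auto
 have Wp: "Np p W<oo" by (rule Np_finite_of_En[OF wm(2) w(2) EW])
 have fin: "Np p (Ph k)<oo" for k
 proof -
  have "Np p (z k)<oo" by (rule Np_finite_of_En) (use S[OF z(1)] z(2) in auto)
  hence "en (2 powr p) * (Np p (z k) + Np p W)<oo" using Wp by (simp add: ennreal_mult_less_top)
  thus ?thesis using Np_diff[of "z k" W p] p1 by (auto simp: zk intro: le_less_trans)
 qed
 have lim': "EX N. ALL i>=N. Np p (%x. Ph i x - (Z x - W x))<=en e" if "0<e" for e using lim[OF that] by (simp add: zk algebra_simps)
 obtain u G where uG: "W0 a r u G" and AEG: "ae x. G x = Z x - W x" and Gp: "Np p G<oo"
  and ulim: "!!e::real. 0<e ==> EX N. ALL i>=N. Np p (%x. ph i x - u x)<=en e" by (rule W0_limit[OF W0 p1 fin _ lim']) auto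
 have um[measurable]: "u : bm" "G : bm" using W0_measurable[OF uG] by auto
 have au: "adm u" unfolding adm_def by (rule constraint_limit[OF ps wm(1) um(1) wm(3) wm(1) _ p1 _ _ ulim]) (use ad in "auto simp: adm_def Np_def")
 let ?a = "%x. W x + G x"
 have E1: "En H U ?a = En H U Z" by (rule En_cong) (use AEG in "auto elim: eventually_mono")
 have min: "En H U ?a<=En H U Y" if "Y : S" for Y unfolding E1 by (rule order_trans[OF EZ]) (simp add: INF_lower[OF that])
 have YS: "?a : S" using uG au by (auto simp: S_def)
 have Eq: "en ep * Np q ?a<=En H U ?a"
 proof -
  have "en ep * Np q ?a = (NN x. en (ep * norm (W x + G x) powr q))" unfolding Np_def using co by (subst nn_integral_cmult[symmetric]) (auto simp: ennreal_mult')
  also have "... = (NL x:U. en (ep * norm (W x + G x) powr q))" by (rule nn_integral_rep[symmetric]) (use U S[OF YS] in auto)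
  also have "...<=En H U ?a" unfolding En_def using co by (intro nn_integral_mono ennreal_leI) auto
  finally show ?thesis .
 qed
 have "En H U ?a<oo" by (rule le_less_trans[OF min[OF WS] EW])
 hence "en ep * Np q ?a<oo" by (rule le_less_trans[OF Eq])
 hence Yq: "Np q ?a<oo" using co by (auto simp: ennreal_mult_less_top)
 have uU: "wg U u G" using uG wg_mono[of UNIV u G U] by (simp add: W0_def)
 have "obstacle_minimiser H q U (cball a r) ps (%x. w x + u x) ?a" unfolding obstacle_minimiser_def
 proof (intro conjI allI impI)
  fix ph Ph assume "wg UNIV ph Ph" "ALL x. x ~: cball a r --> ph x = 0 & Ph x = 0" "ae x. x : U --> ps x<=w x + u x + ph x"
  hence "W0 a r (%x. u x + ph x) (%x. G x + Ph x)" "adm (%x. u x + ph x)" using W0_add[OF uG] by (auto simp: W0_def adm_def add.assoc)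
  hence "(%x. W x + (G x + Ph x)) : S" unfolding S_def by (intro CollectI exI[of _ "%x. u x + ph x"] exI[of _ "%x. G x + Ph x"]) auto
  from min[OF this] show "(NL x:U. en (H x (W x + G x)))<=(NL x:U. en (H x (W x + G x + Ph x)))" by (simp add: En_def add.assoc)
 qed (use wg_add[OF w(1) uU] S[OF YS] Yq au in "auto simp: adm_def")
 thus ?thesis using uG au min[OF WS] by (intro that[of u G]) (auto simp: adm_def)
qed

text \<open>
  The midpoint of an approximate minimiser and \<open>v\<close> violates the constraint for \<open>v\<close> slightly. The sets of
  competitors that are admissible up to a small error decrease, and their infima tend to the energy of
  \<open>v\<close> because a limit of near-minimal elements is admissible for \<open>v\<close>.
\<close>

lemma approximate_minimisers_converge:
 fixes w :: "nat => 'a => real"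
 assumes v: "wg U v G" "!!x. x ~: U ==> G x = 0" "En H U G<oo" and ps[measurable]: "ps : bm"
  and AEv: "ae x. x : B --> ps x<=v x" and B[measurable]: "B : sets borel" and ball: "cball a r<=U"
  and vmin: "!!ph Ph. W0 a r ph Ph ==> Np p Ph<oo ==> ae x. x : B --> ps x<=v x + ph x ==> En H U G<=En H U (%x. G x + Ph x)"
  and w: "!!k. wg U (w k) (W k)" "!!k x. x ~: U ==> W k x = 0" "!!k. Np p (%x. W k x - G x)<=en (1 / Suc k)"
   "!!k. Np p (%x. ind B x *R (w k x - v x))<=en (1 / Suc k)"
  and ph: "!!k. W0 a r (ph k) (Ph k)" "!!k. ae x. x : B --> ps x<=w k x + ph k x"
   "!!k. En H U (%x. W k x + Ph k x)<=En H U G + en (2 / Suc k)" and e: "0<e"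
 shows "EX N. ALL k>=N. Np p (%x. W k x + Ph k x - G x)<=en e"
proof -
 have p1: "1<=p" using par by simp
 define Q where "Q k w W ph Ph <-> wg U w W & (ALL x. x ~: U --> W x = 0) & Np p (%x. W x - G x)<=en (1 / Suc k) &
  Np p (%x. ind B x *R (w x - v x))<=en (1 / Suc k) & W0 a r ph Ph & (ae x. x : B --> ps x<=w x + ph x)" for k :: nat and w W ph Ph
 define S where "S k = {Y. EX w W ph Ph. Y = (%x. W x + Ph x) & Q k w W ph Ph}" for k
 have SI: "(%x. W x + Ph x) : S k" if "Q k w W ph Ph" for k w W ph Ph unfolding S_def using that by blast
 have vm[measurable]: "v : bm" "G : bm" using wg_measurable[OF v(1)] by auto
 have Qk: "Q k (w k) (W k) (ph k) (Ph k)" for k using w ph by (simp add: Q_def)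
 have Qv: "Q k v G (%x. 0) (%x. 0)" for k using v AEv W0_zero by (simp add: Q_def Np_def)
 have GS: "G : S k" for k unfolding S_def by (rule CollectI, rule exI[of _ v], rule exI[of _ G], rule exI[of _ "%x. 0"], rule exI[of _ "%x. 0"]) (use Qv[of k] in simp)
 have Qm: "w : bm" "W : bm" "ph : bm" "Ph : bm" if "Q k w W ph Ph" for k w W ph Ph using that wg_measurable W0_measurable unfolding Q_def by blast+
 have S: "Y : bm & (ALL x. x ~: U --> Y x = 0)" if Y: "Y : S k" for Y k
 proof -
  obtain w W ph Ph where Y: "Y = (%x. W x + Ph x)" "Q k w W ph Ph" using Y by (auto simp: S_def)
  have "Ph x = 0" "W x = 0" if "x ~: U" for x using Y(2) subsetD[OF ball, of x] that by (auto simp: W0_def Q_def)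
  thus ?thesis using Qm[OF Y(2)] by (simp add: Y(1))
 qed
 have dec: "decseq S"
 proof (rule decseq_SucI, rule subsetI)
  fix n Y assume "Y : S (Suc n)"
  then obtain w W ph Ph where Y: "Y = (%x. W x + Ph x)" "Q (Suc n) w W ph Ph" by (auto simp: S_def)
  have "en (1 / Suc (Suc n))<=en (1 / Suc n)" by (intro ennreal_leI divide_left_mono) auto
  hence "Q n w W ph Ph" using Y(2) unfolding Q_def by (blast intro: order_trans)
  thus "Y : S n" using Y(1) by (auto simp: S_def)
 qed
 have mid: "(%x. (Y x + Z x) /\<^sub>R 2) : S k" if YZ: "Y : S k" "Z : S k" for Y Z k
 proof -
  obtain w W ph Ph w' W' ph' Ph' where Y: "Y = (%x. W x + Ph x)" "Q k w W ph Ph" and Z: "Z = (%x. W' x + Ph' x)" "Q k w' W' ph' Ph'" using YZ by (auto simp: S_def)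
  let ?w = "%x. (1/2) * (w x + w' x)" and ?W = "%x. (1/2) *R (W x + W' x)" and ?p = "%x. (1/2) * (ph x + ph' x)" and ?P = "%x. (1/2) *R (Ph x + Ph' x)"
  note [measurable] = Qm[OF Y(2)] Qm[OF Z(2)]
  have wg: "wg U ?w ?W" using Y(2) Z(2) unfolding Q_def by (intro wg_cmult wg_add) auto
  have W0: "W0 a r ?p ?P" using Y(2) Z(2) unfolding Q_def by (intro W0_cmult W0_add) auto
  have N1: "Np p (%x. ?W x - G x)<=en (1 / Suc k)"
  proof -
   have "?W x - G x = ((W x - G x)+(W' x - G x)) /\<^sub>R 2" for x
   proof -
    have "(W x - G x)+(W' x - G x) = (W x + W' x)-2 *R G x" by (simp add: scaleR_2)
    thus ?thesis by (simp only: scaleR_right_diff_distrib) simp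
   qed
   thus ?thesis using Np_midpoint[of "%x. W x - G x" "%x. W' x - G x" p] p1 Y(2) Z(2) by (simp add: Q_def)
  qed
  have N2: "Np p (%x. ind B x *R (?w x - v x))<=en (1 / Suc k)"
  proof -
   have "ind B x *R (?w x - v x) = (ind B x *R (w x - v x) + ind B x *R (w' x - v x)) /\<^sub>R 2" for x by (simp add: field_simps)
   thus ?thesis by (simp only:) (rule Np_midpoint, use p1 Y(2) Z(2) in "auto simp: Q_def simp del: real_scaleR_def")
  qed
  have "ae x. x : B --> ps x<=w x + ph x" "ae x. x : B --> ps x<=w' x + ph' x" using Y(2) Z(2) by (auto simp: Q_def)
  hence A: "ae x. x : B --> ps x<=?w x + ?p x" by eventually_elim (auto simp: field_simps)
  have "(%x. ?W x + ?P x) : S k" by (rule SI[of _ ?w _ ?p]) (unfold Q_def, use wg W0 N1 N2 A Y(2) Z(2) in "auto simp: Q_def")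
  moreover have "(%x. (Y x + Z x) /\<^sub>R 2) = (%x. ?W x + ?P x)" by (simp add: Y(1) Z(1) scaleR_right_distrib add_ac)
  ultimately show ?thesis by (simp only:)
 qed
 define E where "E = enn2real (En H U G)"
 have E: "En H U G = en E" "0<=E" using v(3) by (auto simp: E_def)
 have bd: "(INF Y\<in>S k. En H U Y)<=en E" for k unfolding E(1)[symmetric] by (rule INF_lower[OF GS])
 let ?d = "SUP k. INF Y\<in>S k. En H U Y"
 obtain z Z where z: "!!k. z k : S k" "!!k. En H U (z k)<oo" and Z[measurable]: "Z : bm" and Z0: "!!x. x ~: U ==> Z x = 0"
  and lim: "!!e::real. 0<e ==> EX N. ALL i>=N. Np p (%x. z i x - Z x)<=en e" and EZ: "En H U Z<=?d" by (rule nested_minimisers[of S E]) (use S dec mid bd in auto)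
 from z(1) have "ALL k. EX w W ph Ph. z k = (%x. W x + Ph x) & Q k w W ph Ph" by (simp add: S_def)
 then obtain w' W' ph' Ph' where zk: "!!k. z k = (%x. W' k x + Ph' k x)" and Q': "!!k. Q k (w' k) (W' k) (ph' k) (Ph' k)" by metis
 note [measurable] = Qm[OF Q']
 have W0': "W0 a r (ph' k) (Ph' k)" for k using Q'[of k] by (simp add: Q_def)
 have Wlim: "Np p (%x. W' k x - G x)<=en (1 / Suc k)" and wlim: "Np p (%x. ind B x *R (w' k x - v x))<=en (1 / Suc k)" for k using Q'[of k] by (auto simp: Q_def)
 have small: "EX N. ALL k>=N. en (c / Suc k)<=en d" if "0<d" "0<=c" for c d :: real
 proof -
  obtain N :: nat where "c/d<N" using reals_Archimedean2 by blast
  hence "c / Suc k<=d" if "k >= N" for k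
  proof -
   have "c<d*N" using \<open>c / d < N\<close> \<open>0 < d\<close> by (simp add: field_simps)
   also have "...<=d * Suc k" using that \<open>0 < d\<close> by (intro mult_left_mono) auto
   finally show ?thesis by (simp add: field_simps)
  qed
  thus ?thesis by (auto intro: ennreal_leI)
 qed
 have Gp: "Np p G<oo" by (rule Np_finite_of_En[OF vm(2) v(2,3)])
 let ?b = "%k. %x. Ph' k x - (Z x - G x)"
 let ?e = "en (2 powr p)"
 have Phd: "Np p (?b k)<=?e * (Np p (%x. z k x - Z x) + Np p (%x. W' k x - G x))" for k
 proof -
  have eq: "Ph' k x - (Z x - G x) = (z k x - Z x)-(W' k x - G x)" for x by (simp add: zk)
  have [measurable]: "z k : bm" using S[OF z(1)] by blast
  show ?thesis unfolding eq by (rule Np_diff) (use p1 in auto)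
 qed
 have Phlim: "EX N. ALL k>=N. Np p (?b k)<=en e" if e: "0<e" for e
 proof -
  define d where "d = e/(2 * 2 powr p)"
  have d: "0<d" using e by (simp add: d_def)
  obtain N1 N2 where N: "!!k. k >= N1 ==> Np p (%x. z k x - Z x)<=en d" "!!k. k >= N2 ==> ennreal (1 / Suc k)<=en d" using lim[OF d] small[OF d, of 1] by auto
  have "Np p (?b k)<=en e" if "k >= max N1 N2" for k
  proof -
   have "Np p (?b k)<=?e * (en d + en d)" by (intro order_trans[OF Phd] mult_left_mono add_mono N order_trans[OF Wlim]) (use that in auto)
   also have "... = en e" using d by (simp add: ennreal_mult'[symmetric] ennreal_plus[symmetric] d_def del: ennreal_plus)
   finally show ?thesis .
  qed
  thus ?thesis by blast
 qed
 have fin: "Np p (Ph' k)<oo" for k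
 proof -
  have "Np p (z k)<oo" by (rule Np_finite_of_En) (use S[OF z(1)] z(2) in auto)
  moreover have "Np p (W' k)<oo"
  proof -
   have "?e * (Np p (%x. W' k x - G x) + Np p G)<oo" using le_less_trans[OF Wlim[of k]] Gp by (simp add: ennreal_mult_less_top)
   thus ?thesis using Np_add[of "%x. W' k x - G x" G p] p1 by (auto intro: le_less_trans)
  qed
  ultimately have "?e * (Np p (z k) + Np p (W' k))<oo" by (simp add: ennreal_mult_less_top)
  thus ?thesis using Np_diff[of "z k" "W' k" p] p1 by (auto simp: zk intro: le_less_trans)
 qed
 obtain u D where uD: "W0 a r u D" and AED: "ae x. D x = Z x - G x" and Dp: "Np p D<oo"
  and ulim: "!!e::real. 0<e ==> EX N. ALL i>=N. Np p (%x. ph' i x - u x)<=en e" by (rule W0_limit[OF W0' p1 fin _ Phlim]) auto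
 have "ae x. x : B --> ps x<=v x + u x"
 proof (rule constraint_limit[OF ps vm(1) W0_measurable(1)[OF uD] B Qm(1)[OF Q'] Qm(3)[OF Q'] p1 _ _ ulim])
  show "ae x. x : B --> ps x<=w' i x + ph' i x" for i using Q'[of i] by (simp add: Q_def)
  show "EX N. ALL i>=N. Np p (%x. ind B x *R (w' i x - v x))<=en e" if "0<e" for e using small[OF that, of 1] wlim order_trans by (metis zero_le_one)
 qed
 hence "En H U G<=En H U (%x. G x + D x)" by (rule vmin[OF uD Dp])
 also have "... = En H U Z" by (rule En_cong) (use AED in "auto elim: eventually_mono")
 finally have Es: "en E<=?d" using EZ E(1) by (metis order_trans)
 show ?thesis
 proof (rule uniform_convexity[OF e, of "E+2"], goal_cases)
  case 1 show ?case using E by simp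
 next
  case (2 de)
  note de = 2(1) and uc = 2(2)
  obtain N1 where N1: "en E<=(INF Y\<in>S N1. En H U Y) + en (de/4)" using ennreal_SUP_approx[OF Es _, of "de/4"] de by auto
  obtain N2 where N2: "!!k. k >= N2 ==> ennreal (2 / Suc k)<=en (de/2)" using small[of "de/2" 2] de by auto
  have "Np p (%x. W k x + Ph k x - G x)<=en e" if k: "k >= max N1 N2" for k
  proof (rule uc)
   let ?Y = "%x. W k x + Ph k x"
   have YS: "?Y : S k" by (rule SI[OF Qk])
   show "?Y : bm" "G : bm" "!!x. x ~: U ==> ?Y x = 0 & G x = 0" using S[OF YS] v by auto
   show "En H U G<=en (E+2)" using E by (simp add: ennreal_leI)
   have "en (2 / Suc k)<=en 2" by (rule ennreal_leI) (simp add: field_simps)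
   hence "En H U ?Y<=en E + en 2" using ph(3)[of k] E(1) by (auto intro: order_trans add_left_mono)
   thus "En H U ?Y<=en (E+2)" using E(2) by (simp add: ennreal_plus)
   let ?a = "%x. (?Y x + G x) /\<^sub>R 2"
   let ?c = "En H U ?a + en (de/4)"
   have "(INF Y\<in>S N1. En H U Y)<=En H U ?a" by (rule INF_lower, rule mid[OF _ GS]) (use YS decseqD[OF dec, of N1 k] k in auto)
   hence EE: "en E<=?c" by (rule order_trans[OF N1 add_right_mono])
   have "En H U ?Y + En H U G<=(en E + en (de/2)) + en E" using ph(3)[of k] N2[of k] k E(1) by (intro add_mono) (auto intro: order_trans add_left_mono)
   also have "...<=(?c + en (de/2))+?c" by (intro add_mono EE order_refl)
   also have "... = 2 * En H U ?a + en de"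
   proof -
    have "en de = en (de/4) + en (de/2) + en (de/4)" using de by (simp add: ennreal_plus[symmetric] del: ennreal_plus)
    thus ?thesis by (simp only: mult_2 add_ac)
   qed
   finally show "En H U ?Y + En H U G<=2 * En H U ?a + en de" .
  qed
  thus ?thesis by blast
 qed
qed

end

section \<open>Vanishing gap and strong approximation\<close>

lemma Np1_le_root:
 fixes f :: "'a::euclidean_space => 'b::euclidean_space"
 assumes f[measurable]: "f : bm" and z: "!!x. x ~: cball a R ==> f x = 0" and p: "1<=p" and fin: "Np p f<oo"
 shows "Np 1 f<=en ((measure lborel (cball a R) + 1) * enn2real (Np p f) powr (1/p))"
proof (cases "Np p f = 0")
 case True
 hence "ae x. f x = 0" by (intro Np_zero_AE[of f p]) auto
 hence "Np 1 f = Np 1 (%_ :: 'a. 0 :: 'b)" by (rule Np_cong_AE)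
 thus ?thesis by (simp add: Np_def)
next
 case False
 define n where "n = enn2real (Np p f) powr (1/p)"
 have n: "0<n" "Np p f = en (n powr p)" using False fin p by (cases "Np p f"; auto simp: n_def powr_powr)+
 let ?a = "n * measure lborel (cball a R)"
 have "Np 1 f<=en ?a + en (n powr (1-p)) * Np p f" by (rule Np1_le_Np[OF f z p n(1)])
 also have "... = en (?a + n)" unfolding n(2) using n by (simp add: ennreal_mult'[symmetric] ennreal_plus[symmetric] powr_add[symmetric] del: ennreal_plus)
 finally show ?thesis by (simp add: n_def algebra_simps)
qed

lemma functional_rep:
 fixes h1 :: "'a::euclidean_space => real"
 assumes "U : sets borel" and [measurable]: "h1 : bm" "h2 : bm" and r: "rep U u u'" "rep U (wgrad U u) G"
 shows "(LL x:U. h1 x * u x + h2 x .* wgrad U u x) = (LL x. h1 x * u' x + h2 x .* G x)"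
proof (rule integral_rep[OF assms(1)])
 have [measurable]: "u' : bm" "G : bm" using r by (auto simp: rep_def)
 have "ae x. x : U --> u' x = u x" "ae x. x : U --> G x = wgrad U u x" using r by (auto simp: rep_def)
 hence "ae x. x : U --> h1 x * u' x + h2 x .* G x = h1 x * u x + h2 x .* wgrad U u x" by eventually_elim auto
 thus "rep U (%x. h1 x * u x + h2 x .* wgrad U u x) (%x. h1 x * u' x + h2 x .* G x)" using r by (auto simp: rep_def)
qed

lemma W1_functional_integral:
 fixes h1 :: "'a::euclidean_space => real"
 assumes U: "open U" "bounded U" and p: "1<=p" and h[measurable]: "h1 : bm" "h2 : bm"
  and K: "!!x. abs (h1 x)<=K" "!!x. norm (h2 x)<=K"
 shows "W1_functional p U (%u. (LL x:U. h1 x * u x + h2 x .* wgrad U u x))"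
proof -
 let ?l = "%u. (LL x:U. h1 x * u x + h2 x .* wgrad U u x)"
 let ?L = "%u' G. (LL x. h1 x * u' x + h2 x .* G x)"
 have Ub: "U : sets borel" using U by simp
 have p0: "0<p" "0<=p" using p by auto
 obtain R where "U<=ball 0 R" using bounded_subset_ballD[OF U(2), of 0] by blast
 hence UR: "U<=cball 0 R" using ball_subset_cball by blast
 have int: "Lint (%x. h1 x * u' x + h2 x .* G x)" if "wg U u' G" for u' G
 proof (rule Bochner_Integration.integrable_bound)
  show "Lint (%x. K * (norm (u' x) + norm (G x)))" using that by (auto simp: wg_def)
  have [measurable]: "u' : bm" "G : bm" using wg_measurable[OF that] by auto
  show "(%x. h1 x * u' x + h2 x .* G x) : borel_measurable lborel" by measurable
  show "ae x. norm (h1 x * u' x + h2 x .* G x)<=norm (K*(norm (u' x) + norm (G x)))"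
  proof (rule AE_I2)
   fix x
   have "abs (h1 x * u' x)<=K * norm (u' x)" using K(1)[of x] by (simp add: abs_mult mult_right_mono)
   moreover have "abs (h2 x .* G x)<=K * norm (G x)" by (rule order_trans[OF Cauchy_Schwarz_ineq2 mult_right_mono[OF K(2)]]) simp
   ultimately show "norm (h1 x * u' x + h2 x .* G x)<=norm (K*(norm (u' x) + norm (G x)))" by (simp add: distrib_left)
  qed
 qed
 show ?thesis unfolding W1_functional_def
 proof (intro conjI ballI allI)
  fix u w assume u: "u : W1 p U" and w: "w : W1 p U"
  obtain u' G where u': "rep U u u'" "rep U (wgrad U u) G" "wg U u' G" "Np p u'<oo" "Np p G<oo" by (rule W1_rep[OF U p u])
  obtain w' D where w': "rep U w w'" "rep U (wgrad U w) D" "wg U w' D" "Np p w'<oo" "Np p D<oo" by (rule W1_rep[OF U p w])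
  have fin: "Np p (%x. u' x + w' x)<oo" "Np p (%x. G x + D x)<oo" using u' w' p0 by (auto intro!: le_less_trans[OF Np_add] simp: rep_def ennreal_mult_less_top)
  have "rep U (wgrad U (%x. u x + w x)) (%x. G x + D x)" by (rule W1I(3)[OF U(1) rep_add[OF u'(1) w'(1)] wg_add[OF u'(3) w'(3)] _ p0(1) fin]) (use u' w' in "auto simp: rep_def")
  from functional_rep[OF Ub h rep_add[OF u'(1) w'(1)] this]
  have "?l (%x. u x + w x) = (LL x. (h1 x * u' x + h2 x .* G x) + (h1 x * w' x + h2 x .* D x))" by (simp add: algebra_simps inner_add_right)
  also have "... = ?L u' G + ?L w' D" by (rule Bochner_Integration.integral_add) (use int u' w' in auto)
  finally show "?l (%x. u x + w x) = ?l u + ?l w" by (simp only: functional_rep[OF Ub h u'(1,2)] functional_rep[OF Ub h w'(1,2)])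
 next
  fix u and c :: real assume u: "u : W1 p U"
  obtain u' G where u': "rep U u u'" "rep U (wgrad U u) G" "wg U u' G" "Np p u'<oo" "Np p G<oo" by (rule W1_rep[OF U p u])
  have [measurable]: "u' : bm" "G : bm" using u' by (auto simp: rep_def)
  have cm: "Np p (%x. c *R f x)<oo" if [measurable]: "f : bm" and "Np p f<oo" for f :: "'a => 'b::euclidean_space"
  proof -
   have "Np p (%x. c *R f x) = en (abs c powr p) * Np p f" unfolding Np_def by (subst nn_integral_cmult[symmetric]) (auto simp: powr_mult ennreal_mult')
   thus ?thesis using that by (simp add: ennreal_mult_less_top)
  qed
  let ?a = "%x. c * u x"
  have r: "rep U ?a (%x. c * u' x)" using u'(1) by (auto simp: rep_def elim!: eventually_mono)
  have "rep U (wgrad U ?a) (%x. c *R G x)" by (rule W1I(3)[OF U(1) r wg_cmult[OF u'(3)] _ p0(1)]) (use u' cm[of u'] cm[of G] in "auto simp: rep_def")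
  from functional_rep[OF Ub h r this] have "?l ?a = (LL x. c * (h1 x * u' x + h2 x .* G x))" by (simp add: algebra_simps)
  thus "?l ?a = c * ?l u" by (simp add: functional_rep[OF Ub h u'(1,2)])
 next
  define m where "m = measure lborel (cball (0::'a) R)"
  show "EX B. ALL u:W1 p U. abs (?l u)<=B * W1_norm p U u"
  proof (intro exI[of _ "K*(m+1)"] ballI)
   fix u assume u: "u : W1 p U"
   obtain u' G where u': "rep U u u'" "rep U (wgrad U u) G" "wg U u' G" "Np p u'<oo" "Np p G<oo" by (rule W1_rep[OF U p u])
   have K0: "0<=K" using order_trans[OF abs_ge_zero K(1)] .
   have m0: "0<=m" by (simp add: m_def)
   have L1: "(LL x. norm (f x))<=(m+1) * enn2real (Np p f) powr (1/p)"
    if i: "Lint f" and "rep U g f" "Np p f<oo" for f g :: "'a => 'b::euclidean_space"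
   proof -
    have "en (LL x. norm (f x)) = Np 1 f" unfolding Np_def using nn_integral_eq_integral[OF integrable_norm[OF i]] by simp
    also have "...<=en ((m+1) * enn2real (Np p f) powr (1/p))" unfolding m_def by (rule Np1_le_root) (use that UR p in "auto simp: rep_def")
    finally show ?thesis using m0 by (subst (asm) ennreal_le_iff) auto
   qed
   have iu: "Lint u'" "Lint G" using u'(3) by (auto simp: wg_def)
   have "abs (?L u' G)<=(LL x. K * norm (u' x) + K * norm (G x))"
   proof (rule order_trans[OF integral_abs_bound integral_mono])
    fix x
    have "abs (h1 x * u' x)<=K * norm (u' x)" using K(1)[of x] by (simp add: abs_mult mult_right_mono)
    moreover have "abs (h2 x .* G x)<=K * norm (G x)" by (rule order_trans[OF Cauchy_Schwarz_ineq2 mult_right_mono[OF K(2)]]) simp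
    ultimately show "abs (h1 x * u' x + h2 x .* G x)<=K * norm (u' x) + K * norm (G x)" by linarith
   qed (use int[OF u'(3)] iu in auto)
   also have "... = K*(LL x. norm (u' x))+K*(LL x. norm (G x))" using iu by simp
   also have "...<=K*((m+1) * enn2real (Np p u') powr (1/p))+K*((m+1) * enn2real (Np p G) powr (1/p))" using L1[OF iu(1) u'(1,4)] L1[OF iu(2) u'(2,5)] K0 by (intro add_mono mult_left_mono) auto
   also have "... = K*(m+1) * W1_norm p U u" by (simp add: W1_norm_rep[OF Ub p0(1) u'(1,2)] algebra_simps)
   finally show "abs (?l u)<=K*(m+1) * W1_norm p U u" by (simp only: functional_rep[OF Ub h u'(1,2)])
  qed
 qed
qed

context integrand_on
begin

lemma gap_approximation:
 assumes Uo: "open U" and inOm: "U \<Subset> Om" and v: "rep U v v'" "rep U (wgrad U v) G" "wg U v' G" "Np p v'<oo" "Np p G<oo"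
  and E: "energy H U v<oo" and gap: "lavrentiev_gap p q Om H ps v U = 0" and sub: "cball a (r+ep)<=U" and r: "0<r" "0<ep" and de: "0<de"
 obtains w W where "wg U w W" "!!x. x ~: U ==> W x = 0" "Np q W<oo" "ae x. x : U --> ps x<=w x"
  "Np p (%x. W x - G x)<=en de" "Np p (%x. ind (ball a r) x *R (w x - v' x))<=en de"
  "En H U W<=En H U G + en de"
proof -
 have p1: "1<=p" "0<p" "1<=q" using par by auto
 have [measurable]: "G : bm" "v' : bm" "U : sets borel" using v U by (auto simp: rep_def)
 have en: "energy H U u = En H U D" if "rep U (wgrad U u) D" for u D unfolding energy_def En_def by (rule nn_integral_cong_AE) (use that in "auto simp: AE_lebesgue_on[OF U(2)] rep_def elim!: eventually_mono")
 define e0 where "e0 = enn2real (En H U G)"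
 have e0: "En H U G = en e0" "0<=e0" using E by (auto simp: e0_def en[OF v(2)])
 have rel: "relaxed_energy p q Om H ps v U = en e0" using gap E e0 by (cases "relaxed_energy p q Om H ps v U") (auto simp: lavrentiev_gap_def en[OF v(2)] zero_ereal_def enn2ereal_ennreal)
 define B where "B = ball a r"
 have [measurable]: "B : sets borel" by (simp add: B_def)
 define K where "K = (2*r) powr p * 2 ^ DIM('a)"
 have K: "0<K" using r by (simp add: K_def)
 define b where "b = measure lborel B"
 have b: "0<b" "emeasure lborel B = en b" using r emeasure_lborel_ball_finite[of a r] by (auto simp: b_def B_def content_ball_pos intro!: emeasure_eq_ennreal_measure)
 define e1 where "e1 = min de (de/(2 * 2 powr p * K))"
 have e1: "0<e1" "e1<=de" "2 powr p * (K*e1)<=de/2" using de K by (auto simp: e1_def min_def field_simps)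
 define e2 where "e2 = (de/(2 * 2 powr p * b)) powr (1/p)"
 let ?o = "e2 powr p"
 have e2: "0<e2" "?o = de/(2 * 2 powr p * b)" using de b p1 by (auto simp: e2_def powr_powr)
 show ?thesis
 proof (rule uniform_convexity[OF e1(1), of "e0+de"], goal_cases)
  case 1 show ?case using e0 de by simp
 next
  case (2 ka)
  note ka = 2(1) and uc = 2(2)
  define et where "et = min de (ka/4)"
  have et: "0<et" "et<=de" "4*et<=ka" using de ka by (auto simp: et_def)
  define A where "A j = {x. norm (G x)<=real j}" for j :: nat
  have [measurable]: "A j : sets borel" for j by (simp add: A_def)
  obtain g where g: "rep U (%x. grad (H x) (G x)) g" using rep_ex[OF U(2) integrand_measurable(2)[OF H U(1-3) rep_measurable[OF U(2) rep_refl[of G]]]] v(2) by (auto simp: rep_def)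
  obtain f where f: "rep U (%x. H x (G x)) f" using rep_ex[OF U(2) H_measurable[of G]] by auto
  have [measurable]: "g : bm" "f : bm" using g f by (auto simp: rep_def)
  let ?h = "%x. SUP j. ind (A j) x * en (f x)"
  let ?i = "%j. NN x:A j. f x"
  have "(SUP j. ?i j) = (NN x. ?h x)" by (rule nn_integral_monotone_convergence_SUP[symmetric]) (auto simp: incseq_def le_fun_def indicator_def A_def)
  also have "... >= (NN x. en (f x))"
  proof (rule nn_integral_mono)
   fix x
   obtain j :: nat where "norm (G x)<=j" using real_arch_simple by blast
   hence "en (f x) = ind (A j) x * en (f x)" by (simp add: A_def)
   also have "...<=?h x" by (rule SUP_upper) simp
   finally show "en (f x)<=?h x" .
  qed
  also have "(NN x. en (f x)) = en e0" unfolding e0(1)[symmetric] En_def by (rule nn_integral_rep[symmetric]) (use U f in "auto simp: rep_def elim!: eventually_mono")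
  finally obtain j where j: "en e0<=?i j + en et" using ennreal_SUP_approx[OF _ et(1)] by blast
  define h where "h x = ind (A j) x *R g x" for x
  define h' where "h' x = (if norm (h x)<=2 powr q * L * (1 + real j) powr (q-1) then h x else 0)" for x
  have [measurable]: "h' : bm" unfolding h'_def[abs_def] h_def[abs_def] by measurable
  let ?p = "2 powr q * L * (1 + real j) powr (q-1)"
  have hb: "ae x. x : U --> h' x = ind (A j) x *R grad (H x) (G x)"
  proof -
   have "ae x. x : U --> g x = grad (H x) (G x)" using g by (simp add: rep_def)
   thus ?thesis
   proof eventually_elim
    case (elim x)
    have "norm (grad (H x) (G x))<=?p" if "x : U" "x : A j" by (rule order_trans[OF grad_integrand_bound[OF H]]) (use that U par p1 in "auto simp: A_def intro!: mult_left_mono powr_mono2")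
    thus ?case using elim par by (auto simp: h'_def h_def indicator_def)
   qed
  qed
  define Kh where "Kh = ?p"
  have Kh: "norm (h' x)<=Kh" for x using par by (auto simp: h'_def Kh_def)
  define l1 where "l1 u = (LL x:U. 0 * u x + h' x .* wgrad U u x)" for u
  define l2 where "l2 u = (LL x:U. ind B x * u x + 0 .* wgrad U u x)" for u
  have "W1_functional p U l1" unfolding l1_def[abs_def] by (rule W1_functional_integral[OF Uo U(4) p1(1), of _ _ Kh]) (use Kh order_trans[OF norm_ge_zero Kh] in auto)
  moreover have "W1_functional p U l2" unfolding l2_def[abs_def] by (rule W1_functional_integral[OF Uo U(4) p1(1), of _ _ 1]) (auto simp: indicator_def)
  moreover have "en e0<en e0 + en et" using e0 et by (simp add: ennreal_plus[symmetric] ennreal_lessI del: ennreal_plus)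
  then obtain ws where ws: "!!j. ws j : gap_class p q Om U ps" "weakly_W1_loc p Om ws v" "liminf (%j. energy H U (ws j))<en e0 + en et" unfolding rel[symmetric] relaxed_energy_def INF_less_iff by blast
  ultimately have "(%j. l1 (ws j)) ----> l1 v" "(%j. l2 (ws j)) ----> l2 v" using Uo inOm unfolding weakly_W1_loc_def weakly_W1_def by blast+
  hence ev: "eventually (%j. dist (l1 (ws j)) (l1 v)<et & dist (l2 (ws j)) (l2 v)<b*e2) sequentially" using et b e2 by (intro eventually_conj tendstoD) auto
  have "EX j. dist (l1 (ws j)) (l1 v)<et & dist (l2 (ws j)) (l2 v)<b*e2 & energy H U (ws j)<en e0 + en et"
  proof (rule ccontr)
   assume n: "\<not> ?thesis"
   have "eventually (%j. en e0 + en et<=energy H U (ws j)) sequentially" by (rule eventually_mono[OF ev]) (metis n not_less)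
   hence "en e0 + en et<=liminf (%j. energy H U (ws j))" by (rule Liminf_bounded)
   thus False using ws(3) by simp
  qed
  then obtain i where i: "dist (l1 (ws i)) (l1 v)<et" "dist (l2 (ws i)) (l2 v)<b*e2" "energy H U (ws i)<en e0 + en et" by blast
  have "ws i : W1 q U" and AE: "AE x in lebesgue_on U. ps x<=ws i x" using ws(1)[of i] by (auto simp: gap_class_def)
  then obtain w W where w: "rep U (ws i) w" "rep U (wgrad U (ws i)) W" "wg U w W" "Np q w<oo" "Np q W<oo" using W1_rep[OF Uo U(4) p1(3)] by blast
  have [measurable]: "w : bm" "W : bm" using w by (auto simp: rep_def)
  have z: "W x = 0" "G x = 0" "w x = 0" "v' x = 0" if "x ~: U" for x using w v that by (auto simp: rep_def)
  have EW: "En H U W<=en (e0+et)" using i(3) e0 et by (simp add: en[OF w(2)] ennreal_plus)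
  let ?g = "%x. W x - G x"
  have wd: "wg U (%x. w x - v' x) ?g" by (rule wg_diff[OF w(3) v(3)])
  have iD: "Lint (%x. h' x .* W x)" "Lint (%x. h' x .* G x)"
  proof -
   have "Lint (%x. h' x .* X x)" if X: "Lint X" for X :: "'a => 'a"
   proof (rule Bochner_Integration.integrable_bound[OF integrable_mult_right[OF integrable_norm[OF X], of Kh]])
    show "ae x. norm (h' x .* X x)<=norm (Kh * norm (X x))" by (rule AE_I2) (use order_trans[OF Cauchy_Schwarz_ineq2 mult_right_mono[OF Kh]] order_trans[OF norm_ge_zero Kh] in "auto simp: abs_mult")
   qed (use borel_measurable_integrable[OF X] in measurable)
   thus "Lint (%x. h' x .* W x)" "Lint (%x. h' x .* G x)" using w(3) v(3) by (auto simp: wg_def)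
  qed
  have L1: "abs ((LL x. h' x .* W x)-(LL x. h' x .* G x))<et" using i(1) functional_rep[OF U(2) _ _ w(1,2), of "%_. 0" h'] functional_rep[OF U(2) _ _ v(1,2), of "%_. 0" h'] by (simp add: l1_def dist_real_def)
  have iB: "Lint (%x. ind B x * w x)" "Lint (%x. ind B x * v' x)" using w(3) v(3) integrable_mult_indicator[of B lborel w] integrable_mult_indicator[of B lborel v'] by (auto simp: wg_def)
  let ?l = "LL x. ind B x * (w x - v' x)"
  have L2: "abs ?l<b*e2" using i(2) functional_rep[OF U(2) _ _ w(1,2), of "ind B" "%_. 0"] functional_rep[OF U(2) _ _ v(1,2), of "ind B" "%_. 0"] iB by (simp add: l2_def dist_real_def right_diff_distrib)
  let ?m = "%x. (W x + G x) /\<^sub>R 2"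
  obtain k where k: "rep U (%x. H x (?m x)) k" using rep_ex[OF U(2) H_measurable[of ?m]] by auto
  have [measurable]: "k : bm" using k by (simp add: rep_def)
  let ?n = "2 * En H U ?m"
  have mid: "en (2*e0)<=?n + en (3*et)"
  proof -
   have AEx: "ae x. x : U --> f x = H x (G x)" "ae x. x : U --> k x = H x (?m x)" using f k by (auto simp: rep_def)
   let ?c = "NN x. en (2*(ind (A j) x * max 0 (f x)))"
   let ?e = "NN x. en (2 * max 0 (k x))"
   have "ae x. 2 * (ind (A j) x * max 0 (f x))<=h' x .* (G x - W x)+2 * max 0 (k x)" using AEx hb
   proof eventually_elim
    case (elim x)
    show ?case
    proof (cases "x : U")
     case True
     hence "H x (G x) + grad (H x) (G x) .* (?m x - G x)<=H x (?m x)" using integrand_above_tangent[OF H, of x "G x" "?m x"] U par by auto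
     moreover have "?m x - G x = (1/2) *R (W x - G x)"
     proof -
      have "W x - G x = (W x + G x)-2 *R G x" by (simp add: scaleR_2)
      thus ?thesis by (simp only: scaleR_right_diff_distrib) simp
     qed
     ultimately have "2 * H x (G x)<=grad (H x) (G x) .* (G x - W x)+2 * H x (?m x)" by (simp only: inner_scaleR_right inner_diff_right) (simp add: field_simps)
     thus ?thesis using elim True H_nonneg[OF True, of "?m x"] H_nonneg[OF True, of "G x"] by (auto simp: indicator_def max_def)
    next
     case False thus ?thesis using f by (auto simp: rep_def z)
    qed
   qed
   hence "?c<=?e + en (LL x. h' x .* (G x - W x))" by (intro nn_integral_le_add_integral) (use iD in "auto simp: inner_diff_right")
   also have "?e = ?n"
   proof -
    have "?e = 2*(NN x. en (k x))" by (subst nn_integral_cmult[symmetric]) (auto intro!: nn_integral_cong simp: ennreal_mult' max_def ennreal_neg)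
    also have "(NN x. en (k x)) = En H U ?m" unfolding En_def by (rule nn_integral_rep[symmetric]) (use U k in "auto simp: rep_def elim!: eventually_mono")
    finally show ?thesis .
   qed
   also have "en (LL x. h' x .* (G x - W x))<=en et" using L1 iD by (intro ennreal_leI) (simp add: inner_diff_right)
   finally have 1: "?c<=?n + en et" by (simp add: add_left_mono)
   have "en (2*e0) = 2 * en e0" by (simp add: ennreal_mult')
   also have "...<=2*(?i j + en et)" by (intro mult_left_mono j) simp
   also have "... = ?c + en (2*et)" unfolding distrib_left by (subst nn_integral_cmult[symmetric]) (auto intro!: nn_integral_cong simp: ennreal_mult' indicator_def max_def ennreal_neg)
   also have "...<=(?n + en et) + en (2*et)" by (intro add_right_mono 1)
   also have "... = ?n + en (3*et)" using et by (simp add: add.assoc ennreal_plus[symmetric] del: ennreal_plus)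
   finally show ?thesis .
  qed
  have NG: "Np p ?g<=en e1"
  proof (rule uc)
   show "En H U W<=en (e0+de)" by (rule order_trans[OF EW ennreal_leI]) (use et in simp)
   show "En H U G<=en (e0+de)" unfolding e0(1) using de by (intro ennreal_leI) simp
   have "En H U W + En H U G<=en (e0+et) + en e0" unfolding e0(1) by (intro add_mono EW order_refl)
   also have "... = en (2*e0) + en et" using e0 et by (simp add: ennreal_plus[symmetric] del: ennreal_plus)
   also have "...<=(?n + en (3*et)) + en et" by (intro add_right_mono mid)
   also have "... = ?n + en (4*et)" using et by (simp add: add.assoc ennreal_plus[symmetric] del: ennreal_plus)
   also have "...<=?n + en ka" by (intro add_left_mono ennreal_leI et)
   finally show "En H U W + En H U G<=?n + en ka" .
  qed (use z in auto)
  define M where "M = ?l/b"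
  have M: "abs M<=e2" using L2 b by (simp add: M_def field_simps)
  let ?a = "NN x:B. abs ((w x - v' x) - M) powr p"
  have PW: "?a<=en (K*e1)"
  proof -
   have "?a
    <= en K * (NN x:cball a (r+ep). norm (W x - G x) powr p)" unfolding M_def b_def B_def K_def by (rule poincare_wirtinger[OF wd sub p1(1) r])
   also have "...<=en K * Np p ?g" unfolding Np_def by (intro mult_left_mono nn_integral_mono) (auto simp: indicator_def)
   also have "...<=en K * en e1" by (intro mult_left_mono NG) simp
   finally show ?thesis using K by (simp add: ennreal_mult'[symmetric])
  qed
  let ?d = "%x. ind B x * en (abs ((w x - v' x) - M) powr p) + en (?o) * ind B x"
  let ?j = "2 powr p * (K*e1 + ?o * b)"
  let ?k = "Np p (%x. ind B x *R (w x - v' x))"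
  let ?q = "en (2 powr p)"
  have "?k<=(NN x. ?q * ?d x)" unfolding Np_def
  proof (rule nn_integral_mono)
   fix x
   let ?f = "w x - v' x"
   let ?b = "abs (?f - M) powr p + ?o"
   have "norm ?f powr p<=2 powr p * (abs (?f - M) powr p + abs M powr p)" using norm_add_powr_le[of p "(w x - v' x)-M" M] p1 by simp
   also have "...<=2 powr p * ?b" by (intro mult_left_mono add_left_mono powr_mono2 M) (use p1 in auto)
   finally have "norm ?f powr p<=2 powr p * ?b" .
   hence "en (norm ?f powr p)<=en (2 powr p * ?b)" by (rule ennreal_leI)
   thus "en (norm (ind B x *R ?f) powr p)<=?q * ?d x" by (auto simp: indicator_def ennreal_mult')
  qed
  also have "... = ?q * (?a + en (?o) * en b)" unfolding b(2)[symmetric] by (simp add: nn_integral_add nn_integral_cmult nn_integral_cmult_indicator)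
  also have "...<=?q * (en (K*e1) + en (?o) * en b)" by (intro mult_left_mono add_right_mono PW) simp
  also have "... = en ?j" using K e1 b by (simp add: ennreal_mult'[symmetric] ennreal_plus[symmetric] del: ennreal_plus)
  also have "...<=en de"
  proof (rule ennreal_leI)
   have "2 powr p * (?o * b) = de/2" unfolding e2(2) using b by simp
   thus "?j<=de" using e1(3) by (simp add: distrib_left)
  qed
  finally have N2: "?k<=en de" .
  have AEw: "ae x. x : U --> ps x<=w x"
  proof -
   have "ae x. x : U --> w x = ws i x" using w(1) by (simp add: rep_def)
   with AE[unfolded AE_lebesgue_on[OF U(2)]] show ?thesis by eventually_elim auto
  qed
  have "En H U W<=En H U G + en de" unfolding e0(1) by (rule order_trans[OF EW]) (use e0 et de in "simp add: ennreal_plus[symmetric] ennreal_leI del: ennreal_plus")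
  moreover have "Np p ?g<=en de" by (rule order_trans[OF NG ennreal_leI[OF e1(2)]])
  ultimately show ?thesis using that[OF w(3) z(1) w(5) AEw] N2 by (simp add: B_def)
 qed
qed

end

section \<open>Solutions of the obstacle problem\<close>

lemma V_tendsto:
 fixes Y :: "'c => 'a::euclidean_space"
 assumes Y: "(Y ---> y) F" and p: "1<p" shows "((%k. V mu p (Y k)) ---> V mu p y) F"
proof (cases "mu = 0 & y = 0")
 case True
 have "norm (V mu p z) = norm z powr (p/2)" for z :: 'a
 proof (cases "z = 0")
  case False
  hence "norm (V mu p z) = (norm z) powr ((p-2)/2) * norm z powr 1" using True square_powr[of "norm z" "(p-2)/2"] by (simp add: V_def)
  also have "... = norm z powr (p/2)" by (simp only: powr_add[symmetric] diff_divide_distrib) simp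
  finally show ?thesis .
 qed (use p in "simp add: V_def")
 moreover have "((%k. norm (Y k) powr (p/2)) ---> 0 powr (p/2)) F" by (rule tendsto_powr'[OF _ tendsto_const]) (use tendsto_norm[OF Y] True p in auto)
 ultimately have "((%k. norm (V mu p (Y k))) ---> 0) F" using p by simp
 hence "((%k. V mu p (Y k)) ---> 0) F" by (rule tendsto_norm_zero_cancel)
 thus ?thesis using True by (simp add: V_def)
next
 case False
 hence "mu\<^sup>2 + (norm y)^2 ~= 0" by (simp add: add_nonneg_eq_0_iff)
 thus ?thesis unfolding V_def by (intro tendsto_scaleR tendsto_powr tendsto_add tendsto_power tendsto_norm tendsto_const Y)
qed

lemma Np_limit_AE_subseq:
 fixes f :: "nat => 'a::euclidean_space => 'b::euclidean_space"
 assumes [measurable]: "!!k. f k : bm" "G : bm" and z: "!!k x. x ~: cball a R ==> f k x = 0"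
  and p: "1<=p" and fin: "!!k. Np p (f k)<oo" and lim: "!!e::real. 0<e ==> EX N. ALL i>=N. Np p (%x. f i x - G x)<=en e"
 obtains r :: "nat => nat" where "ae x. (%k. f (r k) x) ----> G x"
proof -
 let ?a = "2 * 2 powr p"
 let ?b = "%u w. Np p (%x. u x - w x)"
 have tri: "?b u w<=en e"
  if "?b u t<=en (e/?a)" "?b w t<=en (e/?a)" "0<e"
  and [measurable]: "u : bm" "w : bm" "t : bm" for u w t :: "'a => 'b" and e
 proof -
  have "?b u w<=en (2 powr p) * (?b u t + ?b w t)" using Np_diff[of "%x. u x - t x" "%x. w x - t x" p] p by simp
  also have "...<=en (2 powr p) * (en (e/?a) + en (e/?a))" by (intro mult_left_mono add_mono that) auto
  also have "... = en e" using that by (simp add: ennreal_mult'[symmetric] ennreal_plus[symmetric] del: ennreal_plus)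
  finally show ?thesis .
 qed
 have Cauchy: "EX N. ALL i>=N. ALL j>=N. Np p (%x. f i x - f j x)<=en e" if e: "0<e" for e
 proof -
  obtain N where N: "!!i. i >= N ==> Np p (%x. f i x - G x)<=en (e/?a)" using lim[of "e/(2 * 2 powr p)"] e by auto
  have "Np p (%x. f i x - f j x)<=en e" if "i >= N" "j >= N" for i j by (rule tri[OF N N e]) (use that in auto)
  thus ?thesis by blast
 qed
 obtain g r where [measurable]: "g : bm" and "!!x. x ~: cball a R ==> g x = 0" and "strict_mono (r :: nat => nat)"
  and AE: "ae x. (%k. f (r k) x) ----> g x" and "Np p g<oo" and glim: "!!e::real. 0<e ==> EX N. ALL i>=N. Np p (%x. f i x - g x)<=en e" by (rule Lp_complete[of f a R p]) (use z p fin Cauchy in auto)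
 have "ae x. g x - G x = 0"
 proof (rule Np_zero_AE)
  fix e :: real assume e: "0<e"
  define d where "d = e/?a"
  have d: "0<d" using e by (simp add: d_def)
  obtain N1 N2 where N: "!!i. i >= N1 ==> Np p (%x. f i x - G x)<=en d" "!!i. i >= N2 ==> Np p (%x. f i x - g x)<=en d" using lim[OF d] glim[OF d] by auto
  show "Np p (%x. g x - G x)<=en e" by (rule tri[of _ "f (max N1 N2)"]) (use N[of "max N1 N2"] e in "auto simp: d_def[symmetric] Np_diff_commute[of p g] Np_diff_commute[of p G]")
 qed measurable
 with AE have "ae x. (%k. f (r k) x) ----> G x" by eventually_elim simp
 thus ?thesis by (rule that)
qed

lemma nn_integral_limit_le:
 assumes "!!k. f k : borel_measurable M" and "AE x in M. (%k::nat. f k x) ----> (g x :: ennreal)" and "!!k. (\<integral>\<^sup>+x. f k x \<partial>M)<=c"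
 shows "(\<integral>\<^sup>+x. g x \<partial>M)<=c"
proof -
 have "(\<integral>\<^sup>+x. g x \<partial>M) = (\<integral>\<^sup>+x. liminf (%k. f k x) \<partial>M)" by (rule nn_integral_cong_AE) (use assms(2) in "auto elim!: eventually_mono simp: lim_imp_Liminf")
 also have "...<=liminf (%k. \<integral>\<^sup>+x. f k x \<partial>M)" by (rule nn_integral_liminf) (use assms(1) in auto)
 also have "...<=liminf (%k::nat. c)" by (rule Liminf_mono) (use assms(3) in auto)
 finally show ?thesis by (simp add: Liminf_const)
qed

lemma En_rep:
 assumes "U : sets borel" "U<=Om" and f: "rep Om (%x. F x (Y x)) f"
 shows "En F U Y = (NN x:U. f x)" unfolding En_def by (rule nn_integral_rep) (use assms in "auto simp: rep_def elim!: eventually_mono")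

lemma solution_energy_finite:
 assumes "open Om" and F: "pq_integrand Om F nu L mu al p q" and "0<nu" and sol: "obstacle_solution p Om F ps g v" and G: "rep Om (wgrad Om v) G"
 shows "En F Om G<oo" "energy F Om v = En F Om G"
proof -
 show eq: "energy F Om v = En F Om G" unfolding energy_def En_def by (rule nn_integral_cong_AE) (use assms in "auto simp: AE_lebesgue_on[OF open_sets_borel] rep_def elim!: eventually_mono")
 have i: "integrable (lebesgue_on Om) (%x. F x (wgrad Om v x))" using sol by (simp add: obstacle_solution_def)
 have "energy F Om v = (NL x:Om. en (norm (F x (wgrad Om v x))))" unfolding energy_def by (rule nn_integral_cong) (use integrand_nonneg[OF F] assms(3) in auto)
 also have "...<oo" by (rule conjunct2[OF iffD1[OF integrable_iff_bounded i]])
 finally show "En F Om G<oo" by (simp only: eq)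
qed

lemma solution_local_minimality:
 fixes Om :: "'a::euclidean_space set"
 assumes Om: "open Om" "bounded Om" and F: "pq_integrand Om F nu L mu al p q" and par: "0<nu" "0<=L" "0<=mu" "mu<=1" "1<p" "p<=q"
  and sol: "obstacle_solution p Om F ps g v" and v: "rep Om v v0" "rep Om (wgrad Om v) G" "wg Om v0 G" "Np p v0<oo" "Np p G<oo"
  and U: "U : sets borel" "U<=Om" "cball a r<=U" and r: "0<r" and ph: "W0 a r ph Ph" "Np p Ph<oo" "ae x. x : cball a r --> ps x<=v0 x + ph x"
 shows "En F U G<=En F U (%x. G x + Ph x)"
proof -
 have p1: "1<=p" "0<p" using par by auto
 have Omb: "Om : sets borel" using Om by simp
 have ca: "cball a r<=Om" using U by blast
 interpret I: integrand_on Om Om F nu L mu al p q by unfold_locales (use F Om par in auto)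
 interpret J: integrand_on Om U F nu L mu al p q by unfold_locales (use F Om U par bounded_subset in auto)
 have wph: "wg UNIV ph Ph" and z: "x ~: cball a r ==> ph x = 0" "x ~: cball a r ==> Ph x = 0" for x using ph(1) by (auto simp: W0_def)
 have [measurable]: "ph : bm" "Ph : bm" "G : bm" "v0 : bm" "U : sets borel" using wg_measurable[OF wph] wg_measurable[OF v(3)] U by auto
 have finph: "Np p ph<oo" by (rule le_less_trans[OF poincare[OF wph z(1) p1(1)]]) (use ph(2) in "auto simp: ennreal_mult_less_top")
 have rph: "rep Om ph ph" by (rule rep_refl, simp) (use z(1) ca in blast)
 let ?b = "%x. G x + Ph x"
 have fin: "Np p (%x. v0 x + ph x)<oo" "Np p ?b<oo" using v ph(2) finph p1 by (auto intro!: le_less_trans[OF Np_add] simp: ennreal_mult_less_top)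
 have zG: "G x + Ph x = 0" if "x ~: Om" for x using v(2) z(2)[of x] subsetD[OF ca, of x] that by (auto simp: rep_def simp del: mem_cball)
 note W = W1I[OF Om(1) rep_add[OF v(1) rph] wg_add[OF v(3) wg_mono[OF wph subset_UNIV]] zG p1(2) fin]
 have vc: "v : obstacle_class p Om ps g" and vmin: "!!w. w : obstacle_class p Om ps g ==> energy F Om v<=energy F Om w" using sol by (auto simp: obstacle_solution_def)
 have AEv: "ae x. x : Om --> v0 x = v x" using v(1) by (simp add: rep_def)
 have AEp: "ae x. x : Om --> ps x<=v x" using vc by (simp add: obstacle_class_def AE_lebesgue_on[OF Omb])
 have "ae x. x : Om --> ps x<=v x + ph x" using AEv AEp ph(3) by eventually_elim (metis z(1) add.right_neutral)
 moreover have "same_trace p Om (%x. v x + ph x) g" by (rule same_trace_perturb[OF Om p1(1) _ wph finph ph(2) ca z r]) (use vc in "auto simp: obstacle_class_def")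
 ultimately have "energy F Om v<=energy F Om (%x. v x + ph x)" by (intro vmin) (use W(1) in "simp add: obstacle_class_def AE_lebesgue_on[OF Omb]")
 moreover have en: "energy F Om u = En F Om D" if "rep Om (wgrad Om u) D" for u D unfolding energy_def En_def by (rule nn_integral_cong_AE) (use that in "auto simp: AE_lebesgue_on[OF Omb] rep_def elim!: eventually_mono")
 ultimately have le: "En F Om G<=En F Om ?b" by (simp add: en[OF v(2)] en[OF W(3)])
 have fin: "En F Om G<oo" by (rule solution_energy_finite[OF Om(1) F par(1) sol v(2)])
 obtain f0 where f0: "rep Om (%x. F x (G x)) f0" using rep_ex[OF Omb I.H_measurable[of G]] by auto
 obtain f1 where f1: "rep Om (%x. F x (G x + Ph x)) f1" using rep_ex[OF Omb I.H_measurable[of "%x. G x + Ph x"]] by auto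
 have [measurable]: "f0 : bm" "f1 : bm" using f0 f1 by (auto simp: rep_def)
 have split: "En F Om Y = En F U Y + (NN x:- U. f x)"
  if f: "rep Om (%x. F x (Y x)) f" for Y f
 proof -
  have [measurable]: "f : bm" using f by (simp add: rep_def)
  have "En F Om Y = (NN x. en (f x))" unfolding En_rep[where F=F and Y=Y, OF Omb order_refl f] by (rule nn_integral_cong) (use f in "auto simp: rep_def indicator_def")
  also have "... = (NN x. ind U x * en (f x) + ind (- U) x * en (f x))" by (intro nn_integral_cong) (auto simp: indicator_def)
  also have "... = (NN x:U. f x)+(NN x:- U. f x)" by (rule nn_integral_add) auto
  finally show ?thesis by (simp only: En_rep[where F=F and Y=Y, OF U(1,2) f])
 qed
 let ?a = "NN x:- U. f0 x"
 have "?a = (NN x:- U. f1 x)"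
 proof (rule nn_integral_cong_AE)
  have "ae x. x : Om --> f0 x = F x (G x)" "ae x. x : Om --> f1 x = F x (G x + Ph x)" using f0 f1 by (auto simp: rep_def)
  thus "ae x. ind (- U) x * en (f0 x) = ind (- U) x * en (f1 x)"
  proof eventually_elim
   case (elim x)
   have "x ~: U ==> Ph x = 0" using z(2)[of x] U(3) by blast
   thus ?case using elim f0 f1 by (cases "x : Om") (auto simp: rep_def indicator_def)
  qed
 qed
 hence "?a + En F U G<=?a + En F U ?b" using le unfolding split[OF f0] split[OF f1] by (simp add: add.commute)
 moreover have "?a<oo" by (rule le_less_trans[OF _ fin]) (simp add: split[OF f0] add_increasing)
 ultimately show ?thesis by (auto simp: ennreal_add_left_cancel_le)
qed

lemma solution_approximation:
 fixes Om :: "'a::euclidean_space set"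
 assumes Om: "open Om" "bounded Om" and F: "pq_integrand Om F nu L mu al p q" and par: "0<nu" "0<=L" "0<=mu" "mu<=1" "1<p" "p<=q"
  and sol: "obstacle_solution p Om F ps g v" and v: "rep Om v v0" "rep Om (wgrad Om v) G" "wg Om v0 G" "Np p v0<oo" "Np p G<oo"
  and ps0: "rep Om ps ps0" and ball: "ball x0 rh \<Subset> Om" "0<rh" and gap: "lavrentiev_gap p q Om F ps v (ball x0 rh) = 0"
 obtains y Y ep where "!!k::nat. 0<=ep k & ep k<=1" "ae x. x : ball x0 rh --> (%k. Y k x) ----> G x"
  "!!k. obstacle_minimiser (%x z. F x z + ep k * qpow q z) q (ball x0 rh) (cball x0 (7*rh/8)) ps0 (y k) (Y k)"
  "!!k. en nu * Np p (Y k)<=En F (ball x0 rh) G + 2"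
proof -
 define U where "U = ball x0 rh"
 have Ub: "U : sets borel" "bounded U" "open U" by (auto simp: U_def)
 have UOm: "U<=Om" using ball(1) closure_subset[of "ball x0 rh"] by (auto simp: compactly_inside_def U_def)
 have Omb: "Om : sets borel" using Om by simp
 have p1: "1<=p" "0<p" "0<=q" "1<=q" using par by auto
 interpret I: integrand_on Om U F nu L mu al p q by unfold_locales (use F Om Ub UOm par in auto)
 have psm[measurable]: "ps0 : bm" and v0m[measurable]: "v0 : bm" and Gm[measurable]: "G : bm" "U : sets borel" using ps0 v Ub by (auto simp: rep_def)
 define v1 where "v1 x = ind U x *R v0 x" for x
 define G1 where "G1 x = ind U x *R G x" for x
 have [measurable]: "v1 : bm" "G1 : bm" unfolding v1_def[abs_def] G1_def[abs_def] by auto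
 have w1: "wg U v1 G1" unfolding v1_def[abs_def] G1_def[abs_def] by (rule wg_indicator[OF wg_mono[OF v(3) UOm] Ub(1)])
 have f1: "Np p v1<oo" "Np p G1<oo" unfolding v1_def[abs_def] G1_def[abs_def] by (rule le_less_trans[OF Np_indicator_le v(4)], rule le_less_trans[OF Np_indicator_le v(5)])
 have rv: "rep U v v1" unfolding v1_def[abs_def] by (rule rep_subset[OF v(1) UOm Ub(1)])
 have rG: "rep U (wgrad U v) G1" by (rule W1I(3)[OF Ub(3) rv w1 _ p1(2) f1]) (simp add: G1_def)
 have G1z: "x ~: U ==> G1 x = 0" for x by (simp add: G1_def)
 let ?e = "En F U G1"
 have EG: "?e = En F U G" by (rule I.En_cong) (simp add: G1_def)
 have vc: "v : obstacle_class p Om ps g" using sol by (simp add: obstacle_solution_def)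
 have EGfin: "?e<oo"
 proof -
  interpret J: integrand_on Om Om F nu L mu al p q by unfold_locales (use F Om par in auto)
  obtain f where f: "rep Om (%x. F x (G x)) f" using rep_ex[OF Omb J.H_measurable[of G]] by auto
  have "En F U G<=En F Om G" unfolding En_rep[where F=F and Y=G, OF Ub(1) UOm f] En_rep[where F=F and Y=G, OF Omb order_refl f] using UOm by (intro nn_integral_mono) (auto simp: indicator_def)
  thus ?thesis unfolding EG by (rule le_less_trans) (rule solution_energy_finite[OF Om(1) F par(1) sol v(2)])
 qed
 have en: "energy F U v<oo"
 proof -
  have "energy F U v = ?e" unfolding energy_def En_def by (rule nn_integral_cong_AE) (use rG in "auto simp: AE_lebesgue_on[OF Ub(1)] rep_def elim!: eventually_mono")
  thus ?thesis using EGfin by simp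
 qed
 have AEps: "ae x. x : Om --> ps0 x = ps x" using ps0 by (simp add: rep_def)
 have AEv: "ae x. x : U --> ps0 x<=v1 x"
 proof -
  have "ae x. x : Om --> ps x<=v x" "ae x. x : Om --> v0 x = v x" using vc v(1) by (auto simp: obstacle_class_def AE_lebesgue_on[OF Omb] rep_def)
  with AEps show ?thesis by eventually_elim (use UOm in "auto simp: v1_def")
 qed
 define B where "B = ball x0 (15*rh/16)"
 let ?b = "7*rh/8"
 let ?f = "cball x0 ?b"
 have B: "B : sets borel" "B<=U" "?f<=B" "?f<=U" "0<15*rh/16" "0<rh/32" "cball x0 (15*rh/16+rh/32)<=U" using ball(2) by (auto simp: B_def U_def)
 let ?g = "%k. en (1 / Suc k)"
 define PW where "PW k w W <-> wg U w W & (ALL x. x ~: U --> W x = 0) & Np q W<oo & (ae x. x : U --> ps0 x<=w x) &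
  Np p (%x. W x - G1 x)<=?g k & Np p (%x. ind B x *R (w x - v1 x))<=?g k &
  En F U W<=?e + ?g k" for k :: nat and w W
 let ?d = "%k. ?e + ?g k"
 have "EX w W. PW k w W" for k
 proof -
  obtain w W where w: "wg U w W" "!!x. x ~: U ==> W x = 0" "Np q W<oo" "ae x. x : U --> ps x<=w x"
   "Np p (%x. W x - G1 x)<=?g k" "Np p (%x. ind B x *R (w x - v1 x))<=?g k" "En F U W<=?d k"
   by (rule I.gap_approximation[OF Ub(3) ball(1)[folded U_def] rv rG w1 f1 en gap[folded U_def] B(7,5,6), of "1 / Suc k", folded B_def]) auto
  have "ae x. x : U --> ps0 x<=w x" using w(4) AEps by eventually_elim (use UOm in auto)
  hence "PW k w W" using w unfolding PW_def by blast
  thus ?thesis by blast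
 qed
 then obtain w W where PW: "!!k. PW k (w k) (W k)" by metis
 have w: "wg U (w k) (W k)" "!!x. x ~: U ==> W k x = 0" "Np q (W k)<oo" "ae x. x : U --> ps0 x<=w k x"
  "Np p (%x. W k x - G1 x)<=?g k" "Np p (%x. ind B x *R (w k x - v1 x))<=?g k"
  "En F U (W k)<=?d k" for k using PW[of k] unfolding PW_def by blast+
 have Wm[measurable]: "W k : bm" for k using wg_measurable[OF w(1)] by simp
 let ?a = "%k. (NL x:U. en (qpow q (W k x)))"
 define T where "T k = enn2real (?a k)" for k
 let ?h = "borel_measurable (lebesgue_on U)"
 have qm[measurable]: "(%x. qpow q (Y x)) : ?h" if "Y : bm" for Y :: "'a => 'a" by (rule rep_measurable[OF Ub(1) rep_indicator]) (use that in "auto simp: qpow_def[abs_def]")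
 have T: "?a k = en (T k)" for k
 proof -
  have i: "integrable (lebesgue_on U) (%x. (1 + norm (W k x) + norm ((%_. 0 :: 'a) x)) powr q)" by (rule integrable_one_plus_powr) (use w(3) Ub p1 in "auto simp: Np_def")
  have "?a k<=(NL x:U. en (norm ((1 + norm (W k x) + norm (0 :: 'a)) powr q)))" unfolding qpow_def using quadratic_growth_bound[OF p1(3)] by (intro nn_integral_mono ennreal_leI) auto
  also have "...<oo" by (rule conjunct2[OF iffD1[OF integrable_iff_bounded i]])
  finally show ?thesis by (simp add: T_def)
 qed
 define ep where "ep k = 1/(real (Suc k) * (1 + T k))" for k
 have T0: "0<=T k" for k by (simp add: T_def)
 have ep: "0<ep k" "ep k<=1" "ep k * T k<=1 / Suc k" for k
 proof -
  have "1*1<=real (Suc k) * (1 + T k)" using T0[of k] by (intro mult_mono) auto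
  thus "0<ep k" "ep k<=1" using T0[of k] by (auto simp: ep_def divide_le_eq add_pos_nonneg)
  have "T k / (1 + T k)<=1" using T0[of k] by (simp add: divide_le_eq add_pos_nonneg)
  hence "(1 / Suc k)*(T k / (1 + T k))<=1 / Suc k" by (intro mult_left_le) auto
  thus "ep k * T k<=1 / Suc k" by (simp add: ep_def)
 qed
 let ?H = "%k x z. F x z + ep k * qpow q z"
 have H: "integrand_on Om U (?H k) nu (L+1) mu al p q" for k by unfold_locales (use pq_integrand_perturb[OF F less_imp_le[OF ep(1)[of k]] ep(2)[of k] p1(4) par(2)] Om Ub UOm par in auto)
 let ?c = "%Y. (NL x:U. en (qpow q (Y x)))"
 have Hsum: "En (?H k) U Y = En F U Y + en (ep k) * (?c Y)" if [measurable]: "Y : bm" for k Y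
 proof -
  have [measurable]: "(%x. F x (Y x)) : ?h" by (rule I.H_measurable[OF that])
  have "En (?H k) U Y = (NL x:U. en (F x (Y x)) + en (ep k) * en (qpow q (Y x)))"
   unfolding En_def using ep(1)[of k] by (intro nn_integral_cong) (auto simp: ennreal_mult'[symmetric] qpow_nonneg I.H_nonneg ennreal_plus[symmetric] simp del: ennreal_plus)
  also have "... = En F U Y + en (ep k) * (?c Y)" unfolding En_def by (subst nn_integral_add) (auto simp: nn_integral_cmult)
  finally show ?thesis .
 qed
 define PM where "PM k ph Ph <-> W0 x0 ?b ph Ph & obstacle_minimiser (?H k) q U ?f ps0 (%x. w k x + ph x) (%x. W k x + Ph x) &
  (ae x. x : U --> ps0 x<=w k x + ph x) & En (?H k) U (%x. W k x + Ph x)<=En (?H k) U (W k)" for k ph Ph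
 have "EX ph Ph. PM k ph Ph" for k
 proof -
  have co: "ep k * norm z powr q<=F x z + ep k * qpow q z" if "x : U" for x z using mult_left_mono[OF norm_powr_le_qpow[OF p1(3)], of "ep k" z] ep(1)[of k] I.H_nonneg[OF that, of z] by linarith
  show ?thesis unfolding PM_def by (rule integrand_on.obstacle_minimiser_exists[OF H ep(1) co w(1,2,3) psm w(4) B(4)]) blast+
 qed
 then obtain ph Ph where PM: "!!k. PM k (ph k) (Ph k)" by metis
 have W0: "W0 x0 ?b (ph k) (Ph k)"
  and om: "obstacle_minimiser (?H k) q U ?f ps0 (%x. w k x + ph k x) (%x. W k x + Ph k x)"
  and AEk: "ae x. x : U --> ps0 x<=w k x + ph k x" and Ek: "En (?H k) U (%x. W k x + Ph k x)<=En (?H k) U (W k)" for k using PM[of k] unfolding PM_def by blast+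
 define Y where "Y k x = W k x + Ph k x" for k x
 have [measurable]: "Ph k : bm" for k using W0_measurable[OF W0] by simp
 have Ym[measurable]: "Y k : bm" for k unfolding Y_def[abs_def] by measurable
 have Yz: "Y k x = 0" if "x ~: U" for k x using om[of k] that by (simp add: obstacle_minimiser_def Y_def)
 have EY: "En F U (Y k)<=?e + en (2 / Suc k)" for k
 proof -
  have "En F U (Y k)<=En (?H k) U (Y k)" unfolding Hsum[OF Ym] by (simp add: add_increasing2)
  also have "...<=En (?H k) U (W k)" using Ek[of k] by (simp add: Y_def[abs_def])
  also have "... = En F U (W k) + en (ep k * T k)" unfolding Hsum[OF Wm] T using ep(1)[of k] by (simp add: ennreal_mult')
  also have "...<=(?d k) + ?g k" by (intro add_mono w(7) ennreal_leI ep)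
  also have "... = ?e + en (2 / Suc k)" by (simp add: add.assoc ennreal_plus[symmetric] del: ennreal_plus)
  finally show ?thesis .
 qed
 have vmin: "?e<=En F U (%x. G1 x + Ph x)" if "W0 x0 ?b ph Ph" "Np p Ph<oo" "ae x. x : B --> ps0 x<=v1 x + ph x" for ph Ph
 proof -
  have "ae x. x : ?f --> ps x<=v0 x + ph x" using that(3) AEps
  proof eventually_elim
   case (elim x)
   have "x : B" "x : U" "x : Om" if "x : ?f" using that B(3,4) UOm by blast+
   thus ?case using elim by (auto simp: v1_def simp del: mem_cball)
  qed
  hence "En F U G<=En F U (%x. G x + Ph x)" by (intro solution_local_minimality[OF Om F par sol v Ub(1) UOm B(4) _ that(1,2)]) (use ball in auto)
  moreover have "En F U (%x. G x + Ph x) = En F U (%x. G1 x + Ph x)" by (rule I.En_cong) (simp add: G1_def)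
  ultimately show ?thesis using EG by simp
 qed
 have conv: "EX N. ALL k>=N. Np p (%x. Y k x - G1 x)<=en e" if "0<e" for e unfolding Y_def
 proof (rule I.approximate_minimisers_converge[OF w1 G1z EGfin psm _ B(1,4) vmin w(1,2,5,6) W0 _ _ that])
  show "ae x. x : B --> ps0 x<=v1 x" by (rule eventually_mono[OF AEv]) (use B(2) in auto)
  show "ae x. x : B --> ps0 x<=w k x + ph k x" for k by (rule eventually_mono[OF AEk]) (use B(2) in auto)
  show "En F U (%x. W k x + Ph k x)<=?e + en (2 / Suc k)" for k using EY[of k] by (simp add: Y_def[abs_def])
 qed
 have YE: "en nu * Np p (Y k)<=En F U G + 2" for k
 proof -
  have "en nu * Np p (Y k)<=?e + en (2 / Suc k)" by (rule order_trans[OF I.Np_le_En[OF Ym Yz] EY])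
  also have "en (2 / Suc k)<=en 2" by (rule ennreal_leI) (simp add: divide_le_eq)
  finally show ?thesis by (simp add: EG add_left_mono)
 qed
 have Yfin: "Np p (Y k)<oo" for k by (rule I.Np_finite_of_En[OF Ym Yz]) (use le_less_trans[OF EY[of k]] EGfin in auto)
 obtain r :: "nat => nat" where r: "ae x. (%k. Y (r k) x) ----> G1 x" by (rule Np_limit_AE_subseq[of Y G1 x0 rh p]) (use Yz p1 Yfin conv in "auto simp: U_def")
 show ?thesis
 proof (rule that[of "%k. ep (r k)" "%k. Y (r k)" "%k x. w (r k) x + ph (r k) x"])
  show "ae x. x : ball x0 rh --> (%k. Y (r k) x) ----> G x" using r by eventually_elim (auto simp: G1_def U_def)
 qed (use ep om YE in "auto simp: U_def Y_def[abs_def] less_imp_le")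
qed

lemma W1frac_imp_W1: "ps : W1frac al q Om ==> ps : W1 q Om" by (auto simp: W1frac_def W2_def split: if_splits)

lemma data_integral:
 fixes Om :: "'a::euclidean_space set"
 assumes Om: "open Om" "bounded Om" and F: "pq_integrand Om F nu L mu al p q" and par: "0<nu"
  and G: "rep Om (wgrad Om v) G" and P: "rep Om (wgrad Om ps) P" and fin: "En F Om G<oo" "Np q P<oo" and U: "U : sets borel" "U<=Om"
 shows "en (LL x:U. F x (wgrad Om v x) + norm (wgrad Om ps x) powr q) = En F U G + (NN x:U. norm (P x) powr q)"
  "0<=(LL x:U. F x (wgrad Om v x) + norm (wgrad Om ps x) powr q)"
proof -
 have Omb: "Om : sets borel" using Om by simp
 let ?f = "%x. F x (wgrad Om v x)" and ?g = "%x. norm (wgrad Om ps x) powr q"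
 have [measurable]: "U : sets borel" "P : bm" "G : bm" using U G P by (auto simp: rep_def)
 let ?c = "lebesgue_on U"
 let ?e = "borel_measurable ?c"
 have wm: "wgrad Om v : ?e" "wgrad Om ps : ?e" by (rule rep_measurable[OF U(1) rep_subset[OF G U(2,1)]], rule rep_measurable[OF U(1) rep_subset[OF P U(2,1)]])
 have [measurable]: "?f : ?e" by (rule integrand_measurable(1)[OF F U(2,1) Omb wm(1)])
 have [measurable]: "?g : ?e" using wm(2) by measurable
 have f0: "0<=?f x" if "x : U" for x using integrand_nonneg[OF F] U par that by (auto intro: less_imp_le)
 have eG: "(NL x:U. en (?f x)) = En F U G" unfolding En_def by (rule nn_integral_cong_AE) (use G U in "auto simp: AE_lebesgue_on[OF U(1)] rep_def elim!: eventually_mono")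
 let ?a = "NN x:U. norm (P x) powr q"
 have eP: "(NL x:U. en (?g x)) = ?a" by (rule nn_integral_rep) (use P U in "auto simp: rep_def elim!: eventually_mono")
 let ?b = "(NL x:U. en (?f x + ?g x))"
 have sum: "?b = En F U G + ?a" unfolding eG[symmetric] eP[symmetric] by (subst nn_integral_add[symmetric]) (auto simp: f0 intro!: nn_integral_cong)
 let ?d = "(LL x:U. ?f x + ?g x)"
 have "En F U G<=En F Om G"
 proof -
  have "(%x. F x (G x)) : borel_measurable (lebesgue_on Om)" by (rule integrand_measurable(1)[OF F order_refl Omb Omb rep_measurable[OF Omb rep_refl]]) (use G in "auto simp: rep_def")
  then obtain f where f: "rep Om (%x. F x (G x)) f" using rep_ex[OF Omb] by blast
  show ?thesis unfolding En_rep[where F=F and Y=G, OF U f] En_rep[where F=F and Y=G, OF Omb order_refl f] using U by (intro nn_integral_mono) (auto simp: indicator_def)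
 qed
 moreover have "?a<=Np q P" unfolding Np_def by (intro nn_integral_mono) (auto simp: indicator_def)
 ultimately have "?b<oo" unfolding sum using fin by (auto intro: le_less_trans)
 hence "integrable ?c (%x. ?f x + ?g x)" by (intro integrableI_nonneg) (auto simp: AE_lebesgue_on f0)
 thus "en ?d = En F U G + ?a" unfolding sum[symmetric] by (intro nn_integral_eq_integral[symmetric]) (auto simp: f0)
 show "0<=?d" by (rule Bochner_Integration.integral_nonneg) (auto simp: f0)
qed

lemma solution_estimate:
 fixes nu L p q al si R0 N :: real
 defines "n == real DIM('a::euclidean_space)"
 defines "k == absorb_exponent n p q al"
 assumes n: "2<=n" and par: "0<nu" "0<=L" "1<p" "p<=q" and al: "0<al" "al<=1"
  and q: "q<p*(1+al/n)" and si: "2<=si" "si<2*n/(n-al)" and R0: "0<R0"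
 obtains C where "0<C" "!!Om F mu ps g v v0 (G :: 'a => 'a) x0 rh.
  open Om ==> bounded Om ==> pq_integrand Om F nu L mu al p q ==> 0<=mu ==> mu<=1 ==> ps : W1frac al q Om ==> W1frac_norm al q Om ps = N ==>
  obstacle_solution p Om F ps g v ==> rep Om v v0 ==> rep Om (wgrad Om v) G ==> wg Om v0 G ==> Np p v0<oo ==> Np p G<oo ==>
  ball x0 rh \<Subset> Om ==> 0<rh ==> rh<=R0 ==> lavrentiev_gap p q Om F ps v (ball x0 rh) = 0 ==>
  (NN x:ball x0 (rh/2). norm (V mu p (G x)) powr si)
   <= en (C*((1+(LL x:ball x0 rh. F x (wgrad Om v x) + norm (wgrad Om ps x) powr q)) powr (2*(1+al/n*k)) / rh powr (4*(k+2)))) &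
  (EX K>=0. ALL h. incr2 (ball x0 (rh/2)) (%x. V mu p (G x)) h<=en (K * norm h powr al))"
proof -
 have q1: "1<=q" "1<=p" "0<=q" using par by auto
 define c1 where "c1 = real DIM('a) powr q * real DIM('a) + 2 * 2 powr q * 2 ^ DIM('a) / unit_ball_vol DIM('a)"
 have c1: "0<=c1" by (simp add: c1_def)
 define e1 where "e1 = 2*(1+al/n*k)"
 define e2 where "e2 = 4*(k+2)"
 show ?thesis
 proof (rule regular_minimiser_estimate[where 'a='a, folded n_def, OF n par(1) _ par(3,4) al q si R0, where N = "c1 * N powr q" and L = "L+1", folded k_def, folded e1_def e2_def], goal_cases)
  case 1 show ?case using par by simp
 next
  case 2 show ?case using c1 by simp
 next
  case (3 C1)
  note C1 = 3(1) and re = 3(2)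
  define b where "b = 1+2/nu"
  have b: "0<b" using par by (simp add: b_def add_pos_pos)
  define C where "C = C1 * b powr e1"
  have C: "0<C" using C1 b by (simp add: C_def)
  show ?thesis
  proof (rule that[OF C], goal_cases)
   case (1 Om F mu ps g v v0 G x0 rh)
   note Om = 1(1,2) and F = 1(3) and mu = 1(4,5) and ps = 1(6,7) and sol = 1(8) and v = 1(9-13) and ball = 1(14,15) and rh = 1(15,16) and gap = 1(17)
   define U where "U = ball x0 rh"
   have U: "U : sets borel" "U<=Om" using ball(1) closure_subset[of "ball x0 rh"] by (auto simp: compactly_inside_def U_def)
   obtain ps0 P where P: "rep Om ps ps0" "rep Om (wgrad Om ps) P" "wg Om ps0 P" "Np q ps0<oo" "Np q P<oo" by (rule W1_rep[OF Om q1(1) W1frac_imp_W1[OF ps(1)]])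
   have [measurable]: "P : bm" "G : bm" "ball x0 (rh/2) : sets borel" using P v by (auto simp: rep_def)
   obtain y Y ep where ep: "!!k::nat. 0<=ep k & ep k<=1" and lim: "ae x. x : U --> (%k. Y k x) ----> G x"
    and om: "!!k. obstacle_minimiser (%x z. F x z + ep k * qpow q z) q U (cball x0 (7*rh/8)) ps0 (y k) (Y k)"
    and YE: "!!k. en nu * Np p (Y k)<=En F U G + 2" by (rule solution_approximation[OF Om F par(1,2) mu par(3,4) sol v P(1) ball gap, folded U_def]) (rule that)
   have [measurable]: "Y k : bm" for k using om[of k] wg_measurable by (auto simp: obstacle_minimiser_def)
   have Efin: "En F Om G<oo" by (rule solution_energy_finite[OF Om(1) F par(1) sol v(2)])
   define D where "D = (LL x:U. F x (wgrad Om v x) + norm (wgrad Om ps x) powr q)"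
   let ?d = "NN x:U. norm (P x) powr q"
   have D: "en D = En F U G + ?d" "0<=D" unfolding D_def using data_integral[OF Om F par(1) v(2) P(2) Efin P(5) U] by auto
   define X where "X = b*(1+D)"
   have bD: "1*1<=b*(1+D)" using D(2) par by (intro mult_mono) (auto simp: b_def)
   hence X: "1<=X" by (simp add: X_def)
   let ?c = "%k. NN x:U. norm (Y k x) powr p + norm (P x) powr q"
   have XI: "?c k<=en X" for k
   proof -
    have "Np p (Y k) = en (1/nu) * (en nu * Np p (Y k))" using par by (simp add: mult.assoc[symmetric] ennreal_mult'[symmetric])
    also have "...<=en (1/nu) * (en D + 2)" by (intro mult_left_mono order_trans[OF YE] add_right_mono) (auto simp: D(1))
    also have "... = en ((D+2)/nu)" using par D(2) by (simp add: ennreal_mult'[symmetric] flip: ennreal_numeral ennreal_plus)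
    finally have 1: "Np p (Y k)<=en ((D+2)/nu)" .
    have "?c k <= (NN x. en (norm (Y k x) powr p) + ind U x * en (norm (P x) powr q))" by (intro nn_integral_mono) (auto simp: indicator_def)
    also have "... = Np p (Y k) + ?d" using U by (simp add: nn_integral_add Np_def)
    also have "...<=en ((D+2)/nu) + en D" by (intro add_mono 1) (simp add: D(1))
    also have "... = en ((D+2)/nu+D)" using D(2) par by simp
    also have "...<=en X"
    proof (rule ennreal_leI)
     have "0<=D/nu" using D(2) par by simp
     thus "(D+2)/nu+D<=X" by (simp add: X_def b_def distrib_left distrib_right add_divide_distrib)
    qed
    finally show ?thesis .
   qed
   have dP: "(NN x:ball x0 (13*rh/16). norm (P (x+h) - P x) powr q)<=en ((c1 * N powr q) * norm h powr (al*q))" if h: "norm h<=rh/16" for h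
   proof -
    have "ball x0 (13*rh/16+2 * norm h)<=U" unfolding U_def using h ball(2) by (intro subset_ball) simp
    hence "ball x0 (13*rh/16+2 * norm h)<=Om" using U(2) by blast
    from obstacle_difference[OF Om q1(1) al(1) ps(1) P(2) this] show ?thesis unfolding ps(2) c1_def by (simp only: mult_ac)
   qed
   let ?a = "ball x0 (rh/2)"
   let ?b = "X powr e1 / rh powr e2"
   have est: "(NN x:?a. norm (V mu p (Y i x)) powr si)<=en (C1*?b) & (ALL h. (incr2 ?a (%x. V mu p (Y i x)) h) <= en (C1*?b * norm h powr al))" for i
   proof (rule re[OF pq_integrand_perturb[OF F _ _ q1(1) par(2)] mu _ _ rh om[of i, unfolded U_def] _ P(5) X])
    show "wg (ball x0 rh) ps0 P" by (rule wg_mono[OF P(3)]) (use U in "simp add: U_def")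
   qed (use ep[of i] U Om XI dP in "auto simp: U_def")
   have inU: "x : U" if "x : ball x0 (rh/2)" for x using that ball(2) by (auto simp: U_def)
   have eq: "C1*?b = C*((1+D) powr e1 / rh powr e2)" by (simp add: X_def C_def powr_mult)
   let ?e = "%x h. V mu p (G (x+h)) - V mu p (G x)"
   let ?f = "%x. norm (V mu p (G x)) powr si"
   have "(NN x:?a. ?f x)<=en (C1*?b)"
   proof (rule nn_integral_limit_le)
    show "ae x. (%i. ind ?a x * en (norm (V mu p (Y i x)) powr si)) ----> ind ?a x * en (?f x)" using lim
    proof eventually_elim
     case (elim x)
     show ?case
     proof (cases "x : ball x0 (rh/2)")
      case True
      have "(%i. norm (V mu p (Y i x)) powr si) ----> ?f x" by (rule tendsto_powr'[OF tendsto_norm[OF V_tendsto[OF _ par(3)]] tendsto_const]) (use elim inU[OF True] si in auto)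
      thus ?thesis using True by (simp add: tendsto_ennrealI)
     qed simp
    qed
   qed (measurable, use est in blast)
   moreover have "(NN x. ind ?a x * ind ?a (x+h) * en (norm (?e x h) powr 2)) <= en (C1*?b * norm h powr al)" for h
   proof (rule nn_integral_limit_le)
    show "ae x. (%i. ind ?a x * ind ?a (x+h) * en (norm (V mu p (Y i (x+h)) - V mu p (Y i x)) powr 2))
     ----> ind ?a x * ind ?a (x+h) * en (norm (?e x h) powr 2)" using lim AE_translate[OF lim, of h]
    proof eventually_elim
     case (elim x)
     show ?case
     proof (cases "x : ball x0 (rh/2) & x+h : ball x0 (rh/2)")
      case True
      have "(%i. norm (V mu p (Y i (x+h)) - V mu p (Y i x)) powr 2) ----> norm (?e x h) powr 2"
       by (rule tendsto_powr'[OF tendsto_norm[OF tendsto_diff[OF V_tendsto[OF _ par(3)] V_tendsto[OF _ par(3)]]] tendsto_const]) (use elim True inU in auto)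
      thus ?thesis using True by (simp add: tendsto_ennrealI del: powr_numeral)
     qed (auto simp: indicator_def)
    qed
   qed (measurable, use est in blast)
   moreover have "0<=C1*?b" using C1 by simp
   ultimately show ?case unfolding eq e1_def[symmetric] e2_def[symmetric] U_def[symmetric] D_def[symmetric] by blast
  qed
 qed
qed

lemma norm_powr_le_V_powr:
 fixes z :: "'a::euclidean_space"
 assumes p: "1<p" and mu: "0<=mu" "mu<=1" and d: "0<=d"
 shows "norm z powr d<=(1 + 2 powr (max d p) * 2 powr (max d p / p))*(1 + norm (V mu p z) powr (2 * max d p / p))"
proof -
 define e where "e = max d p"
 have e: "0<e" "d<=e" "e/p >= 0" using p by (auto simp: e_def)
 let ?a = "1 + norm (V mu p z) powr (2*e/p)"
 let ?b = "norm (V mu p z)"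
 have "norm z powr e = (norm z powr p) powr (e/p)" using p by (simp add: powr_powr)
 also have "...<=(2 powr p * (1+?b^2)) powr (e/p)" using e power_le_V[OF p mu, of z] by (intro powr_mono2) auto
 also have "... = 2 powr e * (1+?b^2) powr (e/p)" using p by (simp add: powr_mult powr_powr)
 also have "...<=2 powr e * (2 powr (e/p) * (1 powr (e/p) + (?b^2) powr (e/p)))" using e by (intro mult_left_mono powr_add_le) auto
 also have "(?b^2) powr (e/p) = norm (V mu p z) powr (2*e/p)" by (cases "V mu p z = 0") (simp_all add: powr_powr flip: powr_numeral)
 finally have 1: "norm z powr e<=2 powr e * 2 powr (e/p) * ?a" by simp
 have "norm z powr d<=1 + norm z powr e"
 proof (cases "norm z<=1")
  case True thus ?thesis using powr_le1[OF d, of "norm z"] by (simp add: add_increasing2)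
 next
  case False thus ?thesis using powr_mono[OF e(2), of "norm z"] by (simp add: add_increasing)
 qed
 also have "...<=1*?a + 2 powr e * 2 powr (e/p) * ?a" using 1 by (intro add_mono) auto
 finally show ?thesis by (simp only: distrib_right e_def)
qed

lemma finite_ball_cover:
 fixes Om :: "'a::euclidean_space set"
 assumes "open Om" and U: "U \<Subset> Om"
 obtains rh X where "0<rh" "rh<=1" "finite X" "U<=(\<Union>x\<in>X. ball x (rh/4))" "!!x. x : X ==> ball x rh \<Subset> Om"
proof -
 have K: "compact (closure U)" "closure U<=Om" using U by (auto simp: compactly_inside_def)
 obtain e where e: "0<e" "(\<Union>x\<in>closure U. ball x e)<=Om" using compact_subset_open_imp_ball_epsilon_subset[OF K(1) assms(1) K(2)] by blast
 define rh where "rh = min 1 (e/2)"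
 have rh: "0<rh" "rh<=1" "rh<e" using e by (auto simp: rh_def)
 obtain X where X: "X<=closure U" "finite X" "closure U<=(\<Union>x\<in>X. ball x (rh/4))" by (rule compactE_image[OF K(1), of "closure U" "%x. ball x (rh/4)"]) (use rh in auto)
 have "ball x rh \<Subset> Om" if "x : X" for x
 proof -
  have "cball x rh<=ball x e" using rh by auto
  hence "cball x rh<=Om" using e(2) X(1) that by blast
  thus ?thesis using rh by (auto simp: compactly_inside_def)
 qed
 thus ?thesis using rh X closure_subset[of U] by (intro that[of rh X]) auto
qed

lemma exponent_range:
 fixes n p al d :: real
 assumes "2<=n" "1<p" "0<al" "al<=1" "d<n*p/(n-al)"
 shows "2<=2 * max d p / p" "2 * max d p / p<2*n/(n-al)"
proof -
 have n: "0<n-al" using assms by simp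
 have "p*(n-al)<p*n" using assms by (intro mult_strict_left_mono) auto
 hence "p<n*p/(n-al)" using n by (simp add: less_divide_eq mult.commute)
 hence "max d p<n*p/(n-al)" using assms by simp
 thus "2 * max d p / p<2*n/(n-al)" using n n assms by (simp add: less_divide_eq divide_less_eq mult_ac)
 show "2<=2 * max d p / p" using assms by (simp add: pos_le_divide_eq)
qed

lemma solution_norm_estimate:
 fixes nu L p q al d R0 N :: real
 defines "n == real DIM('a::euclidean_space)"
 defines "k == absorb_exponent n p q al"
 assumes n: "2<=n" and par: "0<nu" "0<=L" "1<p" "p<=q" and al: "0<al" "al<=1"
  and q: "q<p*(1+al/n)" and d: "1<=d" "d<n*p/(n-al)" and R0: "0<R0"
 shows "EX C. ALL (Om :: 'a set) F mu ps g v x0 rh. open Om --> bounded Om --> pq_integrand Om F nu L mu al p q --> 0<=mu --> mu<=1 -->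
  ps : W1frac al q Om --> W1frac_norm al q Om ps = N --> obstacle_solution p Om F ps g v -->
  ball x0 rh \<Subset> Om --> 0<rh --> rh<=R0 --> lavrentiev_gap p q Om F ps v (ball x0 rh) = 0 -->
  Lp_norm d (ball x0 (rh/2)) (wgrad Om v)<=C / rh powr (4*(k+2)) *
   (1+(LL x:ball x0 rh. F x (wgrad Om v x) + norm (wgrad Om ps x) powr q)) powr (2*(1+al/n*k))"
proof -
 define si where "si = 2 * max d p / p"
 have si: "2<=si" "si<2*n/(n-al)" unfolding si_def by (rule exponent_range[OF n par(3) al d(2)])+
 define e1 where "e1 = 2*(1+al/n*k)"
 define e2 where "e2 = 4*(k+2)"
 have k0: "0<=k"
 proof -
  have "2*q/p<2+al*2/n" using q par n by (simp add: field_simps)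
  moreover have "2<=2*q/p" using par by (simp add: pos_le_divide_eq)
  ultimately show ?thesis unfolding k_def absorb_exponent_def by (intro divide_nonneg_pos) auto
 qed
 have e: "0<=e1" "0<=e2" using k0 n al by (auto simp: e1_def e2_def)
 show ?thesis unfolding e1_def[symmetric] e2_def[symmetric]
 proof (rule solution_estimate[where 'a='a, folded n_def, OF n par al q si R0, where N = N, folded k_def, folded e1_def e2_def], goal_cases)
  case (1 C1)
  note C1 = 1(1) and est = 1(2)[THEN conjunct1]
  define c where "c = 1 + 2 powr (max d p) * 2 powr (max d p / p)"
  have c: "0<c" by (simp add: c_def add_pos_pos)
  define m where "m = measure lborel (cball (0::'a) R0)"
  have m: "0<=m" by (simp add: m_def)
  let ?a = "(1+c*m) * R0 powr e2 + c*C1"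
  let ?b = "%x0 rh. ball x0 (rh/2)"
  have main: "Lp_norm d (?b x0 rh) (wgrad Om v)<=?a / rh powr e2 * (1+(LL x:ball x0 rh. F x (wgrad Om v x) + norm (wgrad Om ps x) powr q)) powr e1"
   if Om: "open Om" "bounded Om" and F: "pq_integrand Om F nu L mu al p q" and mu: "0<=mu" "mu<=1" and ps: "ps : W1frac al q Om" "W1frac_norm al q Om ps = N"
   and sol: "obstacle_solution p Om F ps g v" and rh: "ball x0 rh \<Subset> Om" "0<rh" "rh<=R0" and gap: "lavrentiev_gap p q Om F ps v (ball x0 rh) = 0"
   for Om :: "'a set" and F mu ps g v x0 rh
  proof -
   have p1: "1<=p" "1<=q" using par by auto
   have v: "v : W1 p Om" using sol by (simp add: obstacle_solution_def obstacle_class_def)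
   obtain v0 G where G: "rep Om v v0" "rep Om (wgrad Om v) G" "wg Om v0 G" "Np p v0<oo" "Np p G<oo" by (rule W1_rep[OF Om p1(1) v])
   obtain ps0 P where P: "rep Om ps ps0" "rep Om (wgrad Om ps) P" "wg Om ps0 P" "Np q ps0<oo" "Np q P<oo" by (rule W1_rep[OF Om p1(2) W1frac_imp_W1[OF ps(1)]])
   have [measurable]: "G : bm" "ball x0 (rh/2) : sets borel" using G by (auto simp: rep_def)
   define I where "I = 1+(LL x:ball x0 rh. F x (wgrad Om v x) + norm (wgrad Om ps x) powr q)"
   have sub: "ball x0 rh<=Om" "ball x0 (rh/2)<=Om"
   proof -
    show *: "ball x0 rh<=Om" using rh(1) closure_subset[of "ball x0 rh"] by (auto simp: compactly_inside_def)
    have "ball x0 (rh/2)<=ball x0 rh" using rh(2) by (intro subset_ball) simp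
    thus "ball x0 (rh/2)<=Om" using * by blast
   qed
   have I: "1<=I" unfolding I_def using data_integral(2)[OF Om F par(1) G(2) P(2) solution_energy_finite(1)[OF Om(1) F par(1) sol G(2)] P(5) _ sub(1)] by simp
   define Z where "Z = I powr e1 / rh powr e2"
   have R: "1<=R0 powr e2 * Z"
   proof -
    have "1*1<=(R0/rh) powr e2 * I powr e1" using rh e I by (intro mult_mono ge_one_powr_ge_zero) auto
    thus ?thesis by (simp add: Z_def powr_divide)
   qed
   have Z: "0<=Z" by (simp add: Z_def)
   let ?G = "%x. ind (?b x0 rh) x *R G x"
   let ?c = "%mu x. norm (V mu p (G x)) powr si"
   have "Np d ?G<=(NN x. en c * (ind (?b x0 rh) x + ind (?b x0 rh) x * en (?c mu x)))" unfolding Np_def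
   proof (rule nn_integral_mono)
    fix x
    have "en (norm (G x) powr d)<=en (c*(1 + ?c mu x))" unfolding c_def si_def using d by (intro ennreal_leI norm_powr_le_V_powr[OF par(3) mu]) simp
    thus "en (norm (?G x) powr d)<=en c * (ind (?b x0 rh) x + ind (?b x0 rh) x * en (?c mu x))" using c by (auto simp: indicator_def ennreal_mult')
   qed
   also have "... = en c * (emeasure lborel (?b x0 rh) + (NN x:?b x0 rh. ?c mu x))" by (simp add: nn_integral_add nn_integral_cmult)
   also have "...<=en c * (en m + en (C1*Z))" unfolding m_def Z_def I_def using rh by (intro mult_left_mono add_mono emeasure_ball_le est[OF Om F mu ps sol G rh gap]) auto
   also have "... = en (c*(m+C1*Z))" using m C1 Z c by (simp add: ennreal_mult')
   finally have N: "Np d ?G<=en (c*(m+C1*Z))" .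
   define T where "T = enn2real (Np d ?G)"
   have T: "0<=T" "T<=c*(m+C1*Z)" unfolding T_def using N m C1 Z c by (auto intro: enn2real_leI)
   have "Lp_norm d (?b x0 rh) (wgrad Om v) = T powr (1/d)" unfolding T_def by (rule Lp_norm_rep[OF _ rep_subset[OF G(2) sub(2)]]) (use d in auto)
   also have "...<=1+T"
   proof (cases "T<=1")
    case True thus ?thesis using powr_le1[of "1/d" T] T d by simp
   next
    case False thus ?thesis using powr_mono[of "1/d" 1 T] d by simp
   qed
   also have "...<=1+c*(m+C1*Z)" using T by simp
   also have "... = (1+c*m)+c*C1*Z" by (simp add: algebra_simps)
   also have "...<=(1+c*m)*(R0 powr e2 * Z)+c*C1*Z"
   proof -
    have "(1+c*m)*1<=(1+c*m)*(R0 powr e2 * Z)" using R c m by (intro mult_left_mono) auto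
    thus ?thesis by simp
   qed
   also have "... = ?a*Z" by (simp add: algebra_simps)
   also have "... = ?a / rh powr e2 * I powr e1" by (simp add: Z_def)
   finally show ?thesis by (simp only: I_def)
  qed
  show ?case by (intro exI[of _ "(1+c*m) * R0 powr e2 + c*C1"] allI impI main)
 qed
qed

lemma solution_regularity:
 fixes Om :: "'a::euclidean_space set"
 defines "n == real DIM('a)"
 assumes n: "2<=n" and par: "0<nu" "0<=L" "1<p" "p<=q" and al: "0<al" "al<=1" and q: "q<p*(1+al/n)"
  and Om: "open Om" "bounded Om" and F: "pq_integrand Om F nu L mu al p q" and mu: "0<=mu" "mu<=1" and ps: "ps : W1frac al q Om"
  and sol: "obstacle_solution p Om F ps g v" and gap: "!!U. open U ==> U \<Subset> Om ==> lavrentiev_gap p q Om F ps v U = 0"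
 shows "1<=d ==> d<n*p/(n-al) ==> wgrad Om v : Lp_loc d Om"
  and "0<be ==> be<al/2 ==> (%x. V mu p (wgrad Om v x)) : Wfrac_loc be 2 Om"
proof -
 have p1: "1<=p" using par by auto
 have v: "v : W1 p Om" using sol by (simp add: obstacle_solution_def obstacle_class_def)
 obtain v0 G where G: "rep Om v v0" "rep Om (wgrad Om v) G" "wg Om v0 G" "Np p v0<oo" "Np p G<oo" by (rule W1_rep[OF Om p1 v])
 have [measurable]: "G : bm" using G by (simp add: rep_def)
 let ?a = "%x h. norm (V mu p (G (x+h)) - V mu p (G x)) powr 2"
 have loc: "(NN x:ball x0 (rh/2). norm (V mu p (G x)) powr si)<oo &
  (EX K>=0. ALL h. (NN x. ind (ball x0 (rh/2)) x * ind (ball x0 (rh/2)) (x+h) * en (?a x h))<=en (K * norm h powr al))"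
  if si: "2<=si" "si<2*n/(n-al)" and rh: "ball x0 rh \<Subset> Om" "0<rh" for si x0 rh
 proof (rule solution_estimate[where 'a='a, folded n_def, OF n par al q si rh(2), where N = "W1frac_norm al q Om ps"], goal_cases)
  case (1 C)
  from 1(2)[OF Om F mu ps refl sol G rh order_refl gap[OF open_ball rh(1)]]
  show ?case by (elim conjE) (rule conjI[OF le_less_trans], auto)
 qed
 show "wgrad Om v : Lp_loc d Om" if d: "1<=d" "d<n*p/(n-al)" unfolding Lp_loc_def
 proof (intro CollectI allI impI)
  fix U assume U: "open U & U \<Subset> Om"
  have UOm: "U<=Om" using U closure_subset[of U] by (auto simp: compactly_inside_def)
  have [measurable]: "U : sets borel" using U by auto
  obtain rh X where X: "0<rh" "rh<=1" "finite X" "U<=(\<Union>x\<in>X. ball x (rh/4))" "!!x. x : X ==> ball x rh \<Subset> Om" using finite_ball_cover[OF Om(1)] U by metis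
  define si where "si = 2 * max d p / p"
  have si: "2<=si" "si<2*n/(n-al)" unfolding si_def by (rule exponent_range[OF n par(3) al d(2)])+
  define c where "c = 1 + 2 powr (max d p) * 2 powr (max d p / p)"
  have c: "0<c" by (simp add: c_def add_pos_pos)
  have [measurable]: "ball x r : sets borel" for x :: 'a and r by simp
  let ?j = "%x. norm (V mu p (G x)) powr si"
  let ?c = "%i. emeasure lborel (ball i (rh/2)) + (NN x:ball i (rh/2). ?j x)"
  let ?e = "%i x. ind (ball i (rh/2)) x + ind (ball i (rh/2)) x * en (?j x)"
  have "Np d (%x. ind U x *R G x)<=(NN x. (\<Sum>i\<in>X. en c * ?e i x))" unfolding Np_def
  proof (rule nn_integral_mono)
   fix x
   let ?s = "%i. en c * ?e i x"
   show "en (norm (ind U x *R G x) powr d)<=(\<Sum>i\<in>X. ?s i)"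
   proof (cases "x : U")
    case True
    then obtain i where i: "i : X" "x : ball i (rh/4)" using X(4) by blast
    have "en (norm (G x) powr d)<=en (c*(1 + ?j x))" unfolding c_def si_def using d by (intro ennreal_leI norm_powr_le_V_powr[OF par(3) mu]) simp
    also have "... = ?s i" using i X(1) c by (simp add: ennreal_mult')
    also have "...<=(\<Sum>i\<in>X. ?s i)" by (rule member_le_sum[OF i(1) _ X(3)]) simp
    finally show ?thesis using True by simp
   qed simp
  qed
  also have "... = (\<Sum>i\<in>X. en c * ?c i)" by (subst nn_integral_sum) (auto simp: nn_integral_add nn_integral_cmult)
  also have "...<oo"
  proof -
   have "en c * ?c i<oo" if "i : X" for i using loc[OF si X(5)[OF that] X(1)] emeasure_lborel_ball_finite[of i "rh/2"] by (simp add: ennreal_mult_less_top)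
   thus ?thesis using X(3) by simp
  qed
  finally show "wgrad Om v : Lp d U" using Lp_rep[OF _ rep_subset[OF G(2) UOm], of d] d by simp
 qed
 let ?b = "%x. V mu p (wgrad Om v x)"
 show "?b : Wfrac_loc be 2 Om" if be: "0<be" "be<al/2" unfolding Wfrac_loc_def
 proof (intro CollectI allI impI)
  fix U assume U: "open U & U \<Subset> Om"
  have UOm: "U<=Om" using U closure_subset[of U] by (auto simp: compactly_inside_def)
  have Ub: "bounded U" using bounded_subset[OF Om(2) UOm] .
  have Um[measurable]: "U : sets borel" using U by auto
  obtain rh X where X: "0<rh" "rh<=1" "finite X" "U<=(\<Union>x\<in>X. ball x (rh/4))" "!!x. x : X ==> ball x rh \<Subset> Om" using finite_ball_cover[OF Om(1)] U by metis
  define P where "P x = ind U x *R V mu p (G x)" for x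
  have V0: "V mu p 0 = (0 :: 'a)" by (simp add: V_def)
  have "rep Om ?b (%x. V mu p (G x))" using G(2) V0 by (auto simp: rep_def elim!: eventually_mono)
  hence rP: "rep U ?b P" unfolding P_def[abs_def] by (rule rep_subset[OF _ UOm Um])
  have [measurable]: "ball x r : sets borel" for x :: 'a and r by simp
  let ?i = "%x. en (2 powr p) * (ind U x + en (norm (G x) powr p))"
  have "Np 2 P<=(NN x. ?i x)" unfolding Np_def
  proof (rule nn_integral_mono)
   fix x
   have "en ((norm (V mu p (G x)))^2)<=en (2 powr p * (1 + norm (G x) powr p))" by (intro ennreal_leI V_le_power par mu)
   thus "en (norm (P x) powr 2)<=?i x" by (auto simp: P_def indicator_def ennreal_mult')
  qed
  also have "... = en (2 powr p) * (emeasure lborel U + Np p G)" by (simp add: nn_integral_add nn_integral_cmult Np_def)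
  also have "...<oo" using G(5) emeasure_bounded_finite[OF Ub] by (simp add: ennreal_mult_less_top)
  finally have P2: "Np 2 P<oo" .
  have an: "0<n-al" using n al by simp
  have s2: "(2::real)<=2" "2<2*n/(n-al)" using an al by (auto simp: less_divide_eq)
  let ?g = "%i h. NN x. ind (ball i (rh/2)) x * ind (ball i (rh/2)) (x+h) * en (?a x h)"
  have "ALL i:X. EX K>=0. ALL h. ?g i h<=en (K * norm h powr al)" using loc[OF s2 X(5,1)] by blast
  then obtain K where K: "!!i. i : X ==> 0<=K i" "!!i h. i : X ==> ?g i h<=en (K i * norm h powr al)" unfolding bchoice_iff by blast
  have "gagliardo be 2 U ?b<oo"
  proof (rule gagliardo_finite[OF Um Ub rP _ _ be P2])
   show "0<rh/4" "0<=(\<Sum>i\<in>X. K i)" using X K by (auto intro: sum_nonneg)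
   fix h :: 'a assume h: "norm h<rh/4"
   let ?s = "%i x. ind (ball i (rh/2)) x * ind (ball i (rh/2)) (x+h) * en (?a x h)"
   let ?d = "incr2 U P h"
   let ?h = "(\<Sum>i\<in>X. K i) * norm h powr al"
   have "?d<=(NN x. (\<Sum>i\<in>X. ?s i x))"
   proof (rule nn_integral_mono)
    fix x
    let ?f = "ind U x * ind U (x+h) * en (norm (P (x+h) - P x) powr 2)"
    show "?f<=(\<Sum>i\<in>X. ?s i x)"
    proof (cases "x : U & x+h : U")
     case True
     then obtain i where i: "i : X" "x : ball i (rh/4)" using X(4) by blast
     have "dist i (x+h)<=dist i x + norm h" using norm_triangle_ineq4[of "i-x" h] by (simp add: dist_norm diff_diff_eq)
     hence "x+h : ball i (rh/2)" "x : ball i (rh/2)" using i h X(1) by auto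
     hence "?f = ?s i x" using True by (simp add: P_def)
     also have "...<=(\<Sum>i\<in>X. ?s i x)" by (rule member_le_sum[OF i(1) _ X(3)]) simp
     finally show ?thesis .
    qed (auto simp: indicator_def)
   qed
   also have "... = (\<Sum>i\<in>X. (NN x. ?s i x))" by (rule nn_integral_sum) measurable
   also have "...<=(\<Sum>i\<in>X. en (K i * norm h powr al))" by (intro sum_mono K)
   finally show "?d<=en ?h" using K by (simp add: sum_ennreal sum_distrib_right)
  qed
  thus "?b : Wfrac be 2 U" using Lp_rep[OF Um rP, of 2] P2 by (simp add: Wfrac_def)
 qed
qed

theorem theorem1:
  assumes n_ge_2: "2 \<le> CARD('n::finite)"
  shows "\<exists>(\<theta> :: real \<Rightarrow> real \<Rightarrow> real \<Rightarrow> real)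
   (\<gamma> :: real \<Rightarrow> real \<Rightarrow> real \<Rightarrow> real \<Rightarrow> real)
   (c :: real \<Rightarrow> real \<Rightarrow> real \<Rightarrow> real \<Rightarrow> real \<Rightarrow> real \<Rightarrow> real \<Rightarrow> real \<Rightarrow> real).
   \<forall>(\<Omega> :: (real ^ 'n) set) F \<psi> g v \<nu> L \<mu> \<alpha> p q.
   open \<Omega> \<longrightarrow> connected \<Omega> \<longrightarrow> \<Omega> \<noteq> {} \<longrightarrow> bounded \<Omega> \<longrightarrow> C1_boundary \<Omega> \<longrightarrow>
   0 < \<nu> \<longrightarrow> \<nu> \<le> L \<longrightarrow> 0 \<le> \<mu> \<longrightarrow> \<mu> \<le> 1 \<longrightarrow> 0 < \<alpha> \<longrightarrow> \<alpha> \<le> 1 \<longrightarrow>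
   1 < p \<longrightarrow> p \<le> q \<longrightarrow> q < p * (1 + \<alpha> / real CARD('n)) \<longrightarrow>
   pq_integrand \<Omega> F \<nu> L \<mu> \<alpha> p q \<longrightarrow>
   \<psi> \<in> W1frac \<alpha> q \<Omega> \<longrightarrow> g \<in> W1 p \<Omega> \<longrightarrow> obstacle_class p \<Omega> \<psi> g \<noteq> {} \<longrightarrow>
   obstacle_solution p \<Omega> F \<psi> g v \<longrightarrow>
   (\<forall>U. open U \<and> U \<Subset> \<Omega> \<longrightarrow> lavrentiev_gap p q \<Omega> F \<psi> v U = 0) \<longrightarrow>
   (\<forall>d. 1 \<le> d \<and> d < real CARD('n) * p / (real CARD('n) - \<alpha>) \<longrightarrow>
   wgrad \<Omega> v \<in> Lp_loc d \<Omega>) \<and>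
   (\<forall>\<beta>. 0 < \<beta> \<and> \<beta> < \<alpha> / 2 \<longrightarrow> (\<lambda>x. V \<mu> p (wgrad \<Omega> v x)) \<in> Wfrac_loc \<beta> 2 \<Omega>) \<and>
   (\<forall>x0 \<rho> R d. 0 < \<rho> \<and> \<rho> \<le> R \<and> ball x0 \<rho> \<Subset> \<Omega> \<and>
   1 \<le> d \<and> d < real CARD('n) * p / (real CARD('n) - \<alpha>) \<longrightarrow>
   Lp_norm d (ball x0 (\<rho> / 2)) (wgrad \<Omega> v)
   \<le> c \<nu> L p q \<alpha> (W1frac_norm \<alpha> q \<Omega> \<psi>) d R / \<rho> powr \<theta> p q \<alpha> *
   (1 + (\<integral>x. F x (wgrad \<Omega> v x) + norm (wgrad \<Omega> \<psi> x) powr q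
   \<partial>lebesgue_on (ball x0 \<rho>))) powr \<gamma> p q \<alpha> d)"
proof -
 define n where "n = real CARD('n)"
 have n: "n = real DIM(real ^ 'n)" "2 <= n" using n_ge_2 by (auto simp: n_def)
 define th where "th p q al = 4 * (absorb_exponent n p q al + 2)" for p q al
 define ga where "ga p q al d = 2 * (1 + al / n * absorb_exponent n p q al)" for p q al d :: real
 define bd where "bd nu L p q al N d R0 C <-> (ALL (Om :: (real ^ 'n) set) F mu ps g v x0 rh. open Om --> bounded Om --> pq_integrand Om F nu L mu al p q --> 0 <= mu --> mu <= 1 -->
  ps : W1frac al q Om --> W1frac_norm al q Om ps = N --> obstacle_solution p Om F ps g v -->
  ball x0 rh \<Subset> Om --> 0 < rh --> rh <= R0 --> lavrentiev_gap p q Om F ps v (ball x0 rh) = 0 -->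
  Lp_norm d (ball x0 (rh / 2)) (wgrad Om v) <= C / rh powr th p q al *
  (1 + (LL x:ball x0 rh. F x (wgrad Om v x) + norm (wgrad Om ps x) powr q)) powr ga p q al d)" for nu L p q al N d R0 C :: real
 define c where "c nu L p q al N d R0 = (SOME C. bd nu L p q al N d R0 C)" for nu L p q al N d R0
 have c: "bd nu L p q al N d R0 (c nu L p q al N d R0)"
  if "0 < nu" "nu <= L" "1 < p" "p <= q" "0 < al" "al <= 1" "q < p * (1 + al / n)" "1 <= d" "d < n * p / (n - al)" "0 < R0" for nu L p q al N d R0 unfolding c_def
 proof (rule someI_ex)
  show "EX C. bd nu L p q al N d R0 C" using solution_norm_estimate[where 'a = "real ^ 'n", folded n(1), of nu L p q al d R0 N] n(2) that unfolding bd_def th_def ga_def by simp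
 qed
 show ?thesis
 proof (rule exI[of _ th], rule exI[of _ ga], rule exI[of _ c], intro allI impI, goal_cases)
  case (1 Om F ps g v nu L mu al p q)
  have gap: "open U ==> U \<Subset> Om ==> lavrentiev_gap p q Om F ps v U = 0" for U using 1 by blast
  have q: "q < p * (1 + al / n)" and L: "0 <= L" using 1 by (auto simp: n_def)
  note reg = solution_regularity[where 'a = "real ^ 'n", folded n(1), OF n(2) 1(6) L 1(12,13,10,11) q 1(1,4,15,8,9,16,19) gap]
  show ?case
  proof (intro conjI allI impI)
  fix d assume "1 <= d & d < real CARD('n) * p / (real CARD('n) - al)"
  thus "wgrad Om v : Lp_loc d Om" by (intro reg(1)) (auto simp: n_def)
  next
  fix be assume "0 < be & be < al / 2"
  thus "(%x. V mu p (wgrad Om v x)) : Wfrac_loc be 2 Om" by (intro reg(2)) auto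
  next
  fix x0 rh R d assume a: "0 < rh & rh <= R & ball x0 rh \<Subset> Om & 1 <= d & d < real CARD('n) * p / (real CARD('n) - al)"
  hence b: "bd nu L p q al (W1frac_norm al q Om ps) d R (c nu L p q al (W1frac_norm al q Om ps) d R)" using 1 q by (intro c) (auto simp: n_def)
  have "ball x0 rh \<Subset> Om" "0 < rh" "rh <= R" using a by auto
  with b[unfolded bd_def, rule_format, OF 1(1,4,15,8,9,16) refl 1(19) _ _ _ gap]
  show "Lp_norm d (ball x0 (rh / 2)) (wgrad Om v) <= c nu L p q al (W1frac_norm al q Om ps) d R / rh powr th p q al *
  (1 + (LL x:ball x0 rh. F x (wgrad Om v x) + norm (wgrad Om ps x) powr q)) powr ga p q al d" by simp
  qed
 qed
qed

end
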